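(* Let $R$ be a commutative ring with unity and $S$ a multiplicative subset of $R$. Then $$S\text{-}\mathrm{w.gl.dim}(R[x])=S\text{-}\mathrm{w.gl.dim}(R)+1.$$
   Context: $R[x]$ is the polynomial ring in one indeterminate over $R$, and $S$ is also viewed as a multiplicative subset of $R[x]$ (as constant polynomials). A multiplicative subset $S$ of a commutative ring $R$ is a subset with $1\in S$ and $s_1s_2\in S$ for all $s_1,s_2\in S$. For any commutative ring $R$ and multiplicative subset $S$ of $R$: a sequence of $R$-modules $M\xrightarrow{f}N\xrightarrow{g}L$ is $S$-exact (at $N$) if there is $s\in S$ with $s\,\mathrm{Ker}(g)\subseteq \mathrm{Im}(f)$ and $s\,\mathrm{Im}(f)\subseteq\mathrm{Ker}(g)$; a longer sequence is $S$-exact if it is $S$-exact at each term (the element $s$ may depend on the term). An $R$-module $F$ is $S$-flat if for every $S$-exact sequence $0\to A\to B\to C\to 0$ of $R$-modules the induced sequence $0\to A\otimes_RF\to B\otimes_RF\to C\otimes_RF\to 0$ is $S$-exact. $S\text{-}\mathrm{fd}_R(M)\leq n$ means that there is an $S$-exact sequence $0\to F_n\to\cdots\to F_1\to F_0\to M\to 0$ with every $F_i$ $S$-flat; $S\text{-}\mathrm{fd}_R(M)$ is the least such $n$, or $\infty$ if none exists. $S\text{-}\mathrm{w.gl.dim}(R)=\sup\{S\text{-}\mathrm{fd}_R(M)\mid M \text{ an } R\text{-module}\}$. Convention: $\infty+1=\infty$.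
   Formalization: Assumes 0 is not in S: if 0 is in S, every sequence is S-exact, both dimensions are 0 and the formula would read 0 = 1. "All modules" means all modules of size at most an arbitrary infinite cardinal that is at least |R|, the same on both sides. *)

theory Defs
  imports "HOL-Library.Extended_Nat" "HOL-Library.Equipollence" "HOL-Algebra.UnivPoly"
begin

section \<open>Module homomorphisms, free modules, quotients\<close>

definition mod_hom ::
  "('a, 'm) ring_scheme \<Rightarrow> ('a, 'b, 'n) module_scheme \<Rightarrow> ('a, 'c, 'k) module_scheme \<Rightarrow> ('b \<Rightarrow> 'c) set"
  where "mod_hom R M N =
    {f \<in> hom (add_monoid M) (add_monoid N).
       \<forall>r\<in>carrier R. \<forall>x\<in>carrier M. f (r \<odot>\<^bsub>M\<^esub> x) = r \<odot>\<^bsub>N\<^esub> f x}"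

text \<open>The record \<^typ>\<open>('a, 'b) module\<close> extends the ring record; the fields \<^const>\<open>mult\<close> and
  \<^const>\<open>one\<close> play no role for modules and are left unspecified.\<close>

definition zero_module :: "('a, 'b) module"
  where "zero_module = \<lparr>carrier = {undefined}, mult = undefined, one = undefined,
    zero = undefined, add = (\<lambda>_ _. undefined), smult = (\<lambda>_ _. undefined)\<rparr>"

definition free_module :: "('a, 'm) ring_scheme \<Rightarrow> 'i set \<Rightarrow> ('a, 'i \<Rightarrow> 'a) module"
  where "free_module R I = \<lparr>
    carrier = {p. (\<forall>i\<in>I. p i \<in> carrier R) \<and> (\<forall>i. i \<notin> I \<longrightarrow> p i = \<zero>\<^bsub>R\<^esub>) \<and> finite {i. p i \<noteq> \<zero>\<^bsub>R\<^esub>}},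
    mult = undefined, one = undefined,
    zero = (\<lambda>_. \<zero>\<^bsub>R\<^esub>),
    add = (\<lambda>p q i. p i \<oplus>\<^bsub>R\<^esub> q i),
    smult = (\<lambda>r p i. r \<otimes>\<^bsub>R\<^esub> p i)\<rparr>"

definition free_gen :: "('a, 'm) ring_scheme \<Rightarrow> 'i \<Rightarrow> 'i \<Rightarrow> 'a"
  where "free_gen R i = (\<lambda>j. if j = i then \<one>\<^bsub>R\<^esub> else \<zero>\<^bsub>R\<^esub>)"

definition submodule_span ::
  "('a, 'm) ring_scheme \<Rightarrow> ('a, 'b, 'n) module_scheme \<Rightarrow> 'b set \<Rightarrow> 'b set"
  where "submodule_span R M X = \<Inter>{H. submodule H R M \<and> X \<subseteq> H}"

definition quot_module :: "('a, 'b, 'n) module_scheme \<Rightarrow> 'b set \<Rightarrow> ('a, 'b set) module"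
  where "quot_module M H = \<lparr>
    carrier = a_rcosets\<^bsub>M\<^esub> H, mult = undefined, one = undefined,
    zero = H,
    add = (\<lambda>X Y. X <+>\<^bsub>M\<^esub> Y),
    smult = (\<lambda>r X. \<Union>x\<in>X. H +>\<^bsub>M\<^esub> (r \<odot>\<^bsub>M\<^esub> x))\<rparr>"

section \<open>Tensor products\<close>

definition tensor_free ::
  "('a, 'm) ring_scheme \<Rightarrow> ('a, 'b, 'n) module_scheme \<Rightarrow> ('a, 'c, 'k) module_scheme \<Rightarrow>
   ('a, 'b \<times> 'c \<Rightarrow> 'a) module"
  where "tensor_free R M N = free_module R (carrier M \<times> carrier N)"

definition tensor_relations ::
  "('a, 'm) ring_scheme \<Rightarrow> ('a, 'b, 'n) module_scheme \<Rightarrow> ('a, 'c, 'k) module_scheme \<Rightarrow>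
   ('b \<times> 'c \<Rightarrow> 'a) set"
  where "tensor_relations R M N = (let P = tensor_free R M N; e = free_gen R in
      {e (x \<oplus>\<^bsub>M\<^esub> x', y) \<ominus>\<^bsub>P\<^esub> (e (x, y) \<oplus>\<^bsub>P\<^esub> e (x', y)) |x x' y.
         x \<in> carrier M \<and> x' \<in> carrier M \<and> y \<in> carrier N} \<union>
      {e (x, y \<oplus>\<^bsub>N\<^esub> y') \<ominus>\<^bsub>P\<^esub> (e (x, y) \<oplus>\<^bsub>P\<^esub> e (x, y')) |x y y'.
         x \<in> carrier M \<and> y \<in> carrier N \<and> y' \<in> carrier N} \<union>
      {e (r \<odot>\<^bsub>M\<^esub> x, y) \<ominus>\<^bsub>P\<^esub> r \<odot>\<^bsub>P\<^esub> e (x, y) |r x y.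
         r \<in> carrier R \<and> x \<in> carrier M \<and> y \<in> carrier N} \<union>
      {e (x, r \<odot>\<^bsub>N\<^esub> y) \<ominus>\<^bsub>P\<^esub> r \<odot>\<^bsub>P\<^esub> e (x, y) |r x y.
         r \<in> carrier R \<and> x \<in> carrier M \<and> y \<in> carrier N})"

definition tensor_kernel ::
  "('a, 'm) ring_scheme \<Rightarrow> ('a, 'b, 'n) module_scheme \<Rightarrow> ('a, 'c, 'k) module_scheme \<Rightarrow>
   ('b \<times> 'c \<Rightarrow> 'a) set"
  where "tensor_kernel R M N = submodule_span R (tensor_free R M N) (tensor_relations R M N)"

definition tensor_module ::
  "('a, 'm) ring_scheme \<Rightarrow> ('a, 'b, 'n) module_scheme \<Rightarrow> ('a, 'c, 'k) module_scheme \<Rightarrow>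
   ('a, ('b \<times> 'c \<Rightarrow> 'a) set) module"
  where "tensor_module R M N = quot_module (tensor_free R M N) (tensor_kernel R M N)"

definition pure_tensor ::
  "('a, 'm) ring_scheme \<Rightarrow> ('a, 'b, 'n) module_scheme \<Rightarrow> ('a, 'c, 'k) module_scheme \<Rightarrow>
   'b \<Rightarrow> 'c \<Rightarrow> ('b \<times> 'c \<Rightarrow> 'a) set"
  where "pure_tensor R M N x y = tensor_kernel R M N +>\<^bsub>tensor_free R M N\<^esub> free_gen R (x, y)"

text \<open>The induced map \<open>f \<otimes> id\<close>. It is well defined by lemma \<open>tensor_map_ex1\<close> below.\<close>

definition tensor_map ::
  "('a, 'm) ring_scheme \<Rightarrow> ('a, 'b, 'n) module_scheme \<Rightarrow> ('a, 'd, 'l) module_scheme \<Rightarrow>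
   ('a, 'c, 'k) module_scheme \<Rightarrow> ('b \<Rightarrow> 'd) \<Rightarrow> ('b \<times> 'c \<Rightarrow> 'a) set \<Rightarrow> ('d \<times> 'c \<Rightarrow> 'a) set"
  where "tensor_map R M M' N f =
    (THE h. h \<in> mod_hom R (tensor_module R M N) (tensor_module R M' N) \<and>
            h \<in> extensional (carrier (tensor_module R M N)) \<and>
            (\<forall>x\<in>carrier M. \<forall>y\<in>carrier N. h (pure_tensor R M N x y) = pure_tensor R M' N (f x) y))"

lemma mod_homI:
  assumes "\<And>x. x \<in> carrier M \<Longrightarrow> f x \<in> carrier N"
    and "\<And>x y. x \<in> carrier M \<Longrightarrow> y \<in> carrier M \<Longrightarrow> f (x \<oplus>\<^bsub>M\<^esub> y) = f x \<oplus>\<^bsub>N\<^esub> f y"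
    and "\<And>r x. r \<in> carrier R \<Longrightarrow> x \<in> carrier M \<Longrightarrow> f (r \<odot>\<^bsub>M\<^esub> x) = r \<odot>\<^bsub>N\<^esub> f x"
  shows "f \<in> mod_hom R M N"
  using assms by (auto simp: mod_hom_def hom_def)

lemma mod_homD:
  assumes "f \<in> mod_hom R M N"
  shows "x \<in> carrier M \<Longrightarrow> f x \<in> carrier N"
    and "x \<in> carrier M \<Longrightarrow> y \<in> carrier M \<Longrightarrow> f (x \<oplus>\<^bsub>M\<^esub> y) = f x \<oplus>\<^bsub>N\<^esub> f y"
    and "r \<in> carrier R \<Longrightarrow> x \<in> carrier M \<Longrightarrow> f (r \<odot>\<^bsub>M\<^esub> x) = r \<odot>\<^bsub>N\<^esub> f x"
  using assms by (auto simp: mod_hom_def hom_def)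

lemma mod_hom_zero_minus:
  assumes "module R M" "module R N" "f \<in> mod_hom R M N"
  shows "f \<zero>\<^bsub>M\<^esub> = \<zero>\<^bsub>N\<^esub>" "x \<in> carrier M \<Longrightarrow> f (\<ominus>\<^bsub>M\<^esub> x) = \<ominus>\<^bsub>N\<^esub> f x"
proof -
  interpret M: module R M by fact
  interpret N: module R N by fact
  interpret abelian_group_hom M N f
    using assms(3) by (intro abelian_group_homI M.abelian_group_axioms N.abelian_group_axioms)
      (auto simp: mod_hom_def group_hom_def group_hom_axioms_def M.a_group N.a_group)
  show "f \<zero>\<^bsub>M\<^esub> = \<zero>\<^bsub>N\<^esub>" "x \<in> carrier M \<Longrightarrow> f (\<ominus>\<^bsub>M\<^esub> x) = \<ominus>\<^bsub>N\<^esub> f x" by simp_all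
qed

lemma module_free_module:
  fixes R (structure)
  assumes "cring R" shows "module R (free_module R I)"
proof -
  interpret cring R by fact
  have fin: "finite {i. p i \<oplus> q i \<noteq> \<zero>}" if "finite {i. p i \<noteq> \<zero>}" "finite {i. q i \<noteq> \<zero>}" for p q :: "_ \<Rightarrow> _"
    by (rule finite_subset[OF _ finite_UnI[OF that]]) auto
  have fin2: "finite {i. r \<otimes> q i \<noteq> \<zero>}" if "finite {i. q i \<noteq> \<zero>}" "r \<in> carrier R" for r and q :: "_ \<Rightarrow> _"
    by (rule finite_subset[OF _ that(1)]) (use that in auto)
  have cl: "p i \<in> carrier R" if "p \<in> carrier (free_module R I)" for p i
    using that by (cases "i \<in> I") (auto simp: free_module_def)
  note cl' = cl[simplified free_module_def, simplified]
  have neg: "(\<lambda>i. \<ominus> p i) \<in> carrier (free_module R I)" if "p \<in> carrier (free_module R I)" for p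
  proof -
    have "{i. \<ominus> p i \<noteq> \<zero>} \<subseteq> {i. p i \<noteq> \<zero>}" by auto
    with that show ?thesis by (auto simp: free_module_def intro: finite_subset)
  qed
  show ?thesis
  proof (rule moduleI, fact, rule abelian_groupI)
    fix x assume x: "x \<in> carrier (free_module R I)"
    show "\<exists>y\<in>carrier (free_module R I). y \<oplus>\<^bsub>free_module R I\<^esub> x = \<zero>\<^bsub>free_module R I\<^esub>"
      by (rule bexI[OF _ neg[OF x]]) (use cl[OF x] in \<open>auto simp: free_module_def l_neg\<close>)
  qed (auto simp: free_module_def fun_eq_iff fin fin2 a_ac l_distr r_distr m_assoc cl'
         intro!: a_assoc a_comm)
qed

lemma module_quot_module:
  assumes "module R M" "submodule H R M" shows "module R (quot_module M H)"
    and "\<And>x. x \<in> carrier M \<Longrightarrow> H +>\<^bsub>M\<^esub> x \<in> carrier (quot_module M H)"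
    and "\<And>X. X \<in> carrier (quot_module M H) \<Longrightarrow> \<exists>x\<in>carrier M. X = H +>\<^bsub>M\<^esub> x"
    and "(\<lambda>x. H +>\<^bsub>M\<^esub> x) \<in> mod_hom R M (quot_module M H)"
    and "\<And>x. x \<in> carrier M \<Longrightarrow> H +>\<^bsub>M\<^esub> x = \<zero>\<^bsub>quot_module M H\<^esub> \<longleftrightarrow> x \<in> H"
proof -
  interpret module R M by fact
  interpret sm: submodule H R M by fact
  interpret as: abelian_subgroup H M
    by (rule abelian_subgroupI3) (auto simp: additive_subgroup_def sm.subgroup_axioms M.abelian_group_axioms)
  show car: "\<And>x. x \<in> carrier M \<Longrightarrow> H +>\<^bsub>M\<^esub> x \<in> carrier (quot_module M H)"
    by (auto simp: quot_module_def A_RCOSETS_def')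
  show cos: "\<And>X. X \<in> carrier (quot_module M H) \<Longrightarrow> \<exists>x\<in>carrier M. X = H +>\<^bsub>M\<^esub> x"
    by (auto simp: quot_module_def A_RCOSETS_def')
  have add: "(H +>\<^bsub>M\<^esub> x) \<oplus>\<^bsub>quot_module M H\<^esub> (H +>\<^bsub>M\<^esub> y) = H +>\<^bsub>M\<^esub> (x \<oplus>\<^bsub>M\<^esub> y)"
    if "x \<in> carrier M" "y \<in> carrier M" for x y
    using that by (simp add: quot_module_def as.a_rcos_sum)
  have sub: "h \<in> carrier M" if "h \<in> H" for h using that sm.subset by auto
  have smult: "r \<odot>\<^bsub>quot_module M H\<^esub> (H +>\<^bsub>M\<^esub> x) = H +>\<^bsub>M\<^esub> (r \<odot>\<^bsub>M\<^esub> x)"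
    if r: "r \<in> carrier R" and x: "x \<in> carrier M" for r x
  proof -
    have *: "H +>\<^bsub>M\<^esub> (r \<odot>\<^bsub>M\<^esub> y) = H +>\<^bsub>M\<^esub> (r \<odot>\<^bsub>M\<^esub> x)" if y: "y \<in> H +>\<^bsub>M\<^esub> x" for y
    proof -
      obtain h where h: "h \<in> H" "y = h \<oplus>\<^bsub>M\<^esub> x" using y by (auto simp: a_r_coset_def')
      have "r \<odot>\<^bsub>M\<^esub> y \<in> H +>\<^bsub>M\<^esub> (r \<odot>\<^bsub>M\<^esub> x)"
        using h r x sub sm.smult_closed[OF r h(1)] by (auto simp: a_r_coset_def' smult_r_distr)
      then show ?thesis using r x M.a_repr_independence sm.subgroup_axioms by (metis smult_closed)
    qed
    have "x \<in> H +>\<^bsub>M\<^esub> x" using x by (rule as.a_rcos_self)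
    then have "(\<Union>y\<in>H +>\<^bsub>M\<^esub> x. H +>\<^bsub>M\<^esub> (r \<odot>\<^bsub>M\<^esub> y)) = H +>\<^bsub>M\<^esub> (r \<odot>\<^bsub>M\<^esub> x)"
      using * by blast
    then show ?thesis by (simp only: quot_module_def module.simps)
  qed
  have zero: "\<zero>\<^bsub>quot_module M H\<^esub> = H +>\<^bsub>M\<^esub> \<zero>\<^bsub>M\<^esub>"
    using M.a_coset_add_zero[of H] sub by (simp add: quot_module_def subset_eq)
  show "module R (quot_module M H)"
  proof (rule moduleI, rule is_cring, rule abelian_groupI)
    fix X assume "X \<in> carrier (quot_module M H)"
    then obtain x where x: "x \<in> carrier M" "X = H +>\<^bsub>M\<^esub> x" using cos by blast
    show "\<exists>Y\<in>carrier (quot_module M H). Y \<oplus>\<^bsub>quot_module M H\<^esub> X = \<zero>\<^bsub>quot_module M H\<^esub>"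
      by (rule bexI[of _ "H +>\<^bsub>M\<^esub> (\<ominus>\<^bsub>M\<^esub> x)"]) (use x in \<open>auto simp: add zero M.l_neg intro: car\<close>)
  qed (auto dest!: cos simp: add smult zero car M.a_ac smult_l_distr smult_r_distr smult_assoc1)
  show "(\<lambda>x. H +>\<^bsub>M\<^esub> x) \<in> mod_hom R M (quot_module M H)"
    by (rule mod_homI) (auto simp: add smult car)
  show "H +>\<^bsub>M\<^esub> x = \<zero>\<^bsub>quot_module M H\<^esub> \<longleftrightarrow> x \<in> H" if "x \<in> carrier M" for x
    using that as.a_rcos_self[OF that] as.a_rcos_const by (auto simp: quot_module_def)
qed

lemma submodule_span:
  assumes "module R M" "X \<subseteq> carrier M"
  shows "submodule (submodule_span R M X) R M" "X \<subseteq> submodule_span R M X"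
    "\<And>H. submodule H R M \<Longrightarrow> X \<subseteq> H \<Longrightarrow> submodule_span R M X \<subseteq> H"
proof -
  interpret module R M by fact
  have c: "submodule (carrier M) R M" by (rule carrier_is_submodule)
  show "submodule (submodule_span R M X) R M"
    unfolding submodule_span_def
    apply (rule submoduleI)
    using c assms(2) apply blast
    using submodule.axioms(1)[THEN subgroup.one_closed] apply fastforce
    using submoduleE(3) apply blast
    using submoduleE(5) apply blast
    using submoduleE(4) apply blast
    done
qed (auto simp: submodule_span_def)

lemma free_gen_closed:
  fixes R (structure)
  assumes "cring R" "i \<in> I" shows "free_gen R i \<in> carrier (free_module R I)"
proof -
  interpret cring R by fact
  have "{j. (if j = i then \<one> else \<zero>) \<noteq> \<zero>} \<subseteq> {i}" by auto
  then show ?thesis using assms(2) by (auto simp: free_module_def free_gen_def intro: finite_subset)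
qed

lemma free_module_induct:
  fixes R (structure)
  assumes "cring R" and p: "p \<in> carrier (free_module R I)"
    and "P \<zero>\<^bsub>free_module R I\<^esub>"
    and "\<And>r i q. r \<in> carrier R \<Longrightarrow> i \<in> I \<Longrightarrow> q \<in> carrier (free_module R I) \<Longrightarrow> P q \<Longrightarrow>
      P (r \<odot>\<^bsub>free_module R I\<^esub> free_gen R i \<oplus>\<^bsub>free_module R I\<^esub> q)"
  shows "P p"
proof -
  interpret cring R by fact
  have "finite A \<Longrightarrow> (\<forall>p\<in>carrier (free_module R I). {i. p i \<noteq> \<zero>} \<subseteq> A \<longrightarrow> P p)" for A
  proof (induction A rule: finite_induct)
    case empty
    show ?case
    proof safe
      fix p assume "p \<in> carrier (free_module R I)" "{i. p i \<noteq> \<zero>} \<subseteq> {}"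
      then have "p = \<zero>\<^bsub>free_module R I\<^esub>" by (auto simp: free_module_def)
      then show "P p" using assms(3) by simp
    qed
  next
    case (insert a A)
    show ?case
    proof safe
      fix p assume p: "p \<in> carrier (free_module R I)" "{i. p i \<noteq> \<zero>} \<subseteq> insert a A"
      show "P p"
      proof (cases "a \<in> I")
        case False
        then have "p a = \<zero>" using p by (auto simp: free_module_def)
        then have "{i. p i \<noteq> \<zero>} \<subseteq> A" using p(2) by auto
        with insert.IH p(1) show ?thesis by blast
      next
        case True
        let ?q = "p(a := \<zero>)"
        have "{i. ?q i \<noteq> \<zero>} \<subseteq> {i. p i \<noteq> \<zero>}" by auto
        then have q: "?q \<in> carrier (free_module R I)" using p(1) by (auto simp: free_module_def intro: finite_subset)
        have "{i. ?q i \<noteq> \<zero>} \<subseteq> A" using p(2) by auto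
        with insert.IH q have Pq: "P ?q" by blast
        have pc: "p i \<in> carrier R" for i using p(1) by (cases "i \<in> I") (auto simp: free_module_def)
        have "P (p a \<odot>\<^bsub>free_module R I\<^esub> free_gen R a \<oplus>\<^bsub>free_module R I\<^esub> ?q)"
          by (rule assms(4)) (use True q Pq pc in auto)
        moreover have "p a \<odot>\<^bsub>free_module R I\<^esub> free_gen R a \<oplus>\<^bsub>free_module R I\<^esub> ?q = p"
          using pc by (auto simp: free_module_def free_gen_def fun_eq_iff)
        ultimately show ?thesis by simp
      qed
    qed
  qed
  moreover have "finite {i. p i \<noteq> \<zero>}" using p by (auto simp: free_module_def)
  ultimately show ?thesis using p by blast
qed

lemma free_module_lift:
  fixes R (structure)
  assumes "module R N" "\<And>i. i \<in> I \<Longrightarrow> \<phi> i \<in> carrier N"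
  obtains h where "h \<in> mod_hom R (free_module R I) N" "\<And>i. i \<in> I \<Longrightarrow> h (free_gen R i) = \<phi> i"
proof -
  interpret module R N by fact
  let ?F = "free_module R I"
  define h where "h p = (\<Oplus>\<^bsub>N\<^esub>i\<in>{i\<in>I. p i \<noteq> \<zero>}. p i \<odot>\<^bsub>N\<^esub> \<phi> i)" for p
  have h_eq: "h p = (\<Oplus>\<^bsub>N\<^esub>i\<in>A. p i \<odot>\<^bsub>N\<^esub> \<phi> i)"
    if "p \<in> carrier ?F" "finite A" "A \<subseteq> I" "{i\<in>I. p i \<noteq> \<zero>} \<subseteq> A" for p A
    unfolding h_def
    by (rule M.add.finprod_mono_neutral_cong_left) (use that assms(2) in \<open>auto simp: free_module_def\<close>)
  have pc: "p i \<in> carrier R" if "p \<in> carrier ?F" for p i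
    using that by (cases "i \<in> I") (auto simp: free_module_def)
  have fin: "finite {i\<in>I. p i \<noteq> \<zero>}" if "p \<in> carrier ?F" for p
    using that by (auto simp: free_module_def intro: finite_subset[of _ "{i. p i \<noteq> \<zero>}"])
  interpret F: module R ?F using module_free_module[OF is_cring] .
  show thesis
  proof
    show "h \<in> mod_hom R ?F N"
    proof (rule mod_homI)
      show "h p \<in> carrier N" if "p \<in> carrier ?F" for p
        unfolding h_def using that assms(2) pc by (auto intro!: M.finsum_closed)
      show "h (p \<oplus>\<^bsub>?F\<^esub> q) = h p \<oplus>\<^bsub>N\<^esub> h q" if p: "p \<in> carrier ?F" and q: "q \<in> carrier ?F" for p q
      proof -
        let ?A = "{i\<in>I. p i \<noteq> \<zero>} \<union> {i\<in>I. q i \<noteq> \<zero>}"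
        have A: "finite ?A" "?A \<subseteq> I" using fin p q by auto
        have ad: "(p \<oplus>\<^bsub>?F\<^esub> q) i = p i \<oplus> q i" for i by (simp add: free_module_def)
        have "h (p \<oplus>\<^bsub>?F\<^esub> q) = (\<Oplus>\<^bsub>N\<^esub>i\<in>?A. (p \<oplus>\<^bsub>?F\<^esub> q) i \<odot>\<^bsub>N\<^esub> \<phi> i)"
          by (rule h_eq) (use p q A in \<open>auto simp: ad\<close>)
        also have "\<dots> = (\<Oplus>\<^bsub>N\<^esub>i\<in>?A. p i \<odot>\<^bsub>N\<^esub> \<phi> i \<oplus>\<^bsub>N\<^esub> q i \<odot>\<^bsub>N\<^esub> \<phi> i)"
          by (rule M.finsum_cong') (use assms(2) p q pc in \<open>auto simp: ad smult_l_distr\<close>)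
        also have "\<dots> = (\<Oplus>\<^bsub>N\<^esub>i\<in>?A. p i \<odot>\<^bsub>N\<^esub> \<phi> i) \<oplus>\<^bsub>N\<^esub> (\<Oplus>\<^bsub>N\<^esub>i\<in>?A. q i \<odot>\<^bsub>N\<^esub> \<phi> i)"
          by (rule M.finsum_addf) (use assms(2) p q pc in auto)
        also have "\<dots> = h p \<oplus>\<^bsub>N\<^esub> h q"
          using h_eq[OF p A] h_eq[OF q A] by auto
        finally show ?thesis .
      qed
      show "h (r \<odot>\<^bsub>?F\<^esub> p) = r \<odot>\<^bsub>N\<^esub> h p" if r: "r \<in> carrier R" and p: "p \<in> carrier ?F" for r p
      proof -
        let ?A = "{i\<in>I. p i \<noteq> \<zero>}"
        have ad: "(r \<odot>\<^bsub>?F\<^esub> p) i = r \<otimes> p i" for i by (simp add: free_module_def)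
        have "h (r \<odot>\<^bsub>?F\<^esub> p) = (\<Oplus>\<^bsub>N\<^esub>i\<in>?A. (r \<odot>\<^bsub>?F\<^esub> p) i \<odot>\<^bsub>N\<^esub> \<phi> i)"
          by (rule h_eq) (use p r fin in \<open>auto simp: ad\<close>)
        also have "\<dots> = (\<Oplus>\<^bsub>N\<^esub>i\<in>?A. r \<odot>\<^bsub>N\<^esub> (p i \<odot>\<^bsub>N\<^esub> \<phi> i))"
          by (rule M.finsum_cong') (use assms(2) p r pc in \<open>auto simp: ad smult_assoc1\<close>)
        also have "\<dots> = r \<odot>\<^bsub>N\<^esub> h p" unfolding h_def
          by (rule finsum_smult_ldistr[symmetric]) (use assms(2) p r pc fin in auto)
        finally show ?thesis .
      qed
    qed
    show "h (free_gen R i) = \<phi> i" if i: "i \<in> I" for i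
    proof -
      have "h (free_gen R i) = (\<Oplus>\<^bsub>N\<^esub>j\<in>{i}. free_gen R i j \<odot>\<^bsub>N\<^esub> \<phi> j)"
        by (rule h_eq) (use i free_gen_closed[OF is_cring i] in \<open>auto simp: free_gen_def split: if_splits\<close>)
      then show ?thesis using assms(2)[OF i] by (simp add: free_gen_def)
    qed
  qed
qed

lemma quot_lift:
  assumes "module R M" "module R N" "submodule H R M" "h \<in> mod_hom R M N"
    "\<And>x. x \<in> H \<Longrightarrow> h x = \<zero>\<^bsub>N\<^esub>"
  obtains k where "k \<in> mod_hom R (quot_module M H) N" "\<And>x. x \<in> carrier M \<Longrightarrow> k (H +>\<^bsub>M\<^esub> x) = h x"
proof -
  interpret module R M by fact
  interpret N: module R N by fact
  interpret sm: submodule H R M by fact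
  interpret as: abelian_subgroup H M
    by (rule abelian_subgroupI3) (auto simp: additive_subgroup_def sm.subgroup_axioms M.abelian_group_axioms)
  note q = module_quot_module[OF assms(1,3)]
  note hh = mod_homD[OF assms(4)]
  define k where "k X = h (SOME x. x \<in> X)" for X
  have k: "k (H +>\<^bsub>M\<^esub> x) = h x" if x: "x \<in> carrier M" for x
  proof -
    have "(SOME y. y \<in> H +>\<^bsub>M\<^esub> x) \<in> H +>\<^bsub>M\<^esub> x" using as.a_rcos_self[OF x] by (rule someI)
    then obtain a where a: "a \<in> H" "(SOME y. y \<in> H +>\<^bsub>M\<^esub> x) = a \<oplus>\<^bsub>M\<^esub> x" by (auto simp: a_r_coset_def')
    then have "k (H +>\<^bsub>M\<^esub> x) = h a \<oplus>\<^bsub>N\<^esub> h x" using hh(2) x subgroup.subset[OF sm.subgroup_axioms] by (auto simp: k_def)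
    then show ?thesis using assms(5)[OF a(1)] hh(1)[OF x] by simp
  qed
  show thesis
  proof
    show "k \<in> mod_hom R (quot_module M H) N"
      by (rule mod_homI; (drule q(3))+)
        (auto simp: k hh simp flip: mod_homD(2,3)[OF q(4)])
  qed (fact k)
qed

context
  fixes R :: "('a, 'm) ring_scheme" and M :: "('a, 'b, 'n) module_scheme"
    and N :: "('a, 'c, 'k) module_scheme"
  assumes mods: "module R M" "module R N"
begin

interpretation M: module R M by (fact mods)
interpretation N: module R N by (fact mods)

lemma module_tensor_free: "module R (tensor_free R M N)"
  unfolding tensor_free_def by (rule module_free_module) (rule M.is_cring)

interpretation P: module R "tensor_free R M N" by (rule module_tensor_free)

lemma tensor_gen_closed:
  "x \<in> carrier M \<Longrightarrow> y \<in> carrier N \<Longrightarrow> free_gen R (x, y) \<in> carrier (tensor_free R M N)"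
  unfolding tensor_free_def by (rule free_gen_closed) (auto intro: M.is_cring)

lemma tensor_relations_closed: "tensor_relations R M N \<subseteq> carrier (tensor_free R M N)"
  unfolding tensor_relations_def Let_def
  by (auto intro!: P.minus_closed P.M.add.m_closed P.smult_closed tensor_gen_closed)

lemma submodule_tensor_kernel: "submodule (tensor_kernel R M N) R (tensor_free R M N)"
  unfolding tensor_kernel_def by (rule submodule_span[OF module_tensor_free tensor_relations_closed])

lemma module_tensor_module: "module R (tensor_module R M N)"
  unfolding tensor_module_def by (rule module_quot_module[OF module_tensor_free submodule_tensor_kernel])

lemma pure_tensor_closed:
  "x \<in> carrier M \<Longrightarrow> y \<in> carrier N \<Longrightarrow> pure_tensor R M N x y \<in> carrier (tensor_module R M N)"
  unfolding tensor_module_def pure_tensor_def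
  by (intro module_quot_module[OF module_tensor_free submodule_tensor_kernel] tensor_gen_closed)

lemma tensor_hom_eq:
  assumes "module R L" "h \<in> mod_hom R (tensor_module R M N) L" "h' \<in> mod_hom R (tensor_module R M N) L"
    and eq: "\<And>x y. x \<in> carrier M \<Longrightarrow> y \<in> carrier N \<Longrightarrow> h (pure_tensor R M N x y) = h' (pure_tensor R M N x y)"
    and X: "X \<in> carrier (tensor_module R M N)"
  shows "h X = h' X"
proof -
  interpret T: module R "tensor_module R M N" by (rule module_tensor_module)
  note q = module_quot_module[OF module_tensor_free submodule_tensor_kernel, folded tensor_module_def]
  let ?P = "tensor_free R M N" and ?K = "tensor_kernel R M N" and ?I = "carrier M \<times> carrier N"
  note k = mod_homD[OF q(4)]
  note h = mod_homD[OF assms(2)] mod_homD[OF assms(3)]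
  have "h (?K +>\<^bsub>?P\<^esub> p) = h' (?K +>\<^bsub>?P\<^esub> p)" if "p \<in> carrier (free_module R ?I)" for p
  proof (rule free_module_induct[OF M.is_cring that], goal_cases)
    case 1
    have "?K +>\<^bsub>?P\<^esub> \<zero>\<^bsub>?P\<^esub> = \<zero>\<^bsub>tensor_module R M N\<^esub>"
      by (rule mod_hom_zero_minus[OF module_tensor_free q(1) q(4)])
    then show ?case
      using mod_hom_zero_minus(1)[OF q(1) assms(1,2)] mod_hom_zero_minus(1)[OF q(1) assms(1,3)]
      by (simp add: tensor_free_def)
  next
    case (2 r i q)
    obtain x y where i: "i = (x, y)" "x \<in> carrier M" "y \<in> carrier N" using 2 by auto
    have c: "free_gen R i \<in> carrier ?P" "q \<in> carrier ?P" using 2 i tensor_gen_closed by (auto simp: tensor_free_def)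
    have e: "h (?K +>\<^bsub>?P\<^esub> free_gen R i) = h' (?K +>\<^bsub>?P\<^esub> free_gen R i)" using eq[OF i(2,3)] by (simp add: i pure_tensor_def)
    show ?case using 2 c by (fold tensor_free_def) (simp add: k h e)
  qed
  then show ?thesis using q(3)[OF X] by (auto simp: tensor_free_def)
qed

lemma pure_tensor_bilinear:
  shows "x \<in> carrier M \<Longrightarrow> x' \<in> carrier M \<Longrightarrow> y \<in> carrier N \<Longrightarrow> pure_tensor R M N (x \<oplus>\<^bsub>M\<^esub> x') y = pure_tensor R M N x y \<oplus>\<^bsub>tensor_module R M N\<^esub> pure_tensor R M N x' y"
    and "x \<in> carrier M \<Longrightarrow> y \<in> carrier N \<Longrightarrow> y' \<in> carrier N \<Longrightarrow> pure_tensor R M N x (y \<oplus>\<^bsub>N\<^esub> y') = pure_tensor R M N x y \<oplus>\<^bsub>tensor_module R M N\<^esub> pure_tensor R M N x y'"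
    and "r \<in> carrier R \<Longrightarrow> x \<in> carrier M \<Longrightarrow> y \<in> carrier N \<Longrightarrow> pure_tensor R M N (r \<odot>\<^bsub>M\<^esub> x) y = r \<odot>\<^bsub>tensor_module R M N\<^esub> pure_tensor R M N x y"
    and "r \<in> carrier R \<Longrightarrow> x \<in> carrier M \<Longrightarrow> y \<in> carrier N \<Longrightarrow> pure_tensor R M N x (r \<odot>\<^bsub>N\<^esub> y) = r \<odot>\<^bsub>tensor_module R M N\<^esub> pure_tensor R M N x y"
proof -
  interpret T: module R "tensor_module R M N" by (rule module_tensor_module)
  note q = module_quot_module[OF module_tensor_free submodule_tensor_kernel, folded tensor_module_def]
  let ?P = "tensor_free R M N" and ?K = "tensor_kernel R M N"
  note k = mod_homD[OF q(4)]
  have sub: "tensor_relations R M N \<subseteq> ?K"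
    unfolding tensor_kernel_def by (rule submodule_span[OF module_tensor_free tensor_relations_closed])
  have *: "?K +>\<^bsub>?P\<^esub> a = ?K +>\<^bsub>?P\<^esub> b" if "a \<ominus>\<^bsub>?P\<^esub> b \<in> tensor_relations R M N" "a \<in> carrier ?P" "b \<in> carrier ?P" for a b
  proof -
    have "?K +>\<^bsub>?P\<^esub> (a \<ominus>\<^bsub>?P\<^esub> b) = \<zero>\<^bsub>tensor_module R M N\<^esub>" using that sub q(5) by auto
    moreover have "?K +>\<^bsub>?P\<^esub> (a \<ominus>\<^bsub>?P\<^esub> b) = (?K +>\<^bsub>?P\<^esub> a) \<ominus>\<^bsub>tensor_module R M N\<^esub> (?K +>\<^bsub>?P\<^esub> b)"
      using that mod_hom_zero_minus(2)[OF module_tensor_free q(1) q(4)] by (simp add: a_minus_def k)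
    ultimately show ?thesis using k(1)[OF that(2)] k(1)[OF that(3)] by (metis T.M.minus_equality T.M.minus_minus T.M.a_inv_closed a_minus_def T.M.a_comm)
  qed
  show "pure_tensor R M N (x \<oplus>\<^bsub>M\<^esub> x') y = pure_tensor R M N x y \<oplus>\<^bsub>tensor_module R M N\<^esub> pure_tensor R M N x' y" if "x \<in> carrier M" "x' \<in> carrier M" "y \<in> carrier N" for x x' y
    using that tensor_gen_closed unfolding pure_tensor_def
    by (subst k(2)[symmetric], simp, simp, intro *) (auto simp: tensor_relations_def Let_def)
  show "pure_tensor R M N x (y \<oplus>\<^bsub>N\<^esub> y') = pure_tensor R M N x y \<oplus>\<^bsub>tensor_module R M N\<^esub> pure_tensor R M N x y'" if "x \<in> carrier M" "y \<in> carrier N" "y' \<in> carrier N" for x y y'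
    using that tensor_gen_closed unfolding pure_tensor_def
    by (subst k(2)[symmetric], simp, simp, intro *) (auto simp: tensor_relations_def Let_def)
  show "pure_tensor R M N (r \<odot>\<^bsub>M\<^esub> x) y = r \<odot>\<^bsub>tensor_module R M N\<^esub> pure_tensor R M N x y" if "r \<in> carrier R" "x \<in> carrier M" "y \<in> carrier N" for r x y
    using that tensor_gen_closed unfolding pure_tensor_def
    by (subst k(3)[symmetric], simp, simp, intro *) (auto simp: tensor_relations_def Let_def)
  show "pure_tensor R M N x (r \<odot>\<^bsub>N\<^esub> y) = r \<odot>\<^bsub>tensor_module R M N\<^esub> pure_tensor R M N x y" if "r \<in> carrier R" "x \<in> carrier M" "y \<in> carrier N" for r x y
    using that tensor_gen_closed unfolding pure_tensor_def
    by (subst k(3)[symmetric], simp, simp, intro *) (auto simp: tensor_relations_def Let_def)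
qed

lemma tensor_lift:
  assumes L: "module R L" and cl: "\<And>x y. x \<in> carrier M \<Longrightarrow> y \<in> carrier N \<Longrightarrow> \<phi> x y \<in> carrier L"
    and b: "\<And>x x' y. x \<in> carrier M \<Longrightarrow> x' \<in> carrier M \<Longrightarrow> y \<in> carrier N \<Longrightarrow> \<phi> (x \<oplus>\<^bsub>M\<^esub> x') y = \<phi> x y \<oplus>\<^bsub>L\<^esub> \<phi> x' y"
      "\<And>x y y'. x \<in> carrier M \<Longrightarrow> y \<in> carrier N \<Longrightarrow> y' \<in> carrier N \<Longrightarrow> \<phi> x (y \<oplus>\<^bsub>N\<^esub> y') = \<phi> x y \<oplus>\<^bsub>L\<^esub> \<phi> x y'"
      "\<And>r x y. r \<in> carrier R \<Longrightarrow> x \<in> carrier M \<Longrightarrow> y \<in> carrier N \<Longrightarrow> \<phi> (r \<odot>\<^bsub>M\<^esub> x) y = r \<odot>\<^bsub>L\<^esub> \<phi> x y"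
      "\<And>r x y. r \<in> carrier R \<Longrightarrow> x \<in> carrier M \<Longrightarrow> y \<in> carrier N \<Longrightarrow> \<phi> x (r \<odot>\<^bsub>N\<^esub> y) = r \<odot>\<^bsub>L\<^esub> \<phi> x y"
  shows "\<exists>h\<in>mod_hom R (tensor_module R M N) L. \<forall>x\<in>carrier M. \<forall>y\<in>carrier N. h (pure_tensor R M N x y) = \<phi> x y"
proof -
  interpret L: module R L by fact
  let ?P = "tensor_free R M N" and ?K = "tensor_kernel R M N"
  obtain h where h: "h \<in> mod_hom R ?P L" "\<And>i. i \<in> carrier M \<times> carrier N \<Longrightarrow> h (free_gen R i) = case_prod \<phi> i"
    unfolding tensor_free_def using free_module_lift[OF L, of "carrier M \<times> carrier N" "case_prod \<phi>"] cl by auto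
  note hh = mod_homD[OF h(1)]
  note hm = mod_hom_zero_minus[OF module_tensor_free L h(1)]
  let ?H = "{p\<in>carrier ?P. h p = \<zero>\<^bsub>L\<^esub>}"
  have sH: "submodule ?H R ?P"
    by (rule P.submoduleI) (auto simp: hh hm)
  have "tensor_relations R M N \<subseteq> ?H"
    using tensor_relations_closed
    by (auto simp: tensor_relations_def Let_def)
      (auto simp: a_minus_def hh hm tensor_gen_closed h(2) b cl L.M.r_neg)
  then have "?K \<subseteq> ?H" unfolding tensor_kernel_def
    using submodule_span(3)[OF module_tensor_free tensor_relations_closed sH] by blast
  then obtain k where k: "k \<in> mod_hom R (tensor_module R M N) L" "\<And>p. p \<in> carrier ?P \<Longrightarrow> k (?K +>\<^bsub>?P\<^esub> p) = h p"
    unfolding tensor_module_def using quot_lift[OF module_tensor_free L submodule_tensor_kernel h(1)] by blast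
  have "k (pure_tensor R M N x y) = \<phi> x y" if "x \<in> carrier M" "y \<in> carrier N" for x y
    using k(2)[OF tensor_gen_closed[OF that]] h(2)[of "(x, y)"] that by (simp add: pure_tensor_def)
  with k(1) show ?thesis by blast
qed

end

lemma tensor_map_ex1:
  assumes "module R M" "module R M'" "module R N" "f \<in> mod_hom R M M'"
  shows "\<exists>!h. h \<in> mod_hom R (tensor_module R M N) (tensor_module R M' N) \<and>
            h \<in> extensional (carrier (tensor_module R M N)) \<and>
            (\<forall>x\<in>carrier M. \<forall>y\<in>carrier N. h (pure_tensor R M N x y) = pure_tensor R M' N (f x) y)"
proof -
  interpret M: module R M by fact
  interpret T: module R "tensor_module R M N" by (rule module_tensor_module) fact+
  note f = mod_homD[OF assms(4)]
  have T': "module R (tensor_module R M' N)" by (rule module_tensor_module) fact+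
  obtain h where h: "h \<in> mod_hom R (tensor_module R M N) (tensor_module R M' N)"
    "\<forall>x\<in>carrier M. \<forall>y\<in>carrier N. h (pure_tensor R M N x y) = pure_tensor R M' N (f x) y"
    using tensor_lift[OF assms(1,3) T', of "\<lambda>x y. pure_tensor R M' N (f x) y"]
    by (auto simp: f pure_tensor_closed[OF assms(2,3)] pure_tensor_bilinear[OF assms(2,3)] M.zero_closed)
  let ?h = "restrict h (carrier (tensor_module R M N))"
  show ?thesis
  proof (rule ex1I[of _ ?h], intro conjI)
    show "?h \<in> mod_hom R (tensor_module R M N) (tensor_module R M' N)"
      by (rule mod_homI) (simp_all add: mod_homD[OF h(1)])
    show "?h \<in> extensional (carrier (tensor_module R M N))" by simp
    show "\<forall>x\<in>carrier M. \<forall>y\<in>carrier N. ?h (pure_tensor R M N x y) = pure_tensor R M' N (f x) y"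
      using h(2) pure_tensor_closed[OF assms(1,3)] by simp
  next
    fix k assume k: "k \<in> mod_hom R (tensor_module R M N) (tensor_module R M' N) \<and>
      k \<in> extensional (carrier (tensor_module R M N)) \<and>
      (\<forall>x\<in>carrier M. \<forall>y\<in>carrier N. k (pure_tensor R M N x y) = pure_tensor R M' N (f x) y)"
    show "k = ?h"
    proof (rule extensionalityI[of _ "carrier (tensor_module R M N)"])
      fix X assume "X \<in> carrier (tensor_module R M N)"
      then show "k X = ?h X"
        using tensor_hom_eq[OF assms(1,3) T', of k h X] k h by simp
    qed (use k in auto)
  qed
qed


section \<open>S-exactness, S-flatness and the S-weak global dimension\<close>

text \<open>S-exactness at \<open>N\<close> of \<open>M \<rightarrow> N \<rightarrow> L\<close>, where the maps are \<open>f\<close> and \<open>g\<close>. The composite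
  of the two maps need not be zero.\<close>

definition S_exact_at ::
  "'a set \<Rightarrow> ('a, 'b, 'n) module_scheme \<Rightarrow> ('b \<Rightarrow> 'c) \<Rightarrow> ('a, 'c, 'k) module_scheme \<Rightarrow>
   ('c \<Rightarrow> 'd) \<Rightarrow> ('a, 'd, 'l) module_scheme \<Rightarrow> bool"
  where "S_exact_at S M f N g L \<longleftrightarrow>
    (\<exists>s\<in>S. (\<lambda>y. s \<odot>\<^bsub>N\<^esub> y) ` a_kernel N L g \<subseteq> f ` carrier M \<and>
           (\<lambda>y. s \<odot>\<^bsub>N\<^esub> y) ` (f ` carrier M) \<subseteq> a_kernel N L g)"

definition S_short_exact ::
  "'a set \<Rightarrow> ('a, 'b) module \<Rightarrow> ('b \<Rightarrow> 'c) \<Rightarrow> ('a, 'c) module \<Rightarrow>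
   ('c \<Rightarrow> 'd) \<Rightarrow> ('a, 'd) module \<Rightarrow> bool"
  where "S_short_exact S A f B g C \<longleftrightarrow>
    S_exact_at S (zero_module :: ('a, unit) module) (\<lambda>_. \<zero>\<^bsub>A\<^esub>) A f B \<and>
    S_exact_at S A f B g C \<and>
    S_exact_at S B g C (\<lambda>_. ()) (zero_module :: ('a, unit) module)"

text \<open>A type variable \<open>'u\<close> serves as the universe of modules: ``all \<open>R\<close>-modules'' ranges over all
  \<open>R\<close>-modules whose carrier is a subset of \<open>'u\<close>. It has to be infinite and at least as large as
  \<open>R\<close>; it then contains, up to isomorphism, the free modules on its own subsets and their quotients.
  Tensor products need not lie in the universe.\<close>

definition S_flat :: "('a, 'm) ring_scheme \<Rightarrow> 'a set \<Rightarrow> ('a, 'u) module \<Rightarrow> bool"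
  where "S_flat R S F \<longleftrightarrow> module R F \<and>
    (\<forall>(A :: ('a, 'u) module) (B :: ('a, 'u) module) (C :: ('a, 'u) module) f g.
       module R A \<longrightarrow> module R B \<longrightarrow> module R C \<longrightarrow>
       f \<in> mod_hom R A B \<longrightarrow> g \<in> mod_hom R B C \<longrightarrow>
       S_short_exact S A f B g C \<longrightarrow>
       S_short_exact S
         (tensor_module R A F) (tensor_map R A B F f)
         (tensor_module R B F) (tensor_map R B C F g) (tensor_module R C F))"

text \<open>In \<open>S_fd_le R S M n\<close> the sequence \<open>0 \<rightarrow> F\<^sub>n \<rightarrow> \<dots> \<rightarrow> F\<^sub>0 \<rightarrow> M \<rightarrow> 0\<close> is indexed by
  \<open>X 0 = 0\<close>, \<open>X 1 = M\<close>, \<open>X (i + 2) = F\<^sub>i\<close> for \<open>i \<le> n\<close> and \<open>X (n + 3) = 0\<close>, with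
  \<open>d i\<close> going from \<open>X (Suc i)\<close> to \<open>X i\<close>.\<close>

definition S_exact_seq ::
  "('a, 'm) ring_scheme \<Rightarrow> 'a set \<Rightarrow> nat \<Rightarrow> (nat \<Rightarrow> ('a, 'u) module) \<Rightarrow> (nat \<Rightarrow> 'u \<Rightarrow> 'u) \<Rightarrow> bool"
  where "S_exact_seq R S k X d \<longleftrightarrow>
    (\<forall>i\<le>k. module R (X i)) \<and>
    (\<forall>i<k. d i \<in> mod_hom R (X (Suc i)) (X i)) \<and>
    (\<forall>i. Suc i < k \<longrightarrow> S_exact_at S (X (Suc (Suc i))) (d (Suc i)) (X (Suc i)) (d i) (X i))"

definition S_fd_le :: "('a, 'm) ring_scheme \<Rightarrow> 'a set \<Rightarrow> ('a, 'u) module \<Rightarrow> nat \<Rightarrow> bool"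
  where "S_fd_le R S M n \<longleftrightarrow>
    (\<exists>X d. X 0 = zero_module \<and> X 1 = M \<and> X (n + 3) = zero_module \<and>
       (\<forall>i\<le>n. S_flat R S (X (i + 2))) \<and> S_exact_seq R S (n + 3) X d)"

definition S_fd :: "('a, 'm) ring_scheme \<Rightarrow> 'a set \<Rightarrow> ('a, 'u) module \<Rightarrow> enat"
  where "S_fd R S M = (if \<exists>n. S_fd_le R S M n then enat (LEAST n. S_fd_le R S M n) else \<infinity>)"

definition S_w_gl_dim :: "'u itself \<Rightarrow> ('a, 'm) ring_scheme \<Rightarrow> 'a set \<Rightarrow> enat"
  where "S_w_gl_dim (U :: 'u itself) R S = Sup {S_fd R S M |M :: ('a, 'u) module. module R M}"

definition const_polys :: "('a, 'm) ring_scheme \<Rightarrow> 'a set \<Rightarrow> (nat \<Rightarrow> 'a) set"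
  where "const_polys R S = (\<lambda>s. monom (UP R) s 0) ` S"

text \<open>If \<open>0 \<in> S\<close> then every sequence of modules is S-exact and the S-weak global dimension is
  \<open>0\<close> over every ring, so that the polynomial formula can only hold for \<open>0 \<notin> S\<close>.\<close>

lemma S_exact_trivial:
  assumes "module R M" "module R N" "module R L" "f \<in> mod_hom R M N" "g \<in> mod_hom R N L" "\<zero>\<^bsub>R\<^esub> \<in> S"
  shows "S_exact_at S M f N g L"
proof -
  interpret M: module R M by fact
  interpret N: module R N by fact
  interpret L: module R L by fact
  have "f \<zero>\<^bsub>M\<^esub> = \<zero>\<^bsub>N\<^esub>" "g \<zero>\<^bsub>N\<^esub> = \<zero>\<^bsub>L\<^esub>" using mod_hom_zero_minus(1) assms by metis+
  moreover have "\<zero>\<^bsub>N\<^esub> \<in> f ` carrier M" using calculation(1) M.M.zero_closed by (metis imageI)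
  ultimately show ?thesis unfolding S_exact_at_def
    by (intro bexI[OF _ assms(6)]) (auto simp: a_kernel_def' mod_homD[OF assms(4)])
qed

lemma module_zero_module: "cring R \<Longrightarrow> module R zero_module"
  by (rule moduleI, assumption, rule abelian_groupI) (auto simp: zero_module_def)

lemma S_flat_trivial:
  assumes "module R F" "\<zero>\<^bsub>R\<^esub> \<in> S"
  shows "S_flat R S F"
proof -
  interpret F: module R F by fact
  note z = module_zero_module[OF F.is_cring]
  note t = module_tensor_module[OF _ assms(1)]
  have m: "tensor_map R A B F f \<in> mod_hom R (tensor_module R A F) (tensor_module R B F)"
    if "module R A" "module R B" "f \<in> mod_hom R A B" for A B f
    using theI'[OF tensor_map_ex1[OF that(1,2) assms(1) that(3)]] by (simp add: tensor_map_def)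
  have h0: "(\<lambda>_. \<zero>\<^bsub>A\<^esub>) \<in> mod_hom R zero_module A" if "module R A" for A
  proof -
    interpret A: module R A by fact
    show ?thesis by (rule mod_homI) auto
  qed
  have h1: "(\<lambda>_. ()) \<in> mod_hom R A zero_module" for A
    by (rule mod_homI) (auto simp: zero_module_def)
  show ?thesis unfolding S_flat_def S_short_exact_def using assms
    by (auto intro!: S_exact_trivial[OF z] S_exact_trivial[OF _ _ z] S_exact_trivial t m h0 h1)
qed

lemma S_w_gl_dim_trivial:
  assumes "cring R" "\<zero>\<^bsub>R\<^esub> \<in> S"
  shows "S_w_gl_dim TYPE('u) R S = 0"
proof -
  have "S_fd R S M = 0" if M: "module R M" for M :: "('a, 'u) module"
  proof -
    note z = module_zero_module[OF assms(1)]
    interpret M: module R M by fact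
    define X :: "nat \<Rightarrow> ('a, 'u) module" where "X i = (if i = 1 \<or> i = 2 then M else zero_module)" for i
    define d :: "nat \<Rightarrow> 'u \<Rightarrow> 'u" where "d i = (if i = 1 then id else if i = 0 then (\<lambda>_. undefined) else (\<lambda>_. \<zero>\<^bsub>M\<^esub>))" for i
    have X: "module R (X i)" for i by (simp add: X_def M z)
    have d: "d i \<in> mod_hom R (X (Suc i)) (X i)" if "i < 3" for i
      by (rule mod_homI) (use that in \<open>auto simp: X_def d_def zero_module_def less_Suc_eq numeral_eq_Suc\<close>)
    have "S_fd_le R S M 0" unfolding S_fd_le_def S_exact_seq_def
      by (rule exI[of _ X], rule exI[of _ d])
        (use X d assms M in \<open>auto intro!: S_exact_trivial S_flat_trivial, auto simp: X_def numeral_eq_Suc\<close>)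
    then show ?thesis by (auto simp: S_fd_def zero_enat_def intro!: Least_equality)
  qed
  then have "{S_fd R S M |M :: ('a, 'u) module. module R M} \<subseteq> {0}" by auto
  then have "S_w_gl_dim TYPE('u) R S \<le> 0"
    unfolding S_w_gl_dim_def by (intro Sup_least) auto
  then show ?thesis by simp
qed

end

theory Submission
  imports "HOL-Algebra.Free_Abelian_Groups" Defs
begin

text \<open>Homological dimension is measured on the side of the other tensor factor. For a complex \<open>Q\<close> of free
  modules, exact in positive degrees, and a module \<open>M\<close>, the complex \<open>Q \<otimes> M\<close> consists of finitely supported
  functions with values in \<open>M\<close>, so that a short \<open>S\<close>-exact sequence of modules has a long \<open>S\<close>-exact homology
  sequence without any flatness, and \<open>S\<close>-fd \<open>M \<le> n\<close> holds iff for every such \<open>Q\<close> the homology of \<open>Q \<otimes> M\<close> in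
  degree \<open>n + 1\<close> is killed by an element of \<open>S\<close>, which may depend on \<open>Q\<close>.

  For the upper bound, a complex \<open>Q\<close> over \<open>R[x]\<close> is also a complex of free \<open>R\<close>-modules, and
  \<open>x \<otimes> 1 - 1 \<otimes> x\<close> gives a short exact sequence with terms \<open>Q \<otimes>\<^sub>R M\<close>, \<open>Q \<otimes>\<^sub>R M\<close> and the tensor product of \<open>Q\<close> and
  \<open>M\<close> over \<open>R[x]\<close>. For the lower bound, let \<open>x\<close> act as zero on an \<open>R\<close>-module \<open>M\<close>. If \<open>Q\<close> is a complex over
  \<open>R\<close>, the cone of \<open>x\<close> on \<open>Q[x]\<close> is exact in positive degrees, and after tensoring with \<open>M\<close> its homology
  contains that of \<open>Q \<otimes> M\<close> with the degree raised by one.\<close>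

section \<open>Finitely supported functions\<close>

text \<open>Flatness up to \<open>S\<close> supplies a separate element of \<open>S\<close> for each
  short exact sequence, and infinitely many elements of \<open>S\<close> may have no common multiple
  in \<open>S\<close>. Multipliers therefore cannot be collected over all test modules; the test
  complex \<open>Q\<close> is fixed first, and only finitely many multipliers are combined for it. A
  second obstacle is the universe: modules are confined to \<open>'u\<close>, while free modules and
  tensor products are built on function types. Hence complexes are described by bases and matrices.
  Restriction of scalars turns bases in \<open>'u\<close> into bases in
  \<open>'u \<times> nat\<close>, and the cone turns them into bases in \<open>'u + 'u\<close>; both
  types embed into the infinite type \<open>'u\<close>. The two bounds only say that the dimension
  over \<open>R[x]\<close> is at most \<open>n + 1\<close> iff the dimension over \<open>R\<close>
  is at most \<open>n\<close>. That the former is not 0 needs an argument of its own: otherwise one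
  element of \<open>S\<close> would kill \<open>R\<close>, and 0 would lie in
  \<open>S\<close>.\<close>

definition regular_module :: "('a, 'm) ring_scheme \<Rightarrow> ('a, 'a) module"
  where "regular_module R = \<lparr>carrier = carrier R, mult = undefined, one = undefined,
    zero = \<zero>\<^bsub>R\<^esub>, add = add R, smult = mult R\<rparr>"

text \<open>With \<open>M = regular_module R\<close> this is the free module on \<open>I\<close>,
  and for general \<open>M\<close> its tensor product with \<open>M\<close>. Thus \<open>Q\<close>
  and \<open>Q \<otimes> M\<close> are instances of one construction, which involves no
  quotient.\<close>

definition fs :: "('a, 'b, 'n) module_scheme \<Rightarrow> 'i set \<Rightarrow> ('a, 'i \<Rightarrow> 'b) module"
  where "fs M I = \<lparr>
    carrier = {z. (\<forall>i. z i \<in> carrier M) \<and> (\<forall>i. i \<notin> I \<longrightarrow> z i = \<zero>\<^bsub>M\<^esub>) \<and> finite {i. z i \<noteq> \<zero>\<^bsub>M\<^esub>}},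
    mult = undefined, one = undefined,
    zero = (\<lambda>_. \<zero>\<^bsub>M\<^esub>),
    add = (\<lambda>z w i. z i \<oplus>\<^bsub>M\<^esub> w i),
    smult = (\<lambda>r z i. r \<odot>\<^bsub>M\<^esub> z i)\<rparr>"

definition single :: "('a, 'b, 'n) module_scheme \<Rightarrow> 'i \<Rightarrow> 'b \<Rightarrow> 'i \<Rightarrow> 'b"
  where "single M i m = (\<lambda>j. if j = i then m else \<zero>\<^bsub>M\<^esub>)"

lemma regular_module_simps [simp]:
  "carrier (regular_module R) = carrier R" "\<zero>\<^bsub>regular_module R\<^esub> = \<zero>\<^bsub>R\<^esub>"
  "x \<oplus>\<^bsub>regular_module R\<^esub> y = x \<oplus>\<^bsub>R\<^esub> y" "x \<odot>\<^bsub>regular_module R\<^esub> y = x \<otimes>\<^bsub>R\<^esub> y"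
  by (simp_all add: regular_module_def)

lemma fs_simps [simp]:
  "\<zero>\<^bsub>fs M I\<^esub> = (\<lambda>_. \<zero>\<^bsub>M\<^esub>)" "z \<oplus>\<^bsub>fs M I\<^esub> w = (\<lambda>i. z i \<oplus>\<^bsub>M\<^esub> w i)"
  "r \<odot>\<^bsub>fs M I\<^esub> z = (\<lambda>i. r \<odot>\<^bsub>M\<^esub> z i)"
  by (simp_all add: fs_def)

lemma fs_carrier:
  "z \<in> carrier (fs M I) \<longleftrightarrow>
     (\<forall>i. z i \<in> carrier M) \<and> (\<forall>i. i \<notin> I \<longrightarrow> z i = \<zero>\<^bsub>M\<^esub>) \<and> finite {i. z i \<noteq> \<zero>\<^bsub>M\<^esub>}"
  by (simp add: fs_def)

lemma fs_value: "z \<in> carrier (fs M I) \<Longrightarrow> z i \<in> carrier M"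
  by (simp add: fs_def)

lemma fs_mono: "I \<subseteq> J \<Longrightarrow> z \<in> carrier (fs M I) \<Longrightarrow> z \<in> carrier (fs M J)"
  by (auto simp: fs_carrier)

lemma module_regular_module: "cring R \<Longrightarrow> module R (regular_module R)"
proof -
  assume "cring R"
  interpret cring R by fact
  show "module R (regular_module R)"
    by (rule moduleI, rule is_cring, rule abelian_groupI)
      (auto simp: l_distr r_distr m_assoc a_ac intro: exI[of _ "\<ominus>\<^bsub>R\<^esub> _"] l_neg)
qed

lemma module_fs:
  assumes "module R M" shows "module R (fs M I)"
proof -
  interpret module R M by fact
  have fin: "finite {i. z i \<oplus>\<^bsub>M\<^esub> w i \<noteq> \<zero>\<^bsub>M\<^esub>}"
    if "finite {i. z i \<noteq> \<zero>\<^bsub>M\<^esub>}" "finite {i. w i \<noteq> \<zero>\<^bsub>M\<^esub>}" for z w :: "'x \<Rightarrow> _"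
    by (rule finite_subset[OF _ finite_UnI[OF that]]) auto
  have fin2: "finite {i. r \<odot>\<^bsub>M\<^esub> z i \<noteq> \<zero>\<^bsub>M\<^esub>}" if "finite {i. z i \<noteq> \<zero>\<^bsub>M\<^esub>}" "r \<in> carrier R"
    for r and z :: "'x \<Rightarrow> _"
    by (rule finite_subset[OF _ that(1)]) (use that in auto)
  have neg: "(\<lambda>i. \<ominus>\<^bsub>M\<^esub> z i) \<in> carrier (fs M I)" if "z \<in> carrier (fs M I)" for z
  proof -
    have "{i. \<ominus>\<^bsub>M\<^esub> z i \<noteq> \<zero>\<^bsub>M\<^esub>} \<subseteq> {i. z i \<noteq> \<zero>\<^bsub>M\<^esub>}" by auto
    with that show ?thesis by (auto simp: fs_carrier intro: finite_subset)
  qed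
  show ?thesis
  proof (rule moduleI, rule is_cring, rule abelian_groupI)
    fix x assume x: "x \<in> carrier (fs M I)"
    show "\<exists>y\<in>carrier (fs M I). y \<oplus>\<^bsub>fs M I\<^esub> x = \<zero>\<^bsub>fs M I\<^esub>"
      by (rule bexI[OF _ neg[OF x]]) (use fs_value[OF x] in \<open>auto simp: M.l_neg\<close>)
  qed (auto simp: fs_carrier fun_eq_iff fin fin2 M.a_ac smult_l_distr smult_r_distr smult_assoc1)
qed

lemma fs_minus:
  assumes "module R M" "z \<in> carrier (fs M I)" shows "\<ominus>\<^bsub>fs M I\<^esub> z = (\<lambda>i. \<ominus>\<^bsub>M\<^esub> z i)"
proof -
  interpret M: module R M by fact
  interpret F: module R "fs M I" by (rule module_fs) fact
  have "(\<ominus>\<^bsub>fs M I\<^esub> z) i = \<ominus>\<^bsub>M\<^esub> z i" for i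
  proof -
    have "(\<ominus>\<^bsub>fs M I\<^esub> z) \<oplus>\<^bsub>fs M I\<^esub> z = \<zero>\<^bsub>fs M I\<^esub>" using assms(2) by (rule F.M.l_neg)
    then have "(\<ominus>\<^bsub>fs M I\<^esub> z) i \<oplus>\<^bsub>M\<^esub> z i = \<zero>\<^bsub>M\<^esub>" by (simp add: fun_eq_iff)
    with assms(2) F.M.a_inv_closed[OF assms(2)] show ?thesis
      by (metis M.M.minus_equality fs_value)
  qed
  then show ?thesis by auto
qed

lemma single_closed:
  assumes "module R M" "i \<in> I" "m \<in> carrier M" shows "single M i m \<in> carrier (fs M I)"
proof -
  interpret module R M by fact
  have "{j. single M i m j \<noteq> \<zero>\<^bsub>M\<^esub>} \<subseteq> {i}" by (auto simp: single_def)
  then show ?thesis using assms(2,3) by (auto simp: fs_carrier single_def intro: finite_subset)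
qed

lemma single_hom:
  assumes "module R M" "i \<in> I" shows "single M i \<in> mod_hom R M (fs M I)"
proof -
  interpret module R M by fact
  show ?thesis using single_closed[OF assms] by (intro mod_homI) (auto simp: single_def)
qed

lemma fs_induct [consumes 2, case_names zero add]:
  assumes "module R M" and z: "z \<in> carrier (fs M I)"
    and "P \<zero>\<^bsub>fs M I\<^esub>"
    and "\<And>i m z. i \<in> I \<Longrightarrow> m \<in> carrier M \<Longrightarrow> z \<in> carrier (fs M I) \<Longrightarrow> P z \<Longrightarrow>
      P (single M i m \<oplus>\<^bsub>fs M I\<^esub> z)"
  shows "P z"
proof -
  interpret module R M by fact
  have "finite A \<Longrightarrow> (\<forall>z\<in>carrier (fs M I). {i. z i \<noteq> \<zero>\<^bsub>M\<^esub>} \<subseteq> A \<longrightarrow> P z)" for A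
  proof (induction A rule: finite_induct)
    case empty
    show ?case
    proof safe
      fix z assume "z \<in> carrier (fs M I)" "{i. z i \<noteq> \<zero>\<^bsub>M\<^esub>} \<subseteq> {}"
      then have "z = \<zero>\<^bsub>fs M I\<^esub>" by (auto simp: fs_def)
      then show "P z" using assms(3) by simp
    qed
  next
    case (insert a A)
    show ?case
    proof safe
      fix z assume z: "z \<in> carrier (fs M I)" "{i. z i \<noteq> \<zero>\<^bsub>M\<^esub>} \<subseteq> insert a A"
      show "P z"
      proof (cases "a \<in> I")
        case False
        then have "z a = \<zero>\<^bsub>M\<^esub>" using z by (auto simp: fs_def)
        then have "{i. z i \<noteq> \<zero>\<^bsub>M\<^esub>} \<subseteq> A" using z(2) by auto
        with insert.IH z(1) show ?thesis by blast
      next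
        case True
        let ?q = "z(a := \<zero>\<^bsub>M\<^esub>)"
        have "{i. ?q i \<noteq> \<zero>\<^bsub>M\<^esub>} \<subseteq> {i. z i \<noteq> \<zero>\<^bsub>M\<^esub>}" by auto
        then have q: "?q \<in> carrier (fs M I)" using z(1) by (auto simp: fs_carrier intro: finite_subset)
        have "{i. ?q i \<noteq> \<zero>\<^bsub>M\<^esub>} \<subseteq> A" using z(2) by auto
        with insert.IH q have Pq: "P ?q" by blast
        have "P (single M a (z a) \<oplus>\<^bsub>fs M I\<^esub> ?q)"
          by (rule assms(4)) (use True q Pq fs_value[OF z(1)] in auto)
        moreover have "single M a (z a) \<oplus>\<^bsub>fs M I\<^esub> ?q = z"
          using fs_value[OF z(1)] by (auto simp: single_def fun_eq_iff)
        ultimately show ?thesis by simp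
      qed
    qed
  qed
  moreover have "finite {i. z i \<noteq> \<zero>\<^bsub>M\<^esub>}" using z by (auto simp: fs_def)
  ultimately show ?thesis using z by blast
qed

text \<open>A direct sum is generated by the elements with a single entry. Nearly all identities
  between maps further on are proved by this rule.\<close>

lemma fs_hom_eq:
  assumes "module R M" "module R N" "h \<in> mod_hom R (fs M I) N" "h' \<in> mod_hom R (fs M I) N"
    and "\<And>i m. i \<in> I \<Longrightarrow> m \<in> carrier M \<Longrightarrow> h (single M i m) = h' (single M i m)"
    and "z \<in> carrier (fs M I)"
  shows "h z = h' z"
  using assms(1,6)
proof (induction rule: fs_induct)
  case zero
  show ?case using mod_hom_zero_minus(1)[OF module_fs[OF assms(1)] assms(2)] assms(3,4) by metis
next
  case (add i m z)
  then show ?case using assms(5) mod_homD(2)[OF assms(3)] mod_homD(2)[OF assms(4)] single_closed[OF assms(1)]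
    by metis
qed

definition fs_lift ::
  "('a, 'b, 'n) module_scheme \<Rightarrow> ('a, 'c, 'k) module_scheme \<Rightarrow> ('i \<Rightarrow> 'b \<Rightarrow> 'c) \<Rightarrow> ('i \<Rightarrow> 'b) \<Rightarrow> 'c"
  where "fs_lift M N \<phi> z = (\<Oplus>\<^bsub>N\<^esub>i\<in>{i. z i \<noteq> \<zero>\<^bsub>M\<^esub>}. \<phi> i (z i))"

lemma fs_lift:
  assumes "module R M" "module R N" "\<And>i. i \<in> I \<Longrightarrow> \<phi> i \<in> mod_hom R M N"
  shows "fs_lift M N \<phi> \<in> mod_hom R (fs M I) N"
    and "\<And>i m. i \<in> I \<Longrightarrow> m \<in> carrier M \<Longrightarrow> fs_lift M N \<phi> (single M i m) = \<phi> i m"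
proof -
  interpret M: module R M by fact
  interpret N: module R N by fact
  let ?F = "fs M I" and ?h = "fs_lift M N \<phi>"
  have \<phi>: "\<phi> i m \<in> carrier N" if "i \<in> I" "m \<in> carrier M" for i m
    using mod_homD(1)[OF assms(3)] that by blast
  have \<phi>0: "\<phi> i \<zero>\<^bsub>M\<^esub> = \<zero>\<^bsub>N\<^esub>" if "i \<in> I" for i
    using mod_hom_zero_minus(1)[OF assms(1,2) assms(3)] that by blast
  \<comment> \<open>As \<open>\<phi> i\<close> maps zero to zero, the support may be replaced by any
    larger finite set; the sum of two functions is treated on the union of their supports.\<close>
  have h_eq: "?h z = (\<Oplus>\<^bsub>N\<^esub>i\<in>A. \<phi> i (z i))"
    if "z \<in> carrier ?F" "finite A" "A \<subseteq> I" "{i. z i \<noteq> \<zero>\<^bsub>M\<^esub>} \<subseteq> A" for z A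
    unfolding fs_lift_def
    by (rule N.M.add.finprod_mono_neutral_cong_left) (use that \<phi> \<phi>0 in \<open>auto simp: fs_carrier subset_eq\<close>)
  have fin: "finite {i. z i \<noteq> \<zero>\<^bsub>M\<^esub>}" "{i. z i \<noteq> \<zero>\<^bsub>M\<^esub>} \<subseteq> I" if "z \<in> carrier ?F" for z
    using that by (auto simp: fs_carrier)
  interpret F: module R ?F by (rule module_fs) fact
  show "?h \<in> mod_hom R ?F N"
  proof (rule mod_homI)
    show "?h z \<in> carrier N" if "z \<in> carrier ?F" for z
      unfolding fs_lift_def using \<phi> fin(2)[OF that] fs_value[OF that] by (intro N.M.finsum_closed) blast
    show "?h (z \<oplus>\<^bsub>?F\<^esub> w) = ?h z \<oplus>\<^bsub>N\<^esub> ?h w" if z: "z \<in> carrier ?F" and w: "w \<in> carrier ?F" for z w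
    proof -
      let ?A = "{i. z i \<noteq> \<zero>\<^bsub>M\<^esub>} \<union> {i. w i \<noteq> \<zero>\<^bsub>M\<^esub>}"
      have A: "finite ?A" "?A \<subseteq> I" using fin z w by auto
      have c: "\<phi> i (z i) \<in> carrier N" "\<phi> i (w i) \<in> carrier N" if "i \<in> ?A" for i
        using that A \<phi> fs_value[OF z] fs_value[OF w] by blast+
      have "?h (z \<oplus>\<^bsub>?F\<^esub> w) = (\<Oplus>\<^bsub>N\<^esub>i\<in>?A. \<phi> i ((z \<oplus>\<^bsub>?F\<^esub> w) i))"
        by (rule h_eq) (use A fs_value[OF z] F.M.a_closed[OF z w] in auto)
      also have "\<dots> = (\<Oplus>\<^bsub>N\<^esub>i\<in>?A. \<phi> i (z i) \<oplus>\<^bsub>N\<^esub> \<phi> i (w i))"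
        using A(2) c mod_homD(2)[OF assms(3)] fs_value[OF z] fs_value[OF w]
        by (intro N.M.finsum_cong') (auto simp: subset_eq)
      also have "\<dots> = (\<Oplus>\<^bsub>N\<^esub>i\<in>?A. \<phi> i (z i)) \<oplus>\<^bsub>N\<^esub> (\<Oplus>\<^bsub>N\<^esub>i\<in>?A. \<phi> i (w i))"
        using c by (intro N.M.finsum_addf) auto
      also have "\<dots> = ?h z \<oplus>\<^bsub>N\<^esub> ?h w"
        using h_eq[OF z A] h_eq[OF w A] by auto
      finally show ?thesis .
    qed
    show "?h (r \<odot>\<^bsub>?F\<^esub> z) = r \<odot>\<^bsub>N\<^esub> ?h z" if r: "r \<in> carrier R" and z: "z \<in> carrier ?F" for r z
    proof -
      let ?A = "{i. z i \<noteq> \<zero>\<^bsub>M\<^esub>}"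
      have c: "\<phi> i (z i) \<in> carrier N" if "i \<in> ?A" for i
        using that fin(2)[OF z] \<phi> fs_value[OF z] by blast
      have "?h (r \<odot>\<^bsub>?F\<^esub> z) = (\<Oplus>\<^bsub>N\<^esub>i\<in>?A. \<phi> i ((r \<odot>\<^bsub>?F\<^esub> z) i))"
        by (rule h_eq) (use r fin[OF z] F.smult_closed[OF r z] in auto)
      also have "\<dots> = (\<Oplus>\<^bsub>N\<^esub>i\<in>?A. r \<odot>\<^bsub>N\<^esub> \<phi> i (z i))"
        using fin(2)[OF z] c r mod_homD(3)[OF assms(3)] fs_value[OF z]
        by (intro N.M.finsum_cong') (auto simp: subset_eq)
      also have "\<dots> = r \<odot>\<^bsub>N\<^esub> ?h z" unfolding fs_lift_def
        using c r fin(1)[OF z] by (intro N.finsum_smult_ldistr[symmetric]) auto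
      finally show ?thesis .
    qed
  qed
  show "?h (single M i m) = \<phi> i m" if i: "i \<in> I" and m: "m \<in> carrier M" for i m
  proof -
    have "?h (single M i m) = (\<Oplus>\<^bsub>N\<^esub>j\<in>{i}. \<phi> j (single M i m j))"
      by (rule h_eq) (use i m single_closed[OF assms(1) i m] in \<open>auto simp: single_def split: if_splits\<close>)
    then show ?thesis using \<phi>[OF i m] by (simp add: single_def)
  qed
qed

section \<open>Operations on module homomorphisms\<close>

lemma mod_hom_comp:
  "f \<in> mod_hom R M N \<Longrightarrow> g \<in> mod_hom R N L \<Longrightarrow> (\<lambda>x. g (f x)) \<in> mod_hom R M L"
  by (rule mod_homI) (auto simp: mod_homD)

lemma mod_hom_cong:
  assumes "f \<in> mod_hom R M N" "module R M" "\<And>x. x \<in> carrier M \<Longrightarrow> f x = g x"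
  shows "g \<in> mod_hom R M N"
proof -
  interpret M: module R M by fact
  note f = mod_homD[OF assms(1)]
  show ?thesis
    by (rule mod_homI) (use f in \<open>simp_all flip: assms(3)\<close>)
qed

lemma mod_hom_zero: "module R N \<Longrightarrow> (\<lambda>_. \<zero>\<^bsub>N\<^esub>) \<in> mod_hom R M N"
proof -
  assume "module R N"
  then interpret N: module R N .
  show ?thesis by (rule mod_homI) auto
qed

lemma mod_hom_add:
  assumes "module R N" "f \<in> mod_hom R M N" "g \<in> mod_hom R M N"
  shows "(\<lambda>x. f x \<oplus>\<^bsub>N\<^esub> g x) \<in> mod_hom R M N"
proof -
  interpret N: module R N by fact
  show ?thesis using assms(2,3)
    by (intro mod_homI) (auto simp: mod_homD N.M.a_ac N.smult_r_distr)
qed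

lemma mod_hom_smult:
  assumes "module R N" "f \<in> mod_hom R M N" "s \<in> carrier R"
  shows "(\<lambda>x. s \<odot>\<^bsub>N\<^esub> f x) \<in> mod_hom R M N"
proof -
  interpret N: module R N by fact
  show ?thesis using assms(2,3)
    by (intro mod_homI) (auto simp: mod_homD N.smult_r_distr N.smult_assoc1[symmetric] N.m_comm)
qed

lemma mod_hom_minus:
  assumes "module R N" "f \<in> mod_hom R M N" "g \<in> mod_hom R M N"
  shows "(\<lambda>x. f x \<ominus>\<^bsub>N\<^esub> g x) \<in> mod_hom R M N"
proof -
  interpret N: module R N by fact
  show ?thesis using assms(2,3)
    by (intro mod_homI)
      (auto simp: mod_homD N.M.a_ac N.smult_r_distr N.smult_r_minus N.M.minus_add a_minus_def)
qed

lemma mod_hom_diff: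
  assumes "module R M" "module R N" "f \<in> mod_hom R M N" "x \<in> carrier M" "y \<in> carrier M"
  shows "f (x \<ominus>\<^bsub>M\<^esub> y) = f x \<ominus>\<^bsub>N\<^esub> f y"
proof -
  interpret M: module R M by fact
  show ?thesis using assms by (simp add: a_minus_def mod_homD mod_hom_zero_minus)
qed

lemma fs_post:
  assumes "module R M" "module R N" "f \<in> mod_hom R M N" 
  shows "(\<lambda>z i. f (z i)) \<in> mod_hom R (fs M I) (fs N I)"
proof -
  have f0: "f \<zero>\<^bsub>M\<^esub> = \<zero>\<^bsub>N\<^esub>" by (rule mod_hom_zero_minus(1)[OF assms])
  have "{i. f (z i) \<noteq> \<zero>\<^bsub>N\<^esub>} \<subseteq> {i. z i \<noteq> \<zero>\<^bsub>M\<^esub>}" for z using f0 by auto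
  then show ?thesis using mod_homD[OF assms(3)] f0
    by (intro mod_homI) (auto simp: fs_carrier intro: finite_subset)
qed

lemma fs_post_single:
  assumes "module R M" "module R N" "f \<in> mod_hom R M N"
  shows "(\<lambda>j. f (single M i m j)) = single N i (f m)"
  using mod_hom_zero_minus(1)[OF assms] by (auto simp: single_def)

section \<open>Matrices acting on finitely supported functions\<close>

text \<open>This is the elementary tensor \<open>p \<otimes> m\<close>, for \<open>p\<close> in a
  free module, once the tensor product is identified with \<open>M\<close>-valued functions.\<close>

definition act :: "('a, 'b, 'n) module_scheme \<Rightarrow> ('i \<Rightarrow> 'a) \<Rightarrow> 'b \<Rightarrow> 'i \<Rightarrow> 'b"
  where "act M p m = (\<lambda>i. p i \<odot>\<^bsub>M\<^esub> m)"

text \<open>The matrix \<open>A\<close> is given by its columns: \<open>A j\<close> is the image of the \<open>j\<close>-th generator.\<close>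

definition mx :: "('a, 'b, 'n) module_scheme \<Rightarrow> 'i set \<Rightarrow> ('j \<Rightarrow> 'i \<Rightarrow> 'a) \<Rightarrow> ('j \<Rightarrow> 'b) \<Rightarrow> 'i \<Rightarrow> 'b"
  where "mx M I A = fs_lift M (fs M I) (\<lambda>j. act M (A j))"

lemma smult_hom:
  assumes "module R M" "m \<in> carrier M" shows "(\<lambda>r. r \<odot>\<^bsub>M\<^esub> m) \<in> mod_hom R (regular_module R) M"
proof -
  interpret module R M by fact
  show ?thesis using assms(2) by (intro mod_homI) (auto simp: smult_l_distr smult_assoc1)
qed

lemma act_hom_left:
  assumes "module R M" "m \<in> carrier M"
  shows "(\<lambda>p. act M p m) \<in> mod_hom R (fs (regular_module R) I) (fs M I)"
proof -
  interpret module R M by fact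
  show ?thesis unfolding act_def
    by (rule fs_post[OF module_regular_module[OF is_cring] assms(1) smult_hom[OF assms]])
qed

lemma act_hom:
  assumes "module R M" "p \<in> carrier (fs (regular_module R) I)"
  shows "act M p \<in> mod_hom R M (fs M I)"
proof -
  interpret module R M by fact
  have p: "p i \<in> carrier R" for i using fs_value[OF assms(2)] by simp
  show ?thesis using mod_homD(1)[OF act_hom_left[OF assms(1)] assms(2)] p
    by (intro mod_homI) (auto simp: act_def smult_r_distr smult_assoc1[symmetric] m_comm)
qed

lemma act_closed:
  "module R M \<Longrightarrow> p \<in> carrier (fs (regular_module R) I) \<Longrightarrow> m \<in> carrier M \<Longrightarrow> act M p m \<in> carrier (fs M I)"
  by (rule mod_homD(1)[OF act_hom])

lemma act_single:
  assumes "module R M" "m \<in> carrier M" shows "act M (single (regular_module R) i r) m = single M i (r \<odot>\<^bsub>M\<^esub> m)"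
proof -
  interpret module R M by fact
  show ?thesis using assms(2) by (auto simp: act_def single_def)
qed

lemma mx:
  assumes "module R M" "\<And>j. j \<in> J \<Longrightarrow> A j \<in> carrier (fs (regular_module R) I)"
  shows mx_hom: "mx M I A \<in> mod_hom R (fs M J) (fs M I)"
    and mx_single: "\<And>j m. j \<in> J \<Longrightarrow> m \<in> carrier M \<Longrightarrow> mx M I A (single M j m) = act M (A j) m"
  unfolding mx_def
  by (rule fs_lift[OF assms(1) module_fs[OF assms(1)]], rule act_hom; use assms in blast)+

lemma mx_zero:
  assumes "module R M" shows "mx M I A (\<lambda>_. \<zero>\<^bsub>M\<^esub>) = (\<lambda>_. \<zero>\<^bsub>M\<^esub>)"
proof -
  have "mx M I A \<in> mod_hom R (fs M {}) (fs M I)" by (rule mx_hom[OF assms]) simp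
  from mod_hom_zero_minus(1)[OF module_fs[OF assms] module_fs[OF assms] this] show ?thesis by simp
qed

text \<open>A matrix acts through scalars, and \<open>f\<close> commutes with scalars. This is the
  functoriality of \<open>Q \<otimes> M\<close> in \<open>M\<close>.\<close>

lemma mx_natural:
  assumes "module R M" "module R N" "f \<in> mod_hom R M N"
    and A: "\<And>j. j \<in> J \<Longrightarrow> A j \<in> carrier (fs (regular_module R) I)" and z: "z \<in> carrier (fs M J)"
  shows "mx N I A (\<lambda>j. f (z j)) = (\<lambda>i. f (mx M I A z i))"
proof (rule fs_hom_eq[OF assms(1) module_fs[OF assms(2)] _ _ _ z])
  show "(\<lambda>z. mx N I A (\<lambda>j. f (z j))) \<in> mod_hom R (fs M J) (fs N I)"
    by (rule mod_hom_comp[OF fs_post[OF assms(1-3)] mx_hom[OF assms(2) A]])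
  show "(\<lambda>z i. f (mx M I A z i)) \<in> mod_hom R (fs M J) (fs N I)"
    by (rule mod_hom_comp[OF mx_hom[OF assms(1) A] fs_post[OF assms(1-3)]])
  show "mx N I A (\<lambda>k. f (single M j m k)) = (\<lambda>i. f (mx M I A (single M j m) i))"
    if "j \<in> J" "m \<in> carrier M" for j m
  proof -
    have "A j i \<in> carrier R" for i using fs_value[OF A[OF that(1)]] by simp
    then show ?thesis
      using that mx_single[where A=A, OF assms(1) A that] mx_single[where A=A, OF assms(2) A that(1) mod_homD(1)[OF assms(3) that(2)]]
      by (simp add: fs_post_single[OF assms(1-3)] act_def mod_homD(3)[OF assms(3)])
  qed
qed

text \<open>Naturality along the homomorphism \<open>r \<mapsto> r m\<close> from \<open>R\<close>
  to \<open>M\<close>. Relations between matrices over \<open>R\<close> are carried over to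
  \<open>M\<close> in this way.\<close>

lemma mx_act:
  assumes "module R M" "m \<in> carrier M"
    and A: "\<And>j. j \<in> J \<Longrightarrow> A j \<in> carrier (fs (regular_module R) I)"
    and p: "p \<in> carrier (fs (regular_module R) J)"
  shows "mx M I A (act M p m) = act M (mx (regular_module R) I A p) m"
proof -
  interpret module R M by fact
  show ?thesis unfolding act_def
    by (rule mx_natural[OF module_regular_module[OF is_cring] assms(1) smult_hom[OF assms(1,2)] A p])
qed

section \<open>Complexes of free modules\<close>

text \<open>The resolution proper starts in degree \<open>1\<close>, so exactness is required from degree \<open>2\<close> on only.
  The additional term in degree \<open>0\<close> lets \<open>tor_killed\<close> below start at \<open>n = 0\<close>, where it expresses
  torsion.\<close>

definition free_resolution :: "('a, 'm) ring_scheme \<Rightarrow> (nat \<Rightarrow> 'i set) \<Rightarrow> (nat \<Rightarrow> 'i \<Rightarrow> 'i \<Rightarrow> 'a) \<Rightarrow> bool"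
  where "free_resolution R I A \<longleftrightarrow>
    (\<forall>k. \<forall>j\<in>I (Suc k). A k j \<in> carrier (fs (regular_module R) (I k))) \<and>
    (\<forall>k. \<forall>j\<in>I (Suc (Suc k)). mx (regular_module R) (I k) (A k) (A (Suc k) j) = \<zero>\<^bsub>fs (regular_module R) (I k)\<^esub>) \<and>
    (\<forall>k. \<forall>z\<in>carrier (fs (regular_module R) (I (Suc (Suc k)))).
       mx (regular_module R) (I (Suc k)) (A (Suc k)) z = \<zero>\<^bsub>fs (regular_module R) (I (Suc k))\<^esub> \<longrightarrow>
       (\<exists>w\<in>carrier (fs (regular_module R) (I (Suc (Suc (Suc k))))).
          mx (regular_module R) (I (Suc (Suc k))) (A (Suc (Suc k))) w = z))"

lemma free_resolutionD:
  assumes "free_resolution R I A"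
  shows "j \<in> I (Suc k) \<Longrightarrow> A k j \<in> carrier (fs (regular_module R) (I k))"
    and "j \<in> I (Suc (Suc k)) \<Longrightarrow> mx (regular_module R) (I k) (A k) (A (Suc k) j) = (\<lambda>_. \<zero>\<^bsub>R\<^esub>)"
    and "z \<in> carrier (fs (regular_module R) (I (Suc (Suc k)))) \<Longrightarrow>
       mx (regular_module R) (I (Suc k)) (A (Suc k)) z = (\<lambda>_. \<zero>\<^bsub>R\<^esub>) \<Longrightarrow>
       \<exists>w\<in>carrier (fs (regular_module R) (I (Suc (Suc (Suc k))))).
          mx (regular_module R) (I (Suc (Suc k))) (A (Suc (Suc k))) w = z"
  using assms by (simp_all add: free_resolution_def)

lemma free_resolution_shift:
  "free_resolution R I A \<Longrightarrow> free_resolution R (\<lambda>k. I (Suc k)) (\<lambda>k. A (Suc k))"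
  by (simp add: free_resolution_def)

lemma free_resolution_hom:
  "module R M \<Longrightarrow> free_resolution R I A \<Longrightarrow> mx M (I k) (A k) \<in> mod_hom R (fs M (I (Suc k))) (fs M (I k))"
  by (rule mx_hom, assumption, rule free_resolutionD)

text \<open>On an element with a single entry \<open>m\<close> the claim is, by
  \<open>mx_act\<close>, the relation between the matrices over \<open>R\<close>, applied to
  \<open>m\<close>.\<close>

lemma free_resolution_square:
  assumes "module R M" "free_resolution R I A" "z \<in> carrier (fs M (I (Suc (Suc k))))"
  shows "mx M (I k) (A k) (mx M (I (Suc k)) (A (Suc k)) z) = \<zero>\<^bsub>fs M (I k)\<^esub>"
proof -
  interpret module R M by fact
  show ?thesis
  proof (rule fs_hom_eq[OF assms(1) module_fs[OF assms(1)] _ _ _ assms(3)])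
    show "(\<lambda>z. mx M (I k) (A k) (mx M (I (Suc k)) (A (Suc k)) z)) \<in> mod_hom R (fs M (I (Suc (Suc k)))) (fs M (I k))"
      by (rule mod_hom_comp[OF free_resolution_hom free_resolution_hom]; fact)
    show "(\<lambda>_. \<zero>\<^bsub>fs M (I k)\<^esub>) \<in> mod_hom R (fs M (I (Suc (Suc k)))) (fs M (I k))"
      by (rule mod_hom_zero[OF module_fs[OF assms(1)]])
    show "mx M (I k) (A k) (mx M (I (Suc k)) (A (Suc k)) (single M j m)) = \<zero>\<^bsub>fs M (I k)\<^esub>"
      if j: "j \<in> I (Suc (Suc k))" and m: "m \<in> carrier M" for j m
    proof -
      note A = free_resolutionD(1)[OF assms(2)]
      have "mx M (I (Suc k)) (A (Suc k)) (single M j m) = act M (A (Suc k) j) m"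
        by (rule mx_single[OF assms(1) A j m])
      then show ?thesis
        using mx_act[where A="A k", OF assms(1) m A A[OF j]] m free_resolutionD(2)[OF assms(2) j]
        by (simp add: act_def)
    qed
  qed
qed

text \<open>The index \<open>n\<close> belongs to the outgoing differential \<open>d n\<close>; the
  homology meant is that in degree \<open>Suc n\<close>.\<close>

definition homology_killed ::
  "'a set \<Rightarrow> (nat \<Rightarrow> ('a, 'b, 'n) module_scheme) \<Rightarrow> (nat \<Rightarrow> 'b \<Rightarrow> 'b) \<Rightarrow> nat \<Rightarrow> bool"
  where "homology_killed S C d n \<longleftrightarrow>
    (\<exists>s\<in>S. \<forall>z\<in>carrier (C (Suc n)). d n z = \<zero>\<^bsub>C n\<^esub> \<longrightarrow>
       (\<exists>w\<in>carrier (C (Suc (Suc n))). d (Suc n) w = s \<odot>\<^bsub>C (Suc n)\<^esub> z))"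

text \<open>For \<open>n \<ge> 1\<close> this says that each \<open>Tor\<^sub>n(N, M)\<close> is killed by an element of \<open>S\<close>, which may depend on
  \<open>N\<close>; the modules \<open>N\<close> are those with a free resolution whose bases are subsets of \<open>'i\<close>.\<close>

definition tor_killed ::
  "'i itself \<Rightarrow> ('a, 'm) ring_scheme \<Rightarrow> 'a set \<Rightarrow> ('a, 'b, 'n) module_scheme \<Rightarrow> nat \<Rightarrow> bool"
  where "tor_killed (_ :: 'i itself) R S M n \<longleftrightarrow>
    (\<forall>(I :: nat \<Rightarrow> 'i set) A. free_resolution R I A \<longrightarrow>
       homology_killed S (\<lambda>k. fs M (I k)) (\<lambda>k. mx M (I k) (A k)) n)"

text \<open>Dropping the bottom term of a resolution leaves a resolution and lowers all degrees by
  one.\<close>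

lemma tor_killed_mono:
  assumes "tor_killed TYPE('i) R S M n" "n \<le> m" shows "tor_killed TYPE('i) R S M m"
  using assms(2)
proof (induction rule: dec_induct)
  case (step k)
  show ?case unfolding tor_killed_def
  proof (intro allI impI)
    fix I :: "nat \<Rightarrow> 'i set" and A
    assume "free_resolution R I A"
    from step.IH[unfolded tor_killed_def, rule_format, OF free_resolution_shift[OF this]]
    show "homology_killed S (\<lambda>k. fs M (I k)) (\<lambda>k. mx M (I k) (A k)) (Suc k)"
      by (simp add: homology_killed_def)
  qed
qed (fact assms(1))

text \<open>Functoriality of \<open>Q \<otimes> M\<close>: a cycle is sent to \<open>M\<close> by
  \<open>g\<close>, bounded there up to \<open>s\<close>, and the bounding chain is sent back by
  \<open>f\<close>. The lemma serves to pass to isomorphic modules.\<close>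

lemma tor_killed_retract:
  assumes "module R M" "module R N" "f \<in> mod_hom R M N" "g \<in> mod_hom R N M"
    and "\<And>x. x \<in> carrier N \<Longrightarrow> f (g x) = x" "S \<subseteq> carrier R" "tor_killed TYPE('i) R S M n"
  shows "tor_killed TYPE('i) R S N n"
  unfolding tor_killed_def homology_killed_def
proof (intro allI impI)
  fix I :: "nat \<Rightarrow> 'i set" and A
  assume res: "free_resolution R I A"
  interpret M: module R M by fact
  interpret N: module R N by fact
  note A = free_resolutionD(1)[OF res]
  obtain s where s: "s \<in> S" and *: "\<And>z. z \<in> carrier (fs M (I (Suc n))) \<Longrightarrow> mx M (I n) (A n) z = (\<lambda>_. \<zero>\<^bsub>M\<^esub>) \<Longrightarrow>
      \<exists>w\<in>carrier (fs M (I (Suc (Suc n)))). mx M (I (Suc n)) (A (Suc n)) w = (\<lambda>i. s \<odot>\<^bsub>M\<^esub> z i)"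
    using assms(7) res unfolding tor_killed_def homology_killed_def by fastforce
  show "\<exists>s\<in>S. \<forall>z\<in>carrier (fs N (I (Suc n))). mx N (I n) (A n) z = \<zero>\<^bsub>fs N (I n)\<^esub> \<longrightarrow>
     (\<exists>w\<in>carrier (fs N (I (Suc (Suc n)))). mx N (I (Suc n)) (A (Suc n)) w = s \<odot>\<^bsub>fs N (I (Suc n))\<^esub> z)"
  proof (intro bexI[OF _ s] ballI impI)
    fix z assume z: "z \<in> carrier (fs N (I (Suc n)))" "mx N (I n) (A n) z = \<zero>\<^bsub>fs N (I n)\<^esub>"
    have "mx M (I n) (A n) (\<lambda>i. g (z i)) = (\<lambda>_. \<zero>\<^bsub>M\<^esub>)"
      using mx_natural[where A="A n", OF assms(2,1,4) A z(1)] z(2) mod_hom_zero_minus(1)[OF assms(2,1,4)] by simp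
    then obtain w where w: "w \<in> carrier (fs M (I (Suc (Suc n))))"
      "mx M (I (Suc n)) (A (Suc n)) w = (\<lambda>i. s \<odot>\<^bsub>M\<^esub> g (z i))"
      using *[OF mod_homD(1)[OF fs_post[OF assms(2,1,4)] z(1)]] by auto
    have "mx N (I (Suc n)) (A (Suc n)) (\<lambda>j. f (w j)) = (\<lambda>i. s \<odot>\<^bsub>N\<^esub> z i)"
      using mx_natural[where A="A (Suc n)", OF assms(1,2,3) A w(1)] w(2) mod_homD(3)[OF assms(3)] mod_homD(1)[OF assms(4)]
        fs_value[OF z(1)] s assms(5,6) by (auto simp: subset_eq)
    then show "\<exists>w\<in>carrier (fs N (I (Suc (Suc n)))). mx N (I (Suc n)) (A (Suc n)) w = s \<odot>\<^bsub>fs N (I (Suc n))\<^esub> z"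
      using mod_homD(1)[OF fs_post[OF assms(1,2,3)] w(1)] by auto
  qed
qed

text \<open>A zero entry receives the value zero, so that an entrywise choice keeps finite
  support.\<close>

lemma fs_choice:
  assumes z: "z \<in> carrier (fs M I)"
    and ex: "\<And>i. z i \<noteq> \<zero>\<^bsub>M\<^esub> \<Longrightarrow> \<exists>y\<in>carrier N. Q (z i) y" and "Q \<zero>\<^bsub>M\<^esub> \<zero>\<^bsub>N\<^esub>" "\<zero>\<^bsub>N\<^esub> \<in> carrier N"
  shows "\<exists>w\<in>carrier (fs N I). \<forall>i. Q (z i) (w i)"
proof -
  define w where "w i = (if z i = \<zero>\<^bsub>M\<^esub> then \<zero>\<^bsub>N\<^esub> else SOME y. y \<in> carrier N \<and> Q (z i) y)" for i
  have w: "w i \<in> carrier N \<and> Q (z i) (w i)" for i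
  proof (cases "z i = \<zero>\<^bsub>M\<^esub>")
    case False
    from ex[OF this] have "\<exists>y. y \<in> carrier N \<and> Q (z i) y" by blast
    from someI_ex[OF this] False show ?thesis by (simp add: w_def)
  qed (use assms(3,4) in \<open>simp add: w_def\<close>)
  have "{i. w i \<noteq> \<zero>\<^bsub>N\<^esub>} \<subseteq> {i. z i \<noteq> \<zero>\<^bsub>M\<^esub>}" by (auto simp: w_def)
  then have "w \<in> carrier (fs N I)" using z w by (auto simp: fs_carrier w_def intro: finite_subset)
  with w show ?thesis by blast
qed

section \<open>Long exact sequences up to \<open>S\<close>-torsion\<close>

text \<open>Complexes \<open>A\<close>, \<open>B\<close>, \<open>C\<close> forming a short exact
  sequence up to one multiplier \<open>s\<close>, shared by all degrees. The composite of
  \<open>f k\<close> and \<open>g k\<close> is only killed by \<open>s\<close>, as in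
  \<open>S_exact_at\<close>, where the composite of two maps need not vanish.\<close>

locale S_exact_complexes =
  fixes R :: "('a, 'm) ring_scheme" and S :: "'a set" and s :: 'a
    and A :: "nat \<Rightarrow> ('a, 'b, 'i) module_scheme" and dA
    and B :: "nat \<Rightarrow> ('a, 'c, 'j) module_scheme" and dB
    and C :: "nat \<Rightarrow> ('a, 'd, 'k) module_scheme" and dC
    and f g
  assumes S: "submonoid S R" and s: "s \<in> S"
    and modules: "module R (A k)" "module R (B k)" "module R (C k)"
    and d_hom: "dA k \<in> mod_hom R (A (Suc k)) (A k)" "dB k \<in> mod_hom R (B (Suc k)) (B k)"
      "dC k \<in> mod_hom R (C (Suc k)) (C k)"
    and fg_hom: "f k \<in> mod_hom R (A k) (B k)" "g k \<in> mod_hom R (B k) (C k)"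
    and square: "b \<in> carrier (B (Suc (Suc k))) \<Longrightarrow> dB k (dB (Suc k) b) = \<zero>\<^bsub>B k\<^esub>"
    and f_comm: "a \<in> carrier (A (Suc k)) \<Longrightarrow> f k (dA k a) = dB k (f (Suc k) a)"
    and g_comm: "b \<in> carrier (B (Suc k)) \<Longrightarrow> g k (dB k b) = dC k (g (Suc k) b)"
    and surj: "c \<in> carrier (C k) \<Longrightarrow> \<exists>b\<in>carrier (B k). g k b = s \<odot>\<^bsub>C k\<^esub> c"
    and exact: "b \<in> carrier (B k) \<Longrightarrow> g k b = \<zero>\<^bsub>C k\<^esub> \<Longrightarrow> \<exists>a\<in>carrier (A k). f k a = s \<odot>\<^bsub>B k\<^esub> b"
    and inj: "a \<in> carrier (A k) \<Longrightarrow> f k a = \<zero>\<^bsub>B k\<^esub> \<Longrightarrow> s \<odot>\<^bsub>A k\<^esub> a = \<zero>\<^bsub>A k\<^esub>"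
    and gf: "a \<in> carrier (A k) \<Longrightarrow> s \<odot>\<^bsub>C k\<^esub> g k (f k a) = \<zero>\<^bsub>C k\<^esub>"
begin

sublocale S: submonoid S R by (rule S)
sublocale R: cring R by (rule module.axioms(1)[OF modules(1)[of 0]])
sublocale A: module R "A k" for k by (rule modules)
sublocale B: module R "B k" for k by (rule modules)
sublocale C: module R "C k" for k by (rule modules)

lemmas hom_closed [simp] = mod_homD(1)[OF d_hom(1)] mod_homD(1)[OF d_hom(2)] mod_homD(1)[OF d_hom(3)]
  mod_homD(1)[OF fg_hom(1)] mod_homD(1)[OF fg_hom(2)]
lemmas hom_smult [simp] = mod_homD(3)[OF d_hom(1)] mod_homD(3)[OF d_hom(2)] mod_homD(3)[OF d_hom(3)]
  mod_homD(3)[OF fg_hom(1)] mod_homD(3)[OF fg_hom(2)]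
lemmas hom_diff [simp] = mod_hom_diff[OF modules(1) modules(1) d_hom(1)] mod_hom_diff[OF modules(2) modules(2) d_hom(2)]
  mod_hom_diff[OF modules(3) modules(3) d_hom(3)] mod_hom_diff[OF modules(1) modules(2) fg_hom(1)]
  mod_hom_diff[OF modules(2) modules(3) fg_hom(2)]

lemma S_carrier [simp]: "x \<in> S \<Longrightarrow> x \<in> carrier R"
  using S.subset by blast

lemma smult_diff:
  assumes "x \<in> carrier R" "c \<in> carrier (C k)" "c' \<in> carrier (C k)"
  shows "x \<odot>\<^bsub>C k\<^esub> (c \<ominus>\<^bsub>C k\<^esub> c') = x \<odot>\<^bsub>C k\<^esub> c \<ominus>\<^bsub>C k\<^esub> x \<odot>\<^bsub>C k\<^esub> c'"
  using assms by (simp add: a_minus_def C.smult_r_distr C.smult_r_minus)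

lemma diff_zero [simp]:
  "c \<in> carrier (C k) \<Longrightarrow> c \<ominus>\<^bsub>C k\<^esub> \<zero>\<^bsub>C k\<^esub> = c"
  "b \<in> carrier (B k) \<Longrightarrow> b \<ominus>\<^bsub>B k\<^esub> \<zero>\<^bsub>B k\<^esub> = b"
  by (simp_all add: a_minus_def)

text \<open>The stretch \<open>H(B) \<rightarrow> H(C) \<rightarrow> H(A)\<close> of the long exact
  sequence, with \<open>B\<close> and \<open>C\<close> in degree \<open>n + 2\<close> and
  \<open>A\<close> in degree \<open>n + 1\<close>. It is the usual diagram chase, with every failure
  of exactness paid for by a factor \<open>s\<close>.\<close>

lemma homology_right:
  assumes "homology_killed S A dA n" "homology_killed S B dB (Suc n)"
  shows "homology_killed S C dC (Suc n)"
proof -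
  obtain t where t: "t \<in> S" and ker_A: "\<And>a. a \<in> carrier (A (Suc n)) \<Longrightarrow> dA n a = \<zero>\<^bsub>A n\<^esub> \<Longrightarrow>
      \<exists>a'\<in>carrier (A (Suc (Suc n))). dA (Suc n) a' = t \<odot>\<^bsub>A (Suc n)\<^esub> a"
    using assms(1) by (auto simp: homology_killed_def)
  obtain u where u: "u \<in> S" and ker_B: "\<And>b. b \<in> carrier (B (Suc (Suc n))) \<Longrightarrow> dB (Suc n) b = \<zero>\<^bsub>B (Suc n)\<^esub> \<Longrightarrow>
      \<exists>b'\<in>carrier (B (Suc (Suc (Suc n)))). dB (Suc (Suc n)) b' = u \<odot>\<^bsub>B (Suc (Suc n))\<^esub> b"
    using assms(2) by (auto simp: homology_killed_def)
  \<comment> \<open>The four factors \<open>s\<close> come from \<open>surj\<close>,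
    \<open>exact\<close>, \<open>inj\<close> and \<open>gf\<close>, one from each; \<open>t\<close>
    and \<open>u\<close> come from the homology of \<open>A\<close> and \<open>B\<close>.\<close>
  let ?v = "u \<otimes>\<^bsub>R\<^esub> (t \<otimes>\<^bsub>R\<^esub> (s \<otimes>\<^bsub>R\<^esub> (s \<otimes>\<^bsub>R\<^esub> (s \<otimes>\<^bsub>R\<^esub> s))))"
  have cR: "t \<in> carrier R" "u \<in> carrier R" "s \<in> carrier R" using t u s by simp_all
  have "\<exists>w\<in>carrier (C (Suc (Suc (Suc n)))). dC (Suc (Suc n)) w = ?v \<odot>\<^bsub>C (Suc (Suc n))\<^esub> z"
    if z: "z \<in> carrier (C (Suc (Suc n)))" "dC (Suc n) z = \<zero>\<^bsub>C (Suc n)\<^esub>" for z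
  proof -
    obtain b where b: "b \<in> carrier (B (Suc (Suc n)))" "g (Suc (Suc n)) b = s \<odot>\<^bsub>C (Suc (Suc n))\<^esub> z"
      using surj[OF z(1)] by blast
    have "g (Suc n) (dB (Suc n) b) = \<zero>\<^bsub>C (Suc n)\<^esub>"
      using b z cR by (simp add: g_comm)
    then obtain a where a: "a \<in> carrier (A (Suc n))" "f (Suc n) a = s \<odot>\<^bsub>B (Suc n)\<^esub> dB (Suc n) b"
      using exact b(1) hom_closed(2) by blast
    have "f n (dA n a) = \<zero>\<^bsub>B n\<^esub>" using a b(1) cR by (simp add: f_comm square)
    \<comment> \<open>Injectivity up to \<open>s\<close> makes \<open>s a\<close>, rather than
      \<open>a\<close>, a cycle.\<close>
    then have "dA n (s \<odot>\<^bsub>A (Suc n)\<^esub> a) = \<zero>\<^bsub>A n\<^esub>" using inj[OF hom_closed(1)[OF a(1)]] a(1) cR by simp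
    then obtain a' where a': "a' \<in> carrier (A (Suc (Suc n)))"
      "dA (Suc n) a' = t \<odot>\<^bsub>A (Suc n)\<^esub> (s \<odot>\<^bsub>A (Suc n)\<^esub> a)"
      using ker_A[of "s \<odot>\<^bsub>A (Suc n)\<^esub> a"] a(1) cR by auto
    \<comment> \<open>The multiple \<open>t s s b\<close> and \<open>f a'\<close> have the same
      boundary, so the difference is a cycle. Under \<open>g\<close> it becomes a multiple of
      \<open>z\<close>, up to the term \<open>g (f a')\<close>, which \<open>s\<close>
      kills.\<close>
    define b1 where "b1 = (t \<otimes>\<^bsub>R\<^esub> (s \<otimes>\<^bsub>R\<^esub> s)) \<odot>\<^bsub>B (Suc (Suc n))\<^esub> b \<ominus>\<^bsub>B (Suc (Suc n))\<^esub> f (Suc (Suc n)) a'"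
    have b1: "b1 \<in> carrier (B (Suc (Suc n)))" using a' b cR by (simp add: b1_def)
    have "dB (Suc n) b1 = (t \<otimes>\<^bsub>R\<^esub> (s \<otimes>\<^bsub>R\<^esub> s)) \<odot>\<^bsub>B (Suc n)\<^esub> dB (Suc n) b \<ominus>\<^bsub>B (Suc n)\<^esub> f (Suc n) (dA (Suc n) a')"
      using a'(1) b cR by (simp add: b1_def f_comm)
    also have "\<dots> = \<zero>\<^bsub>B (Suc n)\<^esub>"
      using a a'(2) b(1) cR by (simp add: B.smult_assoc1 a_minus_def B.M.r_neg)
    finally obtain b' where b': "b' \<in> carrier (B (Suc (Suc (Suc n))))"
      "dB (Suc (Suc n)) b' = u \<odot>\<^bsub>B (Suc (Suc n))\<^esub> b1"
      using ker_B[OF b1] by blast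
    have "dC (Suc (Suc n)) (s \<odot>\<^bsub>C (Suc (Suc (Suc n)))\<^esub> g (Suc (Suc (Suc n))) b') =
        s \<odot>\<^bsub>C (Suc (Suc n))\<^esub> (u \<odot>\<^bsub>C (Suc (Suc n))\<^esub> g (Suc (Suc n)) b1)"
      using b' b1 cR by (simp add: g_comm[symmetric])
    also have "\<dots> = u \<odot>\<^bsub>C (Suc (Suc n))\<^esub> (s \<odot>\<^bsub>C (Suc (Suc n))\<^esub> g (Suc (Suc n)) b1)"
      using b1 cR by (simp add: C.smult_assoc1[symmetric] R.m_comm)
    also have "s \<odot>\<^bsub>C (Suc (Suc n))\<^esub> g (Suc (Suc n)) b1 =
        s \<odot>\<^bsub>C (Suc (Suc n))\<^esub> ((t \<otimes>\<^bsub>R\<^esub> (s \<otimes>\<^bsub>R\<^esub> s)) \<odot>\<^bsub>C (Suc (Suc n))\<^esub> (s \<odot>\<^bsub>C (Suc (Suc n))\<^esub> z))"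
      using a' b z cR by (simp add: b1_def smult_diff gf)
    also have "u \<odot>\<^bsub>C (Suc (Suc n))\<^esub> \<dots> = ?v \<odot>\<^bsub>C (Suc (Suc n))\<^esub> z"
      using z cR by (simp add: C.smult_assoc1[symmetric] R.m_ac)
    finally show ?thesis
      using b' cR by (intro bexI[of _ "s \<odot>\<^bsub>C (Suc (Suc (Suc n)))\<^esub> g (Suc (Suc (Suc n))) b'"]) auto
  qed
  moreover have "?v \<in> S" using s t u by auto
  ultimately show ?thesis unfolding homology_killed_def by blast
qed

text \<open>The stretch \<open>H(C) \<rightarrow> H(A) \<rightarrow> H(B)\<close>, with
  \<open>C\<close> in degree \<open>n + 2\<close> and \<open>A\<close>, \<open>B\<close> in degree
  \<open>n + 1\<close>: a cycle of \<open>A\<close> that bounds in \<open>B\<close> comes from a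
  cycle of \<open>C\<close> under the connecting map.\<close>

lemma homology_left:
  assumes "homology_killed S B dB n" "homology_killed S C dC (Suc n)"
  shows "homology_killed S A dA n"
proof -
  obtain t where t: "t \<in> S" and ker_B: "\<And>b. b \<in> carrier (B (Suc n)) \<Longrightarrow> dB n b = \<zero>\<^bsub>B n\<^esub> \<Longrightarrow>
      \<exists>b'\<in>carrier (B (Suc (Suc n))). dB (Suc n) b' = t \<odot>\<^bsub>B (Suc n)\<^esub> b"
    using assms(1) by (auto simp: homology_killed_def)
  obtain u where u: "u \<in> S" and ker_C: "\<And>c. c \<in> carrier (C (Suc (Suc n))) \<Longrightarrow> dC (Suc n) c = \<zero>\<^bsub>C (Suc n)\<^esub> \<Longrightarrow>
      \<exists>c'\<in>carrier (C (Suc (Suc (Suc n)))). dC (Suc (Suc n)) c' = u \<odot>\<^bsub>C (Suc (Suc n))\<^esub> c"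
    using assms(2) by (auto simp: homology_killed_def)
  \<comment> \<open>Again \<open>gf\<close>, \<open>surj\<close>, \<open>exact\<close> and
    \<open>inj\<close> contribute one factor \<open>s\<close> each, and the two assumptions on
    homology contribute \<open>t\<close> and \<open>u\<close>.\<close>
  let ?v = "s \<otimes>\<^bsub>R\<^esub> s \<otimes>\<^bsub>R\<^esub> (s \<otimes>\<^bsub>R\<^esub> u \<otimes>\<^bsub>R\<^esub> s \<otimes>\<^bsub>R\<^esub> t)"
  have cR: "t \<in> carrier R" "u \<in> carrier R" "s \<in> carrier R" using t u s by simp_all
  have "\<exists>w\<in>carrier (A (Suc (Suc n))). dA (Suc n) w = ?v \<odot>\<^bsub>A (Suc n)\<^esub> a"
    if a: "a \<in> carrier (A (Suc n))" "dA n a = \<zero>\<^bsub>A n\<^esub>" for a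
  proof -
    have "dB n (f (Suc n) a) = \<zero>\<^bsub>B n\<^esub>"
      using a mod_hom_zero_minus(1)[OF modules(1,2) fg_hom(1)] by (simp flip: f_comm)
    then obtain b where b: "b \<in> carrier (B (Suc (Suc n)))" "dB (Suc n) b = t \<odot>\<^bsub>B (Suc n)\<^esub> f (Suc n) a"
      using ker_B[of "f (Suc n) a"] a by auto
    \<comment> \<open>By \<open>gf\<close>, the image of \<open>b\<close> under \<open>g\<close>
      becomes a cycle only after multiplication by \<open>s\<close>.\<close>
    define c where "c = s \<odot>\<^bsub>C (Suc (Suc n))\<^esub> g (Suc (Suc n)) b"
    have c: "c \<in> carrier (C (Suc (Suc n)))" using b cR by (simp add: c_def)
    have "dC (Suc n) c = s \<odot>\<^bsub>C (Suc n)\<^esub> (t \<odot>\<^bsub>C (Suc n)\<^esub> g (Suc n) (f (Suc n) a))"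
      using a b cR by (simp add: c_def g_comm[symmetric])
    also have "\<dots> = t \<odot>\<^bsub>C (Suc n)\<^esub> (s \<odot>\<^bsub>C (Suc n)\<^esub> g (Suc n) (f (Suc n) a))"
      using a cR by (simp add: C.smult_assoc1[symmetric] R.m_comm)
    also have "\<dots> = \<zero>\<^bsub>C (Suc n)\<^esub>" using a cR by (simp add: gf)
    finally obtain c' where c': "c' \<in> carrier (C (Suc (Suc (Suc n))))"
      "dC (Suc (Suc n)) c' = u \<odot>\<^bsub>C (Suc (Suc n))\<^esub> c"
      using ker_C[OF c] by blast
    obtain b' where b': "b' \<in> carrier (B (Suc (Suc (Suc n))))"
      "g (Suc (Suc (Suc n))) b' = s \<odot>\<^bsub>C (Suc (Suc (Suc n)))\<^esub> c'"
      using surj[OF c'(1)] by blast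
    let ?x = "s \<otimes>\<^bsub>R\<^esub> u \<otimes>\<^bsub>R\<^esub> s"
    \<comment> \<open>Subtracting the boundary of \<open>b'\<close> does not change the boundary of
      \<open>?x b\<close>, and it moves the element into the kernel of \<open>g\<close>, from where
      it lifts to \<open>A\<close>.\<close>
    define b1 where "b1 = ?x \<odot>\<^bsub>B (Suc (Suc n))\<^esub> b \<ominus>\<^bsub>B (Suc (Suc n))\<^esub> dB (Suc (Suc n)) b'"
    have b1: "b1 \<in> carrier (B (Suc (Suc n)))" using b b' cR by (simp add: b1_def)
    have "g (Suc (Suc n)) b1 = \<zero>\<^bsub>C (Suc (Suc n))\<^esub>"
      using b b' c' cR by (simp add: b1_def g_comm c_def C.smult_assoc1) (simp add: a_minus_def C.M.r_neg)
    then obtain a' where a': "a' \<in> carrier (A (Suc (Suc n)))" "f (Suc (Suc n)) a' = s \<odot>\<^bsub>B (Suc (Suc n))\<^esub> b1"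
      using exact[OF b1] by blast
    have "f (Suc n) (dA (Suc n) a' \<ominus>\<^bsub>A (Suc n)\<^esub> (s \<otimes>\<^bsub>R\<^esub> (?x \<otimes>\<^bsub>R\<^esub> t)) \<odot>\<^bsub>A (Suc n)\<^esub> a) =
        s \<odot>\<^bsub>B (Suc n)\<^esub> dB (Suc n) b1 \<ominus>\<^bsub>B (Suc n)\<^esub> (s \<otimes>\<^bsub>R\<^esub> (?x \<otimes>\<^bsub>R\<^esub> t)) \<odot>\<^bsub>B (Suc n)\<^esub> f (Suc n) a"
      using a a' b1 cR by (simp add: f_comm)
    also have "dB (Suc n) b1 = ?x \<odot>\<^bsub>B (Suc n)\<^esub> (t \<odot>\<^bsub>B (Suc n)\<^esub> f (Suc n) a)"
      using a b b' cR by (simp add: b1_def square)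
    also have "s \<odot>\<^bsub>B (Suc n)\<^esub> \<dots> \<ominus>\<^bsub>B (Suc n)\<^esub> (s \<otimes>\<^bsub>R\<^esub> (?x \<otimes>\<^bsub>R\<^esub> t)) \<odot>\<^bsub>B (Suc n)\<^esub> f (Suc n) a = \<zero>\<^bsub>B (Suc n)\<^esub>"
      using a cR by (simp add: B.smult_assoc1 a_minus_def B.M.r_neg)
    finally have "s \<odot>\<^bsub>A (Suc n)\<^esub> (dA (Suc n) a' \<ominus>\<^bsub>A (Suc n)\<^esub> (s \<otimes>\<^bsub>R\<^esub> (?x \<otimes>\<^bsub>R\<^esub> t)) \<odot>\<^bsub>A (Suc n)\<^esub> a) = \<zero>\<^bsub>A (Suc n)\<^esub>"
      using a a' cR by (intro inj) auto
    then have "s \<odot>\<^bsub>A (Suc n)\<^esub> dA (Suc n) a' = s \<odot>\<^bsub>A (Suc n)\<^esub> ((s \<otimes>\<^bsub>R\<^esub> (?x \<otimes>\<^bsub>R\<^esub> t)) \<odot>\<^bsub>A (Suc n)\<^esub> a)"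
      using a a' cR by (simp add: a_minus_def A.smult_r_distr A.smult_r_minus A.M.minus_unique)
        (metis A.M.r_neg1 A.M.add.m_comm A.M.add.inv_closed A.M.r_neg A.M.minus_equality A.M.minus_minus A.smult_closed R.m_closed hom_closed(1))
    then have "dA (Suc n) (s \<odot>\<^bsub>A (Suc (Suc n))\<^esub> a') = ?v \<odot>\<^bsub>A (Suc n)\<^esub> a"
      using a a' cR by (simp add: A.smult_assoc1 R.m_assoc)
    then show ?thesis using a' cR by (intro bexI[of _ "s \<odot>\<^bsub>A (Suc (Suc n))\<^esub> a'"]) auto
  qed
  moreover have "?v \<in> S" using s t u by auto
  ultimately show ?thesis unfolding homology_killed_def by blast
qed

end

text \<open>Tensoring with a free module is entrywise application, so exactness up to
  \<open>s\<close> passes from the modules to the complexes with the same \<open>s\<close> in every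
  degree.\<close>

lemma S_exact_complexes_fs:
  assumes "submonoid S R" "s \<in> S" "module R A" "module R B" "module R C"
    and "f \<in> mod_hom R A B" "g \<in> mod_hom R B C"
    and "\<And>c. c \<in> carrier C \<Longrightarrow> \<exists>b\<in>carrier B. g b = s \<odot>\<^bsub>C\<^esub> c"
    and "\<And>b. b \<in> carrier B \<Longrightarrow> g b = \<zero>\<^bsub>C\<^esub> \<Longrightarrow> \<exists>a\<in>carrier A. f a = s \<odot>\<^bsub>B\<^esub> b"
    and "\<And>a. a \<in> carrier A \<Longrightarrow> f a = \<zero>\<^bsub>B\<^esub> \<Longrightarrow> s \<odot>\<^bsub>A\<^esub> a = \<zero>\<^bsub>A\<^esub>"
    and "\<And>a. a \<in> carrier A \<Longrightarrow> s \<odot>\<^bsub>C\<^esub> g (f a) = \<zero>\<^bsub>C\<^esub>"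
    and res: "free_resolution R I D"
  shows "S_exact_complexes R S s (\<lambda>k. fs A (I k)) (\<lambda>k. mx A (I k) (D k))
    (\<lambda>k. fs B (I k)) (\<lambda>k. mx B (I k) (D k)) (\<lambda>k. fs C (I k)) (\<lambda>k. mx C (I k) (D k))
    (\<lambda>k z i. f (z i)) (\<lambda>k z i. g (z i))"
proof -
  interpret A: module R A by fact
  interpret B: module R B by fact
  interpret C: module R C by fact
  interpret S: submonoid S R by fact
  have s: "s \<in> carrier R" using assms(2) S.subset by blast
  note D = free_resolutionD(1)[OF res]
  have g0: "g \<zero>\<^bsub>B\<^esub> = \<zero>\<^bsub>C\<^esub>" and f0: "f \<zero>\<^bsub>A\<^esub> = \<zero>\<^bsub>B\<^esub>"
    using mod_hom_zero_minus(1)[OF assms(4,5,7)] mod_hom_zero_minus(1)[OF assms(3,4,6)] by auto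
  show ?thesis
  proof (rule S_exact_complexes.intro, goal_cases)
    \<comment> \<open>Cases 14 and 15 are \<open>surj\<close> and \<open>exact\<close>; the
      preimages are chosen entry by entry.\<close>
    case (14 c k)
    from fs_choice[OF this, of B "\<lambda>x y. g y = s \<odot>\<^bsub>C\<^esub> x"] show ?case
      using assms(8) fs_value[OF 14] g0 s by (auto simp: fun_eq_iff)
  next
    case (15 b k)
    from fs_choice[OF this(1), of A "\<lambda>x y. f y = s \<odot>\<^bsub>B\<^esub> x"] show ?case
      using assms(9) fs_value[OF 15(1)] f0 s 15(2) by (auto simp: fun_eq_iff)
  qed (use assms(1,2) free_resolution_square[OF assms(4) res] in \<open>auto simp: fun_eq_iff assms(10,11) fs_value
      intro!: module_fs assms(3-5) free_resolution_hom[OF _ res] fs_post assms(6,7)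
        mx_natural[symmetric, THEN fun_cong] D\<close>)
qed

section \<open>Encoding modules and resolutions in the universe\<close>

text \<open>A finitely supported function is determined by its graph over the support, a finite
  subset of \<open>J \<times> carrier M\<close>. An infinite type has as many pairs, and as many
  finite subsets, as elements.\<close>

lemma fs_lepoll:
  fixes M :: "('a, 'b, 'n) module_scheme" and J :: "'j set"
  assumes "infinite (UNIV :: 'u set)" "carrier M \<lesssim> (UNIV :: 'u set)" "J \<lesssim> (UNIV :: 'u set)"
  shows "carrier (fs M J) \<lesssim> (UNIV :: 'u set)"
proof -
  let ?G = "\<lambda>z. {(j, z j) |j. z j \<noteq> \<zero>\<^bsub>M\<^esub>}"
  have "inj_on ?G (carrier (fs M J))"
  proof (rule inj_onI, rule ext)
    fix z w j assume *: "?G z = ?G w"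
    have "(z j \<noteq> \<zero>\<^bsub>M\<^esub> \<longleftrightarrow> (j, z j) \<in> ?G z) \<and> (w j \<noteq> \<zero>\<^bsub>M\<^esub> \<longleftrightarrow> (j, w j) \<in> ?G w)" by auto
    with * show "z j = w j" by auto
  qed
  moreover have "?G ` carrier (fs M J) \<subseteq> Fpow (J \<times> carrier M)"
  proof
    fix X assume "X \<in> ?G ` carrier (fs M J)"
    then obtain z where z: "z \<in> carrier (fs M J)" "X = ?G z" by blast
    have "X = (\<lambda>j. (j, z j)) ` {j. z j \<noteq> \<zero>\<^bsub>M\<^esub>}" using z by auto
    with z show "X \<in> Fpow (J \<times> carrier M)" by (auto simp: Fpow_def fs_carrier)
  qed
  ultimately have "carrier (fs M J) \<lesssim> Fpow (J \<times> carrier M)"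
    by (auto simp: lepoll_def)
  moreover have "J \<times> carrier M \<lesssim> (UNIV :: 'u set)"
    using times_lepoll_mono[OF assms(3,2)] card_of_Times_same_infinite[OF assms(1)]
    by (metis card_of_ordIso eqpoll_def eqpoll_imp_lepoll lepoll_trans)
  then obtain e where e: "inj_on e (J \<times> carrier M)" "e ` (J \<times> carrier M) \<subseteq> (UNIV :: 'u set)"
    by (auto simp: lepoll_def)
  have "Fpow (J \<times> carrier M) \<lesssim> Fpow (UNIV :: 'u set)"
    unfolding lepoll_def using inj_on_image_Fpow[OF e(1)] image_Fpow_mono[OF e(2)] by blast
  ultimately show ?thesis
    using eqpoll_Fpow[OF assms(1)] by (meson eqpoll_imp_lepoll lepoll_trans)
qed

text \<open>\<open>S_flat\<close> and \<open>S_fd\<close> speak only about modules with carrier in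
  \<open>'u\<close>. Images, quotients and free modules built over other types enter them through an
  isomorphic copy.\<close>

lemma transport:
  fixes M :: "('a, 'b, 'n) module_scheme"
  assumes "module R M" "carrier M \<lesssim> (UNIV :: 'u set)"
  obtains N :: "('a, 'u) module" and f g where "module R N" "f \<in> mod_hom R M N" "g \<in> mod_hom R N M"
    "\<And>x. x \<in> carrier M \<Longrightarrow> g (f x) = x" "\<And>y. y \<in> carrier N \<Longrightarrow> f (g y) = y"
proof -
  interpret module R M by fact
  obtain f :: "'b \<Rightarrow> 'u" where f: "inj_on f (carrier M)" using assms(2) by (auto simp: lepoll_def)
  define g where "g = inv_into (carrier M) f"
  have gf [simp]: "g (f x) = x" if "x \<in> carrier M" for x using f that by (simp add: g_def)
  define N :: "('a, 'u) module" where "N = \<lparr>carrier = f ` carrier M, mult = undefined, one = undefined,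
    zero = f \<zero>\<^bsub>M\<^esub>, add = (\<lambda>x y. f (g x \<oplus>\<^bsub>M\<^esub> g y)), smult = (\<lambda>r x. f (r \<odot>\<^bsub>M\<^esub> g x))\<rparr>"
  show thesis
  proof
    show "module R N"
    proof (rule moduleI, rule is_cring, rule abelian_groupI)
      fix x assume "x \<in> carrier N"
      then show "\<exists>y\<in>carrier N. y \<oplus>\<^bsub>N\<^esub> x = \<zero>\<^bsub>N\<^esub>"
        by (auto simp: N_def M.l_neg intro!: bexI[of _ "\<ominus>\<^bsub>M\<^esub> g x"])
    qed (auto simp: N_def M.a_ac smult_l_distr smult_r_distr smult_assoc1)
    show "f \<in> mod_hom R M N" by (rule mod_homI) (auto simp: N_def)
    show "g \<in> mod_hom R N M" by (rule mod_homI) (auto simp: N_def)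
  qed (auto simp: N_def)
qed

lemma fs_empty: "module R M \<Longrightarrow> carrier (fs M {}) = {\<lambda>_. \<zero>\<^bsub>M\<^esub>}"
proof -
  assume "module R M"
  then interpret module R M .
  show ?thesis by (auto simp: fs_carrier)
qed

text \<open>A presentation, placed in degrees 1 and 2, is extended upwards by taking every element
  of the kernel as a generator. These elements are functions of type
  \<open>'u \<Rightarrow> 'a\<close>, so they are encoded in \<open>'u\<close> before they can index
  the next basis.\<close>

lemma ex_free_resolution:
  fixes R :: "('a, 'm) ring_scheme" and I1 I2 :: "'u set"
  assumes "cring R" "infinite (UNIV :: 'u set)" "carrier R \<lesssim> (UNIV :: 'u set)"
    and D: "\<And>j. j \<in> I2 \<Longrightarrow> D j \<in> carrier (fs (regular_module R) I1)"
  obtains I A where "free_resolution R I A" "I (Suc 0) = I1" "I (Suc (Suc 0)) = I2" "A (Suc 0) = D"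
proof -
  let ?R = "regular_module R"
  note modR = module_regular_module[OF assms(1)]
  have "carrier (fs ?R (UNIV :: 'u set)) \<lesssim> (UNIV :: 'u set)"
    using assms(2,3) by (intro fs_lepoll) auto
  then obtain enc :: "('u \<Rightarrow> 'a) \<Rightarrow> 'u" where enc: "inj_on enc (carrier (fs ?R UNIV))"
    by (auto simp: lepoll_def)
  define dec where "dec = inv_into (carrier (fs ?R UNIV)) enc"
  have dec: "dec (enc z) = z" if "z \<in> carrier (fs ?R J)" for z J
    using enc fs_mono[OF subset_UNIV that] by (simp add: dec_def)
  define K where "K I0 I1 A = {z\<in>carrier (fs ?R I1). mx ?R I0 A z = \<zero>\<^bsub>fs ?R I0\<^esub>}" for I0 I1 :: "'u set" and A
  \<comment> \<open>Stage \<open>k\<close> holds the bases in degrees \<open>k + 1\<close> and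
    \<open>k + 2\<close> and the matrix between them. The next basis consists of the codes of the
    kernel, and its matrix is decoding: the column at the code of \<open>z\<close> is
    \<open>z\<close>.\<close>
  define st where "st = rec_nat (I1, I2, D) (\<lambda>_ (J0, J1, A). (J1, enc ` K J0 J1 A, dec))"
  define I where "I k = (case k of 0 \<Rightarrow> {} | Suc k \<Rightarrow> fst (st k))" for k
  define A where "A k = (case k of 0 \<Rightarrow> (\<lambda>_ _. \<zero>\<^bsub>R\<^esub>) | Suc k \<Rightarrow> snd (snd (st k)))" for k
  have st: "st k = (I (Suc k), I (Suc (Suc k)), A (Suc k))" for k
    by (cases k) (auto simp: I_def A_def st_def split: prod.splits)
  have step: "I (Suc (Suc (Suc k))) = enc ` K (I (Suc k)) (I (Suc (Suc k))) (A (Suc k))"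
    "A (Suc (Suc k)) = dec" for k
    using st[of "Suc k"] st[of k] by (auto simp: st_def)
  have first: "I 0 = {}" "I (Suc 0) = I1" "I (Suc (Suc 0)) = I2" "A (Suc 0) = D"
    using st[of 0] by (auto simp: st_def I_def)
  have A: "A k j \<in> carrier (fs ?R (I k))" if "j \<in> I (Suc k)" for k j
  proof (cases k)
    case 0
    then show ?thesis by (simp add: first A_def fs_empty[OF modR])
  next
    case (Suc k')
    show ?thesis
    proof (cases k')
      case 0
      then show ?thesis using D that Suc by (simp add: first)
    next
      case (Suc k'')
      with that \<open>k = Suc k'\<close> show ?thesis by (auto simp: step K_def dec)
    qed
  qed
  show thesis
  proof
    show "free_resolution R I A" unfolding free_resolution_def
    proof (intro conjI allI ballI impI)
      fix k j assume j: "j \<in> I (Suc (Suc k))"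
      show "mx ?R (I k) (A k) (A (Suc k) j) = \<zero>\<^bsub>fs ?R (I k)\<^esub>"
      proof (cases k)
        case 0
        have "mx ?R (I k) (A k) (A (Suc k) j) \<in> carrier (fs ?R (I k))"
          by (rule mod_homD(1)[OF mx_hom[where A="A k", OF modR A] A[OF j]])
        then show ?thesis by (simp add: 0 first fs_empty[OF modR])
      next
        case (Suc k')
        with j show ?thesis by (auto simp: step K_def dec)
      qed
    next
      fix k z assume z: "z \<in> carrier (fs ?R (I (Suc (Suc k))))"
        "mx ?R (I (Suc k)) (A (Suc k)) z = \<zero>\<^bsub>fs ?R (I (Suc k))\<^esub>"
      \<comment> \<open>The cycle \<open>z\<close> is itself one of the generators of the next
        term.\<close>
      let ?j = "enc z"
      have j: "?j \<in> I (Suc (Suc (Suc k)))" "A (Suc (Suc k)) ?j = z" using z by (auto simp: step K_def dec)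
      interpret R: cring R by fact
      have "mx ?R (I (Suc (Suc k))) (A (Suc (Suc k))) (single ?R ?j \<one>\<^bsub>R\<^esub>) = act ?R z \<one>\<^bsub>R\<^esub>"
        using mx_single[where A="A (Suc (Suc k))", OF modR A j(1), of "\<one>\<^bsub>R\<^esub>"] j(2) by simp
      also have "\<dots> = z" using fs_value[OF z(1)] by (simp add: act_def)
      finally show "\<exists>w\<in>carrier (fs ?R (I (Suc (Suc (Suc k))))). mx ?R (I (Suc (Suc k))) (A (Suc (Suc k))) w = z"
        by (intro bexI[of _ "single ?R ?j \<one>\<^bsub>R\<^esub>"]) (auto intro!: single_closed[OF modR] j(1))
    qed (rule A)
  qed (fact first)+
qed

section \<open>Change of the index type of the bases\<close>

definition reindex :: "('j \<Rightarrow> 'u) \<Rightarrow> 'b \<Rightarrow> ('j \<Rightarrow> 'b) \<Rightarrow> 'u \<Rightarrow> 'b"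
  where "reindex e c z v = (if v \<in> range e then z (inv_into UNIV e v) else c)"

lemma reindex_apply: "inj e \<Longrightarrow> reindex e c z (e j) = z j"
  by (simp add: reindex_def)

lemma reindex_eq_iff: "inj e \<Longrightarrow> reindex e c z = reindex e c w \<longleftrightarrow> z = w"
  by (metis ext reindex_apply)

lemma reindex_hom:
  assumes "module R M" "inj e"
  shows "reindex e \<zero>\<^bsub>M\<^esub> \<in> mod_hom R (fs M J) (fs M (e ` J))"
proof -
  interpret module R M by fact
  have supp: "{v. reindex e \<zero>\<^bsub>M\<^esub> z v \<noteq> \<zero>\<^bsub>M\<^esub>} \<subseteq> e ` {j. z j \<noteq> \<zero>\<^bsub>M\<^esub>}" for z
    using assms(2) by (auto simp: reindex_def)
  have fin: "finite {v. reindex e \<zero>\<^bsub>M\<^esub> z v \<noteq> \<zero>\<^bsub>M\<^esub>}" if "z \<in> carrier (fs M J)" for z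
    using that by (intro finite_subset[OF supp]) (auto simp: fs_carrier)
  have "reindex e \<zero>\<^bsub>M\<^esub> z v = \<zero>\<^bsub>M\<^esub>" if "z \<in> carrier (fs M J)" "v \<notin> e ` J" for z v
    using that assms(2) by (auto simp: reindex_def fs_carrier)
  then have "reindex e \<zero>\<^bsub>M\<^esub> z \<in> carrier (fs M (e ` J))" if "z \<in> carrier (fs M J)" for z
    using that fin[OF that] fs_value[OF that] by (auto simp: fs_carrier[of "reindex e \<zero>\<^bsub>M\<^esub> z"]) (auto simp: reindex_def)
  then show ?thesis
    by (intro mod_homI) (auto simp: reindex_def fun_eq_iff)
qed

lemma reindex_surj:
  assumes "inj e" "y \<in> carrier (fs M (e ` J))"
  shows "\<exists>z\<in>carrier (fs M J). y = reindex e \<zero>\<^bsub>M\<^esub> z"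
proof
  have "e ` {j. y (e j) \<noteq> \<zero>\<^bsub>M\<^esub>} \<subseteq> {v. y v \<noteq> \<zero>\<^bsub>M\<^esub>}" by auto
  moreover have "finite {v. y v \<noteq> \<zero>\<^bsub>M\<^esub>}" using assms(2) by (simp add: fs_carrier)
  ultimately have "finite {j. y (e j) \<noteq> \<zero>\<^bsub>M\<^esub>}"
    using finite_subset finite_imageD inj_on_subset[OF assms(1) subset_UNIV] by blast
  moreover have "y (e j) = \<zero>\<^bsub>M\<^esub>" if "j \<notin> J" for j
  proof -
    have "e j \<notin> e ` J" using that assms(1) by (simp add: inj_image_mem_iff)
    then show ?thesis using assms(2) by (simp add: fs_carrier)
  qed
  ultimately show "(\<lambda>j. y (e j)) \<in> carrier (fs M J)"
    using fs_value[OF assms(2)] by (simp add: fs_carrier)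
  show "y = reindex e \<zero>\<^bsub>M\<^esub> (\<lambda>j. y (e j))"
  proof
    fix v show "y v = reindex e \<zero>\<^bsub>M\<^esub> (\<lambda>j. y (e j)) v"
    proof (cases "v \<in> range e")
      case True
      then show ?thesis using assms(1) by (auto simp: reindex_def)
    next
      case False
      then have "v \<notin> e ` J" by blast
      then show ?thesis using assms(2) False by (simp add: reindex_def fs_carrier)
    qed
  qed
qed

lemma reindex_single: "inj e \<Longrightarrow> reindex e \<zero>\<^bsub>M\<^esub> (single M j m) = single M (e j) m"
  by (auto simp: reindex_def single_def fun_eq_iff)

lemma reindex_mx:
  assumes "module R M" "inj e" and A: "\<And>j. j \<in> J \<Longrightarrow> A j \<in> carrier (fs (regular_module R) I)"
    and z: "z \<in> carrier (fs M J)"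
  shows "mx M (e ` I) (\<lambda>v. reindex e \<zero>\<^bsub>R\<^esub> (A (inv_into UNIV e v))) (reindex e \<zero>\<^bsub>M\<^esub> z) = reindex e \<zero>\<^bsub>M\<^esub> (mx M I A z)"
proof -
  interpret module R M by fact
  note modR = module_regular_module[OF is_cring]
  have A': "reindex e \<zero>\<^bsub>R\<^esub> (A (inv_into UNIV e v)) \<in> carrier (fs (regular_module R) (e ` I))" if "v \<in> e ` J" for v
    using mod_homD(1)[OF reindex_hom[OF modR assms(2)] A] that assms(2) by auto
  show ?thesis
  proof (rule fs_hom_eq[OF assms(1) module_fs[OF assms(1)] _ _ _ z])
    show "(\<lambda>z. mx M (e ` I) (\<lambda>v. reindex e \<zero>\<^bsub>R\<^esub> (A (inv_into UNIV e v))) (reindex e \<zero>\<^bsub>M\<^esub> z)) \<in> mod_hom R (fs M J) (fs M (e ` I))"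
      by (rule mod_hom_comp[OF reindex_hom[OF assms(1,2)] mx_hom[OF assms(1) A']])
    show "(\<lambda>z. reindex e \<zero>\<^bsub>M\<^esub> (mx M I A z)) \<in> mod_hom R (fs M J) (fs M (e ` I))"
      by (rule mod_hom_comp[OF mx_hom[OF assms(1) A] reindex_hom[OF assms(1,2)]])
    show "mx M (e ` I) (\<lambda>v. reindex e \<zero>\<^bsub>R\<^esub> (A (inv_into UNIV e v))) (reindex e \<zero>\<^bsub>M\<^esub> (single M j m)) =
        reindex e \<zero>\<^bsub>M\<^esub> (mx M I A (single M j m))" if "j \<in> J" "m \<in> carrier M" for j m
    proof -
      have "mx M (e ` I) (\<lambda>v. reindex e \<zero>\<^bsub>R\<^esub> (A (inv_into UNIV e v))) (single M (e j) m) = act M (reindex e \<zero>\<^bsub>R\<^esub> (A (inv_into UNIV e (e j)))) m"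
        using that by (intro mx_single[OF assms(1) A']) auto
      then show ?thesis
        using that assms(2) mx_single[where A=A, OF assms(1) A that]
        by (auto simp: reindex_single act_def reindex_def)
    qed
  qed
qed

lemma free_resolution_reindex:
  assumes "cring R" "free_resolution R I A" "inj e"
  shows "free_resolution R (\<lambda>k. e ` I k) (\<lambda>k v. reindex e \<zero>\<^bsub>R\<^esub> (A k (inv_into UNIV e v)))"
proof -
  note modR = module_regular_module[OF assms(1)]
  note A = free_resolutionD[OF assms(2)]
  note hom = reindex_hom[OF modR assms(3)]
  have mxe: "mx (regular_module R) (e ` I k) (\<lambda>v. reindex e \<zero>\<^bsub>R\<^esub> (A k (inv_into UNIV e v))) (reindex e \<zero>\<^bsub>R\<^esub> z) =
      reindex e \<zero>\<^bsub>R\<^esub> (mx (regular_module R) (I k) (A k) z)" if "z \<in> carrier (fs (regular_module R) (I (Suc k)))" for k z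
    using reindex_mx[OF modR assms(3) A(1) that] by simp
  have zero: "reindex e \<zero>\<^bsub>R\<^esub> (\<lambda>_. \<zero>\<^bsub>R\<^esub>) = (\<lambda>_. \<zero>\<^bsub>R\<^esub>)" by (auto simp: reindex_def)
  show ?thesis unfolding free_resolution_def
  proof (intro conjI allI ballI impI, goal_cases)
    case (1 k j)
    then show ?case using mod_homD(1)[OF hom] A(1) assms(3) by fastforce
  next
    case (2 k j)
    then obtain i where "i \<in> I (Suc (Suc k))" "j = e i" by blast
    then show ?case using A(2) assms(3) mxe[OF A(1)] by (simp add: zero)
  next
    case (3 k y)
    then obtain z where z: "z \<in> carrier (fs (regular_module R) (I (Suc (Suc k))))" "y = reindex e \<zero>\<^bsub>R\<^esub> z"
      using reindex_surj[OF assms(3)] by (metis regular_module_simps(2))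
    have "mx (regular_module R) (I (Suc k)) (A (Suc k)) z = (\<lambda>_. \<zero>\<^bsub>R\<^esub>)"
      using 3(2) reindex_eq_iff[OF assms(3), of "\<zero>\<^bsub>R\<^esub>"] z zero by (simp add: mxe) (metis zero)
    from A(3)[OF z(1) this] obtain w where "w \<in> carrier (fs (regular_module R) (I (Suc (Suc (Suc k)))))"
      "mx (regular_module R) (I (Suc (Suc k))) (A (Suc (Suc k))) w = z" by blast
    then show ?case
      using mod_homD(1)[OF hom] by (intro bexI[of _ "reindex e \<zero>\<^bsub>R\<^esub> w"]) (auto simp: mxe z)
  qed
qed

text \<open>An injection of index types carries the complex and the cycle to \<open>'u\<close>; the
  bounding chain found there lives on the image of the old basis and is pulled back. This is applied
  to \<open>'u \<times> nat\<close> and \<open>'u + 'u\<close>.\<close>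

lemma tor_killed_reindex:
  fixes R :: "('a, 'm) ring_scheme"
  assumes "module R M" "tor_killed TYPE('u) R S M n" "(UNIV :: 'j set) \<lesssim> (UNIV :: 'u set)" "S \<subseteq> carrier R"
  shows "tor_killed TYPE('j) R S M n"
  unfolding tor_killed_def homology_killed_def
proof (intro allI impI)
  fix I :: "nat \<Rightarrow> 'j set" and A
  assume res: "free_resolution R I A"
  interpret module R M by fact
  note A = free_resolutionD(1)[OF res]
  obtain e :: "'j \<Rightarrow> 'u" where e: "inj e" using assms(3) by (auto simp: lepoll_def)
  have mxe: "mx M (e ` I k) (\<lambda>v. reindex e \<zero>\<^bsub>R\<^esub> (A k (inv_into UNIV e v))) (reindex e \<zero>\<^bsub>M\<^esub> z) =
      reindex e \<zero>\<^bsub>M\<^esub> (mx M (I k) (A k) z)" if "z \<in> carrier (fs M (I (Suc k)))" for k z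
    using reindex_mx[OF assms(1) e A that] by simp
  have zero: "reindex e \<zero>\<^bsub>M\<^esub> (\<lambda>_. \<zero>\<^bsub>M\<^esub>) = (\<lambda>_. \<zero>\<^bsub>M\<^esub>)" by (auto simp: reindex_def)
  let ?A = "\<lambda>k v. reindex e \<zero>\<^bsub>R\<^esub> (A k (inv_into UNIV e v))"
  have "homology_killed S (\<lambda>k. fs M (e ` I k)) (\<lambda>k. mx M (e ` I k) (?A k)) n"
    by (rule assms(2)[unfolded tor_killed_def, rule_format, OF free_resolution_reindex[OF is_cring res e]])
  then obtain s where s: "s \<in> S" and all: "\<forall>z\<in>carrier (fs M (e ` I (Suc n))). mx M (e ` I n) (?A n) z = \<zero>\<^bsub>fs M (e ` I n)\<^esub> \<longrightarrow>
      (\<exists>w\<in>carrier (fs M (e ` I (Suc (Suc n)))). mx M (e ` I (Suc n)) (?A (Suc n)) w = s \<odot>\<^bsub>fs M (e ` I (Suc n))\<^esub> z)"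
    unfolding homology_killed_def by (rule bexE)
  show "\<exists>s\<in>S. \<forall>z\<in>carrier (fs M (I (Suc n))). mx M (I n) (A n) z = \<zero>\<^bsub>fs M (I n)\<^esub> \<longrightarrow>
     (\<exists>w\<in>carrier (fs M (I (Suc (Suc n)))). mx M (I (Suc n)) (A (Suc n)) w = s \<odot>\<^bsub>fs M (I (Suc n))\<^esub> z)"
  proof (intro bexI[OF _ s] ballI impI)
    fix z assume z: "z \<in> carrier (fs M (I (Suc n)))" "mx M (I n) (A n) z = \<zero>\<^bsub>fs M (I n)\<^esub>"
    have "mx M (e ` I n) (?A n) (reindex e \<zero>\<^bsub>M\<^esub> z) = \<zero>\<^bsub>fs M (e ` I n)\<^esub>"
      unfolding mxe[OF z(1)] z(2) fs_simps by (rule zero)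
    from all[rule_format, OF mod_homD(1)[OF reindex_hom[OF assms(1) e] z(1)] this]
    obtain w where w: "w \<in> carrier (fs M (e ` I (Suc (Suc n))))"
        "mx M (e ` I (Suc n)) (?A (Suc n)) w = s \<odot>\<^bsub>fs M (e ` I (Suc n))\<^esub> reindex e \<zero>\<^bsub>M\<^esub> z"
      by (rule bexE)
    obtain w' where w': "w' \<in> carrier (fs M (I (Suc (Suc n))))" "w = reindex e \<zero>\<^bsub>M\<^esub> w'"
      using reindex_surj[OF e w(1)] by blast
    have sR: "s \<in> carrier R" using s assms(4) by blast
    have "reindex e \<zero>\<^bsub>M\<^esub> (mx M (I (Suc n)) (A (Suc n)) w') = reindex e \<zero>\<^bsub>M\<^esub> (s \<odot>\<^bsub>fs M (I (Suc n))\<^esub> z)"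
      using w(2) unfolding w'(2) mxe[OF w'(1)] mod_homD(3)[OF reindex_hom[OF assms(1) e] sR z(1)] .
    then show "\<exists>w\<in>carrier (fs M (I (Suc (Suc n)))). mx M (I (Suc n)) (A (Suc n)) w = s \<odot>\<^bsub>fs M (I (Suc n))\<^esub> z"
      unfolding reindex_eq_iff[OF e] by (rule bexI[OF _ w'(1)])
  qed
qed

section \<open>Short exact sequences and free covers\<close>

text \<open>Both stretches of the long exact sequence for one short \<open>S\<close>-exact sequence
  of modules. With \<open>B\<close> flat they shift the dimension: \<open>tor_killed_right\<close>
  climbs along a given flat sequence, and \<open>tor_killed_left\<close> descends along a free
  cover.\<close>

lemma tor_killed_short_exact:
  assumes "submonoid S R" "s \<in> S" "module R A" "module R B" "module R C"
    and "f \<in> mod_hom R A B" "g \<in> mod_hom R B C"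
    and "\<And>c. c \<in> carrier C \<Longrightarrow> \<exists>b\<in>carrier B. g b = s \<odot>\<^bsub>C\<^esub> c"
    and "\<And>b. b \<in> carrier B \<Longrightarrow> g b = \<zero>\<^bsub>C\<^esub> \<Longrightarrow> \<exists>a\<in>carrier A. f a = s \<odot>\<^bsub>B\<^esub> b"
    and "\<And>a. a \<in> carrier A \<Longrightarrow> f a = \<zero>\<^bsub>B\<^esub> \<Longrightarrow> s \<odot>\<^bsub>A\<^esub> a = \<zero>\<^bsub>A\<^esub>"
    and "\<And>a. a \<in> carrier A \<Longrightarrow> s \<odot>\<^bsub>C\<^esub> g (f a) = \<zero>\<^bsub>C\<^esub>"
  shows tor_killed_right: "tor_killed TYPE('i) R S A n \<Longrightarrow> tor_killed TYPE('i) R S B (Suc n) \<Longrightarrow> tor_killed TYPE('i) R S C (Suc n)"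
    and tor_killed_left: "tor_killed TYPE('i) R S B n \<Longrightarrow> tor_killed TYPE('i) R S C (Suc n) \<Longrightarrow> tor_killed TYPE('i) R S A n"
proof -
  assume killed: "tor_killed TYPE('i) R S A n" "tor_killed TYPE('i) R S B (Suc n)"
  show "tor_killed TYPE('i) R S C (Suc n)" unfolding tor_killed_def
  proof (intro allI impI)
    fix I :: "nat \<Rightarrow> 'i set" and D
    assume res: "free_resolution R I D"
    interpret S_exact_complexes R S s "\<lambda>k. fs A (I k)" "\<lambda>k. mx A (I k) (D k)"
      "\<lambda>k. fs B (I k)" "\<lambda>k. mx B (I k) (D k)" "\<lambda>k. fs C (I k)" "\<lambda>k. mx C (I k) (D k)"
      "\<lambda>k z i. f (z i)" "\<lambda>k z i. g (z i)"
      by (rule S_exact_complexes_fs[OF assms res])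
    show "homology_killed S (\<lambda>k. fs C (I k)) (\<lambda>k. mx C (I k) (D k)) (Suc n)"
      using killed res unfolding tor_killed_def by (intro homology_right; simp)
  qed
next
  assume killed: "tor_killed TYPE('i) R S B n" "tor_killed TYPE('i) R S C (Suc n)"
  show "tor_killed TYPE('i) R S A n" unfolding tor_killed_def
  proof (intro allI impI)
    fix I :: "nat \<Rightarrow> 'i set" and D
    assume res: "free_resolution R I D"
    interpret S_exact_complexes R S s "\<lambda>k. fs A (I k)" "\<lambda>k. mx A (I k) (D k)"
      "\<lambda>k. fs B (I k)" "\<lambda>k. mx B (I k) (D k)" "\<lambda>k. fs C (I k)" "\<lambda>k. mx C (I k) (D k)"
      "\<lambda>k z i. f (z i)" "\<lambda>k z i. g (z i)"
      by (rule S_exact_complexes_fs[OF assms res])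
    show "homology_killed S (\<lambda>k. fs A (I k)) (\<lambda>k. mx A (I k) (D k)) n"
      using killed res unfolding tor_killed_def by (intro homology_left; simp)
  qed
qed

text \<open>With coefficients in a free module the complex splits into copies of \<open>Q\<close>,
  one for each \<open>x\<close> in \<open>X\<close>, and \<open>Q\<close> is exact in degree 2, the
  degree that belongs to \<open>n = 1\<close>.\<close>

lemma tor_killed_free:
  assumes "cring R" "submonoid S R"
  shows "tor_killed TYPE('i) R S (fs (regular_module R) X) 1"
  unfolding tor_killed_def homology_killed_def One_nat_def
proof (intro allI impI)
  fix I :: "nat \<Rightarrow> 'i set" and A
  assume res: "free_resolution R I A"
  interpret cring R by fact
  interpret S: submonoid S R by fact
  let ?R = "regular_module R" let ?P = "fs ?R X"
  note modR = module_regular_module[OF assms(1)]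
  note modP = module_fs[OF modR]
  note A = free_resolutionD[OF res]
  have ev: "(\<lambda>p. p x) \<in> mod_hom R ?P ?R" for x
    by (rule mod_homI) (auto simp: fs_carrier)
  have nat: "mx ?R (I k) (A k) (\<lambda>j. z j x) = (\<lambda>i. mx ?P (I k) (A k) z i x)"
    if "z \<in> carrier (fs ?P (I (Suc k)))" for k z x
    by (rule mx_natural[OF modP modR ev A(1) that])
  show "\<exists>s\<in>S. \<forall>z\<in>carrier (fs ?P (I (Suc (Suc 0)))). mx ?P (I (Suc 0)) (A (Suc 0)) z = \<zero>\<^bsub>fs ?P (I (Suc 0))\<^esub> \<longrightarrow>
     (\<exists>w\<in>carrier (fs ?P (I (Suc (Suc (Suc 0))))). mx ?P (I (Suc (Suc 0))) (A (Suc (Suc 0))) w = s \<odot>\<^bsub>fs ?P (I (Suc (Suc 0)))\<^esub> z)"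
  proof (intro bexI[OF _ S.one_closed] ballI impI)
    fix z assume z: "z \<in> carrier (fs ?P (I (Suc (Suc 0))))" "mx ?P (I (Suc 0)) (A (Suc 0)) z = \<zero>\<^bsub>fs ?P (I (Suc 0))\<^esub>"
    let ?F = "\<Union>j\<in>{j. z j \<noteq> (\<lambda>_. \<zero>\<^bsub>R\<^esub>)}. {x. z j x \<noteq> \<zero>\<^bsub>R\<^esub>}"
    have zj: "z j \<in> carrier ?P" for j using fs_value[OF z(1)] .
    have F: "finite ?F" "?F \<subseteq> X" using z(1) zj by (auto simp: fs_carrier)
    have zx: "(\<lambda>j. z j x) \<in> carrier (fs ?R (I (Suc (Suc 0))))" for x
      using mod_homD(1)[OF fs_post[OF modP modR ev] z(1)] .
    have "\<exists>w\<in>carrier (fs ?R (I (Suc (Suc (Suc 0))))). mx ?R (I (Suc (Suc 0))) (A (Suc (Suc 0))) w = (\<lambda>j. z j x)" for x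
      by (rule A(3)[OF zx]) (simp add: nat[OF z(1)] z(2))
    then obtain w where w: "\<And>x. w x \<in> carrier (fs ?R (I (Suc (Suc (Suc 0)))))"
      "\<And>x. mx ?R (I (Suc (Suc 0))) (A (Suc (Suc 0))) (w x) = (\<lambda>j. z j x)"
      unfolding Bex_def using choice[of "\<lambda>x w. w \<in> carrier (fs ?R (I (Suc (Suc (Suc 0))))) \<and>
        mx ?R (I (Suc (Suc 0))) (A (Suc (Suc 0))) w = (\<lambda>j. z j x)"] by auto
    \<comment> \<open>Outside the finite set \<open>?F\<close> of coordinates occurring in
      \<open>z\<close> the solution is zero and not the chosen \<open>w x\<close>; otherwise
      infinitely many coordinates could occur.\<close>
    define v where "v j x = (if x \<in> ?F then w x j else \<zero>\<^bsub>R\<^esub>)" for j x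
    have vj: "v j \<in> carrier ?P" for j
      using F w(1) by (auto simp: fs_carrier v_def intro: finite_subset[OF _ F(1)])
    have "{j. v j \<noteq> (\<lambda>_. \<zero>\<^bsub>R\<^esub>)} \<subseteq> (\<Union>x\<in>?F. {j. w x j \<noteq> \<zero>\<^bsub>R\<^esub>})"
      by (auto simp: v_def fun_eq_iff split: if_splits)
    moreover have "finite (\<Union>x\<in>?F. {j. w x j \<noteq> \<zero>\<^bsub>R\<^esub>})"
      by (rule finite_UN_I[OF F(1)]) (use w(1) in \<open>simp add: fs_carrier\<close>)
    ultimately have v: "v \<in> carrier (fs ?P (I (Suc (Suc (Suc 0)))))"
      using vj w(1) finite_subset by (simp add: fs_carrier[of v]) (auto simp: v_def fs_carrier)
    have zero: "mx ?R (I (Suc (Suc 0))) (A (Suc (Suc 0))) (\<lambda>_. \<zero>\<^bsub>R\<^esub>) = (\<lambda>_. \<zero>\<^bsub>R\<^esub>)"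
      using mod_hom_zero_minus(1)[OF module_fs[OF modR] module_fs[OF modR] free_resolution_hom[OF modR res]] by simp
    have "mx ?P (I (Suc (Suc 0))) (A (Suc (Suc 0))) v j x = z j x" for j x
    proof -
      have "mx ?P (I (Suc (Suc 0))) (A (Suc (Suc 0))) v j x = mx ?R (I (Suc (Suc 0))) (A (Suc (Suc 0))) (\<lambda>j. v j x) j"
        unfolding nat[OF v] ..
      also have "\<dots> = z j x"
      proof (cases "x \<in> ?F")
        case True
        then have "(\<lambda>j. v j x) = w x" by (auto simp: v_def)
        then show ?thesis using w(2) by simp
      next
        case False
        then have "(\<lambda>j. v j x) = (\<lambda>_. \<zero>\<^bsub>R\<^esub>)" unfolding v_def by (simp only: if_False)
        moreover have "z j x = \<zero>\<^bsub>R\<^esub>" by (cases "z j = (\<lambda>_. \<zero>\<^bsub>R\<^esub>)") (use False in auto)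
        ultimately show ?thesis using zero by simp
      qed
      finally show ?thesis .
    qed
    then show "\<exists>w\<in>carrier (fs ?P (I (Suc (Suc (Suc 0))))). mx ?P (I (Suc (Suc 0))) (A (Suc (Suc 0))) w = \<one>\<^bsub>R\<^esub> \<odot>\<^bsub>fs ?P (I (Suc (Suc 0)))\<^esub> z"
      by (intro bexI[OF _ v]) (simp add: fun_eq_iff fs_value[OF zj, simplified])
  qed
qed

text \<open>The free module on all elements of \<open>M\<close>, moved into
  \<open>'u\<close>.\<close>

lemma free_cover:
  fixes M :: "('a, 'u) module"
  assumes "module R M" "submonoid S R" "infinite (UNIV :: 'u set)" "carrier R \<lesssim> (UNIV :: 'u set)"
  obtains P :: "('a, 'u) module" and g where "module R P" "g \<in> mod_hom R P M" "g ` carrier P = carrier M"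
    "tor_killed TYPE('i) R S P 1"
proof -
  interpret module R M by fact
  interpret S: submonoid S R by fact
  let ?R = "regular_module R" let ?F = "fs ?R (carrier M)"
  note modR = module_regular_module[OF is_cring]
  have "carrier ?F \<lesssim> (UNIV :: 'u set)"
    by (rule fs_lepoll[OF assms(3)]) (auto simp: assms(4) subset_imp_lepoll)
  from transport[OF module_fs[OF modR] this] obtain P :: "('a, 'u) module" and f g
    where P: "module R P" "f \<in> mod_hom R ?F P" "g \<in> mod_hom R P ?F"
      "\<And>x. x \<in> carrier ?F \<Longrightarrow> g (f x) = x" "\<And>y. y \<in> carrier P \<Longrightarrow> f (g y) = y" by blast
  have sm: "(\<lambda>r. r \<odot>\<^bsub>M\<^esub> m) \<in> mod_hom R ?R M" if "m \<in> carrier M" for m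
    by (rule smult_hom[OF assms(1) that])
  define c where "c = fs_lift ?R M (\<lambda>m r. r \<odot>\<^bsub>M\<^esub> m)"
  have c: "c \<in> mod_hom R ?F M" "\<And>m r. m \<in> carrier M \<Longrightarrow> r \<in> carrier R \<Longrightarrow> c (single ?R m r) = r \<odot>\<^bsub>M\<^esub> m"
    unfolding c_def using fs_lift[OF modR assms(1) sm] by auto
  show thesis
  proof
    show "module R P" by (rule P(1))
    show hom: "(\<lambda>y. c (g y)) \<in> mod_hom R P M" by (rule mod_hom_comp[OF P(3) c(1)])
    have "m \<in> (\<lambda>y. c (g y)) ` carrier P" if m: "m \<in> carrier M" for m
    proof -
      have "single ?R m \<one>\<^bsub>R\<^esub> \<in> carrier ?F" by (rule single_closed[OF modR m]) simp
      then show ?thesis using m P(4) mod_homD(1)[OF P(2)] c(2)[OF m, of "\<one>\<^bsub>R\<^esub>"]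
        by (intro image_eqI[of _ _ "f (single ?R m \<one>\<^bsub>R\<^esub>)"]) auto
    qed
    then show "(\<lambda>y. c (g y)) ` carrier P = carrier M" using mod_homD(1)[OF hom] by auto
    show "tor_killed TYPE('i) R S P 1"
      by (rule tor_killed_retract[OF module_fs[OF modR] P(1-3) P(5) S.subset tor_killed_free[OF is_cring assms(2)]])
  qed
qed

section \<open>\<open>S\<close>-flatness in terms of free resolutions\<close>

lemma diff_eq_zero_iff:
  assumes "module R M" "x \<in> carrier M" "y \<in> carrier M"
  shows "x \<ominus>\<^bsub>M\<^esub> y = \<zero>\<^bsub>M\<^esub> \<longleftrightarrow> x = y"
proof -
  interpret module R M by fact
  show ?thesis using assms(2,3)
    by (metis M.minus_equality M.minus_minus M.r_neg a_minus_def M.a_inv_closed)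
qed

lemma image_bexD: "y \<in> f ` A \<Longrightarrow> \<exists>x\<in>A. f x = y"
  by blast

lemma submodule_image:
  assumes "module R M" "module R N" "f \<in> mod_hom R M N"
  shows "submodule (f ` carrier M) R N"
proof -
  interpret M: module R M by fact
  interpret N: module R N by fact
  show ?thesis
  proof (rule N.submoduleI)
    show "\<zero>\<^bsub>N\<^esub> \<in> f ` carrier M"
      using mod_hom_zero_minus(1)[OF assms] M.M.zero_closed by (metis imageI)
    show "\<ominus>\<^bsub>N\<^esub> a \<in> f ` carrier M" if "a \<in> f ` carrier M" for a
    proof -
      obtain y where "y \<in> carrier M" "a = f y" using \<open>a \<in> _\<close> by blast
      then show ?thesis using mod_hom_zero_minus(2)[OF assms] by (intro image_eqI[of _ _ "\<ominus>\<^bsub>M\<^esub> y"]) auto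
    qed
    show "a \<oplus>\<^bsub>N\<^esub> b \<in> f ` carrier M" if "a \<in> f ` carrier M" "b \<in> f ` carrier M" for a b
    proof -
      obtain x y where "x \<in> carrier M" "y \<in> carrier M" "a = f x" "b = f y" using \<open>a \<in> _\<close> \<open>b \<in> _\<close> by blast
      then show ?thesis using mod_homD(2)[OF assms(3)] by (intro image_eqI[of _ _ "x \<oplus>\<^bsub>M\<^esub> y"]) auto
    qed
    show "r \<odot>\<^bsub>N\<^esub> x \<in> f ` carrier M" if "r \<in> carrier R" "x \<in> f ` carrier M" for r x
    proof -
      obtain y where "y \<in> carrier M" "x = f y" using \<open>x \<in> _\<close> by blast
      then show ?thesis using mod_homD(3)[OF assms(3)] \<open>r \<in> _\<close> by (intro image_eqI[of _ _ "r \<odot>\<^bsub>M\<^esub> y"]) auto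
    qed
  qed (use mod_homD(1)[OF assms(3)] in auto)
qed

definition coset_map :: "('a, 'b, 'n) module_scheme \<Rightarrow> 'b set \<Rightarrow> 'b \<Rightarrow> 'b set"
  where "coset_map M H x = H +>\<^bsub>M\<^esub> x"

text \<open>Membership in an image is vanishing in the cokernel, an equation between homomorphisms
  that may be tested on generators. Surjectivity and exactness for tensor products are proved in
  this way below.\<close>

lemma quot_image:
  assumes "module R M" "module R N" "f \<in> mod_hom R M N"
  defines "H \<equiv> f ` carrier M"
  shows "module R (quot_module N H)" "coset_map N H \<in> mod_hom R N (quot_module N H)"
    "\<And>x. x \<in> carrier N \<Longrightarrow> coset_map N H x = \<zero>\<^bsub>quot_module N H\<^esub> \<longleftrightarrow> x \<in> H"
    "coset_map N H ` carrier N = carrier (quot_module N H)"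
proof -
  note q = module_quot_module[OF assms(2) submodule_image[OF assms(1-3)], folded H_def]
  have eq: "coset_map N H = (\<lambda>x. H +>\<^bsub>N\<^esub> x)" by (auto simp: coset_map_def)
  show "module R (quot_module N H)" by (rule q)
  show "coset_map N H \<in> mod_hom R N (quot_module N H)" unfolding eq by (rule q)
  show "coset_map N H ` carrier N = carrier (quot_module N H)"
    unfolding eq using q(2,3) by blast
  show "\<And>x. x \<in> carrier N \<Longrightarrow> coset_map N H x = \<zero>\<^bsub>quot_module N H\<^esub> \<longleftrightarrow> x \<in> H"
    unfolding eq by (rule q)
qed

lemma module_minus_zero:
  assumes "module R N" shows "\<ominus>\<^bsub>N\<^esub> \<zero>\<^bsub>N\<^esub> = \<zero>\<^bsub>N\<^esub>"
proof -
  interpret N: module R N by fact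
  show ?thesis using N.M.l_zero N.M.r_neg N.M.zero_closed N.M.a_inv_closed by metis
qed

lemma hom_eq_if_diff:
  assumes "module R M" "module R N" "f \<in> mod_hom R M N" "x \<in> carrier M" "y \<in> carrier M"
    and "f (x \<ominus>\<^bsub>M\<^esub> y) = \<zero>\<^bsub>N\<^esub>"
  shows "f x = f y"
  using assms diff_eq_zero_iff[OF assms(2)] mod_hom_diff[OF assms(1-5)] mod_homD(1)[OF assms(3)] by metis

section \<open>Tensor products by generators and relations\<close>

lemma tensor_map:
  assumes "module R M" "module R M'" "module R N" "f \<in> mod_hom R M M'"
  shows tensor_map_hom: "tensor_map R M M' N f \<in> mod_hom R (tensor_module R M N) (tensor_module R M' N)"
    and tensor_map_pure: "\<And>x y. x \<in> carrier M \<Longrightarrow> y \<in> carrier N \<Longrightarrow>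
      tensor_map R M M' N f (pure_tensor R M N x y) = pure_tensor R M' N (f x) y"
  using theI'[OF tensor_map_ex1[OF assms]] by (simp_all add: tensor_map_def)

lemma pure_tensor_hom_right:
  assumes "module R M" "module R N" "x \<in> carrier M"
  shows "pure_tensor R M N x \<in> mod_hom R N (tensor_module R M N)"
  using assms by (intro mod_homI) (auto simp: pure_tensor_closed pure_tensor_bilinear)

lemma pure_tensor_hom_left:
  assumes "module R M" "module R N" "y \<in> carrier N"
  shows "(\<lambda>x. pure_tensor R M N x y) \<in> mod_hom R M (tensor_module R M N)"
  using assms by (intro mod_homI) (auto simp: pure_tensor_closed pure_tensor_bilinear)

text \<open>The canonical map \<open>R^(M) \<otimes> N \<rightarrow> M \<otimes> N\<close>, where
  \<open>R^(M)\<close> is the free module on all elements of \<open>M\<close> and its tensor product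
  with \<open>N\<close> is written as functions from \<open>carrier M\<close> to
  \<open>N\<close>.\<close>

definition tensor_of_fs ::
  "('a, 'm) ring_scheme \<Rightarrow> ('a, 'b, 'n) module_scheme \<Rightarrow> ('a, 'c, 'k) module_scheme \<Rightarrow>
   ('b \<Rightarrow> 'c) \<Rightarrow> ('b \<times> 'c \<Rightarrow> 'a) set"
  where "tensor_of_fs R M N = fs_lift N (tensor_module R M N) (pure_tensor R M N)"

lemma tensor_of_fs:
  assumes "module R M" "module R N"
  shows tensor_of_fs_hom: "tensor_of_fs R M N \<in> mod_hom R (fs N (carrier M)) (tensor_module R M N)"
    and tensor_of_fs_single: "\<And>x y. x \<in> carrier M \<Longrightarrow> y \<in> carrier N \<Longrightarrow>
      tensor_of_fs R M N (single N x y) = pure_tensor R M N x y"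
  unfolding tensor_of_fs_def
  by (rule fs_lift[OF assms(2) module_tensor_module[OF assms]], rule pure_tensor_hom_right[OF assms], assumption+)+

text \<open>The image contains the pure tensors, on which a homomorphism to the cokernel is
  determined.\<close>

lemma tensor_of_fs_surj:
  assumes "module R M" "module R N" and X: "X \<in> carrier (tensor_module R M N)"
  shows "\<exists>x\<in>carrier (fs N (carrier M)). X = tensor_of_fs R M N x"
proof -
  note T = module_tensor_module[OF assms(1,2)]
  define H where "H = tensor_of_fs R M N ` carrier (fs N (carrier M))"
  define Q where "Q = quot_module (tensor_module R M N) H"
  define \<pi> where "\<pi> = coset_map (tensor_module R M N) H"
  note Q = quot_image[OF module_fs[OF assms(2)] T tensor_of_fs_hom[OF assms(1,2)], folded H_def, folded Q_def \<pi>_def]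
  have "\<pi> X = \<zero>\<^bsub>Q\<^esub>"
  proof (rule tensor_hom_eq[OF assms(1,2) Q(1,2) mod_hom_zero[OF Q(1)] _ X])
    fix x y assume xy: "x \<in> carrier M" "y \<in> carrier N"
    then have "pure_tensor R M N x y \<in> H"
      unfolding H_def using tensor_of_fs_single[OF assms(1,2)] single_closed[OF assms(2)] by (metis imageI)
    then show "\<pi> (pure_tensor R M N x y) = \<zero>\<^bsub>Q\<^esub>"
      using Q(3) pure_tensor_closed[OF assms(1,2) xy] by blast
  qed
  then show ?thesis using Q(3)[OF X] by (auto simp: H_def)
qed

definition free_eval :: "('a, 'm) ring_scheme \<Rightarrow> ('a, 'b, 'n) module_scheme \<Rightarrow> ('b \<Rightarrow> 'a) \<Rightarrow> 'b"
  where "free_eval R M = fs_lift (regular_module R) M (\<lambda>m r. r \<odot>\<^bsub>M\<^esub> m)"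

lemma free_eval:
  assumes "module R M"
  shows free_eval_hom: "free_eval R M \<in> mod_hom R (fs (regular_module R) (carrier M)) M"
    and free_eval_single: "\<And>m r. m \<in> carrier M \<Longrightarrow> r \<in> carrier R \<Longrightarrow>
      free_eval R M (single (regular_module R) m r) = r \<odot>\<^bsub>M\<^esub> m"
proof -
  interpret module R M by fact
  show "free_eval R M \<in> mod_hom R (fs (regular_module R) (carrier M)) M"
    "\<And>m r. m \<in> carrier M \<Longrightarrow> r \<in> carrier R \<Longrightarrow> free_eval R M (single (regular_module R) m r) = r \<odot>\<^bsub>M\<^esub> m"
    unfolding free_eval_def
    using fs_lift(1)[OF module_regular_module[OF is_cring] assms smult_hom[OF assms], of "carrier M" "\<lambda>m. m"]
      fs_lift(2)[OF module_regular_module[OF is_cring] assms smult_hom[OF assms], of "carrier M" "\<lambda>m. m"]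
    by auto
qed

text \<open>Right exactness of the tensor product for the presentation of \<open>M\<close> by all its elements and all
  their relations.\<close>

lemma tensor_of_fs_kernel:
  assumes "module R M" "module R N"
    and D: "\<And>j. j \<in> J \<Longrightarrow> D j \<in> carrier (fs (regular_module R) (carrier M))"
    and rel: "\<And>p. p \<in> carrier (fs (regular_module R) (carrier M)) \<Longrightarrow> free_eval R M p = \<zero>\<^bsub>M\<^esub> \<Longrightarrow> \<exists>j\<in>J. D j = p"
    and v: "v \<in> carrier (fs N (carrier M))" "tensor_of_fs R M N v = \<zero>\<^bsub>tensor_module R M N\<^esub>"
  shows "\<exists>l\<in>carrier (fs N J). mx N (carrier M) D l = v"
proof -
  interpret M: module R M by fact
  interpret N: module R N by fact
  let ?R = "regular_module R" let ?P = "fs ?R (carrier M)" let ?F = "fs N (carrier M)"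
  note modR = module_regular_module[OF M.is_cring]
  note modP = module_fs[OF modR]
  interpret P: module R ?P by (rule modP)
  note T = module_tensor_module[OF assms(1,2)]
  have mxh: "mx N (carrier M) D \<in> mod_hom R (fs N J) ?F" by (rule mx_hom[OF assms(2) D])
  define H where "H = mx N (carrier M) D ` carrier (fs N J)"
  define Q where "Q = quot_module ?F H"
  define \<pi> where "\<pi> = coset_map ?F H"
  note Q = quot_image[OF module_fs[OF assms(2)] module_fs[OF assms(2)] mxh, folded H_def, folded Q_def \<pi>_def]
  interpret Q: module R Q by (rule Q)
  \<comment> \<open>Modulo the image of the relations, \<open>p \<otimes> y\<close> depends only on
    the value of \<open>p\<close> in \<open>M\<close>. This makes
    \<open>(x, y) \<mapsto> e x \<otimes> y\<close> bilinear.\<close>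
  have act_eq: "\<pi> (act N p y) = \<pi> (act N q y)"
    if pq: "p \<in> carrier ?P" "q \<in> carrier ?P" "free_eval R M p = free_eval R M q" and y: "y \<in> carrier N" for p q y
  proof -
    have "free_eval R M (p \<ominus>\<^bsub>?P\<^esub> q) = \<zero>\<^bsub>M\<^esub>"
      using mod_hom_diff[OF modP assms(1) free_eval_hom[OF assms(1)] pq(1,2)] pq(3)
        diff_eq_zero_iff[OF assms(1)] mod_homD(1)[OF free_eval_hom[OF assms(1)] pq(2)] by metis
    then obtain j where j: "j \<in> J" "D j = p \<ominus>\<^bsub>?P\<^esub> q" using rel P.M.minus_closed pq by blast
    have "act N (p \<ominus>\<^bsub>?P\<^esub> q) y = mx N (carrier M) D (single N j y)"
      using mx_single[where A = D, OF assms(2) D j(1) y] j(2) by simp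
    then have "\<pi> (act N (p \<ominus>\<^bsub>?P\<^esub> q) y) = \<zero>\<^bsub>Q\<^esub>"
      using Q(3) act_closed[OF assms(2) P.M.minus_closed y] pq single_closed[OF assms(2) j(1) y] unfolding H_def by (metis imageI)
    with hom_eq_if_diff[OF modP Q(1) mod_hom_comp[OF act_hom_left[OF assms(2) y] Q(2)] pq(1,2)]
    show ?thesis by blast
  qed
  let ?e = "\<lambda>x. single ?R x \<one>\<^bsub>R\<^esub>"
  have e: "?e x \<in> carrier ?P" "free_eval R M (?e x) = x" if "x \<in> carrier M" for x
    using single_closed[OF modR that] free_eval_single[OF assms(1) that] that by auto
  have se: "single N x y = act N (?e x) y" if "y \<in> carrier N" for x y
    using act_single[OF assms(2) that, of x "\<one>\<^bsub>R\<^esub>"] that by simp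
  note ev = mod_homD[OF free_eval_hom[OF assms(1)]]
  note al = mod_homD[OF mod_hom_comp[OF act_hom_left[OF assms(2)] Q(2)]]
  note ar = mod_homD[OF mod_hom_comp[OF act_hom[OF assms(2)] Q(2)]]
  \<comment> \<open>The map \<open>h\<close> is a left inverse of the map from the cokernel
    \<open>Q\<close> to the tensor product, so an element with value zero is zero in
    \<open>Q\<close>.\<close>
  have "\<exists>h\<in>mod_hom R (tensor_module R M N) Q. \<forall>x\<in>carrier M. \<forall>y\<in>carrier N. h (pure_tensor R M N x y) = \<pi> (act N (?e x) y)"
  proof (rule tensor_lift[OF assms(1,2) Q(1)])
    fix x y assume "x \<in> carrier M" "y \<in> carrier N"
    then show "\<pi> (act N (?e x) y) \<in> carrier Q" using al(1) e by blast
  next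
    fix x x' y assume a: "x \<in> carrier M" "x' \<in> carrier M" "y \<in> carrier N"
    have "\<pi> (act N (?e (x \<oplus>\<^bsub>M\<^esub> x')) y) = \<pi> (act N (?e x \<oplus>\<^bsub>?P\<^esub> ?e x') y)"
      using a e by (intro act_eq) (auto simp: ev simp del: fs_simps)
    also have "\<dots> = \<pi> (act N (?e x) y) \<oplus>\<^bsub>Q\<^esub> \<pi> (act N (?e x') y)"
      by (rule al(2)) (use a e in auto)
    finally show "\<pi> (act N (?e (x \<oplus>\<^bsub>M\<^esub> x')) y) = \<pi> (act N (?e x) y) \<oplus>\<^bsub>Q\<^esub> \<pi> (act N (?e x') y)" .
  next
    fix x y y' assume "x \<in> carrier M" "y \<in> carrier N" "y' \<in> carrier N"
    then show "\<pi> (act N (?e x) (y \<oplus>\<^bsub>N\<^esub> y')) = \<pi> (act N (?e x) y) \<oplus>\<^bsub>Q\<^esub> \<pi> (act N (?e x) y')"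
      using ar(2)[OF e(1)] by blast
  next
    fix r x y assume a: "r \<in> carrier R" "x \<in> carrier M" "y \<in> carrier N"
    have "\<pi> (act N (?e (r \<odot>\<^bsub>M\<^esub> x)) y) = \<pi> (act N (r \<odot>\<^bsub>?P\<^esub> ?e x) y)"
      using a e by (intro act_eq) (auto simp: ev simp del: fs_simps)
    also have "\<dots> = r \<odot>\<^bsub>Q\<^esub> \<pi> (act N (?e x) y)"
      by (rule al(3)) (use a e in auto)
    finally show "\<pi> (act N (?e (r \<odot>\<^bsub>M\<^esub> x)) y) = r \<odot>\<^bsub>Q\<^esub> \<pi> (act N (?e x) y)" .
  next
    fix r x y assume "r \<in> carrier R" "x \<in> carrier M" "y \<in> carrier N"
    then show "\<pi> (act N (?e x) (r \<odot>\<^bsub>N\<^esub> y)) = r \<odot>\<^bsub>Q\<^esub> \<pi> (act N (?e x) y)"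
      using ar(3)[OF e(1)] by blast
  qed
  then obtain h where h: "h \<in> mod_hom R (tensor_module R M N) Q"
    "\<And>x y. x \<in> carrier M \<Longrightarrow> y \<in> carrier N \<Longrightarrow> h (pure_tensor R M N x y) = \<pi> (act N (?e x) y)"
    by blast
  have "h (tensor_of_fs R M N v) = \<pi> v"
    by (rule fs_hom_eq[OF assms(2) Q(1) mod_hom_comp[OF tensor_of_fs_hom[OF assms(1,2)] h(1)] Q(2) _ v(1)])
      (simp add: tensor_of_fs_single[OF assms(1,2)] h(2) se[symmetric])
  then have "\<pi> v = \<zero>\<^bsub>Q\<^esub>" using v(2) mod_hom_zero_minus(1)[OF T Q(1) h(1)] by simp
  then show ?thesis using Q(3)[OF v(1)] unfolding H_def by blast
qed

text \<open>The three places of exactness come with three elements of \<open>S\<close>; their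
  product serves at all of them. This is the form required by
  \<open>S_exact_complexes\<close>.\<close>

lemma S_short_exactD:
  assumes "submonoid S R" "module R A" "module R B" "module R C" "f \<in> mod_hom R A B" "g \<in> mod_hom R B C"
    and "S_short_exact S A f B g C"
  obtains s where "s \<in> S"
    "\<And>c. c \<in> carrier C \<Longrightarrow> \<exists>b\<in>carrier B. g b = s \<odot>\<^bsub>C\<^esub> c"
    "\<And>b. b \<in> carrier B \<Longrightarrow> g b = \<zero>\<^bsub>C\<^esub> \<Longrightarrow> \<exists>a\<in>carrier A. f a = s \<odot>\<^bsub>B\<^esub> b"
    "\<And>a. a \<in> carrier A \<Longrightarrow> f a = \<zero>\<^bsub>B\<^esub> \<Longrightarrow> s \<odot>\<^bsub>A\<^esub> a = \<zero>\<^bsub>A\<^esub>"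
    "\<And>a. a \<in> carrier A \<Longrightarrow> s \<odot>\<^bsub>C\<^esub> g (f a) = \<zero>\<^bsub>C\<^esub>"
proof -
  interpret S: submonoid S R by fact
  interpret A: module R A by fact
  interpret B: module R B by fact
  interpret C: module R C by fact
  have ex: "S_exact_at S (zero_module :: ('a, unit) module) (\<lambda>_. \<zero>\<^bsub>A\<^esub>) A f B" "S_exact_at S A f B g C"
    "S_exact_at S B g C (\<lambda>_. ()) (zero_module :: ('a, unit) module)"
    using assms(7) by (simp_all add: S_short_exact_def)
  obtain s1 where s1: "s1 \<in> S" "(\<odot>\<^bsub>A\<^esub>) s1 ` a_kernel A B f \<subseteq> (\<lambda>_. \<zero>\<^bsub>A\<^esub>) ` carrier (zero_module :: ('a, unit) module)"
    using ex(1) unfolding S_exact_at_def by (elim bexE conjE)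
  have s1': "s1 \<odot>\<^bsub>A\<^esub> a = \<zero>\<^bsub>A\<^esub>" if "a \<in> carrier A" "f a = \<zero>\<^bsub>B\<^esub>" for a
  proof -
    have "a \<in> a_kernel A B f" using that by (simp add: a_kernel_def')
    with s1(2) show ?thesis by blast
  qed
  obtain s2 where s2: "s2 \<in> S" "(\<odot>\<^bsub>B\<^esub>) s2 ` a_kernel B C g \<subseteq> f ` carrier A"
    "(\<odot>\<^bsub>B\<^esub>) s2 ` f ` carrier A \<subseteq> a_kernel B C g"
    using ex(2) unfolding S_exact_at_def by (elim bexE conjE)
  have s2': "\<exists>a\<in>carrier A. f a = s2 \<odot>\<^bsub>B\<^esub> b" if "b \<in> carrier B" "g b = \<zero>\<^bsub>C\<^esub>" for b
  proof -
    have "b \<in> a_kernel B C g" using that by (simp add: a_kernel_def')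
    then have "s2 \<odot>\<^bsub>B\<^esub> b \<in> f ` carrier A" using s2(2) by blast
    then show ?thesis by (metis imageE)
  qed
  have s2'': "g (s2 \<odot>\<^bsub>B\<^esub> f a) = \<zero>\<^bsub>C\<^esub>" if "a \<in> carrier A" for a
  proof -
    have "s2 \<odot>\<^bsub>B\<^esub> f a \<in> a_kernel B C g" using that s2(3) by blast
    then show ?thesis by (simp add: a_kernel_def')
  qed
  obtain s3 where s3: "s3 \<in> S" "(\<odot>\<^bsub>C\<^esub>) s3 ` a_kernel C (zero_module :: ('a, unit) module) (\<lambda>_. ()) \<subseteq> g ` carrier B"
    using ex(3) unfolding S_exact_at_def by (elim bexE conjE)
  have s3': "\<exists>b\<in>carrier B. g b = s3 \<odot>\<^bsub>C\<^esub> c" if "c \<in> carrier C" for c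
  proof -
    have "c \<in> a_kernel C (zero_module :: ('a, unit) module) (\<lambda>_. ())" using that by (simp add: a_kernel_def')
    then have "s3 \<odot>\<^bsub>C\<^esub> c \<in> g ` carrier B" using s3(2) by blast
    then show ?thesis by (metis imageE)
  qed
  have c: "s1 \<in> carrier R" "s2 \<in> carrier R" "s3 \<in> carrier R" using s1(1) s2(1) s3(1) S.subset by auto
  note f = mod_homD[OF assms(5)] and g = mod_homD[OF assms(6)]
  show thesis
  proof
    show "s1 \<otimes>\<^bsub>R\<^esub> s2 \<otimes>\<^bsub>R\<^esub> s3 \<in> S" using s1(1) s2(1) s3(1) by simp
    show "\<exists>b\<in>carrier B. g b = (s1 \<otimes>\<^bsub>R\<^esub> s2 \<otimes>\<^bsub>R\<^esub> s3) \<odot>\<^bsub>C\<^esub> c'" if c': "c' \<in> carrier C" for c'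
    proof -
      obtain b where "b \<in> carrier B" "g b = s3 \<odot>\<^bsub>C\<^esub> c'" using s3'[OF c'] by (rule bexE)
      then show ?thesis using c c' by (intro bexI[of _ "(s1 \<otimes>\<^bsub>R\<^esub> s2) \<odot>\<^bsub>B\<^esub> b"]) (auto simp: g C.smult_assoc1)
    qed
    show "\<exists>a\<in>carrier A. f a = (s1 \<otimes>\<^bsub>R\<^esub> s2 \<otimes>\<^bsub>R\<^esub> s3) \<odot>\<^bsub>B\<^esub> b" if b: "b \<in> carrier B" "g b = \<zero>\<^bsub>C\<^esub>" for b
    proof -
      obtain a where "a \<in> carrier A" "f a = s2 \<odot>\<^bsub>B\<^esub> b" using s2'[OF b] by (rule bexE)
      then show ?thesis using c b
        by (intro bexI[of _ "(s1 \<otimes>\<^bsub>R\<^esub> s3) \<odot>\<^bsub>A\<^esub> a"]) (auto simp: f B.smult_assoc1[symmetric] A.m_ac)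
    qed
    show "(s1 \<otimes>\<^bsub>R\<^esub> s2 \<otimes>\<^bsub>R\<^esub> s3) \<odot>\<^bsub>A\<^esub> a = \<zero>\<^bsub>A\<^esub>" if a: "a \<in> carrier A" "f a = \<zero>\<^bsub>B\<^esub>" for a
    proof -
      have "(s1 \<otimes>\<^bsub>R\<^esub> s2 \<otimes>\<^bsub>R\<^esub> s3) \<odot>\<^bsub>A\<^esub> a = (s2 \<otimes>\<^bsub>R\<^esub> s3) \<odot>\<^bsub>A\<^esub> (s1 \<odot>\<^bsub>A\<^esub> a)"
        using a c by (simp add: A.smult_assoc1[symmetric] A.m_ac)
      then show ?thesis using s1'[OF a] c by simp
    qed
    show "(s1 \<otimes>\<^bsub>R\<^esub> s2 \<otimes>\<^bsub>R\<^esub> s3) \<odot>\<^bsub>C\<^esub> g (f a) = \<zero>\<^bsub>C\<^esub>" if a: "a \<in> carrier A" for a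
    proof -
      have "(s1 \<otimes>\<^bsub>R\<^esub> s2 \<otimes>\<^bsub>R\<^esub> s3) \<odot>\<^bsub>C\<^esub> g (f a) = (s1 \<otimes>\<^bsub>R\<^esub> s3) \<odot>\<^bsub>C\<^esub> g (s2 \<odot>\<^bsub>B\<^esub> f a)"
        using a c by (simp add: f g C.smult_assoc1[symmetric] A.m_ac)
      then show ?thesis using s2''[OF a] c by simp
    qed
  qed
qed

lemma S_short_exactI:
  assumes "module R A" "module R B" "module R C" "f \<in> mod_hom R A B" "g \<in> mod_hom R B C" "S \<subseteq> carrier R"
    and "s1 \<in> S" "\<And>c. c \<in> carrier C \<Longrightarrow> \<exists>b\<in>carrier B. g b = s1 \<odot>\<^bsub>C\<^esub> c"
    and "s2 \<in> S" "\<And>b. b \<in> carrier B \<Longrightarrow> g b = \<zero>\<^bsub>C\<^esub> \<Longrightarrow> \<exists>a\<in>carrier A. f a = s2 \<odot>\<^bsub>B\<^esub> b"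
    and "\<And>a. a \<in> carrier A \<Longrightarrow> s2 \<odot>\<^bsub>C\<^esub> g (f a) = \<zero>\<^bsub>C\<^esub>"
    and "s3 \<in> S" "\<And>a. a \<in> carrier A \<Longrightarrow> f a = \<zero>\<^bsub>B\<^esub> \<Longrightarrow> s3 \<odot>\<^bsub>A\<^esub> a = \<zero>\<^bsub>A\<^esub>"
  shows "S_short_exact S A f B g C"
proof -
  interpret A: module R A by fact
  interpret B: module R B by fact
  interpret C: module R C by fact
  note f = mod_homD[OF assms(4)] and g = mod_homD[OF assms(5)]
  have f0: "f \<zero>\<^bsub>A\<^esub> = \<zero>\<^bsub>B\<^esub>" by (rule mod_hom_zero_minus(1)[OF assms(1,2,4)])
  have c: "s1 \<in> carrier R" "s2 \<in> carrier R" "s3 \<in> carrier R" using assms(6,7,9,12) by auto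
  show ?thesis unfolding S_short_exact_def S_exact_at_def
  proof (intro conjI)
    show "\<exists>s\<in>S. (\<odot>\<^bsub>A\<^esub>) s ` a_kernel A B f \<subseteq> (\<lambda>_. \<zero>\<^bsub>A\<^esub>) ` carrier (zero_module :: ('a, unit) module) \<and>
        (\<odot>\<^bsub>A\<^esub>) s ` (\<lambda>_. \<zero>\<^bsub>A\<^esub>) ` carrier (zero_module :: ('a, unit) module) \<subseteq> a_kernel A B f"
      by (rule bexI[OF _ assms(12)]) (use assms(13) f0 c in \<open>auto simp: a_kernel_def' zero_module_def\<close>)
    show "\<exists>s\<in>S. (\<odot>\<^bsub>B\<^esub>) s ` a_kernel B C g \<subseteq> f ` carrier A \<and> (\<odot>\<^bsub>B\<^esub>) s ` f ` carrier A \<subseteq> a_kernel B C g"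
    proof (rule bexI[OF _ assms(9)], intro conjI)
      show "(\<odot>\<^bsub>B\<^esub>) s2 ` a_kernel B C g \<subseteq> f ` carrier A"
      proof
        fix y assume "y \<in> (\<odot>\<^bsub>B\<^esub>) s2 ` a_kernel B C g"
        then obtain b where "b \<in> carrier B" "g b = \<zero>\<^bsub>C\<^esub>" "y = s2 \<odot>\<^bsub>B\<^esub> b"
          unfolding a_kernel_def' by blast
        with assms(10)[of b] show "y \<in> f ` carrier A" by (metis image_eqI)
      qed
      show "(\<odot>\<^bsub>B\<^esub>) s2 ` f ` carrier A \<subseteq> a_kernel B C g"
        using assms(11) c f g by (auto simp: a_kernel_def')
    qed
    show "\<exists>s\<in>S. (\<odot>\<^bsub>C\<^esub>) s ` a_kernel C (zero_module :: ('a, unit) module) (\<lambda>_. ()) \<subseteq> g ` carrier B \<and>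
        (\<odot>\<^bsub>C\<^esub>) s ` g ` carrier B \<subseteq> a_kernel C (zero_module :: ('a, unit) module) (\<lambda>_. ())"
    proof (rule bexI[OF _ assms(7)], intro conjI)
      show "(\<odot>\<^bsub>C\<^esub>) s1 ` a_kernel C (zero_module :: ('a, unit) module) (\<lambda>_. ()) \<subseteq> g ` carrier B"
      proof
        fix y assume "y \<in> (\<odot>\<^bsub>C\<^esub>) s1 ` a_kernel C (zero_module :: ('a, unit) module) (\<lambda>_. ())"
        then obtain c where "c \<in> carrier C" "y = s1 \<odot>\<^bsub>C\<^esub> c"
          unfolding a_kernel_def' by blast
        with assms(8)[of c] show "y \<in> g ` carrier B" by (metis image_eqI)
      qed
      show "(\<odot>\<^bsub>C\<^esub>) s1 ` g ` carrier B \<subseteq> a_kernel C (zero_module :: ('a, unit) module) (\<lambda>_. ())"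
        using c g by (auto simp: a_kernel_def')
    qed
  qed
qed

text \<open>Flatness is applied to \<open>0 \<rightarrow> Im \<rightarrow> P1 \<rightarrow> P1 / Im
  \<rightarrow> 0\<close>, with \<open>Im\<close> the image of \<open>d\<close> from
  \<open>P2\<close> to \<open>P1\<close>. The resulting \<open>s\<close> kills the kernel of
  \<open>Im \<otimes> F \<rightarrow> P1 \<otimes> F\<close>. As \<open>Im \<otimes> F\<close> is
  the cokernel of the differential from degree 3 to degree 2 of \<open>Q \<otimes> F\<close>, this
  kernel is the homology in degree 2.\<close>

lemma tor_killed_of_S_flat:
  fixes F :: "('a, 'u) module"
  assumes "S_flat R S F" "submonoid S R" "infinite (UNIV :: 'u set)" "carrier R \<lesssim> (UNIV :: 'u set)"
  shows "tor_killed TYPE('u) R S F 1"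
  unfolding tor_killed_def homology_killed_def One_nat_def
proof (intro allI impI)
  fix I :: "nat \<Rightarrow> 'u set" and A
  assume res: "free_resolution R I A"
  have modF: "module R F" using assms(1) by (simp add: S_flat_def)
  interpret F: module R F by (rule modF)
  interpret S: submonoid S R by fact
  let ?R = "regular_module R" let ?P1 = "fs ?R (I (Suc 0))" let ?P2 = "fs ?R (I (Suc (Suc 0)))"
  note modR = module_regular_module[OF F.is_cring]
  note modP = module_fs[OF modR]
  interpret P2: module R ?P2 by (rule modP)
  note A = free_resolutionD[OF res]
  define d where "d = mx ?R (I (Suc 0)) (A (Suc 0))"
  have d: "d \<in> mod_hom R ?P2 ?P1" unfolding d_def by (rule free_resolution_hom[OF modR res])
  define Im where "Im = d ` carrier ?P2"
  define C0 where "C0 = quot_module ?P1 Im"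
  define \<rho> where "\<rho> = coset_map ?P1 Im"
  note C0 = quot_image[OF modP modP d, folded Im_def, folded C0_def \<rho>_def]
  have modIm: "module R (?P1\<lparr>carrier := Im\<rparr>)"
    using submodule_image[OF modP modP d] submodule.submodule_is_module[OF _ modP] unfolding Im_def by blast
  have P1_card: "carrier ?P1 \<lesssim> (UNIV :: 'u set)"
    by (rule fs_lepoll[OF assms(3)]) (auto simp: assms(4) subset_imp_lepoll)
  have Im_sub: "Im \<subseteq> carrier ?P1" unfolding Im_def using mod_homD(1)[OF d] by blast
  have "carrier (?P1\<lparr>carrier := Im\<rparr>) \<lesssim> (UNIV :: 'u set)"
    using P1_card Im_sub by (simp, meson lepoll_trans subset_imp_lepoll)
  \<comment> \<open>The modules \<open>A'\<close>, \<open>B'\<close> and \<open>C'\<close> are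
    copies of \<open>Im\<close>, \<open>P1\<close> and \<open>P1 / Im\<close> in the universe of
    \<open>S_flat\<close>.\<close>
  from transport[OF modIm this] obtain A' :: "('a, 'u) module" and hA kA
    where A': "module R A'" "hA \<in> mod_hom R (?P1\<lparr>carrier := Im\<rparr>) A'" "kA \<in> mod_hom R A' (?P1\<lparr>carrier := Im\<rparr>)"
      "\<And>x. x \<in> carrier (?P1\<lparr>carrier := Im\<rparr>) \<Longrightarrow> kA (hA x) = x" "\<And>y. y \<in> carrier A' \<Longrightarrow> hA (kA y) = y" by blast
  from transport[OF modP P1_card] obtain B' :: "('a, 'u) module" and hB kB
    where B': "module R B'" "hB \<in> mod_hom R ?P1 B'" "kB \<in> mod_hom R B' ?P1"
      "\<And>x. x \<in> carrier ?P1 \<Longrightarrow> kB (hB x) = x" "\<And>y. y \<in> carrier B' \<Longrightarrow> hB (kB y) = y" by blast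
  have "carrier C0 \<lesssim> (UNIV :: 'u set)"
    unfolding C0(4)[symmetric] using P1_card image_lepoll lepoll_trans by blast
  from transport[OF C0(1) this] obtain C' :: "('a, 'u) module" and hC kC
    where C': "module R C'" "hC \<in> mod_hom R C0 C'" "kC \<in> mod_hom R C' C0"
      "\<And>x. x \<in> carrier C0 \<Longrightarrow> kC (hC x) = x" "\<And>y. y \<in> carrier C' \<Longrightarrow> hC (kC y) = y" by blast
  have kA: "kA \<in> mod_hom R A' ?P1"
    using A'(3) Im_sub by (auto simp: mod_hom_def hom_def)
  have kA_Im: "kA a \<in> Im" if "a \<in> carrier A'" for a using mod_homD(1)[OF A'(3) that] by simp
  define f where "f a = hB (kA a)" for a
  define g where "g b = hC (\<rho> (kB b))" for b
  have f: "f \<in> mod_hom R A' B'" unfolding f_def by (rule mod_hom_comp[OF kA B'(2)])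
  have \<rho>k: "(\<lambda>b. \<rho> (kB b)) \<in> mod_hom R B' C0" by (rule mod_hom_comp[OF B'(3) C0(2)])
  have g: "g \<in> mod_hom R B' C'" unfolding g_def by (rule mod_hom_comp[OF \<rho>k C'(2)])
  note zero = mod_hom_zero_minus(1)
  have g0: "g b = \<zero>\<^bsub>C'\<^esub> \<longleftrightarrow> kB b \<in> Im" if "b \<in> carrier B'" for b
  proof -
    have "g b = \<zero>\<^bsub>C'\<^esub> \<longleftrightarrow> \<rho> (kB b) = \<zero>\<^bsub>C0\<^esub>"
      using zero[OF C0(1) C'(1,2)] zero[OF C'(1) C0(1) C'(3)] C'(4)[OF mod_homD(1)[OF \<rho>k that]]
      unfolding g_def by metis
    then show ?thesis using C0(3)[OF mod_homD(1)[OF B'(3) that]] by simp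
  qed
  have short: "S_short_exact S A' f B' g C'"
  proof (rule S_short_exactI[OF A'(1) B'(1) C'(1) f g S.subset S.one_closed _ S.one_closed _ _ S.one_closed])
    interpret A': module R A' by fact
    interpret B': module R B' by fact
    interpret C': module R C' by fact
    fix c assume c: "c \<in> carrier C'"
    then obtain p where p: "p \<in> carrier ?P1" "\<rho> p = kC c" using C0(4) mod_homD(1)[OF C'(3) c] by (metis imageE)
    then have "g (hB p) = c" using C'(5)[OF c] B'(4)[OF p(1)] by (simp add: g_def)
    then show "\<exists>b\<in>carrier B'. g b = \<one>\<^bsub>R\<^esub> \<odot>\<^bsub>C'\<^esub> c" using mod_homD(1)[OF B'(2) p(1)] c by auto
  next
    interpret B': module R B' by fact
    fix b assume b: "b \<in> carrier B'" "g b = \<zero>\<^bsub>C'\<^esub>"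
    then have Im: "kB b \<in> carrier (?P1\<lparr>carrier := Im\<rparr>)" using g0 by simp
    have "f (hA (kB b)) = b" unfolding f_def A'(4)[OF Im] by (rule B'(5)[OF b(1)])
    then show "\<exists>a\<in>carrier A'. f a = \<one>\<^bsub>R\<^esub> \<odot>\<^bsub>B'\<^esub> b" using mod_homD(1)[OF A'(2) Im] b by auto
  next
    interpret C': module R C' by fact
    fix a assume a: "a \<in> carrier A'"
    have "g (f a) = \<zero>\<^bsub>C'\<^esub>"
      using g0[OF mod_homD(1)[OF f a]] kA_Im[OF a] B'(4)[OF mod_homD(1)[OF kA a]] by (simp add: f_def)
    then show "\<one>\<^bsub>R\<^esub> \<odot>\<^bsub>C'\<^esub> g (f a) = \<zero>\<^bsub>C'\<^esub>" by simp
  next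
    interpret A': module R A' by fact
    fix a assume a: "a \<in> carrier A'" "f a = \<zero>\<^bsub>B'\<^esub>"
    then have "kB (f a) = \<zero>\<^bsub>?P1\<^esub>" using zero[OF B'(1) modP B'(3)] by simp
    then have "kA a = \<zero>\<^bsub>?P1\<lparr>carrier := Im\<rparr>\<^esub>" using B'(4)[OF mod_homD(1)[OF kA a(1)]] by (simp add: f_def)
    then have "a = \<zero>\<^bsub>A'\<^esub>" using A'(5)[OF a(1)] zero[OF modIm A'(1,2)] by simp
    then show "\<one>\<^bsub>R\<^esub> \<odot>\<^bsub>A'\<^esub> a = \<zero>\<^bsub>A'\<^esub>" by simp
  qed
  note TA = module_tensor_module[OF A'(1) modF] and TB = module_tensor_module[OF B'(1) modF]
    and TC = module_tensor_module[OF C'(1) modF]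
  note tf = tensor_map[OF A'(1) B'(1) modF f] and tg = tensor_map[OF B'(1) C'(1) modF g]
  have short_tensor: "S_short_exact S (tensor_module R A' F) (tensor_map R A' B' F f)
      (tensor_module R B' F) (tensor_map R B' C' F g) (tensor_module R C' F)"
    using assms(1) A'(1) B'(1) C'(1) f g short unfolding S_flat_def by simp
  obtain s where s: "s \<in> S" and inj: "\<And>X. X \<in> carrier (tensor_module R A' F) \<Longrightarrow>
      tensor_map R A' B' F f X = \<zero>\<^bsub>tensor_module R B' F\<^esub> \<Longrightarrow>
      s \<odot>\<^bsub>tensor_module R A' F\<^esub> X = \<zero>\<^bsub>tensor_module R A' F\<^esub>"
    by (rule S_short_exactD[OF assms(2) TA TB TC tf(1) tg(1) short_tensor]) (rule that)
  have sR: "s \<in> carrier R" using s S.subset by blast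
  let ?F1 = "fs F (I (Suc 0))" let ?F2 = "fs F (I (Suc (Suc 0)))" let ?F3 = "fs F (I (Suc (Suc (Suc 0))))"
  note modFs = module_fs[OF modF]
  have m1: "mx F (I (Suc 0)) (A (Suc 0)) \<in> mod_hom R ?F2 ?F1" by (rule free_resolution_hom[OF modF res])
  have m2: "mx F (I (Suc (Suc 0))) (A (Suc (Suc 0))) \<in> mod_hom R ?F3 ?F2" by (rule free_resolution_hom[OF modF res])
  have d_single: "d (single ?R j \<one>\<^bsub>R\<^esub>) = A (Suc 0) j" if j: "j \<in> I (Suc (Suc 0))" for j
  proof -
    have "d (single ?R j \<one>\<^bsub>R\<^esub>) = act ?R (A (Suc 0) j) \<one>\<^bsub>R\<^esub>"
      unfolding d_def by (rule mx_single[where A = "A (Suc 0)", OF modR A(1) j]) simp_all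
    also have "\<dots> = A (Suc 0) j" using fs_value[OF A(1)[OF j]] by (simp add: act_def)
    finally show ?thesis .
  qed
  have e2: "single ?R j \<one>\<^bsub>R\<^esub> \<in> carrier ?P2" if "j \<in> I (Suc (Suc 0))" for j
    by (rule single_closed[OF modR that]) simp
  have Aj: "A (Suc 0) j \<in> carrier (?P1\<lparr>carrier := Im\<rparr>)" if "j \<in> I (Suc (Suc 0))" for j
    using d_single[OF that] e2[OF that] unfolding Im_def by (metis imageI partial_object.select_convs(1) partial_object.surjective partial_object.update_convs(1))
  \<comment> \<open>\<open>\<tau>\<close> is the map
    \<open>P2 \<otimes> F \<rightarrow> Im \<otimes> F\<close> induced by \<open>d\<close>, and
    \<open>\<sigma>\<close> below is the canonical map
    \<open>P1 \<otimes> F \<rightarrow> B' \<otimes> F\<close>.\<close>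
  define \<tau> where "\<tau> = fs_lift F (tensor_module R A' F) (\<lambda>j. pure_tensor R A' F (hA (A (Suc 0) j)))"
  have hAj: "hA (A (Suc 0) j) \<in> carrier A'" if "j \<in> I (Suc (Suc 0))" for j
    using mod_homD(1)[OF A'(2) Aj[OF that]] .
  have \<tau>: "\<tau> \<in> mod_hom R ?F2 (tensor_module R A' F)"
    unfolding \<tau>_def by (rule fs_lift(1)[OF modF TA pure_tensor_hom_right[OF A'(1) modF hAj]])
  have \<tau>_single: "\<tau> (single F j y) = pure_tensor R A' F (hA (A (Suc 0) j)) y"
    if "j \<in> I (Suc (Suc 0))" "y \<in> carrier F" for j y
    unfolding \<tau>_def by (rule fs_lift(2)[OF modF TA pure_tensor_hom_right[OF A'(1) modF hAj] that])
  let ?e = "\<lambda>i. hB (single ?R i \<one>\<^bsub>R\<^esub>)"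
  have e1: "single ?R i \<one>\<^bsub>R\<^esub> \<in> carrier ?P1" if "i \<in> I (Suc 0)" for i
    by (rule single_closed[OF modR that]) simp
  have hBe: "?e i \<in> carrier B'" if "i \<in> I (Suc 0)" for i
    using mod_homD(1)[OF B'(2) e1[OF that]] .
  define \<sigma> where "\<sigma> = fs_lift F (tensor_module R B' F) (\<lambda>i. pure_tensor R B' F (?e i))"
  have \<sigma>: "\<sigma> \<in> mod_hom R ?F1 (tensor_module R B' F)"
    unfolding \<sigma>_def by (rule fs_lift(1)[OF modF TB pure_tensor_hom_right[OF B'(1) modF hBe]])
  have \<sigma>_single: "\<sigma> (single F i y) = pure_tensor R B' F (?e i) y"
    if "i \<in> I (Suc 0)" "y \<in> carrier F" for i y
    unfolding \<sigma>_def by (rule fs_lift(2)[OF modF TB pure_tensor_hom_right[OF B'(1) modF hBe] that])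
  have \<sigma>_act: "\<sigma> (act F p y) = pure_tensor R B' F (hB p) y" if p: "p \<in> carrier ?P1" and y: "y \<in> carrier F" for p y
  proof (rule fs_hom_eq[OF modR TB mod_hom_comp[OF act_hom_left[OF modF y] \<sigma>]
        mod_hom_comp[OF B'(2) pure_tensor_hom_left[OF B'(1) modF y]] _ p])
    fix i r assume i: "i \<in> I (Suc 0)" and "r \<in> carrier ?R"
    then have r: "r \<in> carrier R" by simp
    have "\<sigma> (act F (single ?R i r) y) = r \<odot>\<^bsub>tensor_module R B' F\<^esub> pure_tensor R B' F (?e i) y"
      using \<sigma>_single[OF i] r y hBe[OF i] pure_tensor_bilinear(4)[OF B'(1) modF] by (simp add: act_single[OF modF y])
    also have "\<dots> = pure_tensor R B' F (r \<odot>\<^bsub>B'\<^esub> ?e i) y"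
      using pure_tensor_bilinear(3)[OF B'(1) modF r hBe[OF i] y] by simp
    also have "r \<odot>\<^bsub>B'\<^esub> ?e i = hB (r \<odot>\<^bsub>?P1\<^esub> single ?R i \<one>\<^bsub>R\<^esub>)"
      using mod_homD(3)[OF B'(2) r e1[OF i]] by simp
    also have "r \<odot>\<^bsub>?P1\<^esub> single ?R i \<one>\<^bsub>R\<^esub> = single ?R i r" using r by (auto simp: single_def)
    finally show "\<sigma> (act F (single ?R i r) y) = pure_tensor R B' F (hB (single ?R i r)) y" .
  qed
  have f\<tau>: "tensor_map R A' B' F f (\<tau> z) = \<sigma> (mx F (I (Suc 0)) (A (Suc 0)) z)" if z: "z \<in> carrier ?F2" for z
  proof (rule fs_hom_eq[OF modF TB mod_hom_comp[OF \<tau> tf(1)] mod_hom_comp[OF m1 \<sigma>] _ z])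
    fix j y assume j: "j \<in> I (Suc (Suc 0))" and y: "y \<in> carrier F"
    show "tensor_map R A' B' F f (\<tau> (single F j y)) = \<sigma> (mx F (I (Suc 0)) (A (Suc 0)) (single F j y))"
      using mx_single[where A = "A (Suc 0)", OF modF A(1) j y]
      by (simp add: \<tau>_single[OF j y] tf(2)[OF hAj[OF j] y] f_def A'(4)[OF Aj[OF j]] \<sigma>_act[OF A(1)[OF j] y])
  qed
  define H where "H = mx F (I (Suc (Suc 0))) (A (Suc (Suc 0))) ` carrier ?F3"
  define Q where "Q = quot_module ?F2 H"
  define \<pi> where "\<pi> = coset_map ?F2 H"
  note Q = quot_image[OF modFs modFs m2, folded H_def, folded Q_def \<pi>_def]
  interpret Q: module R Q by (rule Q)
  \<comment> \<open>Exactness of the resolution in degree 2: elements with the same image under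
    \<open>d\<close> differ by a boundary, so \<open>p \<otimes> y\<close> modulo boundaries depends
    on \<open>d p\<close> alone.\<close>
  have act_eq: "\<pi> (act F p y) = \<pi> (act F q y)"
    if pq: "p \<in> carrier ?P2" "q \<in> carrier ?P2" "d p = d q" and y: "y \<in> carrier F" for p q y
  proof -
    have c: "p \<ominus>\<^bsub>?P2\<^esub> q \<in> carrier ?P2" using pq by simp
    have "d (p \<ominus>\<^bsub>?P2\<^esub> q) = (\<lambda>_. \<zero>\<^bsub>R\<^esub>)"
      using mod_hom_diff[OF modP modP d pq(1,2)] pq(3) diff_eq_zero_iff[OF modP] mod_homD(1)[OF d pq(2)] by auto
    from A(3)[OF c this[unfolded d_def]] obtain w where w: "w \<in> carrier (fs ?R (I (Suc (Suc (Suc 0)))))"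
      "mx ?R (I (Suc (Suc 0))) (A (Suc (Suc 0))) w = p \<ominus>\<^bsub>?P2\<^esub> q" by blast
    have "act F (p \<ominus>\<^bsub>?P2\<^esub> q) y = mx F (I (Suc (Suc 0))) (A (Suc (Suc 0))) (act F w y)"
      using mx_act[where A = "A (Suc (Suc 0))", OF modF y A(1) w(1)] w(2) by simp
    then have "\<pi> (act F (p \<ominus>\<^bsub>?P2\<^esub> q) y) = \<zero>\<^bsub>Q\<^esub>"
      using Q(3)[OF act_closed[OF modF c y]] act_closed[OF modF w(1) y] unfolding H_def by (metis imageI)
    with hom_eq_if_diff[OF modP Q(1) mod_hom_comp[OF act_hom_left[OF modF y] Q(2)] pq(1,2)]
    show ?thesis by blast
  qed
  \<comment> \<open>A chosen preimage under \<open>d\<close>, in general not linear in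
    \<open>a\<close>; by \<open>act_eq\<close> the class of \<open>lft a \<otimes> y\<close> is
    bilinear nevertheless.\<close>
  define lft where "lft a = (SOME p. p \<in> carrier ?P2 \<and> d p = kA a)" for a
  have lft: "lft a \<in> carrier ?P2" "d (lft a) = kA a" if "a \<in> carrier A'" for a
  proof -
    have "\<exists>p. p \<in> carrier ?P2 \<and> d p = kA a" using kA_Im[OF that] unfolding Im_def by (metis imageE)
    from someI_ex[OF this] show "lft a \<in> carrier ?P2" "d (lft a) = kA a" by (auto simp: lft_def)
  qed
  note al = mod_homD[OF mod_hom_comp[OF act_hom_left[OF modF] Q(2)]]
  note ar = mod_homD[OF mod_hom_comp[OF act_hom[OF modF] Q(2)]]
  have "\<exists>h\<in>mod_hom R (tensor_module R A' F) Q. \<forall>a\<in>carrier A'. \<forall>y\<in>carrier F. h (pure_tensor R A' F a y) = \<pi> (act F (lft a) y)"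
  proof (rule tensor_lift[OF A'(1) modF Q(1)])
    interpret A': module R A' by fact
    show "\<pi> (act F (lft a) y) \<in> carrier Q" if "a \<in> carrier A'" "y \<in> carrier F" for a y
      using al(1)[OF that(2) lft(1)[OF that(1)]] .
    show "\<pi> (act F (lft (a \<oplus>\<^bsub>A'\<^esub> a')) y) = \<pi> (act F (lft a) y) \<oplus>\<^bsub>Q\<^esub> \<pi> (act F (lft a') y)"
      if "a \<in> carrier A'" "a' \<in> carrier A'" "y \<in> carrier F" for a a' y
    proof -
      have "\<pi> (act F (lft (a \<oplus>\<^bsub>A'\<^esub> a')) y) = \<pi> (act F (lft a \<oplus>\<^bsub>?P2\<^esub> lft a') y)"
        using that lft mod_homD(2)[OF d] mod_homD(2)[OF kA] P2.M.a_closed A'.M.a_closed by (intro act_eq) metis+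
      also have "\<dots> = \<pi> (act F (lft a) y) \<oplus>\<^bsub>Q\<^esub> \<pi> (act F (lft a') y)"
        by (rule al(2)[OF that(3) lft(1)[OF that(1)] lft(1)[OF that(2)]])
      finally show ?thesis .
    qed
    show "\<pi> (act F (lft a) (y \<oplus>\<^bsub>F\<^esub> y')) = \<pi> (act F (lft a) y) \<oplus>\<^bsub>Q\<^esub> \<pi> (act F (lft a) y')"
      if "a \<in> carrier A'" "y \<in> carrier F" "y' \<in> carrier F" for a y y'
      by (rule ar(2)[OF lft(1)[OF that(1)] that(2,3)])
    show "\<pi> (act F (lft (r \<odot>\<^bsub>A'\<^esub> a)) y) = r \<odot>\<^bsub>Q\<^esub> \<pi> (act F (lft a) y)"
      if "r \<in> carrier R" "a \<in> carrier A'" "y \<in> carrier F" for r a y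
    proof -
      have "\<pi> (act F (lft (r \<odot>\<^bsub>A'\<^esub> a)) y) = \<pi> (act F (r \<odot>\<^bsub>?P2\<^esub> lft a) y)"
        using that lft mod_homD(3)[OF d] mod_homD(3)[OF kA] P2.smult_closed A'.smult_closed by (intro act_eq) metis+
      also have "\<dots> = r \<odot>\<^bsub>Q\<^esub> \<pi> (act F (lft a) y)"
        by (rule al(3)[OF that(3,1) lft(1)[OF that(2)]])
      finally show ?thesis .
    qed
    show "\<pi> (act F (lft a) (r \<odot>\<^bsub>F\<^esub> y)) = r \<odot>\<^bsub>Q\<^esub> \<pi> (act F (lft a) y)"
      if "r \<in> carrier R" "a \<in> carrier A'" "y \<in> carrier F" for r a y
      by (rule ar(3)[OF lft(1)[OF that(2)] that(1,3)])
  qed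
  then obtain h where h: "h \<in> mod_hom R (tensor_module R A' F) Q"
    "\<And>a y. a \<in> carrier A' \<Longrightarrow> y \<in> carrier F \<Longrightarrow> h (pure_tensor R A' F a y) = \<pi> (act F (lft a) y)" by blast
  \<comment> \<open>The map \<open>h\<close> undoes \<open>\<tau>\<close> modulo boundaries, so
    \<open>s \<tau> z = 0\<close> makes \<open>s z\<close> a boundary.\<close>
  have h\<tau>: "h (\<tau> z) = \<pi> z" if z: "z \<in> carrier ?F2" for z
  proof (rule fs_hom_eq[OF modF Q(1) mod_hom_comp[OF \<tau> h(1)] Q(2) _ z])
    fix j y assume j: "j \<in> I (Suc (Suc 0))" and y: "y \<in> carrier F"
    have "h (\<tau> (single F j y)) = \<pi> (act F (lft (hA (A (Suc 0) j))) y)"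
      by (simp add: \<tau>_single[OF j y] h(2)[OF hAj[OF j] y])
    also have "\<dots> = \<pi> (act F (single ?R j \<one>\<^bsub>R\<^esub>) y)"
      by (rule act_eq[OF lft(1)[OF hAj[OF j]] e2[OF j] _ y])
        (simp add: lft(2)[OF hAj[OF j]] A'(4)[OF Aj[OF j]] d_single[OF j])
    finally show "h (\<tau> (single F j y)) = \<pi> (single F j y)" using y by (simp add: act_single[OF modF])
  qed
  show "\<exists>s\<in>S. \<forall>z\<in>carrier ?F2. mx F (I (Suc 0)) (A (Suc 0)) z = \<zero>\<^bsub>?F1\<^esub> \<longrightarrow>
     (\<exists>w\<in>carrier ?F3. mx F (I (Suc (Suc 0))) (A (Suc (Suc 0))) w = s \<odot>\<^bsub>?F2\<^esub> z)"
  proof (intro bexI[OF _ s] ballI impI)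
    fix z assume z: "z \<in> carrier ?F2" "mx F (I (Suc 0)) (A (Suc 0)) z = \<zero>\<^bsub>?F1\<^esub>"
    have "tensor_map R A' B' F f (\<tau> z) = \<zero>\<^bsub>tensor_module R B' F\<^esub>"
      unfolding f\<tau>[OF z(1)] z(2) by (rule zero[OF modFs TB \<sigma>])
    then have "s \<odot>\<^bsub>tensor_module R A' F\<^esub> \<tau> z = \<zero>\<^bsub>tensor_module R A' F\<^esub>"
      by (rule inj[OF mod_homD(1)[OF \<tau> z(1)]])
    then have "h (\<tau> (s \<odot>\<^bsub>?F2\<^esub> z)) = \<zero>\<^bsub>Q\<^esub>"
      unfolding mod_homD(3)[OF \<tau> sR z(1)] using zero[OF TA Q(1) h(1)] by simp
    moreover have sz: "s \<odot>\<^bsub>?F2\<^esub> z \<in> carrier ?F2" by (rule module.smult_closed[OF modFs sR z(1)])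
    ultimately have "s \<odot>\<^bsub>?F2\<^esub> z \<in> H" using h\<tau>[OF sz] Q(3)[OF sz] by simp
    then show "\<exists>w\<in>carrier ?F3. mx F (I (Suc (Suc 0))) (A (Suc (Suc 0))) w = s \<odot>\<^bsub>?F2\<^esub> z"
      unfolding H_def by (metis imageE)
  qed
qed

text \<open>The classical inverse from \<open>C \<otimes> F\<close> to the cokernel sends
  \<open>c \<otimes> y\<close> to the class of \<open>b \<otimes> y\<close> with
  \<open>g b = c\<close>. Here only \<open>s c\<close> is known to have a preimage, and an element
  of the kernel of \<open>g\<close> comes from \<open>A\<close> only after multiplication by
  \<open>s\<close>; this accounts for the two factors.\<close>

lemma tensor_right_exact:
  assumes F: "module R F" and S: "submonoid S R" and mods: "module R A" "module R B" "module R C"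
    and f: "f \<in> mod_hom R A B" and g: "g \<in> mod_hom R B C" and s: "s \<in> S"
    and surj: "\<And>c. c \<in> carrier C \<Longrightarrow> \<exists>b\<in>carrier B. g b = s \<odot>\<^bsub>C\<^esub> c"
    and ex: "\<And>b. b \<in> carrier B \<Longrightarrow> g b = \<zero>\<^bsub>C\<^esub> \<Longrightarrow> \<exists>a\<in>carrier A. f a = s \<odot>\<^bsub>B\<^esub> b"
    and X: "X \<in> carrier (tensor_module R B F)" "tensor_map R B C F g X = \<zero>\<^bsub>tensor_module R C F\<^esub>"
  shows "\<exists>Y\<in>carrier (tensor_module R A F). tensor_map R A B F f Y = (s \<otimes>\<^bsub>R\<^esub> s) \<odot>\<^bsub>tensor_module R B F\<^esub> X"
proof -
  interpret S: submonoid S R by fact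
  interpret A: module R A by fact
  interpret B: module R B by fact
  interpret C: module R C by fact
  interpret F: module R F by fact
  let ?TA = "tensor_module R A F" let ?TB = "tensor_module R B F" let ?TC = "tensor_module R C F"
  note TA = module_tensor_module[OF mods(1) F] and TB = module_tensor_module[OF mods(2) F]
    and TC = module_tensor_module[OF mods(3) F]
  interpret TB: module R ?TB by (rule TB)
  note tf = tensor_map[OF mods(1,2) F f] and tg = tensor_map[OF mods(2,3) F g]
  have sR: "s \<in> carrier R" using s S.subset by blast
  define H where "H = tensor_map R A B F f ` carrier ?TA"
  define Q where "Q = quot_module ?TB H"
  define \<pi> where "\<pi> = coset_map ?TB H"
  note Q = quot_image[OF TA TB tf(1), folded H_def, folded Q_def \<pi>_def]
  interpret Q: module R Q by (rule Q)
  note \<pi> = mod_homD[OF Q(2)]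
  note pB = pure_tensor_closed[OF mods(2) F]
  note bil = pure_tensor_bilinear[OF mods(2) F]
  \<comment> \<open>The factor \<open>s\<close> makes \<open>\<phi> b y\<close> depend on
    \<open>g b\<close> alone.\<close>
  define \<phi> where "\<phi> b y = \<pi> (s \<odot>\<^bsub>?TB\<^esub> pure_tensor R B F b y)" for b y
  have hl: "(\<lambda>b. \<phi> b y) \<in> mod_hom R B Q" if "y \<in> carrier F" for y
    unfolding \<phi>_def
    by (rule mod_hom_comp[OF mod_hom_smult[OF TB pure_tensor_hom_left[OF mods(2) F that] sR] Q(2)])
  have hr: "\<phi> b \<in> mod_hom R F Q" if "b \<in> carrier B" for b
    unfolding \<phi>_def
    by (rule mod_hom_comp[OF mod_hom_smult[OF TB pure_tensor_hom_right[OF mods(2) F that] sR] Q(2)])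
  have \<phi>_eq: "\<phi> b y = \<phi> b' y" if b: "b \<in> carrier B" "b' \<in> carrier B" "g b = g b'" and y: "y \<in> carrier F" for b b' y
  proof -
    have c: "b \<ominus>\<^bsub>B\<^esub> b' \<in> carrier B" using b by simp
    have "g (b \<ominus>\<^bsub>B\<^esub> b') = \<zero>\<^bsub>C\<^esub>"
      using mod_hom_diff[OF mods(2,3) g b(1,2)] b(3) diff_eq_zero_iff[OF mods(3)] mod_homD(1)[OF g b(2)] by metis
    then obtain a where a: "a \<in> carrier A" "f a = s \<odot>\<^bsub>B\<^esub> (b \<ominus>\<^bsub>B\<^esub> b')" using ex[OF c] by blast
    have "s \<odot>\<^bsub>?TB\<^esub> pure_tensor R B F (b \<ominus>\<^bsub>B\<^esub> b') y = tensor_map R A B F f (pure_tensor R A F a y)"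
      using tf(2)[OF a(1) y] a(2) bil(3)[OF sR c y] by simp
    then have "s \<odot>\<^bsub>?TB\<^esub> pure_tensor R B F (b \<ominus>\<^bsub>B\<^esub> b') y \<in> H"
      unfolding H_def using pure_tensor_closed[OF mods(1) F a(1) y] by (metis imageI)
    then have "\<phi> (b \<ominus>\<^bsub>B\<^esub> b') y = \<zero>\<^bsub>Q\<^esub>"
      unfolding \<phi>_def using Q(3)[OF TB.smult_closed[OF sR pB[OF c y]]] by simp
    with hom_eq_if_diff[OF mods(2) Q(1) hl[OF y] b(1,2)] show ?thesis by blast
  qed
  define lft where "lft c = (SOME b. b \<in> carrier B \<and> g b = s \<odot>\<^bsub>C\<^esub> c)" for c
  have lft: "lft c \<in> carrier B" "g (lft c) = s \<odot>\<^bsub>C\<^esub> c" if "c \<in> carrier C" for c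
  proof -
    have "\<exists>b. b \<in> carrier B \<and> g b = s \<odot>\<^bsub>C\<^esub> c" using surj[OF that] by blast
    from someI_ex[OF this] show "lft c \<in> carrier B" "g (lft c) = s \<odot>\<^bsub>C\<^esub> c" by (auto simp: lft_def)
  qed
  note gB = mod_homD[OF g]
  have "\<exists>h\<in>mod_hom R ?TC Q. \<forall>c\<in>carrier C. \<forall>y\<in>carrier F. h (pure_tensor R C F c y) = \<phi> (lft c) y"
  proof (rule tensor_lift[OF mods(3) F Q(1)])
    show "\<phi> (lft c) y \<in> carrier Q" if "c \<in> carrier C" "y \<in> carrier F" for c y
      using mod_homD(1)[OF hr[OF lft(1)[OF that(1)]] that(2)] .
    show "\<phi> (lft (c \<oplus>\<^bsub>C\<^esub> c')) y = \<phi> (lft c) y \<oplus>\<^bsub>Q\<^esub> \<phi> (lft c') y"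
      if "c \<in> carrier C" "c' \<in> carrier C" "y \<in> carrier F" for c c' y
    proof -
      have "\<phi> (lft (c \<oplus>\<^bsub>C\<^esub> c')) y = \<phi> (lft c \<oplus>\<^bsub>B\<^esub> lft c') y"
        by (rule \<phi>_eq) (use that lft sR in \<open>simp_all add: gB C.smult_r_distr\<close>)
      also have "\<dots> = \<phi> (lft c) y \<oplus>\<^bsub>Q\<^esub> \<phi> (lft c') y"
        by (rule mod_homD(2)[OF hl[OF that(3)] lft(1)[OF that(1)] lft(1)[OF that(2)]])
      finally show ?thesis .
    qed
    show "\<phi> (lft c) (y \<oplus>\<^bsub>F\<^esub> y') = \<phi> (lft c) y \<oplus>\<^bsub>Q\<^esub> \<phi> (lft c) y'"
      if "c \<in> carrier C" "y \<in> carrier F" "y' \<in> carrier F" for c y y'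
      by (rule mod_homD(2)[OF hr[OF lft(1)[OF that(1)]] that(2,3)])
    show "\<phi> (lft (r \<odot>\<^bsub>C\<^esub> c)) y = r \<odot>\<^bsub>Q\<^esub> \<phi> (lft c) y"
      if "r \<in> carrier R" "c \<in> carrier C" "y \<in> carrier F" for r c y
    proof -
      have "\<phi> (lft (r \<odot>\<^bsub>C\<^esub> c)) y = \<phi> (r \<odot>\<^bsub>B\<^esub> lft c) y"
        by (rule \<phi>_eq) (use that lft sR in \<open>simp_all add: gB C.smult_assoc1[symmetric] A.m_comm\<close>)
      also have "\<dots> = r \<odot>\<^bsub>Q\<^esub> \<phi> (lft c) y"
        by (rule mod_homD(3)[OF hl[OF that(3)] that(1) lft(1)[OF that(2)]])
      finally show ?thesis .
    qed
    show "\<phi> (lft c) (r \<odot>\<^bsub>F\<^esub> y) = r \<odot>\<^bsub>Q\<^esub> \<phi> (lft c) y"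
      if "r \<in> carrier R" "c \<in> carrier C" "y \<in> carrier F" for r c y
      by (rule mod_homD(3)[OF hr[OF lft(1)[OF that(2)]] that(1,3)])
  qed
  then obtain h where h: "h \<in> mod_hom R ?TC Q"
    "\<And>c y. c \<in> carrier C \<Longrightarrow> y \<in> carrier F \<Longrightarrow> h (pure_tensor R C F c y) = \<phi> (lft c) y" by blast
  have ss: "(\<lambda>X. \<pi> ((s \<otimes>\<^bsub>R\<^esub> s) \<odot>\<^bsub>?TB\<^esub> X)) \<in> mod_hom R ?TB Q"
    by (rule mod_hom_comp[OF mod_hom_smult[OF TB _ A.m_closed[OF sR sR]] Q(2)]) (rule mod_homI, simp_all)
  have "h (tensor_map R B C F g X) = \<pi> ((s \<otimes>\<^bsub>R\<^esub> s) \<odot>\<^bsub>?TB\<^esub> X)"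
  proof (rule tensor_hom_eq[OF mods(2) F Q(1) mod_hom_comp[OF tg(1) h(1)] ss _ X(1)])
    fix b y assume b: "b \<in> carrier B" and y: "y \<in> carrier F"
    have gb: "g b \<in> carrier C" using b gB(1) by simp
    have "h (tensor_map R B C F g (pure_tensor R B F b y)) = \<phi> (lft (g b)) y"
      by (simp add: tg(2)[OF b y] h(2)[OF gb y])
    also have "\<dots> = \<phi> (s \<odot>\<^bsub>B\<^esub> b) y"
      by (rule \<phi>_eq) (use b y gb sR lft in \<open>simp_all add: gB\<close>)
    also have "\<dots> = \<pi> ((s \<otimes>\<^bsub>R\<^esub> s) \<odot>\<^bsub>?TB\<^esub> pure_tensor R B F b y)"
      unfolding \<phi>_def using b y sR pB[OF b y] by (simp add: bil(3) TB.smult_assoc1)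
    finally show "h (tensor_map R B C F g (pure_tensor R B F b y)) = \<pi> ((s \<otimes>\<^bsub>R\<^esub> s) \<odot>\<^bsub>?TB\<^esub> pure_tensor R B F b y)" .
  qed
  then have "\<pi> ((s \<otimes>\<^bsub>R\<^esub> s) \<odot>\<^bsub>?TB\<^esub> X) = \<zero>\<^bsub>Q\<^esub>"
    using X(2) mod_hom_zero_minus(1)[OF TC Q(1) h(1)] by simp
  moreover have "(s \<otimes>\<^bsub>R\<^esub> s) \<odot>\<^bsub>?TB\<^esub> X \<in> carrier ?TB" using X(1) sR by simp
  ultimately have "(s \<otimes>\<^bsub>R\<^esub> s) \<odot>\<^bsub>?TB\<^esub> X \<in> H" using Q(3) by simp
  then show ?thesis unfolding H_def by (rule image_bexD)
qed

text \<open>For injective \<open>f\<close> the kernel is a quotient of \<open>Tor\<close> of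
  \<open>B / f(A)\<close> and \<open>F\<close> in degree 1. A presentation of
  \<open>B / f(A)\<close> is therefore written down: generators are all elements of
  \<open>B\<close>, relations all formal sums with value in the image of \<open>f\<close>. Extended
  to a resolution, it provides \<open>s\<close>, and \<open>t\<close> compensates for the failure of
  injectivity.\<close>

lemma tensor_kernel_killed:
  fixes F :: "('a, 'b, 'n) module_scheme" and B :: "('a, 'u, 'k) module_scheme"
  assumes F: "module R F" and S: "submonoid S R" and inf: "infinite (UNIV :: 'u set)" "carrier R \<lesssim> (UNIV :: 'u set)"
    and tor: "tor_killed TYPE('u) R S F 1"
    and mods: "module R A" "module R B" and f: "f \<in> mod_hom R A B" and t: "t \<in> S"
    and inj: "\<And>a. a \<in> carrier A \<Longrightarrow> f a = \<zero>\<^bsub>B\<^esub> \<Longrightarrow> t \<odot>\<^bsub>A\<^esub> a = \<zero>\<^bsub>A\<^esub>"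
  shows "\<exists>s\<in>S. \<forall>X\<in>carrier (tensor_module R A F).
    tensor_map R A B F f X = \<zero>\<^bsub>tensor_module R B F\<^esub> \<longrightarrow> s \<odot>\<^bsub>tensor_module R A F\<^esub> X = \<zero>\<^bsub>tensor_module R A F\<^esub>"
proof -
  interpret S: submonoid S R by fact
  interpret A: module R A by fact
  interpret B: module R B by fact
  interpret F: module R F by fact
  let ?TA = "tensor_module R A F" let ?TB = "tensor_module R B F"
  note TA = module_tensor_module[OF mods(1) F] and TB = module_tensor_module[OF mods(2) F]
  interpret TA: module R ?TA by (rule TA)
  note tf = tensor_map[OF mods F f]
  have tR: "t \<in> carrier R" using t S.subset by blast
  let ?R = "regular_module R" let ?P = "fs ?R (carrier B)"
  note modR = module_regular_module[OF A.is_cring]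
  note modP = module_fs[OF modR]
  let ?ev = "free_eval R B"
  note ev = free_eval[OF mods(2)]
  \<comment> \<open>\<open>K\<close> consists of the relations for \<open>B / f(A)\<close>, and its
    subset \<open>L\<close> of the relations for \<open>B\<close> itself.\<close>
  define K where "K = {p\<in>carrier ?P. \<exists>a\<in>carrier A. f a = ?ev p}"
  define L where "L = {p\<in>carrier ?P. ?ev p = \<zero>\<^bsub>B\<^esub>}"
  have f0: "f \<zero>\<^bsub>A\<^esub> = \<zero>\<^bsub>B\<^esub>" by (rule mod_hom_zero_minus(1)[OF mods f])
  have LK: "L \<subseteq> K" using f0 A.M.zero_closed by (auto simp: L_def K_def)
  have "carrier (fs ?R (UNIV :: 'u set)) \<lesssim> (UNIV :: 'u set)"
    by (rule fs_lepoll[OF inf(1)]) (auto simp: inf(2))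
  then obtain enc :: "('u \<Rightarrow> 'a) \<Rightarrow> 'u" where enc: "inj_on enc (carrier (fs ?R UNIV))"
    by (auto simp: lepoll_def)
  define D where "D = inv_into (carrier (fs ?R UNIV)) enc"
  have D_enc: "D (enc p) = p" if "p \<in> carrier ?P" for p
    using enc fs_mono[OF subset_UNIV that] by (simp add: D_def)
  have D: "D j \<in> carrier ?P" "D j \<in> K" if "j \<in> enc ` K" for j
    using that D_enc by (auto simp: K_def)
  obtain I M where res: "free_resolution R I M" and I: "I (Suc 0) = carrier B" "I (Suc (Suc 0)) = enc ` K" "M (Suc 0) = D"
    by (rule ex_free_resolution[OF A.is_cring inf, of "enc ` K" D "carrier B"]) (use D in blast)+
  obtain s where s: "s \<in> S" and tor_s: "\<And>z. z \<in> carrier (fs F (enc ` K)) \<Longrightarrow> mx F (carrier B) D z = \<zero>\<^bsub>fs F (carrier B)\<^esub> \<Longrightarrow>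
      \<exists>w\<in>carrier (fs F (I (Suc (Suc (Suc 0))))). mx F (enc ` K) (M (Suc (Suc 0))) w = s \<odot>\<^bsub>fs F (enc ` K)\<^esub> z"
  proof -
    have "homology_killed S (\<lambda>k. fs F (I k)) (\<lambda>k. mx F (I k) (M k)) 1"
      using tor res unfolding tor_killed_def by blast
    then show thesis unfolding homology_killed_def One_nat_def I
      by (elim bexE) (rule that, assumption, blast)
  qed
  have sR: "s \<in> carrier R" using s S.subset by blast
  \<comment> \<open>A preimage in \<open>A\<close> of the value of \<open>p\<close>. It is linear
    only modulo the kernel of \<open>f\<close>, which \<open>t\<close> kills; this is why the
    identities below hold after multiplication by \<open>t\<close>.\<close>
  define \<alpha> where "\<alpha> p = (SOME a. a \<in> carrier A \<and> f a = ?ev p)" for p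
  have \<alpha>: "\<alpha> p \<in> carrier A" "f (\<alpha> p) = ?ev p" if "p \<in> K" for p
  proof -
    have "\<exists>a. a \<in> carrier A \<and> f a = ?ev p" using that by (auto simp: K_def)
    from someI_ex[OF this] show "\<alpha> p \<in> carrier A" "f (\<alpha> p) = ?ev p" by (auto simp: \<alpha>_def)
  qed
  have \<alpha>D: "\<alpha> (D j) \<in> carrier A" if "j \<in> enc ` K" for j using \<alpha>(1)[OF D(2)[OF that]] .
  let ?F2 = "fs F (enc ` K)" let ?F3 = "fs F (I (Suc (Suc (Suc 0))))" let ?P2 = "fs ?R (enc ` K)"
  note modFs = module_fs[OF F]
  \<comment> \<open>\<open>\<Psi>\<close> sends \<open>e_j \<otimes> y\<close> to
    \<open>\<alpha> (D j) \<otimes> y\<close>; it starts in degree 2 of the resolution tensored with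
    \<open>F\<close>. The map \<open>\<chi>\<close> below is the same before tensoring.\<close>
  define \<Psi> where "\<Psi> = fs_lift F ?TA (\<lambda>j. pure_tensor R A F (\<alpha> (D j)))"
  have \<Psi>: "\<Psi> \<in> mod_hom R ?F2 ?TA"
    unfolding \<Psi>_def by (rule fs_lift(1)[OF F TA pure_tensor_hom_right[OF mods(1) F \<alpha>D]])
  have \<Psi>_single: "\<Psi> (single F j y) = pure_tensor R A F (\<alpha> (D j)) y" if "j \<in> enc ` K" "y \<in> carrier F" for j y
    unfolding \<Psi>_def by (rule fs_lift(2)[OF F TA pure_tensor_hom_right[OF mods(1) F \<alpha>D] that])
  define \<chi> where "\<chi> = fs_lift ?R A (\<lambda>j r. r \<odot>\<^bsub>A\<^esub> \<alpha> (D j))"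
  have \<chi>: "\<chi> \<in> mod_hom R ?P2 A"
    unfolding \<chi>_def by (rule fs_lift(1)[OF modR mods(1) smult_hom[OF mods(1) \<alpha>D]])
  have \<chi>_single: "\<chi> (single ?R j r) = r \<odot>\<^bsub>A\<^esub> \<alpha> (D j)" if "j \<in> enc ` K" "r \<in> carrier R" for j r
    unfolding \<chi>_def by (rule fs_lift(2)[OF modR mods(1) smult_hom[OF mods(1) \<alpha>D] that(1)]) (use that(2) in simp_all)
  have \<Psi>_act: "\<Psi> (act F q y) = pure_tensor R A F (\<chi> q) y" if q: "q \<in> carrier ?P2" and y: "y \<in> carrier F" for q y
  proof (rule fs_hom_eq[OF modR TA mod_hom_comp[OF act_hom_left[OF F y] \<Psi>]
        mod_hom_comp[OF \<chi> pure_tensor_hom_left[OF mods(1) F y]] _ q])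
    fix j r assume j: "j \<in> enc ` K" and "r \<in> carrier ?R"
    then have r: "r \<in> carrier R" by simp
    show "\<Psi> (act F (single ?R j r) y) = pure_tensor R A F (\<chi> (single ?R j r)) y"
      using \<Psi>_single[OF j] r y \<alpha>D[OF j] pure_tensor_bilinear(3,4)[OF mods(1) F]
      by (simp add: act_single[OF F y] \<chi>_single[OF j r])
  qed
  have mxD: "mx F (carrier B) D \<in> mod_hom R ?F2 (fs F (carrier B))" by (rule mx_hom[OF F D(1)])
  have mxRD: "mx ?R (carrier B) D \<in> mod_hom R ?P2 ?P" by (rule mx_hom[OF modR D(1)])
  have f\<chi>: "f (\<chi> q) = ?ev (mx ?R (carrier B) D q)" if q: "q \<in> carrier ?P2" for q
  proof (rule fs_hom_eq[OF modR mods(2) mod_hom_comp[OF \<chi> f] mod_hom_comp[OF mxRD ev(1)] _ q])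
    fix j r assume j: "j \<in> enc ` K" and "r \<in> carrier ?R"
    then have r: "r \<in> carrier R" by simp
    have Dj: "D j i \<in> carrier R" for i using fs_value[OF D(1)[OF j]] by simp
    have "act ?R (D j) r = r \<odot>\<^bsub>?P\<^esub> D j"
      using r Dj by (simp add: act_def A.m_comm)
    moreover have "mx ?R (carrier B) D (single ?R j r) = act ?R (D j) r"
      by (rule mx_single[OF modR D(1) j]) (use r in simp_all)
    ultimately show "f (\<chi> (single ?R j r)) = ?ev (mx ?R (carrier B) D (single ?R j r))"
      using r mod_homD(3)[OF f r \<alpha>D[OF j]] mod_homD(3)[OF ev(1) r D(1)[OF j]] \<alpha>(2)[OF D(2)[OF j]]
      by (simp only: \<chi>_single[OF j r])
  qed
  \<comment> \<open>Boundaries from degree 3 are killed: a column \<open>q\<close> of the next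
    matrix is a relation among the relations, so \<open>f (\<chi> q) = 0\<close>.\<close>
  have kill1: "t \<odot>\<^bsub>?TA\<^esub> \<Psi> (mx F (enc ` K) (M (Suc (Suc 0))) w) = \<zero>\<^bsub>?TA\<^esub>" if w: "w \<in> carrier ?F3" for w
  proof (rule fs_hom_eq[OF F TA _ mod_hom_zero[OF TA] _ w])
    have m: "mx F (enc ` K) (M (Suc (Suc 0))) \<in> mod_hom R ?F3 ?F2"
      using free_resolution_hom[OF F res, of "Suc (Suc 0)"] by (simp only: I)
    show "(\<lambda>w. t \<odot>\<^bsub>?TA\<^esub> \<Psi> (mx F (enc ` K) (M (Suc (Suc 0))) w)) \<in> mod_hom R ?F3 ?TA"
      by (rule mod_hom_smult[OF TA mod_hom_comp[OF m \<Psi>] tR])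
    fix j y assume j: "j \<in> I (Suc (Suc (Suc 0)))" and y: "y \<in> carrier F"
    let ?q = "M (Suc (Suc 0)) j"
    have Mq: "M (Suc (Suc 0)) i \<in> carrier ?P2" if "i \<in> I (Suc (Suc (Suc 0)))" for i
      using free_resolutionD(1)[OF res that] by (simp only: I)
    have q: "?q \<in> carrier ?P2" by (rule Mq[OF j])
    have "mx ?R (carrier B) D ?q = \<zero>\<^bsub>?P\<^esub>" using free_resolutionD(2)[OF res j] by (simp add: I)
    then have "f (\<chi> ?q) = \<zero>\<^bsub>B\<^esub>" using f\<chi>[OF q] mod_hom_zero_minus(1)[OF modP mods(2) ev(1)] by simp
    then have t\<chi>: "t \<odot>\<^bsub>A\<^esub> \<chi> ?q = \<zero>\<^bsub>A\<^esub>" by (rule inj[OF mod_homD(1)[OF \<chi> q]])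
    have "t \<odot>\<^bsub>?TA\<^esub> \<Psi> (act F ?q y) = pure_tensor R A F (t \<odot>\<^bsub>A\<^esub> \<chi> ?q) y"
      unfolding \<Psi>_act[OF q y] by (rule pure_tensor_bilinear(3)[OF mods(1) F tR mod_homD(1)[OF \<chi> q] y, symmetric])
    also have "\<dots> = \<zero>\<^bsub>?TA\<^esub>"
      unfolding t\<chi> by (rule mod_hom_zero_minus(1)[OF mods(1) TA pure_tensor_hom_left[OF mods(1) F y]])
    finally show "t \<odot>\<^bsub>?TA\<^esub> \<Psi> (mx F (enc ` K) (M (Suc (Suc 0))) (single F j y)) = \<zero>\<^bsub>?TA\<^esub>"
      using mx_single[OF F Mq j y] by simp
  qed
  \<comment> \<open>A relation \<open>p\<close> of \<open>B\<close> has value zero, so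
    \<open>\<alpha> p\<close> lies in the kernel of \<open>f\<close>.\<close>
  have kill2: "t \<odot>\<^bsub>?TA\<^esub> \<Psi> l = \<zero>\<^bsub>?TA\<^esub>" if l: "l \<in> carrier (fs F (enc ` L))" for l
  proof (rule fs_hom_eq[OF F TA _ mod_hom_zero[OF TA] _ l])
    have "\<Psi> \<in> mod_hom R (fs F (enc ` L)) ?TA"
      unfolding \<Psi>_def
      by (rule fs_lift(1)[OF F TA], rule pure_tensor_hom_right[OF mods(1) F \<alpha>D]) (use LK in blast)
    then show "(\<lambda>l. t \<odot>\<^bsub>?TA\<^esub> \<Psi> l) \<in> mod_hom R (fs F (enc ` L)) ?TA"
      by (rule mod_hom_smult[OF TA _ tR])
    fix j y assume "j \<in> enc ` L" and y: "y \<in> carrier F"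
    then obtain p where p: "p \<in> L" "j = enc p" by blast
    then have pK: "p \<in> K" "p \<in> carrier ?P" using LK by (auto simp: K_def)
    have Dj: "D j = p" using D_enc[OF pK(2)] p(2) by simp
    have jK: "j \<in> enc ` K" using pK p by blast
    have "f (\<alpha> p) = \<zero>\<^bsub>B\<^esub>" using \<alpha>(2)[OF pK(1)] p(1) by (simp add: L_def)
    then have t\<alpha>: "t \<odot>\<^bsub>A\<^esub> \<alpha> p = \<zero>\<^bsub>A\<^esub>" by (rule inj[OF \<alpha>(1)[OF pK(1)]])
    have "t \<odot>\<^bsub>?TA\<^esub> \<Psi> (single F j y) = pure_tensor R A F (t \<odot>\<^bsub>A\<^esub> \<alpha> p) y"
      unfolding \<Psi>_single[OF jK y] Dj by (rule pure_tensor_bilinear(3)[OF mods(1) F tR \<alpha>(1)[OF pK(1)] y, symmetric])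
    also have "\<dots> = \<zero>\<^bsub>?TA\<^esub>"
      unfolding t\<alpha> by (rule mod_hom_zero_minus(1)[OF mods(1) TA pure_tensor_hom_left[OF mods(1) F y]])
    finally show "t \<odot>\<^bsub>?TA\<^esub> \<Psi> (single F j y) = \<zero>\<^bsub>?TA\<^esub>" .
  qed
  let ?e = "\<lambda>b. single ?R b \<one>\<^bsub>R\<^esub>"
  have e: "?e b \<in> carrier ?P" "?ev (?e b) = b" if "b \<in> carrier B" for b
    using single_closed[OF modR that] ev(2)[OF that] that by auto
  have eK: "?e (f a) \<in> K" if "a \<in> carrier A" for a
    using e[OF mod_homD(1)[OF f that]] that by (auto simp: K_def)
  \<comment> \<open>The element \<open>a\<close> is sent to the relation \<open>e_(f a)\<close>,
    whose value \<open>f a\<close> lies in the image of \<open>f\<close>. In this way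
    \<open>\<Psi>\<close> after \<open>\<epsilon>\<close> agrees with the canonical map to
    \<open>A \<otimes> F\<close> up to \<open>t\<close>.\<close>
  define \<epsilon> where "\<epsilon> = fs_lift F ?F2 (\<lambda>a. single F (enc (?e (f a))))"
  have eh: "single F (enc (?e (f a))) \<in> mod_hom R F ?F2" if "a \<in> carrier A" for a
    by (rule single_hom[OF F imageI[OF eK[OF that]]])
  have \<epsilon>: "\<epsilon> \<in> mod_hom R (fs F (carrier A)) ?F2"
    unfolding \<epsilon>_def by (rule fs_lift(1)[OF F modFs eh])
  have \<epsilon>_single: "\<epsilon> (single F a y) = single F (enc (?e (f a))) y" if "a \<in> carrier A" "y \<in> carrier F" for a y
    unfolding \<epsilon>_def by (rule fs_lift(2)[OF F modFs eh that])
  let ?UA = "tensor_of_fs R A F" let ?UB = "tensor_of_fs R B F"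
  note UA = tensor_of_fs[OF mods(1) F] and UB = tensor_of_fs[OF mods(2) F]
  have t\<Psi>\<epsilon>: "t \<odot>\<^bsub>?TA\<^esub> \<Psi> (\<epsilon> x) = t \<odot>\<^bsub>?TA\<^esub> ?UA x" if x: "x \<in> carrier (fs F (carrier A))" for x
  proof (rule fs_hom_eq[OF F TA mod_hom_smult[OF TA mod_hom_comp[OF \<epsilon> \<Psi>] tR] mod_hom_smult[OF TA UA(1) tR] _ x])
    fix a y assume a: "a \<in> carrier A" and y: "y \<in> carrier F"
    let ?p = "?e (f a)"
    have p: "?p \<in> K" "D (enc ?p) = ?p" using eK[OF a] D_enc e mod_homD(1)[OF f a] by auto
    have \<alpha>p: "\<alpha> ?p \<in> carrier A" "f (\<alpha> ?p) = f a" using \<alpha>[OF p(1)] e(2) mod_homD(1)[OF f a] by auto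
    have "f (\<alpha> ?p \<ominus>\<^bsub>A\<^esub> a) = \<zero>\<^bsub>B\<^esub>"
      using mod_hom_diff[OF mods f \<alpha>p(1) a] \<alpha>p(2) diff_eq_zero_iff[OF mods(2)] mod_homD(1)[OF f a] by metis
    then have "t \<odot>\<^bsub>A\<^esub> (\<alpha> ?p \<ominus>\<^bsub>A\<^esub> a) = \<zero>\<^bsub>A\<^esub>" using inj \<alpha>p(1) a by simp
    moreover have "(\<lambda>x. t \<odot>\<^bsub>A\<^esub> x) \<in> mod_hom R A A"
      by (rule mod_hom_smult[OF mods(1) _ tR]) (rule mod_homI, simp_all)
    ultimately have t\<alpha>: "t \<odot>\<^bsub>A\<^esub> \<alpha> ?p = t \<odot>\<^bsub>A\<^esub> a"
      using hom_eq_if_diff[OF mods(1) mods(1) _ \<alpha>p(1) a] by blast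
    have "t \<odot>\<^bsub>?TA\<^esub> \<Psi> (\<epsilon> (single F a y)) = t \<odot>\<^bsub>?TA\<^esub> pure_tensor R A F (\<alpha> ?p) y"
      using \<Psi>_single[OF imageI[OF p(1)] y] p(2) by (simp add: \<epsilon>_single[OF a y])
    also have "\<dots> = t \<odot>\<^bsub>?TA\<^esub> pure_tensor R A F a y"
      using pure_tensor_bilinear(3)[OF mods(1) F tR \<alpha>p(1) y] pure_tensor_bilinear(3)[OF mods(1) F tR a y] t\<alpha> by simp
    finally show "t \<odot>\<^bsub>?TA\<^esub> \<Psi> (\<epsilon> (single F a y)) = t \<odot>\<^bsub>?TA\<^esub> ?UA (single F a y)"
      by (simp add: UA(2)[OF a y])
  qed
  have U\<epsilon>: "?UB (mx F (carrier B) D (\<epsilon> x)) = tensor_map R A B F f (?UA x)" if x: "x \<in> carrier (fs F (carrier A))" for x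
  proof (rule fs_hom_eq[OF F TB mod_hom_comp[OF mod_hom_comp[OF \<epsilon> mxD] UB(1)] mod_hom_comp[OF UA(1) tf(1)] _ x])
    fix a y assume a: "a \<in> carrier A" and y: "y \<in> carrier F"
    have fa: "f a \<in> carrier B" using mod_homD(1)[OF f a] .
    have "mx F (carrier B) D (single F (enc (?e (f a))) y) = act F (D (enc (?e (f a)))) y"
      by (rule mx_single[OF F D(1) imageI[OF eK[OF a]] y])
    also have "\<dots> = single F (f a) y"
      using y by (simp add: D_enc[OF e(1)[OF fa]] act_single[OF F y])
    finally show "?UB (mx F (carrier B) D (\<epsilon> (single F a y))) = tensor_map R A B F f (?UA (single F a y))"
      by (simp add: \<epsilon>_single[OF a y] UB(2)[OF fa y] UA(2)[OF a y] tf(2)[OF a y])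
  qed
  have "(s \<otimes>\<^bsub>R\<^esub> t) \<odot>\<^bsub>?TA\<^esub> X = \<zero>\<^bsub>?TA\<^esub>"
    if X: "X \<in> carrier ?TA" "tensor_map R A B F f X = \<zero>\<^bsub>?TB\<^esub>" for X
  proof -
    obtain x where x: "x \<in> carrier (fs F (carrier A))" "X = ?UA x"
      using tensor_of_fs_surj[OF mods(1) F X(1)] by blast
    have c: "mx F (carrier B) D (\<epsilon> x) \<in> carrier (fs F (carrier B))" "\<epsilon> x \<in> carrier ?F2"
      using mod_homD(1)[OF mxD] mod_homD(1)[OF \<epsilon> x(1)] by auto
    \<comment> \<open>The element \<open>\<epsilon> x\<close> need not be a cycle, since its image
      vanishes only in \<open>B \<otimes> F\<close>. By right exactness it differs from a cycle by
      some \<open>l\<close> supported on the relations of \<open>B\<close>, which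
      \<open>kill2\<close> discards.\<close>
    have "\<exists>l\<in>carrier (fs F (enc ` L)). mx F (carrier B) D l = mx F (carrier B) D (\<epsilon> x)"
    proof (rule tensor_of_fs_kernel[OF mods(2) F _ _ c(1)])
      show "D j \<in> carrier ?P" if "j \<in> enc ` L" for j using that D(1) LK by blast
      show "\<exists>j\<in>enc ` L. D j = p" if "p \<in> carrier ?P" "?ev p = \<zero>\<^bsub>B\<^esub>" for p
        using that D_enc[OF that(1)] by (intro bexI[of _ "enc p"]) (auto simp: L_def)
      show "?UB (mx F (carrier B) D (\<epsilon> x)) = \<zero>\<^bsub>?TB\<^esub>" using U\<epsilon>[OF x(1)] X x(2) by simp
    qed
    then obtain l where l: "l \<in> carrier (fs F (enc ` L))" "mx F (carrier B) D l = mx F (carrier B) D (\<epsilon> x)" by blast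
    have l2: "l \<in> carrier ?F2" by (rule fs_mono[OF image_mono[OF LK] l(1)])
    interpret F2: module R ?F2 by (rule modFs)
    let ?z = "\<epsilon> x \<ominus>\<^bsub>?F2\<^esub> l"
    have z: "?z \<in> carrier ?F2" using c l2 by simp
    have "mx F (carrier B) D ?z = \<zero>\<^bsub>fs F (carrier B)\<^esub>"
      using mod_hom_diff[OF modFs modFs mxD c(2) l2] l(2) diff_eq_zero_iff[OF modFs c(1) c(1)] by simp
    then obtain w where w: "w \<in> carrier ?F3" "mx F (enc ` K) (M (Suc (Suc 0))) w = s \<odot>\<^bsub>?F2\<^esub> ?z"
      using tor_s[OF z] by blast
    note t\<Psi> = mod_hom_smult[OF TA \<Psi> tR]
    have "s \<odot>\<^bsub>?TA\<^esub> (t \<odot>\<^bsub>?TA\<^esub> \<Psi> ?z) = \<zero>\<^bsub>?TA\<^esub>"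
      using kill1[OF w(1)] mod_homD(3)[OF t\<Psi> sR z] unfolding w(2) by simp
    moreover have "t \<odot>\<^bsub>?TA\<^esub> \<Psi> ?z = t \<odot>\<^bsub>?TA\<^esub> X"
      using mod_hom_diff[OF modFs TA t\<Psi> c(2) l2] t\<Psi>\<epsilon>[OF x(1)] kill2[OF l(1)] x(2) X(1) tR
      by (simp add: a_minus_def)
    ultimately show ?thesis using X(1) sR tR by (simp add: TA.smult_assoc1)
  qed
  then show ?thesis using s t by (intro bexI[of _ "s \<otimes>\<^bsub>R\<^esub> t"]) auto
qed

lemma S_flat_of_tor_killed:
  fixes F :: "('a, 'u) module"
  assumes F: "module R F" and S: "submonoid S R" and inf: "infinite (UNIV :: 'u set)" "carrier R \<lesssim> (UNIV :: 'u set)"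
    and tor: "tor_killed TYPE('u) R S F 1"
  shows "S_flat R S F"
  unfolding S_flat_def
proof (intro conjI allI impI, fact F)
  fix A B C :: "('a, 'u) module" and f g
  assume mods: "module R A" "module R B" "module R C" and f: "f \<in> mod_hom R A B" and g: "g \<in> mod_hom R B C"
    and short: "S_short_exact S A f B g C"
  interpret S: submonoid S R by fact
  interpret A: module R A by fact
  interpret C: module R C by fact
  let ?TA = "tensor_module R A F" let ?TB = "tensor_module R B F" let ?TC = "tensor_module R C F"
  note TA = module_tensor_module[OF mods(1) F] and TB = module_tensor_module[OF mods(2) F]
    and TC = module_tensor_module[OF mods(3) F]
  note tf = tensor_map[OF mods(1,2) F f] and tg = tensor_map[OF mods(2,3) F g]
  interpret TB: module R ?TB by (rule TB)
  interpret TC: module R ?TC by (rule TC)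
  obtain s where s: "s \<in> S"
    and surj: "\<And>c. c \<in> carrier C \<Longrightarrow> \<exists>b\<in>carrier B. g b = s \<odot>\<^bsub>C\<^esub> c"
    and ex: "\<And>b. b \<in> carrier B \<Longrightarrow> g b = \<zero>\<^bsub>C\<^esub> \<Longrightarrow> \<exists>a\<in>carrier A. f a = s \<odot>\<^bsub>B\<^esub> b"
    and inj: "\<And>a. a \<in> carrier A \<Longrightarrow> f a = \<zero>\<^bsub>B\<^esub> \<Longrightarrow> s \<odot>\<^bsub>A\<^esub> a = \<zero>\<^bsub>A\<^esub>"
    and gf: "\<And>a. a \<in> carrier A \<Longrightarrow> s \<odot>\<^bsub>C\<^esub> g (f a) = \<zero>\<^bsub>C\<^esub>"
    by (rule S_short_exactD[OF S mods f g short]) (rule that)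
  have sR: "s \<in> carrier R" using s S.subset by blast
  have ss: "s \<otimes>\<^bsub>R\<^esub> s \<in> S" using s by simp
  obtain s' where s': "s' \<in> S" and inj': "\<And>X. X \<in> carrier ?TA \<Longrightarrow> tensor_map R A B F f X = \<zero>\<^bsub>?TB\<^esub> \<Longrightarrow>
      s' \<odot>\<^bsub>?TA\<^esub> X = \<zero>\<^bsub>?TA\<^esub>"
    using tensor_kernel_killed[OF F S inf tor mods(1,2) f s inj] by blast
  have gf0: "s \<odot>\<^bsub>?TC\<^esub> tensor_map R B C F g (tensor_map R A B F f X) = \<zero>\<^bsub>?TC\<^esub>" if X: "X \<in> carrier ?TA" for X
  proof (rule tensor_hom_eq[OF mods(1) F TC mod_hom_smult[OF TC mod_hom_comp[OF tf(1) tg(1)] sR] mod_hom_zero[OF TC] _ X])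
    fix a y assume a: "a \<in> carrier A" and y: "y \<in> carrier F"
    have fa: "f a \<in> carrier B" "g (f a) \<in> carrier C" using mod_homD(1)[OF f a] mod_homD(1)[OF g] by auto
    have "s \<odot>\<^bsub>?TC\<^esub> pure_tensor R C F (g (f a)) y = pure_tensor R C F \<zero>\<^bsub>C\<^esub> y"
      using pure_tensor_bilinear(3)[OF mods(3) F sR fa(2) y] gf[OF a] by simp
    also have "\<dots> = \<zero>\<^bsub>?TC\<^esub>" by (rule mod_hom_zero_minus(1)[OF mods(3) TC pure_tensor_hom_left[OF mods(3) F y]])
    finally show "s \<odot>\<^bsub>?TC\<^esub> tensor_map R B C F g (tensor_map R A B F f (pure_tensor R A F a y)) = \<zero>\<^bsub>?TC\<^esub>"
      by (simp add: tf(2)[OF a y] tg(2)[OF fa(1) y])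
  qed
  \<comment> \<open>It suffices that \<open>s\<close> moves pure tensors into the image, as the
    cokernel is generated by their classes.\<close>
  have surj': "\<exists>Y\<in>carrier ?TB. tensor_map R B C F g Y = s \<odot>\<^bsub>?TC\<^esub> X" if X: "X \<in> carrier ?TC" for X
  proof -
    define H where "H = tensor_map R B C F g ` carrier ?TB"
    define Q where "Q = quot_module ?TC H"
    define \<pi> where "\<pi> = coset_map ?TC H"
    note Q = quot_image[OF TB TC tg(1), folded H_def, folded Q_def \<pi>_def]
    have "\<pi> (s \<odot>\<^bsub>?TC\<^esub> X) = \<zero>\<^bsub>Q\<^esub>"
    proof (rule tensor_hom_eq[OF mods(3) F Q(1) _ mod_hom_zero[OF Q(1)] _ X])
      show "(\<lambda>X. \<pi> (s \<odot>\<^bsub>?TC\<^esub> X)) \<in> mod_hom R ?TC Q"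
        by (rule mod_hom_comp[OF mod_hom_smult[OF TC _ sR] Q(2)]) (rule mod_homI, simp_all)
      fix c y assume c: "c \<in> carrier C" and y: "y \<in> carrier F"
      obtain b where b: "b \<in> carrier B" "g b = s \<odot>\<^bsub>C\<^esub> c" using surj[OF c] by blast
      have "s \<odot>\<^bsub>?TC\<^esub> pure_tensor R C F c y = tensor_map R B C F g (pure_tensor R B F b y)"
        using pure_tensor_bilinear(3)[OF mods(3) F sR c y] b(2) tg(2)[OF b(1) y] by simp
      then have "s \<odot>\<^bsub>?TC\<^esub> pure_tensor R C F c y \<in> H"
        unfolding H_def using pure_tensor_closed[OF mods(2) F b(1) y] by (metis imageI)
      then show "\<pi> (s \<odot>\<^bsub>?TC\<^esub> pure_tensor R C F c y) = \<zero>\<^bsub>Q\<^esub>"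
        using Q(3) TC.smult_closed[OF sR pure_tensor_closed[OF mods(3) F c y]] by blast
    qed
    then have "s \<odot>\<^bsub>?TC\<^esub> X \<in> H" using Q(3)[OF TC.smult_closed[OF sR X]] by blast
    then show ?thesis unfolding H_def by (rule image_bexD)
  qed
  show "S_short_exact S ?TA (tensor_map R A B F f) ?TB (tensor_map R B C F g) ?TC"
  proof (rule S_short_exactI[OF TA TB TC tf(1) tg(1) S.subset s surj' ss _ _ s' inj'])
    show "\<exists>Y\<in>carrier ?TA. tensor_map R A B F f Y = (s \<otimes>\<^bsub>R\<^esub> s) \<odot>\<^bsub>?TB\<^esub> X"
      if "X \<in> carrier ?TB" "tensor_map R B C F g X = \<zero>\<^bsub>?TC\<^esub>" for X
      by (rule tensor_right_exact[OF F S mods f g s surj ex that])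
    show "(s \<otimes>\<^bsub>R\<^esub> s) \<odot>\<^bsub>?TC\<^esub> tensor_map R B C F g (tensor_map R A B F f X) = \<zero>\<^bsub>?TC\<^esub>" if X: "X \<in> carrier ?TA" for X
      using gf0[OF X] mod_homD(1)[OF tg(1) mod_homD(1)[OF tf(1) X]] sR by (simp add: TC.smult_assoc1)
  qed
qed

section \<open>\<open>S\<close>-flat dimension in terms of free resolutions\<close>

text \<open>Entrywise multiplication by \<open>s\<close> is zero, so the zero chain bounds
  \<open>s z\<close>.\<close>

lemma tor_killed_torsion:
  assumes "module R M" "s \<in> S" "\<And>m. m \<in> carrier M \<Longrightarrow> s \<odot>\<^bsub>M\<^esub> m = \<zero>\<^bsub>M\<^esub>"
  shows "tor_killed TYPE('i) R S M n"
  unfolding tor_killed_def homology_killed_def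
proof (intro allI impI bexI[OF _ assms(2)] ballI)
  fix I :: "nat \<Rightarrow> 'i set" and A z
  assume res: "free_resolution R I A" and z: "z \<in> carrier (fs M (I (Suc n)))"
  interpret module R "fs M (I (Suc (Suc n)))" by (rule module_fs) fact
  have "mx M (I (Suc n)) (A (Suc n)) \<zero>\<^bsub>fs M (I (Suc (Suc n)))\<^esub> = \<zero>\<^bsub>fs M (I (Suc n))\<^esub>"
    by (rule mod_hom_zero_minus(1)[OF module_fs[OF assms(1)] module_fs[OF assms(1)] free_resolution_hom[OF assms(1) res]])
  then show "\<exists>w\<in>carrier (fs M (I (Suc (Suc n)))). mx M (I (Suc n)) (A (Suc n)) w = s \<odot>\<^bsub>fs M (I (Suc n))\<^esub> z"
    using assms(3) fs_value[OF z] by (intro bexI[of _ "\<zero>\<^bsub>fs M (I (Suc (Suc n)))\<^esub>"]) (simp_all del: fs_simps(1), simp)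
qed

definition kernel_module ::
  "('a, 'b, 'n) module_scheme \<Rightarrow> ('a, 'c, 'k) module_scheme \<Rightarrow> ('b \<Rightarrow> 'c) \<Rightarrow> ('a, 'b, 'n) module_scheme"
  where "kernel_module M N f = M\<lparr>carrier := {x\<in>carrier M. f x = \<zero>\<^bsub>N\<^esub>}\<rparr>"

lemma kernel_module_simps [simp]:
  "carrier (kernel_module M N f) = {x\<in>carrier M. f x = \<zero>\<^bsub>N\<^esub>}"
  "\<zero>\<^bsub>kernel_module M N f\<^esub> = \<zero>\<^bsub>M\<^esub>" "x \<oplus>\<^bsub>kernel_module M N f\<^esub> y = x \<oplus>\<^bsub>M\<^esub> y"
  "r \<odot>\<^bsub>kernel_module M N f\<^esub> x = r \<odot>\<^bsub>M\<^esub> x"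
  by (simp_all add: kernel_module_def)

lemma module_kernel_module:
  assumes "module R M" "module R N" "f \<in> mod_hom R M N"
  shows "module R (kernel_module M N f)"
proof -
  interpret M: module R M by fact
  interpret N: module R N by fact
  have "submodule {x\<in>carrier M. f x = \<zero>\<^bsub>N\<^esub>} R M"
    by (rule M.submoduleI) (auto simp: mod_homD[OF assms(3)] mod_hom_zero_minus[OF assms])
  then show ?thesis unfolding kernel_module_def by (rule submodule.submodule_is_module) fact
qed

lemma kernel_inclusion: "(\<lambda>x. x) \<in> mod_hom R (kernel_module M N f) M"
  by (rule mod_homI) auto

text \<open>Dimension shifting along the kernels \<open>K i\<close>. The leftmost one is killed by
  an element of \<open>S\<close>, as the sequence begins with zero; every flat term passed raises
  the degree by one; and \<open>K 0\<close> is \<open>M\<close>.\<close>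

lemma tor_killed_of_S_fd_le:
  fixes M :: "('a, 'u) module"
  assumes S: "submonoid S R" and inf: "infinite (UNIV :: 'u set)" "carrier R \<lesssim> (UNIV :: 'u set)"
    and "S_fd_le R S M n"
  shows "tor_killed TYPE('u) R S M (Suc n)"
proof -
  interpret S: submonoid S R by fact
  obtain X d where X: "X 0 = zero_module" "X 1 = M" "X (n + 3) = zero_module"
    and flat: "\<And>i. i \<le> n \<Longrightarrow> S_flat R S (X (i + 2))" and seq: "S_exact_seq R S (n + 3) X d"
    using assms(4) unfolding S_fd_le_def by blast
  have mods: "module R (X i)" if "i \<le> n + 3" for i using seq that by (simp add: S_exact_seq_def)
  have d: "d i \<in> mod_hom R (X (Suc i)) (X i)" if "i < n + 3" for i using seq that by (simp add: S_exact_seq_def)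
  have exact: "S_exact_at S (X (Suc (Suc i))) (d (Suc i)) (X (Suc i)) (d i) (X i)" if "Suc i < n + 3" for i
    using seq that by (simp add: S_exact_seq_def)
  define K where "K i = kernel_module (X (Suc i)) (X i) (d i)" for i
  have K: "module R (K i)" if "i < n + 3" for i
    unfolding K_def by (rule module_kernel_module[OF mods mods d]) (use that in auto)
  have top: "tor_killed TYPE('u) R S (K (Suc n)) 0"
  proof -
    have e: "S_exact_at S (X (n + 3)) (d (Suc (Suc n))) (X (Suc (Suc n))) (d (Suc n)) (X (Suc n))"
      using exact[of "Suc n"] by (simp add: numeral_eq_Suc)
    obtain s where s: "s \<in> S"
      "(\<lambda>y. s \<odot>\<^bsub>X (Suc (Suc n))\<^esub> y) ` a_kernel (X (Suc (Suc n))) (X (Suc n)) (d (Suc n)) \<subseteq> d (Suc (Suc n)) ` carrier (X (n + 3))"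
      using e unfolding S_exact_at_def by (elim bexE conjE)
    have dh: "d (Suc (Suc n)) \<in> mod_hom R (X (n + 3)) (X (Suc (Suc n)))"
      using d[of "Suc (Suc n)"] by (simp add: numeral_eq_Suc)
    have "d (Suc (Suc n)) \<zero>\<^bsub>X (n + 3)\<^esub> = \<zero>\<^bsub>X (Suc (Suc n))\<^esub>"
      by (rule mod_hom_zero_minus(1)[OF mods mods dh]) auto
    then have im: "d (Suc (Suc n)) ` carrier (X (n + 3)) = {\<zero>\<^bsub>X (Suc (Suc n))\<^esub>}"
      unfolding X(3) by (simp add: zero_module_def)
    show ?thesis
    proof (rule tor_killed_torsion[OF K s(1)])
      fix m assume "m \<in> carrier (K (Suc n))"
      then have "m \<in> a_kernel (X (Suc (Suc n))) (X (Suc n)) (d (Suc n))" by (simp add: K_def a_kernel_def')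
      then show "s \<odot>\<^bsub>K (Suc n)\<^esub> m = \<zero>\<^bsub>K (Suc n)\<^esub>" using s(2) im by (auto simp: K_def)
    qed simp
  qed
  have step: "tor_killed TYPE('u) R S (K i) (Suc m)" if i: "i \<le> n" and tor: "tor_killed TYPE('u) R S (K (Suc i)) m" for i m
  proof -
    let ?B = "X (Suc (Suc i))" let ?C = "X (Suc i)" let ?d = "d (Suc i)"
    have mB: "module R ?B" and mC: "module R ?C" using mods i by auto
    interpret B: module R ?B by (rule mB)
    interpret C: module R ?C by (rule mC)
    have dh: "?d \<in> mod_hom R ?B ?C" "d i \<in> mod_hom R ?C (X i)" using d i by auto
    note dD = mod_homD[OF dh(1)]
    have "S_exact_at S ?B ?d ?C (d i) (X i)" using exact i by simp
    then obtain s where s: "s \<in> S"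
      "(\<lambda>y. s \<odot>\<^bsub>?C\<^esub> y) ` a_kernel ?C (X i) (d i) \<subseteq> ?d ` carrier ?B"
      "(\<lambda>y. s \<odot>\<^bsub>?C\<^esub> y) ` ?d ` carrier ?B \<subseteq> a_kernel ?C (X i) (d i)"
      unfolding S_exact_at_def by (elim bexE conjE)
    have sR: "s \<in> carrier R" using s(1) S.subset by blast
    have in_K: "s \<odot>\<^bsub>?C\<^esub> ?d b \<in> carrier (K i)" if "b \<in> carrier ?B" for b
      using s(3) that by (auto simp: K_def a_kernel_def')
    \<comment> \<open>As the composite of two maps need not vanish, \<open>d\<close> itself may fail
      to land in \<open>K i\<close>, but \<open>s d\<close> does. Exactness then holds with
      multiplier \<open>s s\<close>.\<close>
    have g: "(\<lambda>b. s \<odot>\<^bsub>?C\<^esub> ?d b) \<in> mod_hom R ?B (K i)"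
    proof (rule mod_homI)
      note h = mod_homD[OF mod_hom_smult[OF mC dh(1) sR]]
      show "s \<odot>\<^bsub>?C\<^esub> ?d (x \<oplus>\<^bsub>?B\<^esub> y) = s \<odot>\<^bsub>?C\<^esub> ?d x \<oplus>\<^bsub>K i\<^esub> s \<odot>\<^bsub>?C\<^esub> ?d y"
        if "x \<in> carrier ?B" "y \<in> carrier ?B" for x y using h(2)[OF that] by (simp add: K_def)
      show "s \<odot>\<^bsub>?C\<^esub> ?d (r \<odot>\<^bsub>?B\<^esub> x) = r \<odot>\<^bsub>K i\<^esub> (s \<odot>\<^bsub>?C\<^esub> ?d x)"
        if "r \<in> carrier R" "x \<in> carrier ?B" for r x using h(3)[OF that] by (simp add: K_def)
    qed (rule in_K)
    have inc: "(\<lambda>x. x) \<in> mod_hom R (K (Suc i)) ?B" unfolding K_def by (rule kernel_inclusion)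
    have ss: "s \<otimes>\<^bsub>R\<^esub> s \<in> S" using s(1) by simp
    have flat': "tor_killed TYPE('u) R S ?B (Suc m)"
    proof -
      have "S_flat R S ?B" using flat[OF i] by simp
      from tor_killed_mono[OF tor_killed_of_S_flat[OF this S inf]] show ?thesis by simp
    qed
    have KS: "module R (K (Suc i))" "module R (K i)" using K i by auto
    show ?thesis
    proof (rule tor_killed_right[OF S ss KS(1) mB KS(2) inc g _ _ _ _ tor flat'])
      fix c assume c: "c \<in> carrier (K i)"
      then have cC: "c \<in> carrier ?C" and "c \<in> a_kernel ?C (X i) (d i)" by (auto simp: K_def a_kernel_def')
      then have "s \<odot>\<^bsub>?C\<^esub> c \<in> ?d ` carrier ?B" using s(2) by blast
      then obtain b where b: "b \<in> carrier ?B" "?d b = s \<odot>\<^bsub>?C\<^esub> c" using image_bexD by metis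
      then show "\<exists>b\<in>carrier ?B. s \<odot>\<^bsub>?C\<^esub> ?d b = (s \<otimes>\<^bsub>R\<^esub> s) \<odot>\<^bsub>K i\<^esub> c"
        using sR cC by (intro bexI[of _ b]) (simp_all add: K_def C.smult_assoc1)
    next
      fix b assume b: "b \<in> carrier ?B" "s \<odot>\<^bsub>?C\<^esub> ?d b = \<zero>\<^bsub>K i\<^esub>"
      then have "?d (s \<odot>\<^bsub>?B\<^esub> b) = \<zero>\<^bsub>?C\<^esub>" using sR by (simp add: dD K_def)
      then have "?d (s \<odot>\<^bsub>?B\<^esub> (s \<odot>\<^bsub>?B\<^esub> b)) = \<zero>\<^bsub>?C\<^esub>" using b sR by (simp add: dD)
      then show "\<exists>a\<in>carrier (K (Suc i)). a = (s \<otimes>\<^bsub>R\<^esub> s) \<odot>\<^bsub>?B\<^esub> b"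
        using b sR by (simp add: K_def B.smult_assoc1)
    next
      fix a assume "a \<in> carrier (K (Suc i))" "a = \<zero>\<^bsub>?B\<^esub>"
      then show "(s \<otimes>\<^bsub>R\<^esub> s) \<odot>\<^bsub>K (Suc i)\<^esub> a = \<zero>\<^bsub>K (Suc i)\<^esub>" using sR by (simp add: K_def)
    next
      fix a assume "a \<in> carrier (K (Suc i))"
      then show "(s \<otimes>\<^bsub>R\<^esub> s) \<odot>\<^bsub>K i\<^esub> (s \<odot>\<^bsub>?C\<^esub> ?d a) = \<zero>\<^bsub>K i\<^esub>" using sR by (simp add: K_def)
    qed
  qed
  \<comment> \<open>\<open>j\<close> counts the flat terms passed, starting from the left end at
    \<open>K (Suc n)\<close>.\<close>
  have "tor_killed TYPE('u) R S (K (Suc n - j)) j" if "j \<le> Suc n" for j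
    using that
  proof (induction j)
    case 0
    then show ?case using top by simp
  next
    case (Suc j)
    then show ?case using step[of "n - j" j] by (simp add: Suc_diff_le)
  qed
  from this[of "Suc n"] have tor: "tor_killed TYPE('u) R S (K 0) (Suc n)" by simp
  have K0: "module R (K 0)" by (rule K) simp
  have M: "module R M" using mods[of 1] X(2) by simp
  have X1: "X (Suc 0) = M" using X(2) by simp
  have K0_eq: "K 0 = kernel_module M (zero_module :: ('a, 'u) module) (d 0)" by (simp add: K_def X1 X(1))
  have "d 0 x = \<zero>\<^bsub>(zero_module :: ('a, 'u) module)\<^esub>" if "x \<in> carrier M" for x
    using mod_homD(1)[OF d[of 0]] that X1 X(1) by (simp add: zero_module_def)
  then have up: "(\<lambda>x. x) \<in> mod_hom R M (K 0)" unfolding K0_eq by (intro mod_homI) simp_all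
  have down: "(\<lambda>x. x) \<in> mod_hom R (K 0) M" unfolding K0_eq by (rule kernel_inclusion)
  show ?thesis by (rule tor_killed_retract[OF K0 M down up refl S.subset tor])
qed

lemma S_fd_le_0:
  fixes M :: "('a, 'u) module"
  assumes S: "submonoid S R" and flat: "S_flat R S M"
  shows "S_fd_le R S M 0"
proof -
  have M: "module R M" using flat by (simp add: S_flat_def)
  interpret M: module R M by (rule M)
  interpret S: submonoid S R by fact
  note z = module_zero_module[OF M.is_cring]
  define X :: "nat \<Rightarrow> ('a, 'u) module" where "X i = (if i = 1 \<or> i = 2 then M else zero_module)" for i
  define d :: "nat \<Rightarrow> 'u \<Rightarrow> 'u" where "d i = (if i = 1 then id else if i = 0 then (\<lambda>_. undefined) else (\<lambda>_. \<zero>\<^bsub>M\<^esub>))" for i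
  have X: "module R (X i)" for i by (simp add: X_def M z)
  have d: "d i \<in> mod_hom R (X (Suc i)) (X i)" if "i < 3" for i
    by (rule mod_homI) (use that in \<open>auto simp: X_def d_def zero_module_def less_Suc_eq numeral_eq_Suc\<close>)
  have "S_exact_at S (X (Suc (Suc i))) (d (Suc i)) (X (Suc i)) (d i) (X i)" if "Suc i < 3" for i
  proof -
    have "i = 0 \<or> i = 1" using that by auto
    then show ?thesis unfolding S_exact_at_def
      by (intro bexI[OF _ S.one_closed])
        (auto simp: X_def d_def a_kernel_def' zero_module_def numeral_eq_Suc image_iff)
  qed
  then show ?thesis unfolding S_fd_le_def S_exact_seq_def
    by (intro exI[of _ X] exI[of _ d]) (use X d flat in \<open>auto simp: X_def numeral_eq_Suc\<close>)
qed

text \<open>The sequence of the kernel is spliced with \<open>P \<rightarrow> M\<close>. The kernel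
  shares its operations with \<open>P\<close>, so the map onto it is reused as a map into
  \<open>P\<close>.\<close>

lemma S_fd_le_Suc:
  fixes M P :: "('a, 'u) module"
  assumes S: "submonoid S R" and flat: "S_flat R S P" and M: "module R M" and g: "g \<in> mod_hom R P M"
    and surj: "g ` carrier P = carrier M" and ker: "S_fd_le R S (kernel_module P M g) n"
  shows "S_fd_le R S M (Suc n)"
proof -
  interpret S: submonoid S R by fact
  interpret M: module R M by fact
  have P: "module R P" using flat by (simp add: S_flat_def)
  interpret P: module R P by (rule P)
  let ?K = "kernel_module P M g"
  obtain X d where X: "X 0 = zero_module" "X 1 = ?K" "X (n + 3) = zero_module"
    and flatX: "\<And>i. i \<le> n \<Longrightarrow> S_flat R S (X (i + 2))" and seq: "S_exact_seq R S (n + 3) X d"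
    using ker unfolding S_fd_le_def by blast
  have mods: "module R (X i)" if "i \<le> n + 3" for i using seq that by (simp add: S_exact_seq_def)
  have d: "d i \<in> mod_hom R (X (Suc i)) (X i)" if "i < n + 3" for i using seq that by (simp add: S_exact_seq_def)
  have exact: "S_exact_at S (X (Suc (Suc i))) (d (Suc i)) (X (Suc i)) (d i) (X i)" if "Suc i < n + 3" for i
    using seq that by (simp add: S_exact_seq_def)
  \<comment> \<open>Terms 0, 1, 2 are zero, \<open>M\<close> and \<open>P\<close>. From term 3 on
    the old sequence continues with its own term 2; the kernel, its term 1, is left out.\<close>
  define X' where "X' i = (case i of 0 \<Rightarrow> zero_module | Suc 0 \<Rightarrow> M | Suc (Suc 0) \<Rightarrow> P | Suc (Suc (Suc i)) \<Rightarrow> X (Suc (Suc i)))" for i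
  define d' where "d' i = (case i of 0 \<Rightarrow> (\<lambda>_. undefined) | Suc 0 \<Rightarrow> g | Suc (Suc i) \<Rightarrow> d (Suc i))" for i
  have X'_simps: "X' 0 = zero_module" "X' (Suc 0) = M" "X' (Suc (Suc 0)) = P" "\<And>i. X' (Suc (Suc (Suc i))) = X (Suc (Suc i))"
    by (simp_all add: X'_def)
  have d'_simps: "d' 0 = (\<lambda>_. undefined)" "d' (Suc 0) = g" "\<And>i. d' (Suc (Suc i)) = d (Suc i)"
    by (simp_all add: d'_def)
  have d1: "d (Suc 0) \<in> mod_hom R (X (Suc (Suc 0))) ?K" using d[of "Suc 0"] X by simp
  then have d1P: "d (Suc 0) \<in> mod_hom R (X (Suc (Suc 0))) P"
    by (auto simp: mod_hom_def hom_def)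
  have mods': "module R (X' i)" if "i \<le> n + 4" for i
  proof -
    consider "i = 0" | "i = 1" | "i = 2" | j where "i = Suc (Suc (Suc j))"
      by (metis One_nat_def Suc_1 not0_implies_Suc)
    then show ?thesis using that mods M P module_zero_module[OF M.is_cring] by cases (simp_all add: X'_def numeral_eq_Suc)
  qed
  have dhom': "d' i \<in> mod_hom R (X' (Suc i)) (X' i)" if "i < n + 4" for i
  proof -
    consider "i = 0" | "i = 1" | "i = 2" | j where "i = Suc (Suc (Suc j))"
      by (metis One_nat_def Suc_1 not0_implies_Suc)
    then show ?thesis
    proof cases
      case 1
      show ?thesis unfolding 1 X'_simps d'_simps by (rule mod_homI) (simp_all add: zero_module_def)
    next
      case 4
      then show ?thesis using that d[of "Suc (Suc j)"] by (simp add: X'_simps d'_simps)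
    qed (use g d1P in \<open>simp_all add: X'_simps d'_simps numeral_eq_Suc\<close>)
  qed
  have exact': "S_exact_at S (X' (Suc (Suc i))) (d' (Suc i)) (X' (Suc i)) (d' i) (X' i)" if "Suc i < n + 4" for i
  proof -
    consider "i = 0" | "i = 1" | "i = 2" | j where "i = Suc (Suc (Suc j))"
      by (metis One_nat_def Suc_1 not0_implies_Suc)
    then show ?thesis
    proof cases
      case 1
      show ?thesis unfolding 1 X'_simps d'_simps S_exact_at_def
        by (rule bexI[OF _ S.one_closed]) (use surj in \<open>auto simp: a_kernel_def' zero_module_def\<close>)
    next
      \<comment> \<open>Exactness at \<open>P\<close>: the kernel of \<open>g\<close> is all of
        \<open>X 1\<close>, hence also the kernel of \<open>d 0\<close>.\<close>
      case 2
      let ?Z = "zero_module :: ('a, 'u) module"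
      have "S_exact_at S (X (Suc (Suc 0))) (d (Suc 0)) ?K (d 0) ?Z" using exact[of 0] X by simp
      then obtain s where s: "s \<in> S" "(\<lambda>y. s \<odot>\<^bsub>?K\<^esub> y) ` a_kernel ?K ?Z (d 0) \<subseteq> d (Suc 0) ` carrier (X (Suc (Suc 0)))"
        unfolding S_exact_at_def by (elim bexE conjE) (rule that)
      have "d 0 x = \<zero>\<^bsub>?Z\<^esub>" if "x \<in> carrier ?K" for x
        using mod_homD(1)[OF d[of 0]] X that by (simp add: zero_module_def)
      then have "a_kernel ?K ?Z (d 0) = a_kernel P M g" by (auto simp: a_kernel_def')
      then have s2: "(\<lambda>y. s \<odot>\<^bsub>P\<^esub> y) ` a_kernel P M g \<subseteq> d (Suc 0) ` carrier (X (Suc (Suc 0)))" using s(2) by simp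
      have sR: "s \<in> carrier R" using s(1) S.subset by blast
      have s3: "(\<lambda>y. s \<odot>\<^bsub>P\<^esub> y) ` d (Suc 0) ` carrier (X (Suc (Suc 0))) \<subseteq> a_kernel P M g"
        using mod_homD(1)[OF d1] sR by (auto simp: a_kernel_def' mod_homD[OF g])
      have "i = Suc 0" using 2 by simp
      then show ?thesis unfolding S_exact_at_def using s(1) s2 s3 by (auto simp only: X'_simps d'_simps One_nat_def)
    next
      case 3
      have "S_exact_at S (X (Suc (Suc (Suc 0)))) (d (Suc (Suc 0))) (X (Suc (Suc 0))) (d (Suc 0)) ?K"
        using exact[of "Suc 0"] X by simp
      moreover have "a_kernel (X (Suc (Suc 0))) ?K (d (Suc 0)) = a_kernel (X (Suc (Suc 0))) P (d (Suc 0))"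
        by (simp add: a_kernel_def')
      moreover have "i = Suc (Suc 0)" using 3 by simp
      ultimately show ?thesis by (simp only: X'_simps d'_simps S_exact_at_def)
    next
      case 4
      then show ?thesis using that exact[of "Suc (Suc j)"] by (simp add: X'_simps d'_simps)
    qed
  qed
  have flat': "S_flat R S (X' (i + 2))" if "i \<le> Suc n" for i
  proof (cases i)
    case 0
    then show ?thesis using flat by (simp add: X'_simps numeral_eq_Suc)
  next
    case (Suc j)
    then show ?thesis using that flatX[of j] by (simp add: X'_simps)
  qed
  show ?thesis unfolding S_fd_le_def S_exact_seq_def
  proof (intro exI[of _ X'] exI[of _ d'] conjI allI impI)
    show "X' (Suc n + 3) = zero_module" using X(3) by (simp add: X'_def numeral_eq_Suc)
    show "module R (X' i)" if "i \<le> Suc n + 3" for i using mods' that by simp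
    show "d' i \<in> mod_hom R (X' (Suc i)) (X' i)" if "i < Suc n + 3" for i using dhom' that by simp
    show "S_exact_at S (X' (Suc (Suc i))) (d' (Suc i)) (X' (Suc i)) (d' i) (X' i)" if "Suc i < Suc n + 3" for i
      using exact' that by simp
    show "S_flat R S (X' (i + 2))" if "i \<le> Suc n" for i by (rule flat'[OF that])
  qed (simp_all add: X'_simps)
qed

text \<open>Replacing a module by the kernel of a free cover lowers the degree of the killed
  \<open>Tor\<close> by one, through \<open>tor_killed_left\<close>; once degree 1 is reached the
  module is \<open>S\<close>-flat.\<close>

lemma S_fd_le_of_tor_killed:
  fixes M :: "('a, 'u) module"
  assumes S: "submonoid S R" and inf: "infinite (UNIV :: 'u set)" "carrier R \<lesssim> (UNIV :: 'u set)"
  shows "module R M \<Longrightarrow> tor_killed TYPE('u) R S M (Suc n) \<Longrightarrow> S_fd_le R S M n"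
proof (induction n arbitrary: M)
  case 0
  then show ?case using S_fd_le_0[OF S S_flat_of_tor_killed[OF 0(1) S inf]] by simp
next
  case (Suc n)
  interpret S: submonoid S R by fact
  interpret M: module R M by fact
  obtain P :: "('a, 'u) module" and g where P: "module R P" "g \<in> mod_hom R P M" "g ` carrier P = carrier M"
    "tor_killed TYPE('u) R S P 1"
    by (rule free_cover[OF Suc.prems(1) S inf])
  interpret P: module R P by fact
  let ?K = "kernel_module P M g"
  have K: "module R ?K" by (rule module_kernel_module[OF P(1) Suc.prems(1) P(2)])
  interpret K: module R ?K by (rule K)
  have "tor_killed TYPE('u) R S ?K (Suc n)"
  proof (rule tor_killed_left[OF S S.one_closed K P(1) Suc.prems(1) kernel_inclusion P(2) _ _ _ _ _ Suc.prems(2)])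
    show "tor_killed TYPE('u) R S P (Suc n)" using tor_killed_mono[OF P(4)] by simp
    show "\<exists>b\<in>carrier P. g b = \<one>\<^bsub>R\<^esub> \<odot>\<^bsub>M\<^esub> c" if c: "c \<in> carrier M" for c
      using image_bexD[of c g "carrier P"] c P(3) by simp
  qed auto
  then show ?case
    by (intro S_fd_le_Suc[OF S S_flat_of_tor_killed[OF P(1) S inf P(4)] Suc.prems(1) P(2,3)] Suc.IH K)
qed

lemma S_fd_le_iff_tor_killed:
  fixes M :: "('a, 'u) module"
  assumes "submonoid S R" "infinite (UNIV :: 'u set)" "carrier R \<lesssim> (UNIV :: 'u set)" "module R M"
  shows "S_fd_le R S M n \<longleftrightarrow> tor_killed TYPE('u) R S M (Suc n)"
  using tor_killed_of_S_fd_le[OF assms(1-3)] S_fd_le_of_tor_killed[OF assms] by blast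

section \<open>Modules over the polynomial ring\<close>

lemma UP_carrier_iff:
  assumes "cring R"
  shows "p \<in> carrier (UP R) \<longleftrightarrow> (\<forall>c. p c \<in> carrier R) \<and> finite {c. p c \<noteq> \<zero>\<^bsub>R\<^esub>}"
proof -
  interpret cring R by fact
  have "(\<exists>n. bound \<zero>\<^bsub>R\<^esub> n p) \<longleftrightarrow> finite {c. p c \<noteq> \<zero>\<^bsub>R\<^esub>}"
  proof
    assume "\<exists>n. bound \<zero>\<^bsub>R\<^esub> n p"
    then obtain n where "bound \<zero>\<^bsub>R\<^esub> n p" by blast
    then have "{c. p c \<noteq> \<zero>\<^bsub>R\<^esub>} \<subseteq> {..n}" by (auto simp: bound_def not_less[symmetric])
    then show "finite {c. p c \<noteq> \<zero>\<^bsub>R\<^esub>}" by (rule finite_subset) simp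
  next
    assume "finite {c. p c \<noteq> \<zero>\<^bsub>R\<^esub>}"
    then obtain n where "\<forall>c\<in>{c. p c \<noteq> \<zero>\<^bsub>R\<^esub>}. c \<le> n" using finite_nat_set_iff_bounded_le by blast
    then show "\<exists>n. bound \<zero>\<^bsub>R\<^esub> n p" by (intro exI[of _ n]) (force simp: bound_def)
  qed
  then show ?thesis by (auto simp: UP_def up_def)
qed

text \<open>The carrier of \<open>UP R\<close> consists of coefficient functions. These equations
  expose the operations in that form, in which polynomials can be exchanged with families indexed by
  \<open>nat\<close>.\<close>

lemma UP_ops:
  assumes "cring R"
  shows "\<zero>\<^bsub>UP R\<^esub> = (\<lambda>_. \<zero>\<^bsub>R\<^esub>)"
    and "p \<in> carrier (UP R) \<Longrightarrow> q \<in> carrier (UP R) \<Longrightarrow> p \<oplus>\<^bsub>UP R\<^esub> q = (\<lambda>c. p c \<oplus>\<^bsub>R\<^esub> q c)"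
    and "r \<in> carrier R \<Longrightarrow> monom (UP R) r n = (\<lambda>c. if c = n then r else \<zero>\<^bsub>R\<^esub>)"
    and "r \<in> carrier R \<Longrightarrow> p \<in> carrier (UP R) \<Longrightarrow> monom (UP R) r 0 \<otimes>\<^bsub>UP R\<^esub> p = (\<lambda>c. r \<otimes>\<^bsub>R\<^esub> p c)"
    and "p \<in> carrier (UP R) \<Longrightarrow>
      p \<otimes>\<^bsub>UP R\<^esub> monom (UP R) \<one>\<^bsub>R\<^esub> 1 = (\<lambda>c. case c of 0 \<Rightarrow> \<zero>\<^bsub>R\<^esub> | Suc c \<Rightarrow> p c)"
proof -
  interpret cring R by fact
  interpret U: UP_cring R "UP R" by (rule UP_cring.intro[OF assms]) 
  have coeff: "coeff (UP R) p = p" if "p \<in> carrier (UP R)" for p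
    using that by (simp add: UP_def)
  show "\<zero>\<^bsub>UP R\<^esub> = (\<lambda>_. \<zero>\<^bsub>R\<^esub>)" by (simp add: UP_def)
  show "p \<oplus>\<^bsub>UP R\<^esub> q = (\<lambda>c. p c \<oplus>\<^bsub>R\<^esub> q c)" if "p \<in> carrier (UP R)" "q \<in> carrier (UP R)"
    using that by (simp add: UP_def)
  show monom: "monom (UP R) r n = (\<lambda>c. if c = n then r else \<zero>\<^bsub>R\<^esub>)" if "r \<in> carrier R" for r n
    using that by (simp add: UP_def)
  show "monom (UP R) r 0 \<otimes>\<^bsub>UP R\<^esub> p = (\<lambda>c. r \<otimes>\<^bsub>R\<^esub> p c)" if "r \<in> carrier R" "p \<in> carrier (UP R)"
    using that U.monom_mult_is_smult[OF that] by (simp add: UP_def)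
  show "p \<otimes>\<^bsub>UP R\<^esub> monom (UP R) \<one>\<^bsub>R\<^esub> 1 = (\<lambda>c. case c of 0 \<Rightarrow> \<zero>\<^bsub>R\<^esub> | Suc c \<Rightarrow> p c)" if p: "p \<in> carrier (UP R)"
  proof
    fix c
    have pc: "p c \<in> carrier R" for c using p UP_carrier_iff[OF assms] by blast
    have X: "monom (UP R) \<one>\<^bsub>R\<^esub> 1 \<in> carrier (UP R)" by simp
    have "(p \<otimes>\<^bsub>UP R\<^esub> monom (UP R) \<one>\<^bsub>R\<^esub> 1) c = coeff (UP R) (monom (UP R) \<one>\<^bsub>R\<^esub> 1 \<otimes>\<^bsub>UP R\<^esub> p) c"
      using p X U.UP_m_comm[OF p X] coeff[of "p \<otimes>\<^bsub>UP R\<^esub> monom (UP R) \<one>\<^bsub>R\<^esub> 1"] by simp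
    also have "\<dots> = (case c of 0 \<Rightarrow> \<zero>\<^bsub>R\<^esub> | Suc c \<Rightarrow> p c)"
    proof (cases c)
      case 0
      have "coeff (UP R) (monom (UP R) \<one>\<^bsub>R\<^esub> 1 \<otimes>\<^bsub>UP R\<^esub> p) 0 = \<zero>\<^bsub>R\<^esub>"
        using U.coeff_mult[OF X p, of 0] p by simp
      then show ?thesis using 0 by simp
    next
      case (Suc c')
      then show ?thesis using U.coeff_monom_mult[OF one_closed p, of 1 c'] pc by (simp add: coeff[OF p])
    qed
    finally show "(p \<otimes>\<^bsub>UP R\<^esub> monom (UP R) \<one>\<^bsub>R\<^esub> 1) c = (case c of 0 \<Rightarrow> \<zero>\<^bsub>R\<^esub> | Suc c \<Rightarrow> p c)" .
  qed
qed

section \<open>Restriction of scalars to constant polynomials\<close>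

definition restrict_scalars ::
  "('a, 'm) ring_scheme \<Rightarrow> (nat \<Rightarrow> 'a, 'b, 'n) module_scheme \<Rightarrow> ('a, 'b) module"
  where "restrict_scalars R M = \<lparr>carrier = carrier M, mult = undefined, one = undefined,
    zero = \<zero>\<^bsub>M\<^esub>, add = add M, smult = (\<lambda>r m. monom (UP R) r 0 \<odot>\<^bsub>M\<^esub> m)\<rparr>"

lemma restrict_scalars_simps [simp]:
  "carrier (restrict_scalars R M) = carrier M" "\<zero>\<^bsub>restrict_scalars R M\<^esub> = \<zero>\<^bsub>M\<^esub>"
  "x \<oplus>\<^bsub>restrict_scalars R M\<^esub> y = x \<oplus>\<^bsub>M\<^esub> y"
  "r \<odot>\<^bsub>restrict_scalars R M\<^esub> x = monom (UP R) r 0 \<odot>\<^bsub>M\<^esub> x"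
  by (simp_all add: restrict_scalars_def)

lemma cring_UP: "cring R \<Longrightarrow> cring (UP R)"
  using UP_cring.UP_cring[OF UP_cring.intro] by blast

lemma module_restrict_scalars:
  assumes "cring R" "module (UP R) M" shows "module R (restrict_scalars R M)"
proof -
  interpret cring R by fact
  interpret U: UP_cring R "UP R" by (rule UP_cring.intro[OF assms(1)])
  interpret M: module "UP R" M by fact
  show ?thesis
  proof (rule moduleI, fact, rule abelian_groupI)
    fix x assume "x \<in> carrier (restrict_scalars R M)"
    then show "\<exists>y\<in>carrier (restrict_scalars R M). y \<oplus>\<^bsub>restrict_scalars R M\<^esub> x = \<zero>\<^bsub>restrict_scalars R M\<^esub>"
      using M.M.l_neg M.M.a_inv_closed by (intro bexI[of _ "\<ominus>\<^bsub>M\<^esub> x"]) auto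
  next
    fix a b x assume a: "a \<in> carrier R" "b \<in> carrier R" "x \<in> carrier (restrict_scalars R M)"
    show "(a \<otimes>\<^bsub>R\<^esub> b) \<odot>\<^bsub>restrict_scalars R M\<^esub> x = a \<odot>\<^bsub>restrict_scalars R M\<^esub> (b \<odot>\<^bsub>restrict_scalars R M\<^esub> x)"
      using a U.monom_mult[of a b 0 0] by (simp add: M.smult_assoc1)
  next
    fix x assume "x \<in> carrier (restrict_scalars R M)"
    then show "\<one>\<^bsub>R\<^esub> \<odot>\<^bsub>restrict_scalars R M\<^esub> x = x" by (simp only: restrict_scalars_simps U.monom_one M.smult_one)
  qed (auto simp: M.M.a_ac M.smult_l_distr M.smult_r_distr)
qed

lemma mod_hom_restrict_scalars:
  assumes "cring R" "f \<in> mod_hom (UP R) M N"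
  shows "f \<in> mod_hom R (restrict_scalars R M) (restrict_scalars R N)"
proof -
  interpret U: UP_cring R "UP R" by (rule UP_cring.intro[OF assms(1)])
  show ?thesis using assms(2) by (intro mod_homI) (auto simp: mod_homD)
qed

definition X_power :: "('a, 'm) ring_scheme \<Rightarrow> (nat \<Rightarrow> 'a, 'b, 'n) module_scheme \<Rightarrow> nat \<Rightarrow> 'b \<Rightarrow> 'b"
  where "X_power R M c m = monom (UP R) \<one>\<^bsub>R\<^esub> c \<odot>\<^bsub>M\<^esub> m"

lemma X_power:
  assumes "cring R" "module (UP R) M"
  shows X_power_hom: "X_power R M c \<in> mod_hom R (restrict_scalars R M) (restrict_scalars R M)"
    and X_power_0: "m \<in> carrier M \<Longrightarrow> X_power R M 0 m = m"
    and X_power_Suc: "m \<in> carrier M \<Longrightarrow> X_power R M (Suc c) m = X_power R M c (X_power R M (Suc 0) m)"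
    and X_power_closed: "m \<in> carrier M \<Longrightarrow> X_power R M c m \<in> carrier M"
proof -
  interpret cring R by fact
  interpret U: UP_cring R "UP R" by (rule UP_cring.intro[OF assms(1)])
  interpret M: module "UP R" M by fact
  show "X_power R M c \<in> mod_hom R (restrict_scalars R M) (restrict_scalars R M)"
    by (rule mod_homI)
      (auto simp: X_power_def M.smult_r_distr M.smult_assoc1[symmetric] U.UP_m_comm)
  show "m \<in> carrier M \<Longrightarrow> X_power R M 0 m = m" by (simp add: X_power_def)
  show "m \<in> carrier M \<Longrightarrow> X_power R M (Suc c) m = X_power R M c (X_power R M (Suc 0) m)"
    using U.monom_mult[of "\<one>\<^bsub>R\<^esub>" "\<one>\<^bsub>R\<^esub>" c "Suc 0"] by (simp add: X_power_def M.smult_assoc1)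
  show "m \<in> carrier M \<Longrightarrow> X_power R M c m \<in> carrier M" by (simp add: X_power_def)
qed

text \<open>Currying is the isomorphism between \<open>R^(I \<times> nat)\<close> and
  \<open>R[x]^(I)\<close>; the basis element \<open>(i, c)\<close> corresponds to
  \<open>x^c e_i\<close>.\<close>

definition cur :: "('i \<times> nat \<Rightarrow> 'a) \<Rightarrow> 'i \<Rightarrow> nat \<Rightarrow> 'a"
  where "cur z = (\<lambda>i c. z (i, c))"

definition unc :: "('i \<Rightarrow> nat \<Rightarrow> 'a) \<Rightarrow> 'i \<times> nat \<Rightarrow> 'a"
  where "unc q = (\<lambda>(i, c). q i c)"

lemma cur_unc [simp]: "cur (unc q) = q" "unc (cur z) = z"
  by (auto simp: cur_def unc_def)

section \<open>Free modules over \<open>R[x]\<close> as free modules over \<open>R\<close>\<close>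

context
  fixes R :: "('a, 'm) ring_scheme"
  assumes R: "cring R"
begin

interpretation R: cring R by (fact R)
interpretation U: UP_cring R "UP R" by (rule UP_cring.intro[OF R])

lemma modules_regular: "module R (regular_module R)" "module (UP R) (regular_module (UP R))"
  by (rule module_regular_module, fact R) (rule module_regular_module, rule cring_UP, fact R)

lemma cur_closed:
  assumes "z \<in> carrier (fs (regular_module R) (I \<times> UNIV))" shows "cur z \<in> carrier (fs (regular_module (UP R)) I)"
proof -
  let ?S = "{x. z x \<noteq> \<zero>\<^bsub>R\<^esub>}"
  have z: "\<And>x. z x \<in> carrier R" "\<And>x. x \<notin> I \<times> UNIV \<Longrightarrow> z x = \<zero>\<^bsub>R\<^esub>" and fin: "finite ?S"
    using assms unfolding fs_carrier regular_module_simps by blast+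
  have "{c. z (i, c) \<noteq> \<zero>\<^bsub>R\<^esub>} \<subseteq> snd ` ?S" for i
    by (rule subsetI, rule_tac x = "(i, x)" in image_eqI) simp_all
  then have "finite {c. z (i, c) \<noteq> \<zero>\<^bsub>R\<^esub>}" for i by (rule finite_subset) (rule finite_imageI[OF fin])
  then have "cur z i \<in> carrier (UP R)" for i using z(1) by (simp add: UP_carrier_iff[OF R] cur_def)
  moreover have "{i. cur z i \<noteq> (\<lambda>_. \<zero>\<^bsub>R\<^esub>)} \<subseteq> fst ` ?S"
  proof
    fix i assume "i \<in> {i. cur z i \<noteq> (\<lambda>_. \<zero>\<^bsub>R\<^esub>)}"
    then obtain c where "z (i, c) \<noteq> \<zero>\<^bsub>R\<^esub>" by (auto simp: cur_def)
    then show "i \<in> fst ` ?S" by (intro image_eqI[of _ _ "(i, c)"]) simp_all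
  qed
  then have "finite {i. cur z i \<noteq> (\<lambda>_. \<zero>\<^bsub>R\<^esub>)}" by (rule finite_subset) (rule finite_imageI[OF fin])
  moreover have "cur z i = (\<lambda>_. \<zero>\<^bsub>R\<^esub>)" if "i \<notin> I" for i using z(2) that by (simp add: cur_def)
  ultimately show ?thesis by (simp add: fs_carrier UP_ops(1)[OF R])
qed

lemma unc_closed:
  assumes "q \<in> carrier (fs (regular_module (UP R)) I)" shows "unc q \<in> carrier (fs (regular_module R) (I \<times> UNIV))"
proof -
  have q: "\<And>i. q i \<in> carrier (UP R)" "finite {i. q i \<noteq> (\<lambda>_. \<zero>\<^bsub>R\<^esub>)}" "\<And>i. i \<notin> I \<Longrightarrow> q i = (\<lambda>_. \<zero>\<^bsub>R\<^esub>)"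
    using assms by (auto simp: fs_carrier UP_ops(1)[OF R])
  have "{x. unc q x \<noteq> \<zero>\<^bsub>R\<^esub>} \<subseteq> Sigma {i. q i \<noteq> (\<lambda>_. \<zero>\<^bsub>R\<^esub>)} (\<lambda>i. {c. q i c \<noteq> \<zero>\<^bsub>R\<^esub>})"
    by (auto simp: unc_def)
  moreover have "finite (Sigma {i. q i \<noteq> (\<lambda>_. \<zero>\<^bsub>R\<^esub>)} (\<lambda>i. {c. q i c \<noteq> \<zero>\<^bsub>R\<^esub>}))"
    using q(1,2) by (intro finite_SigmaI) (auto simp: UP_carrier_iff[OF R])
  ultimately have "finite {x. unc q x \<noteq> \<zero>\<^bsub>R\<^esub>}" by (rule finite_subset)
  then show ?thesis using q(1,3) by (auto simp: fs_carrier unc_def UP_carrier_iff[OF R])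
qed

lemma cur_hom: "cur \<in> mod_hom R (fs (regular_module R) (I \<times> UNIV)) (restrict_scalars R (fs (regular_module (UP R)) I))"
proof (rule mod_homI)
  fix z w assume z: "z \<in> carrier (fs (regular_module R) (I \<times> (UNIV :: nat set)))" and w: "w \<in> carrier (fs (regular_module R) (I \<times> (UNIV :: nat set)))"
  have "cur z i \<in> carrier (UP R)" "cur w i \<in> carrier (UP R)" for i
    using fs_value[OF cur_closed[OF z]] fs_value[OF cur_closed[OF w]] by auto
  then show "cur (z \<oplus>\<^bsub>fs (regular_module R) (I \<times> UNIV)\<^esub> w) = cur z \<oplus>\<^bsub>restrict_scalars R (fs (regular_module (UP R)) I)\<^esub> cur w"
    by (simp add: UP_ops(2)[OF R]) (simp add: cur_def)
next
  fix r z assume r: "r \<in> carrier R" and z: "z \<in> carrier (fs (regular_module R) (I \<times> (UNIV :: nat set)))"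
  have "cur z i \<in> carrier (UP R)" for i using fs_value[OF cur_closed[OF z]] by auto
  then show "cur (r \<odot>\<^bsub>fs (regular_module R) (I \<times> UNIV)\<^esub> z) = r \<odot>\<^bsub>restrict_scalars R (fs (regular_module (UP R)) I)\<^esub> cur z"
    using r by (simp add: UP_ops(4)[OF R]) (simp add: cur_def)
qed (simp add: cur_closed)

lemma cur_single: "r \<in> carrier R \<Longrightarrow> cur (single (regular_module R) (i, c) r) = single (regular_module (UP R)) i (monom (UP R) r c)"
  by (auto simp: cur_def single_def UP_ops[OF R] fun_eq_iff)

text \<open>The column at \<open>(j, b)\<close> is \<open>x^b\<close> times column \<open>j\<close>,
  expanded over the basis of powers of \<open>x\<close>.\<close>

definition restricted_matrix :: "('i \<Rightarrow> 'i \<Rightarrow> nat \<Rightarrow> 'a) \<Rightarrow> 'i \<times> nat \<Rightarrow> 'i \<times> nat \<Rightarrow> 'a"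
  where "restricted_matrix A = (\<lambda>(j, b). unc (act (regular_module (UP R)) (A j) (monom (UP R) \<one>\<^bsub>R\<^esub> b)))"

lemma restricted_matrix_closed:
  assumes "\<And>j. j \<in> J \<Longrightarrow> A j \<in> carrier (fs (regular_module (UP R)) I)" "x \<in> J \<times> UNIV"
  shows "restricted_matrix A x \<in> carrier (fs (regular_module R) (I \<times> UNIV))"
proof -
  have "act (regular_module (UP R)) (A j) (monom (UP R) \<one>\<^bsub>R\<^esub> b) \<in> carrier (fs (regular_module (UP R)) I)" if "j \<in> J" for j b
    by (rule act_closed[OF modules_regular(2) assms(1)[OF that]]) simp
  then show ?thesis using assms(2) unc_closed by (auto simp: restricted_matrix_def)
qed

lemma cur_mx:
  assumes A: "\<And>j. j \<in> J \<Longrightarrow> A j \<in> carrier (fs (regular_module (UP R)) I)" and z: "z \<in> carrier (fs (regular_module R) (J \<times> UNIV))"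
  shows "cur (mx (regular_module R) (I \<times> UNIV) (restricted_matrix A) z) = mx (regular_module (UP R)) I A (cur z)"
proof -
  have rA: "restricted_matrix A x \<in> carrier (fs (regular_module R) (I \<times> UNIV))" if "x \<in> J \<times> UNIV" for x
    by (rule restricted_matrix_closed[OF A that])
  have mods: "module R (restrict_scalars R (fs (regular_module (UP R)) I))"
    by (rule module_restrict_scalars[OF R module_fs[OF modules_regular(2)]])
  show ?thesis
  proof (rule fs_hom_eq[OF modules_regular(1) mods mod_hom_comp[OF mx_hom[OF modules_regular(1) rA] cur_hom] _ _ z])
    show "(\<lambda>z. mx (regular_module (UP R)) I A (cur z)) \<in> mod_hom R (fs (regular_module R) (J \<times> UNIV)) (restrict_scalars R (fs (regular_module (UP R)) I))"
      by (rule mod_hom_comp[OF cur_hom mod_hom_restrict_scalars[OF R mx_hom[OF modules_regular(2) A]]])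
    fix x r assume x: "x \<in> J \<times> (UNIV :: nat set)" and "r \<in> carrier (regular_module R)"
    then obtain j b where jb: "x = (j, b)" "j \<in> J" and r: "r \<in> carrier R" by auto
    have m: "monom (UP R) r b \<in> carrier (regular_module (UP R))" using r by simp
    have rx: "restricted_matrix A x i \<in> carrier R" for i using fs_value[OF rA[OF x]] by simp
    have Aj: "A j i \<in> carrier (UP R)" for i using fs_value[OF A[OF jb(2)]] by simp
    have "mx (regular_module R) (I \<times> UNIV) (restricted_matrix A) (single (regular_module R) x r) = act (regular_module R) (restricted_matrix A x) r"
      by (rule mx_single[OF modules_regular(1) rA x]) (use r in simp_all)
    also have "\<dots> = r \<odot>\<^bsub>fs (regular_module R) (I \<times> UNIV)\<^esub> restricted_matrix A x"
      using r rx by (simp add: act_def R.m_comm)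
    finally have "cur (mx (regular_module R) (I \<times> UNIV) (restricted_matrix A) (single (regular_module R) x r)) =
        cur (r \<odot>\<^bsub>fs (regular_module R) (I \<times> UNIV)\<^esub> restricted_matrix A x)"
      by (rule arg_cong)
    also have "\<dots> = r \<odot>\<^bsub>restrict_scalars R (fs (regular_module (UP R)) I)\<^esub> act (regular_module (UP R)) (A j) (monom (UP R) \<one>\<^bsub>R\<^esub> b)"
      unfolding mod_homD(3)[OF cur_hom r rA[OF x]] by (simp only: restricted_matrix_def jb(1) prod.case cur_unc)
    also have "\<dots> = act (regular_module (UP R)) (A j) (monom (UP R) r b)"
    proof
      fix i
      have "monom (UP R) r 0 \<otimes>\<^bsub>UP R\<^esub> (A j i \<otimes>\<^bsub>UP R\<^esub> monom (UP R) \<one>\<^bsub>R\<^esub> b) = A j i \<otimes>\<^bsub>UP R\<^esub> (monom (UP R) r 0 \<otimes>\<^bsub>UP R\<^esub> monom (UP R) \<one>\<^bsub>R\<^esub> b)"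
        by (simp only: U.UP_m_assoc[OF U.monom_closed[OF r] Aj U.monom_closed[OF R.one_closed], symmetric]
            U.UP_m_comm[OF U.monom_closed[OF r] Aj] U.UP_m_assoc[OF Aj U.monom_closed[OF r] U.monom_closed[OF R.one_closed]])
      also have "monom (UP R) r 0 \<otimes>\<^bsub>UP R\<^esub> monom (UP R) \<one>\<^bsub>R\<^esub> b = monom (UP R) r b"
        using U.monom_mult[OF r R.one_closed, of 0 b] r by simp
      finally show "(r \<odot>\<^bsub>restrict_scalars R (fs (regular_module (UP R)) I)\<^esub> act (regular_module (UP R)) (A j) (monom (UP R) \<one>\<^bsub>R\<^esub> b)) i = act (regular_module (UP R)) (A j) (monom (UP R) r b) i"
        by (simp add: act_def)
    qed
    also have "\<dots> = mx (regular_module (UP R)) I A (single (regular_module (UP R)) j (monom (UP R) r b))"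
      by (rule mx_single[OF modules_regular(2) A jb(2) m, symmetric])
    finally show "cur (mx (regular_module R) (I \<times> UNIV) (restricted_matrix A) (single (regular_module R) x r)) = mx (regular_module (UP R)) I A (cur (single (regular_module R) x r))"
      by (simp add: jb(1) cur_single[OF r])
  qed
qed

text \<open>Currying is bijective and commutes with the differentials, so vanishing squares and
  exactness carry over.\<close>

lemma free_resolution_restrict:
  assumes res: "free_resolution (UP R) I A"
  shows "free_resolution R (\<lambda>k. I k \<times> UNIV) (\<lambda>k. restricted_matrix (A k))"
proof -
  note A = free_resolutionD[OF res]
  have rA: "restricted_matrix (A k) x \<in> carrier (fs (regular_module R) (I k \<times> UNIV))" if "x \<in> I (Suc k) \<times> UNIV" for k x
    by (rule restricted_matrix_closed[OF A(1) that])
  have mxr: "cur (mx (regular_module R) (I k \<times> UNIV) (restricted_matrix (A k)) z) = mx (regular_module (UP R)) (I k) (A k) (cur z)"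
    if "z \<in> carrier (fs (regular_module R) (I (Suc k) \<times> UNIV))" for k z
    by (rule cur_mx[OF A(1) that])
  have zero: "cur z = (\<lambda>_. \<zero>\<^bsub>UP R\<^esub>) \<longleftrightarrow> z = (\<lambda>_. \<zero>\<^bsub>R\<^esub>)" for z :: "'b \<times> nat \<Rightarrow> 'a"
    by (auto simp: cur_def UP_ops(1)[OF R] fun_eq_iff)
  show ?thesis unfolding free_resolution_def
  proof (intro conjI allI ballI impI)
    fix k x assume x: "x \<in> I (Suc (Suc k)) \<times> (UNIV :: nat set)"
    then obtain j b where jb: "x = (j, b)" "j \<in> I (Suc (Suc k))" by auto
    have m: "monom (UP R) \<one>\<^bsub>R\<^esub> b \<in> carrier (regular_module (UP R))" by simp
    have "cur (mx (regular_module R) (I k \<times> UNIV) (restricted_matrix (A k)) (restricted_matrix (A (Suc k)) x)) =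
        mx (regular_module (UP R)) (I k) (A k) (act (regular_module (UP R)) (A (Suc k) j) (monom (UP R) \<one>\<^bsub>R\<^esub> b))"
      using mxr[OF rA[OF x]] by (simp add: restricted_matrix_def jb(1))
    also have "\<dots> = act (regular_module (UP R)) (mx (regular_module (UP R)) (I k) (A k) (A (Suc k) j)) (monom (UP R) \<one>\<^bsub>R\<^esub> b)"
      by (rule mx_act[OF modules_regular(2) m A(1) A(1)[OF jb(2)]])
    also have "\<dots> = (\<lambda>_. \<zero>\<^bsub>UP R\<^esub>)" unfolding A(2)[OF jb(2)] by (simp add: act_def)
    finally show "mx (regular_module R) (I k \<times> UNIV) (restricted_matrix (A k)) (restricted_matrix (A (Suc k)) x) = \<zero>\<^bsub>fs (regular_module R) (I k \<times> UNIV)\<^esub>"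
      by (simp add: zero)
  next
    fix k z assume z: "z \<in> carrier (fs (regular_module R) (I (Suc (Suc k)) \<times> (UNIV :: nat set)))"
      "mx (regular_module R) (I (Suc k) \<times> UNIV) (restricted_matrix (A (Suc k))) z = \<zero>\<^bsub>fs (regular_module R) (I (Suc k) \<times> UNIV)\<^esub>"
    have "mx (regular_module (UP R)) (I (Suc k)) (A (Suc k)) (cur z) = (\<lambda>_. \<zero>\<^bsub>UP R\<^esub>)"
      unfolding mxr[OF z(1), symmetric] using z(2) by (simp add: zero)
    from A(3)[OF cur_closed[OF z(1)] this] obtain w where w: "w \<in> carrier (fs (regular_module (UP R)) (I (Suc (Suc (Suc k)))))"
      "mx (regular_module (UP R)) (I (Suc (Suc k))) (A (Suc (Suc k))) w = cur z" by blast
    have "cur (mx (regular_module R) (I (Suc (Suc k)) \<times> UNIV) (restricted_matrix (A (Suc (Suc k)))) (unc w)) = cur z"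
      using mxr[OF unc_closed[OF w(1)]] w(2) by simp
    then have "mx (regular_module R) (I (Suc (Suc k)) \<times> UNIV) (restricted_matrix (A (Suc (Suc k)))) (unc w) = z"
      by (metis cur_unc(2))
    then show "\<exists>w\<in>carrier (fs (regular_module R) (I (Suc (Suc (Suc k))) \<times> UNIV)).
        mx (regular_module R) (I (Suc (Suc k)) \<times> UNIV) (restricted_matrix (A (Suc (Suc k)))) w = z"
      using unc_closed[OF w(1)] by blast
  qed (rule rA)
qed

end

text \<open>The counterpart of \<open>fs_hom_eq\<close> for maps that are linear over
  \<open>R\<close> only: the elements \<open>single M i m\<close> with arbitrary \<open>m\<close>
  generate additively.\<close>

lemma fs_hom_eq_restrict_scalars:
  assumes R: "cring R" and M: "module (UP R) M" and N: "module R N"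
    and h: "h \<in> mod_hom R (restrict_scalars R (fs M I)) N" "h' \<in> mod_hom R (restrict_scalars R (fs M I)) N"
    and eq: "\<And>i m. i \<in> I \<Longrightarrow> m \<in> carrier M \<Longrightarrow> h (single M i m) = h' (single M i m)"
    and z: "z \<in> carrier (fs M I)"
  shows "h z = h' z"
  using M z
proof (induction rule: fs_induct)
  case zero
  have "module R (restrict_scalars R (fs M I))" by (rule module_restrict_scalars[OF R module_fs[OF M]])
  from mod_hom_zero_minus(1)[OF this N] h show ?case by (metis restrict_scalars_simps(2))
next
  case (add i m z)
  have "single M i m \<in> carrier (fs M I)" by (rule single_closed[OF M add(1,2)])
  with add eq mod_homD(2)[OF h(1)] mod_homD(2)[OF h(2)] show ?case by (metis restrict_scalars_simps(1,3))
qed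

text \<open>Multiplication by \<open>x\<close> on the factor \<open>R[x]\<close>, in terms of
  coefficients; \<open>c\<close> stands for the zero of the module of values.\<close>

definition shift :: "'b \<Rightarrow> ('i \<times> nat \<Rightarrow> 'b) \<Rightarrow> 'i \<times> nat \<Rightarrow> 'b"
  where "shift c z = (\<lambda>(i, b). case b of 0 \<Rightarrow> c | Suc b \<Rightarrow> z (i, b))"

lemma shift_simps [simp]: "shift c z (i, 0) = c" "shift c z (i, Suc b) = z (i, b)"
  by (simp_all add: shift_def)

lemma shift_hom:
  assumes "module R M"
  shows "shift \<zero>\<^bsub>M\<^esub> \<in> mod_hom R (fs M (I \<times> UNIV)) (fs M (I \<times> UNIV))"
proof -
  interpret module R M by fact
  have closed: "shift \<zero>\<^bsub>M\<^esub> z \<in> carrier (fs M (I \<times> UNIV))" if "z \<in> carrier (fs M (I \<times> UNIV))" for z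
  proof -
    have z: "\<And>x. z x \<in> carrier M" "\<And>x. x \<notin> I \<times> UNIV \<Longrightarrow> z x = \<zero>\<^bsub>M\<^esub>" "finite {x. z x \<noteq> \<zero>\<^bsub>M\<^esub>}"
      using that unfolding fs_carrier by blast+
    have "{x. shift \<zero>\<^bsub>M\<^esub> z x \<noteq> \<zero>\<^bsub>M\<^esub>} \<subseteq> (\<lambda>(i, b). (i, Suc b)) ` {x. z x \<noteq> \<zero>\<^bsub>M\<^esub>}"
    proof
      fix x assume x: "x \<in> {x. shift \<zero>\<^bsub>M\<^esub> z x \<noteq> \<zero>\<^bsub>M\<^esub>}"
      obtain i b where ib: "x = (i, b)" by (cases x)
      with x obtain b' where "b = Suc b'" by (cases b) auto
      with x ib show "x \<in> (\<lambda>(i, b). (i, Suc b)) ` {x. z x \<noteq> \<zero>\<^bsub>M\<^esub>}"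
        by (intro image_eqI[of _ _ "(i, b')"]) auto
    qed
    then have "finite {x. shift \<zero>\<^bsub>M\<^esub> z x \<noteq> \<zero>\<^bsub>M\<^esub>}" by (rule finite_subset) (rule finite_imageI[OF z(3)])
    moreover have "shift \<zero>\<^bsub>M\<^esub> z x \<in> carrier M" for x using z(1) by (cases x, cases "snd x") auto
    moreover have "shift \<zero>\<^bsub>M\<^esub> z x = \<zero>\<^bsub>M\<^esub>" if "x \<notin> I \<times> UNIV" for x
      using z(2) that by (cases x, cases "snd x") auto
    ultimately show ?thesis unfolding fs_carrier by blast
  qed
  show ?thesis
    by (rule mod_homI) (use closed in \<open>auto simp: shift_def fun_eq_iff split: nat.split\<close>)
qed

lemma shift_single: "shift \<zero>\<^bsub>M\<^esub> (single M (i, b) m) = single M (i, Suc b) m"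
  by (auto simp: shift_def single_def fun_eq_iff split: nat.split)

lemma shift_restricted_matrix:
  assumes R: "cring R" and A: "A j \<in> carrier (fs (regular_module (UP R)) I)"
  shows "shift \<zero>\<^bsub>R\<^esub> (restricted_matrix R A (j, b)) = restricted_matrix R A (j, Suc b)"
proof -
  interpret R: cring R by (rule R)
  interpret U: UP_cring R "UP R" by (rule UP_cring.intro[OF R])
  have Aj: "A j i \<in> carrier (UP R)" for i using fs_value[OF A] by simp
  have "A j i \<otimes>\<^bsub>UP R\<^esub> monom (UP R) \<one>\<^bsub>R\<^esub> (Suc b) = (\<lambda>c. case c of 0 \<Rightarrow> \<zero>\<^bsub>R\<^esub> | Suc c \<Rightarrow> (A j i \<otimes>\<^bsub>UP R\<^esub> monom (UP R) \<one>\<^bsub>R\<^esub> b) c)" for i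
  proof -
    have "A j i \<otimes>\<^bsub>UP R\<^esub> monom (UP R) \<one>\<^bsub>R\<^esub> (Suc b) = A j i \<otimes>\<^bsub>UP R\<^esub> (monom (UP R) \<one>\<^bsub>R\<^esub> b \<otimes>\<^bsub>UP R\<^esub> monom (UP R) \<one>\<^bsub>R\<^esub> 1)"
      using U.monom_mult[OF R.one_closed R.one_closed, of b 1] by simp
    also have "\<dots> = (A j i \<otimes>\<^bsub>UP R\<^esub> monom (UP R) \<one>\<^bsub>R\<^esub> b) \<otimes>\<^bsub>UP R\<^esub> monom (UP R) \<one>\<^bsub>R\<^esub> 1"
      by (rule U.UP_m_assoc[symmetric]) (use Aj in simp_all)
    also have "\<dots> = (\<lambda>c. case c of 0 \<Rightarrow> \<zero>\<^bsub>R\<^esub> | Suc c \<Rightarrow> (A j i \<otimes>\<^bsub>UP R\<^esub> monom (UP R) \<one>\<^bsub>R\<^esub> b) c)"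
      by (rule UP_ops(5)[OF R]) (use Aj in simp)
    finally show ?thesis .
  qed
  then show ?thesis
    by (auto simp: restricted_matrix_def[OF R] unc_def act_def shift_def fun_eq_iff split: nat.split)
qed

lemma X_power_commute_mx:
  assumes R: "cring R" and M: "module (UP R) M"
    and A: "\<And>x. x \<in> J \<Longrightarrow> A x \<in> carrier (fs (regular_module R) I)" and z: "z \<in> carrier (fs (restrict_scalars R M) J)"
  shows "mx (restrict_scalars R M) I A (\<lambda>x. X_power R M c (z x)) = (\<lambda>x. X_power R M c (mx (restrict_scalars R M) I A z x))"
  by (rule mx_natural[OF module_restrict_scalars[OF R M] module_restrict_scalars[OF R M] X_power_hom[OF R M] A z])

text \<open>The map \<open>x \<otimes> 1 - 1 \<otimes> x\<close> on
  \<open>R[x]^(I) \<otimes> M\<close>, the tensor product being taken over \<open>R\<close>.\<close>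

definition poly_phi :: "('a, 'm) ring_scheme \<Rightarrow> (nat \<Rightarrow> 'a, 'b, 'n) module_scheme \<Rightarrow> 'i set \<Rightarrow> ('i \<times> nat \<Rightarrow> 'b) \<Rightarrow> 'i \<times> nat \<Rightarrow> 'b"
  where "poly_phi R M I z = shift \<zero>\<^bsub>M\<^esub> z \<ominus>\<^bsub>fs (restrict_scalars R M) (I \<times> UNIV)\<^esub> (\<lambda>x. X_power R M (Suc 0) (z x))"

text \<open>The canonical map to the tensor product over \<open>R[x]\<close>, which is
  \<open>M^(I)\<close>. It sends \<open>x^b e_i \<otimes> m\<close> to
  \<open>e_i \<otimes> x^b m\<close>.\<close>

definition poly_psi :: "('a, 'm) ring_scheme \<Rightarrow> (nat \<Rightarrow> 'a, 'b, 'n) module_scheme \<Rightarrow> 'i set \<Rightarrow> ('i \<times> nat \<Rightarrow> 'b) \<Rightarrow> 'i \<Rightarrow> 'b"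
  where "poly_psi R M I = fs_lift (restrict_scalars R M) (restrict_scalars R (fs M I)) (\<lambda>(i, b) m. single M i (X_power R M b m))"

text \<open>An \<open>R\<close>-linear section of \<open>poly_psi\<close>, with values in the part
  of degree 0 in \<open>x\<close>.\<close>

definition poly_iota :: "'b \<Rightarrow> ('i \<Rightarrow> 'b) \<Rightarrow> 'i \<times> nat \<Rightarrow> 'b"
  where "poly_iota c z = (\<lambda>(i, b). if b = 0 then z i else c)"

section \<open>Exactness and naturality of the sequence of
  \<open>x \<otimes> 1 - 1 \<otimes> x\<close>\<close>

context
  fixes R :: "('a, 'm) ring_scheme" and M :: "(nat \<Rightarrow> 'a, 'b, 'n) module_scheme"
  assumes R: "cring R" and M: "module (UP R) M"
begin

interpretation R: cring R by (fact R)
interpretation U: UP_cring R "UP R" by (rule UP_cring.intro[OF R])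
interpretation M: module "UP R" M by (fact M)

abbreviation (input) "M' \<equiv> restrict_scalars R M"
abbreviation (input) "big I \<equiv> fs M' (I \<times> (UNIV :: nat set))"
abbreviation (input) "small I \<equiv> restrict_scalars R (fs M I)"
abbreviation (input) "xp \<equiv> X_power R M"

lemma mod_M': "module R M'" by (rule module_restrict_scalars[OF R M])
lemma mod_big: "module R (big I)" by (rule module_fs[OF mod_M'])
lemma mod_small: "module R (small I)" by (rule module_restrict_scalars[OF R module_fs[OF M]])

interpretation M': module R M' by (rule mod_M')

lemma poly_phi_hom: "poly_phi R M I \<in> mod_hom R (big I) (big I)"
  unfolding poly_phi_def[abs_def]
  by (rule mod_hom_minus[OF mod_big shift_hom[OF mod_M', simplified] fs_post[OF mod_M' mod_M' X_power_hom[OF R M]]])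

lemma minus_M': "x \<in> carrier M \<Longrightarrow> \<ominus>\<^bsub>M'\<^esub> x = \<ominus>\<^bsub>M\<^esub> x"
  by (metis M.M.l_neg M.M.a_inv_closed M'.M.minus_equality restrict_scalars_simps(1-3))

lemma poly_phi_value:
  assumes "z \<in> carrier (big I)"
  shows "poly_phi R M I z x = shift \<zero>\<^bsub>M\<^esub> z x \<ominus>\<^bsub>M\<^esub> xp (Suc 0) (z x)"
proof -
  have c: "(\<lambda>x. xp (Suc 0) (z x)) \<in> carrier (big I)"
    by (rule mod_homD(1)[OF fs_post[OF mod_M' mod_M' X_power_hom[OF R M]] assms])
  show ?thesis
    using fs_value[OF c] unfolding poly_phi_def by (simp add: a_minus_def fs_minus[OF mod_M' c] minus_M')
qed

lemma poly_phi_single: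
  assumes "i \<in> I" "m \<in> carrier M"
  shows "poly_phi R M I (single M' (i, b) m) = single M' (i, Suc b) m \<ominus>\<^bsub>big I\<^esub> single M' (i, b) (xp (Suc 0) m)"
proof -
  have "(\<lambda>x. xp (Suc 0) (single M' (i, b) m x)) = single M' (i, b) (xp (Suc 0) m)"
    by (rule fs_post_single[OF mod_M' mod_M' X_power_hom[OF R M]])
  moreover have "shift \<zero>\<^bsub>M\<^esub> (single M' (i, b) m) = single M' (i, Suc b) m"
    using shift_single[of M' i b m] by simp
  ultimately show ?thesis by (simp add: poly_phi_def)
qed

lemma poly_psi_term: "i \<in> I \<Longrightarrow> (\<lambda>m. single M i (xp b m)) \<in> mod_hom R M' (small I)"
  by (rule mod_hom_comp[OF X_power_hom[OF R M] mod_hom_restrict_scalars[OF R single_hom[OF M]]])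

lemma poly_psi_hom: "poly_psi R M I \<in> mod_hom R (big I) (small I)"
  unfolding poly_psi_def
  by (rule fs_lift(1)[OF mod_M' mod_small]) (use poly_psi_term in auto)

lemma poly_psi_single:
  assumes "i \<in> I" "m \<in> carrier M"
  shows "poly_psi R M I (single M' (i, b) m) = single M i (xp b m)"
proof -
  have "poly_psi R M I (single M' (i, b) m) = (\<lambda>(i, b) m. single M i (xp b m)) (i, b) m"
    unfolding poly_psi_def
    by (rule fs_lift(2)[OF mod_M' mod_small, of "I \<times> UNIV"]) (use poly_psi_term assms in auto)
  then show ?thesis by simp
qed

lemma poly_iota_hom: "poly_iota \<zero>\<^bsub>M\<^esub> \<in> mod_hom R (small I) (big I)"
proof (rule mod_homI)
  fix z assume "z \<in> carrier (small I)"
  then have z: "\<And>x. z x \<in> carrier M" "\<And>x. x \<notin> I \<Longrightarrow> z x = \<zero>\<^bsub>M\<^esub>" "finite {x. z x \<noteq> \<zero>\<^bsub>M\<^esub>}"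
    by (auto simp: fs_carrier)
  have "{x. poly_iota \<zero>\<^bsub>M\<^esub> z x \<noteq> \<zero>\<^bsub>M\<^esub>} \<subseteq> (\<lambda>i. (i, 0)) ` {x. z x \<noteq> \<zero>\<^bsub>M\<^esub>}"
    by (auto simp: poly_iota_def split: if_splits)
  then have "finite {x. poly_iota \<zero>\<^bsub>M\<^esub> z x \<noteq> \<zero>\<^bsub>M\<^esub>}" by (rule finite_subset) (rule finite_imageI[OF z(3)])
  then show "poly_iota \<zero>\<^bsub>M\<^esub> z \<in> carrier (big I)" using z(1,2) by (auto simp: fs_carrier poly_iota_def)
qed (auto simp: poly_iota_def fun_eq_iff)

lemma poly_iota_single: "poly_iota \<zero>\<^bsub>M\<^esub> (single M i m) = single M' (i, 0) m"
  by (auto simp: poly_iota_def single_def fun_eq_iff)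

lemma poly_psi_iota:
  assumes "z \<in> carrier (fs M I)" shows "poly_psi R M I (poly_iota \<zero>\<^bsub>M\<^esub> z) = z"
proof (rule fs_hom_eq_restrict_scalars[where h' = "\<lambda>z. z", OF R M mod_small mod_hom_comp[OF poly_iota_hom poly_psi_hom] _ _ assms])
  show "(\<lambda>z. z) \<in> mod_hom R (small I) (small I)" by (rule mod_homI) auto
qed (simp add: poly_iota_single poly_psi_single X_power_0[OF R M])

lemma poly_psi_phi:
  assumes "z \<in> carrier (big I)" shows "poly_psi R M I (poly_phi R M I z) = \<zero>\<^bsub>small I\<^esub>"
proof (rule fs_hom_eq[OF mod_M' mod_small mod_hom_comp[OF poly_phi_hom poly_psi_hom] mod_hom_zero[OF mod_small] _ assms])
  fix x m assume "x \<in> I \<times> (UNIV :: nat set)" and "m \<in> carrier M'"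
  then obtain i b where x: "x = (i, b)" "i \<in> I" and m: "m \<in> carrier M" by auto
  have xm: "xp (Suc 0) m \<in> carrier M" by (rule X_power_closed[OF R M m])
  have s: "single M' (i, b) n \<in> carrier (big I)" if "n \<in> carrier M" for b n
    by (rule single_closed[OF mod_M']) (use x that in auto)
  have "poly_psi R M I (poly_phi R M I (single M' x m)) =
      poly_psi R M I (single M' (i, Suc b) m) \<ominus>\<^bsub>small I\<^esub> poly_psi R M I (single M' (i, b) (xp (Suc 0) m))"
    unfolding x(1) poly_phi_single[OF x(2) m]
    by (rule mod_hom_diff[OF mod_big mod_small poly_psi_hom s[OF m] s[OF xm]])
  also have "poly_psi R M I (single M' (i, Suc b) m) = poly_psi R M I (single M' (i, b) (xp (Suc 0) m))"
    unfolding poly_psi_single[OF x(2) m] poly_psi_single[OF x(2) xm] X_power_Suc[OF R M m, of b] ..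
  finally show "poly_psi R M I (poly_phi R M I (single M' x m)) = \<zero>\<^bsub>small I\<^esub>"
    by (simp only: diff_eq_zero_iff[OF mod_small mod_homD(1)[OF poly_psi_hom s[OF xm]] mod_homD(1)[OF poly_psi_hom s[OF xm]]])
qed

text \<open>Modulo the image of \<open>poly_phi\<close>, \<open>x^(b+1) e_i \<otimes> m\<close>
  equals \<open>x^b e_i \<otimes> x m\<close>. By induction on \<open>b\<close> every element is
  congruent to its image under \<open>poly_psi\<close> followed by \<open>poly_iota\<close>, which
  is zero on the kernel.\<close>

lemma poly_psi_kernel:
  assumes z: "z \<in> carrier (big I)" and zero: "poly_psi R M I z = \<zero>\<^bsub>small I\<^esub>"
  shows "\<exists>y\<in>carrier (big I). poly_phi R M I y = z"
proof -
  define H where "H = poly_phi R M I ` carrier (big I)"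
  define Q where "Q = quot_module (big I) H"
  define \<pi> where "\<pi> = coset_map (big I) H"
  note Q = quot_image[OF mod_big mod_big poly_phi_hom[of I], folded H_def, folded Q_def \<pi>_def]
  have s: "single M' (i, b) n \<in> carrier (big I)" if "i \<in> I" "n \<in> carrier M" for i b n
    by (rule single_closed[OF mod_M']) (use that in auto)
  have red: "\<pi> (single M' (i, b) m) = \<pi> (single M' (i, 0) (xp b m))" if i: "i \<in> I" and m: "m \<in> carrier M" for i b m
    using m
  proof (induction b arbitrary: m)
    case 0
    then show ?case by (simp add: X_power_0[OF R M])
  next
    case (Suc b)
    have xm: "xp (Suc 0) m \<in> carrier M" by (rule X_power_closed[OF R M Suc.prems])
    have "single M' (i, Suc b) m \<ominus>\<^bsub>big I\<^esub> single M' (i, b) (xp (Suc 0) m) \<in> H"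
      unfolding poly_phi_single[OF i Suc.prems, symmetric] H_def by (rule imageI[OF s[OF i Suc.prems]])
    then have "\<pi> (single M' (i, Suc b) m \<ominus>\<^bsub>big I\<^esub> single M' (i, b) (xp (Suc 0) m)) = \<zero>\<^bsub>Q\<^esub>"
      by (simp only: Q(3)[OF abelian_group.minus_closed[OF module.axioms(2)[OF mod_big] s[OF i Suc.prems] s[OF i xm]]])
    then have "\<pi> (single M' (i, Suc b) m) = \<pi> (single M' (i, b) (xp (Suc 0) m))"
      by (rule hom_eq_if_diff[OF mod_big Q(1,2) s[OF i Suc.prems] s[OF i xm]])
    also have "\<dots> = \<pi> (single M' (i, 0) (xp (Suc b) m))"
      unfolding Suc.IH[OF xm] X_power_Suc[OF R M Suc.prems, of b] ..
    finally show ?case .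
  qed
  have "\<pi> z = \<pi> (poly_iota \<zero>\<^bsub>M\<^esub> (poly_psi R M I z))"
  proof (rule fs_hom_eq[OF mod_M' Q(1,2) mod_hom_comp[OF mod_hom_comp[OF poly_psi_hom poly_iota_hom] Q(2)] _ z])
    fix x m assume "x \<in> I \<times> (UNIV :: nat set)" and "m \<in> carrier M'"
    then obtain i b where x: "x = (i, b)" "i \<in> I" and m: "m \<in> carrier M" by auto
    show "\<pi> (single M' x m) = \<pi> (poly_iota \<zero>\<^bsub>M\<^esub> (poly_psi R M I (single M' x m)))"
      unfolding x(1) poly_psi_single[OF x(2) m] poly_iota_single red[OF x(2) m] ..
  qed
  also have "\<dots> = \<zero>\<^bsub>Q\<^esub>"
    unfolding zero mod_hom_zero_minus(1)[OF mod_small mod_big poly_iota_hom] by (rule mod_hom_zero_minus(1)[OF mod_big Q(1,2)])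
  finally have "z \<in> H" using Q(3)[OF z] by simp
  then show ?thesis unfolding H_def by (rule image_bexD)
qed

text \<open>The entries at \<open>b + 1\<close> give \<open>z (i, b) = x z (i, b + 1)\<close>. A
  nonzero entry would force all later ones to be nonzero, against finite support.\<close>

lemma poly_phi_inj:
  assumes z: "z \<in> carrier (big I)" and zero: "poly_phi R M I z = \<zero>\<^bsub>big I\<^esub>"
  shows "z = \<zero>\<^bsub>big I\<^esub>"
proof -
  have zc: "z x \<in> carrier M" for x using fs_value[OF z] by simp
  have step: "z (i, b) = xp (Suc 0) (z (i, Suc b))" for i b
  proof -
    have "z (i, b) \<ominus>\<^bsub>M\<^esub> xp (Suc 0) (z (i, Suc b)) = \<zero>\<^bsub>M\<^esub>"
      using poly_phi_value[OF z, of "(i, Suc b)"] fun_cong[OF zero, of "(i, Suc b)"] by simp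
    then show ?thesis using diff_eq_zero_iff[OF M zc X_power_closed[OF R M zc]] by simp
  qed
  have xp0: "xp (Suc 0) \<zero>\<^bsub>M\<^esub> = \<zero>\<^bsub>M\<^esub>" using mod_hom_zero_minus(1)[OF mod_M' mod_M' X_power_hom[OF R M]] by simp
  have vanish: "z (i, b + k) = \<zero>\<^bsub>M\<^esub> \<Longrightarrow> z (i, b) = \<zero>\<^bsub>M\<^esub>" for i b k
  proof (induction k)
    case (Suc k)
    then show ?case using step[of i "b + k"] xp0 by simp
  qed simp
  have "z (i, b) = \<zero>\<^bsub>M\<^esub>" for i b
  proof (rule ccontr)
    assume "z (i, b) \<noteq> \<zero>\<^bsub>M\<^esub>"
    then have "range (\<lambda>k. (i, b + k)) \<subseteq> {x. z x \<noteq> \<zero>\<^bsub>M\<^esub>}" using vanish by auto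
    moreover have "finite {x. z x \<noteq> \<zero>\<^bsub>M\<^esub>}" using z by (simp add: fs_carrier)
    ultimately have "finite (range (\<lambda>k. (i, b + k)))" by (rule finite_subset)
    moreover have "inj (\<lambda>k. (i, b + k))" by (rule injI) simp
    ultimately show False using finite_imageD by blast
  qed
  then show ?thesis by auto
qed

text \<open>The differential is linear over \<open>R[x]\<close> in the first factor, hence commutes
  with \<open>shift\<close>; on the second factor it acts through scalars of \<open>R\<close>, hence
  commutes with multiplication by \<open>x\<close> on \<open>M\<close>.\<close>

lemma poly_phi_mx:
  assumes A: "\<And>j. j \<in> J \<Longrightarrow> A j \<in> carrier (fs (regular_module (UP R)) I)" and z: "z \<in> carrier (big J)"
  shows "poly_phi R M I (mx M' (I \<times> UNIV) (restricted_matrix R A) z) = mx M' (I \<times> UNIV) (restricted_matrix R A) (poly_phi R M J z)"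
proof -
  let ?D = "mx M' (I \<times> UNIV) (restricted_matrix R A)"
  have rA: "restricted_matrix R A x \<in> carrier (fs (regular_module R) (I \<times> UNIV))" if "x \<in> J \<times> UNIV" for x
    by (rule restricted_matrix_closed[OF R A that])
  have D: "?D \<in> mod_hom R (big J) (big I)" by (rule mx_hom[OF mod_M' rA])
  have "shift \<zero>\<^bsub>M\<^esub> (?D z) = ?D (shift \<zero>\<^bsub>M\<^esub> z)"
  proof (rule fs_hom_eq[OF mod_M' mod_big mod_hom_comp[OF D shift_hom[OF mod_M', simplified]]
        mod_hom_comp[OF shift_hom[OF mod_M', simplified] D] _ z])
    fix x m assume x: "x \<in> J \<times> (UNIV :: nat set)" and m: "m \<in> carrier M'"
    obtain j b where jb: "x = (j, b)" "j \<in> J" using x by auto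
    have "?D (single M' x m) = act M' (restricted_matrix R A x) m" by (rule mx_single[OF mod_M' rA x m])
    then have "shift \<zero>\<^bsub>M\<^esub> (?D (single M' x m)) = act M' (shift \<zero>\<^bsub>R\<^esub> (restricted_matrix R A x)) m"
      using M'.smult_l_null[OF m] by (auto simp: act_def shift_def fun_eq_iff split: nat.split simp del: restrict_scalars_simps(4))
    also have "\<dots> = act M' (restricted_matrix R A (j, Suc b)) m"
      unfolding jb(1) shift_restricted_matrix[where A = A, OF R A[OF jb(2)]] ..
    also have "\<dots> = ?D (single M' (j, Suc b) m)"
      by (rule mx_single[OF mod_M' rA _ m, symmetric]) (use jb in auto)
    also have "single M' (j, Suc b) m = shift \<zero>\<^bsub>M\<^esub> (single M' x m)" using shift_single[of M' j b m] by (simp add: jb(1))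
    finally show "shift \<zero>\<^bsub>M\<^esub> (?D (single M' x m)) = ?D (shift \<zero>\<^bsub>M\<^esub> (single M' x m))" .
  qed
  moreover have "?D (\<lambda>x. xp (Suc 0) (z x)) = (\<lambda>x. xp (Suc 0) (?D z x))"
    by (rule X_power_commute_mx[OF R M rA z])
  moreover have "(\<lambda>x. xp (Suc 0) (z x)) \<in> carrier (big J)"
    by (rule mod_homD(1)[OF fs_post[OF mod_M' mod_M' X_power_hom[OF R M]] z])
  moreover have "shift \<zero>\<^bsub>M\<^esub> z \<in> carrier (big J)" using mod_homD(1)[OF shift_hom[OF mod_M'] z] by simp
  ultimately show ?thesis
    unfolding poly_phi_def using mod_hom_diff[OF mod_big mod_big D] by simp
qed

lemma poly_psi_act:
  assumes p: "p \<in> carrier (fs (regular_module R) (I \<times> UNIV))" and m: "m \<in> carrier M"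
  shows "poly_psi R M I (act M' p m) = act M (cur p) m"
proof -
  have m': "m \<in> carrier M'" using m by simp
  have h: "(\<lambda>p. act M (cur p) m) \<in> mod_hom R (fs (regular_module R) (I \<times> UNIV)) (small I)"
    by (rule mod_hom_comp[OF cur_hom[OF R] mod_hom_restrict_scalars[OF R act_hom_left[OF M m]]])
  show ?thesis
  proof (rule fs_hom_eq[OF modules_regular(1)[OF R] mod_small mod_hom_comp[OF act_hom_left[OF mod_M' m'] poly_psi_hom] h _ p])
    fix x r assume "x \<in> I \<times> (UNIV :: nat set)" and "r \<in> carrier (regular_module R)"
    then obtain i b where x: "x = (i, b)" "i \<in> I" and r: "r \<in> carrier R" by auto
    have rm: "monom (UP R) r 0 \<odot>\<^bsub>M\<^esub> m \<in> carrier M" using r m by simp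
    have "poly_psi R M I (act M' (single (regular_module R) x r) m) = single M i (xp b (monom (UP R) r 0 \<odot>\<^bsub>M\<^esub> m))"
      unfolding act_single[OF mod_M' m'] x(1) using poly_psi_single[OF x(2) rm] by simp
    also have "xp b (monom (UP R) r 0 \<odot>\<^bsub>M\<^esub> m) = monom (UP R) r b \<odot>\<^bsub>M\<^esub> m"
      using U.monom_mult[OF R.one_closed r, of b 0] r m by (simp add: X_power_def M.smult_assoc1[symmetric] del: U.monom_mult)
    also have "single M i (monom (UP R) r b \<odot>\<^bsub>M\<^esub> m) = act M (cur (single (regular_module R) x r)) m"
      unfolding x(1) cur_single[OF R r] act_single[OF M m] ..
    finally show "poly_psi R M I (act M' (single (regular_module R) x r) m) = act M (cur (single (regular_module R) x r)) m" .
  qed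
qed

lemma poly_psi_mx:
  assumes A: "\<And>j. j \<in> J \<Longrightarrow> A j \<in> carrier (fs (regular_module (UP R)) I)" and z: "z \<in> carrier (big J)"
  shows "poly_psi R M I (mx M' (I \<times> UNIV) (restricted_matrix R A) z) = mx M I A (poly_psi R M J z)"
proof -
  let ?D = "mx M' (I \<times> UNIV) (restricted_matrix R A)"
  have rA: "restricted_matrix R A x \<in> carrier (fs (regular_module R) (I \<times> UNIV))" if "x \<in> J \<times> UNIV" for x
    by (rule restricted_matrix_closed[OF R A that])
  have D: "?D \<in> mod_hom R (big J) (big I)" by (rule mx_hom[OF mod_M' rA])
  have DM: "mx M I A \<in> mod_hom R (small J) (small I)"
    by (rule mod_hom_restrict_scalars[OF R mx_hom[OF M A]])
  show ?thesis
  proof (rule fs_hom_eq[OF mod_M' mod_small mod_hom_comp[OF D poly_psi_hom] mod_hom_comp[OF poly_psi_hom DM] _ z])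
    fix x m assume x: "x \<in> J \<times> (UNIV :: nat set)" and m': "m \<in> carrier M'"
    obtain j b where jb: "x = (j, b)" "j \<in> J" using x by auto
    have m: "m \<in> carrier M" using m' by simp
    have Aj: "A j i \<in> carrier (UP R)" for i using fs_value[OF A[OF jb(2)]] by simp
    have "?D (single M' x m) = act M' (restricted_matrix R A x) m" by (rule mx_single[OF mod_M' rA x m'])
    then have "poly_psi R M I (?D (single M' x m)) = act M (cur (restricted_matrix R A x)) m"
      using poly_psi_act[OF rA[OF x] m] by simp
    also have "\<dots> = act M (A j) (xp b m)"
      using Aj m by (auto simp: jb(1) restricted_matrix_def[OF R] act_def X_power_def M.smult_assoc1)
    also have "\<dots> = mx M I A (single M j (xp b m))"
      by (rule mx_single[OF M A jb(2) X_power_closed[OF R M m], symmetric])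
    also have "single M j (xp b m) = poly_psi R M J (single M' x m)"
      unfolding jb(1) by (rule poly_psi_single[OF jb(2) m, symmetric])
    finally show "poly_psi R M I (?D (single M' x m)) = mx M I A (poly_psi R M J (single M' x m))" .
  qed
qed

end

text \<open>The long exact sequence of \<open>0 \<rightarrow> Q \<otimes>\<^sub>R M \<rightarrow> Q \<otimes>\<^sub>R M \<rightarrow> Q \<otimes>\<^bsub>R[x]\<^esub> M \<rightarrow> 0\<close>, where the first map is
  \<open>x \<otimes> 1 - 1 \<otimes> x\<close>.\<close>

lemma tor_killed_polynomial_ring:
  assumes R: "cring R" and S: "submonoid S R" and M: "module (UP R) M"
    and tor: "tor_killed TYPE('i \<times> nat) R S (restrict_scalars R M) n"
  shows "tor_killed TYPE('i) (UP R) (const_polys R S) M (Suc n)"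
  unfolding tor_killed_def
proof (intro allI impI)
  fix I :: "nat \<Rightarrow> 'i set" and A
  assume res: "free_resolution (UP R) I A"
  interpret S: submonoid S R by fact
  interpret R: cring R by fact
  note A = free_resolutionD(1)[OF res]
  note res' = free_resolution_restrict[OF R res]
  let ?M = "restrict_scalars R M"
  note mod = mod_M'[OF R M] mod_big[OF R M] mod_small[OF R M]
  interpret module R ?M by (rule mod)
  interpret big: module R "fs ?M (I k \<times> (UNIV :: nat set))" for k by (rule mod)
  interpret small: module R "restrict_scalars R (fs M (I k))" for k by (rule mod)
  \<comment> \<open>The multiplier is 1. The complex over \<open>R[x]\<close> is regarded as one
    over \<open>R\<close>, like the other two.\<close>
  interpret S_exact_complexes R S "\<one>\<^bsub>R\<^esub>" "\<lambda>k. fs ?M (I k \<times> (UNIV :: nat set))" "\<lambda>k. mx ?M (I k \<times> UNIV) (restricted_matrix R (A k))"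
    "\<lambda>k. fs ?M (I k \<times> (UNIV :: nat set))" "\<lambda>k. mx ?M (I k \<times> UNIV) (restricted_matrix R (A k))"
    "\<lambda>k. restrict_scalars R (fs M (I k))" "\<lambda>k. mx M (I k) (A k)" "\<lambda>k. poly_phi R M (I k)" "\<lambda>k. poly_psi R M (I k)"
  proof (rule S_exact_complexes.intro, goal_cases)
    case (12 a k)
    show ?case by (rule poly_phi_mx[OF R M _ 12]) (rule A)
  next
    case (13 b k)
    show ?case by (rule poly_psi_mx[OF R M _ 13]) (rule A)
  next
    case (14 c k)
    then have c: "c \<in> carrier (fs M (I k))" by simp
    show ?case
      using poly_psi_iota[OF R M c] mod_homD(1)[OF poly_iota_hom[OF R M], of c "I k"] small.smult_one[OF 14] c
      by (intro bexI[of _ "poly_iota \<zero>\<^bsub>M\<^esub> c"]) (simp_all only: restrict_scalars_simps(1))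
  next
    case (15 b k)
    show ?case using poly_psi_kernel[OF R M 15] by (simp only: big.smult_one[OF 15(1)])
  next
    case (16 a k)
    show ?case unfolding poly_phi_inj[OF R M 16] by (rule big.smult_r_null) simp
  next
    case (17 a k)
    show ?case unfolding poly_psi_phi[OF R M 17] by (rule small.smult_r_null) simp
  qed (fact S S.one_closed mod mod_hom_restrict_scalars[OF R free_resolution_hom[OF M res]]
      free_resolution_hom[OF mod(1) res'] poly_phi_hom[OF R M] poly_psi_hom[OF R M]
      free_resolution_square[OF mod(1) res'])+
  \<comment> \<open>The first two complexes coincide; the chase needs the first at index
    \<open>n\<close> and the second at index \<open>Suc n\<close>.\<close>
  have "tor_killed TYPE('i \<times> nat) R S ?M (Suc n)" by (rule tor_killed_mono[OF tor]) simp
  then have "homology_killed S (\<lambda>k. restrict_scalars R (fs M (I k))) (\<lambda>k. mx M (I k) (A k)) (Suc n)"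
    using tor res' unfolding tor_killed_def by (intro homology_right; simp)
  then show "homology_killed (const_polys R S) (\<lambda>k. fs M (I k)) (\<lambda>k. mx M (I k) (A k)) (Suc n)"
    \<comment> \<open>After restriction of scalars \<open>s\<close> acts as the constant polynomial
      \<open>s\<close>, which is the corresponding element of
      \<open>const_polys R S\<close>.\<close>
    unfolding homology_killed_def restrict_scalars_simps const_polys_def by (rule bexE) (rule bexI[OF _ imageI])
qed

section \<open>Modules on which the variable acts as zero\<close>

text \<open>Pullback along evaluation at zero: \<open>p 0\<close> is the constant coefficient of
  \<open>p\<close>.\<close>

definition zero_extension :: "('a, 'b, 'n) module_scheme \<Rightarrow> (nat \<Rightarrow> 'a, 'b) module"
  where "zero_extension N = \<lparr>carrier = carrier N, mult = undefined, one = undefined,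
    zero = \<zero>\<^bsub>N\<^esub>, add = add N, smult = (\<lambda>p m. p 0 \<odot>\<^bsub>N\<^esub> m)\<rparr>"

lemma zero_extension_simps [simp]:
  "carrier (zero_extension N) = carrier N" "\<zero>\<^bsub>zero_extension N\<^esub> = \<zero>\<^bsub>N\<^esub>"
  "x \<oplus>\<^bsub>zero_extension N\<^esub> y = x \<oplus>\<^bsub>N\<^esub> y" "p \<odot>\<^bsub>zero_extension N\<^esub> x = p 0 \<odot>\<^bsub>N\<^esub> x"
  by (simp_all add: zero_extension_def)

lemma UP_coeff_0:
  assumes R: "cring R" and p: "p \<in> carrier (UP R)" "q \<in> carrier (UP R)"
  shows "(p \<otimes>\<^bsub>UP R\<^esub> q) 0 = p 0 \<otimes>\<^bsub>R\<^esub> q 0"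
proof -
  interpret R: cring R by (rule R)
  interpret U: UP_cring R "UP R" by (rule UP_cring.intro[OF R])
  have coeff: "coeff (UP R) p = p" if "p \<in> carrier (UP R)" for p
    using that by (simp add: UP_def)
  have "(p \<otimes>\<^bsub>UP R\<^esub> q) 0 = coeff (UP R) (p \<otimes>\<^bsub>UP R\<^esub> q) 0" using coeff[of "p \<otimes>\<^bsub>UP R\<^esub> q"] p by simp
  also have "\<dots> = coeff (UP R) p 0 \<otimes>\<^bsub>R\<^esub> coeff (UP R) q 0" using U.coeff_mult[OF p, of 0] p by simp
  finally show "(p \<otimes>\<^bsub>UP R\<^esub> q) 0 = p 0 \<otimes>\<^bsub>R\<^esub> q 0" by (simp add: coeff p)
qed

lemma UP_one_0: "\<one>\<^bsub>UP R\<^esub> 0 = \<one>\<^bsub>R\<^esub>"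
  by (simp add: UP_def)

lemma module_zero_extension:
  assumes N: "module R N" shows "module (UP R) (zero_extension N)"
proof -
  interpret N: module R N by fact
  note R = N.is_cring
  interpret U: UP_cring R "UP R" by (rule UP_cring.intro[OF R])
  have pc: "p c \<in> carrier R" if "p \<in> carrier (UP R)" for p c using that UP_carrier_iff[OF R] by blast
  show ?thesis
  proof (rule moduleI, rule cring_UP[OF R], rule abelian_groupI)
    fix x assume "x \<in> carrier (zero_extension N)"
    then show "\<exists>y\<in>carrier (zero_extension N). y \<oplus>\<^bsub>zero_extension N\<^esub> x = \<zero>\<^bsub>zero_extension N\<^esub>"
      by (intro bexI[of _ "\<ominus>\<^bsub>N\<^esub> x"]) (auto simp: N.M.l_neg)
  qed (auto simp: N.M.a_ac pc UP_ops(2)[OF R] UP_coeff_0[OF R] UP_one_0 N.smult_l_distr N.smult_r_distr N.smult_assoc1)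
qed

text \<open>The cone of multiplication by \<open>x\<close> on \<open>Q[x]\<close> for a complex \<open>Q\<close> of free \<open>R\<close>-modules. It resolves
  the cokernel of \<open>Q\<close>, with \<open>x\<close> acting as zero.\<close>

definition prev :: "(nat \<Rightarrow> 'i set) \<Rightarrow> nat \<Rightarrow> 'i set"
  where "prev I k = (case k of 0 \<Rightarrow> {} | Suc k \<Rightarrow> I k)"

definition cone_index :: "(nat \<Rightarrow> 'i set) \<Rightarrow> nat \<Rightarrow> ('i + 'i) set"
  where "cone_index I k = I k <+> prev I k"

text \<open>In blocks this is \<open>(a, b) \<mapsto> (D a + x b, - D b)\<close>, with
  \<open>a\<close> in degree \<open>k + 1\<close> of \<open>Q[x]\<close> and \<open>b\<close> in
  degree \<open>k\<close>; the sign makes the square vanish. For \<open>k = 0\<close> the right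
  summand of the target is empty, and its block is set to zero.\<close>

definition cone_matrix ::
  "('a, 'm) ring_scheme \<Rightarrow> (nat \<Rightarrow> 'i \<Rightarrow> 'i \<Rightarrow> 'a) \<Rightarrow> nat \<Rightarrow> 'i + 'i \<Rightarrow> 'i + 'i \<Rightarrow> nat \<Rightarrow> 'a"
  where "cone_matrix R A k v u =
    (case v of
       Inl j \<Rightarrow> (case u of Inl i \<Rightarrow> monom (UP R) (A k j i) 0 | Inr i \<Rightarrow> \<zero>\<^bsub>UP R\<^esub>)
     | Inr j \<Rightarrow> (case u of Inl i \<Rightarrow> (if i = j then monom (UP R) \<one>\<^bsub>R\<^esub> 1 else \<zero>\<^bsub>UP R\<^esub>)
                | Inr i \<Rightarrow> (case k of 0 \<Rightarrow> \<zero>\<^bsub>UP R\<^esub> | Suc k \<Rightarrow> monom (UP R) (\<ominus>\<^bsub>R\<^esub> A k j i) 0)))"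

lemma fs_component:
  assumes z: "z \<in> carrier (fs M (I <+> J))"
  shows "(\<lambda>i. z (Inl i)) \<in> carrier (fs M I)" "(\<lambda>i. z (Inr i)) \<in> carrier (fs M J)"
proof -
  have fin: "finite {x. z x \<noteq> \<zero>\<^bsub>M\<^esub>}" using z by (simp add: fs_carrier)
  have "finite {i. z (Inl i) \<noteq> \<zero>\<^bsub>M\<^esub>}" "finite {i. z (Inr i) \<noteq> \<zero>\<^bsub>M\<^esub>}"
    using finite_vimageI[OF fin inj_Inl] finite_vimageI[OF fin inj_Inr] by (simp_all add: vimage_def)
  then show "(\<lambda>i. z (Inl i)) \<in> carrier (fs M I)" "(\<lambda>i. z (Inr i)) \<in> carrier (fs M J)"
    using z by (auto simp: fs_carrier)
qed

lemma fs_case_sum: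
  assumes "a \<in> carrier (fs M I)" "b \<in> carrier (fs M J)"
  shows "case_sum a b \<in> carrier (fs M (I <+> J))"
proof -
  have "{x. case_sum a b x \<noteq> \<zero>\<^bsub>M\<^esub>} \<subseteq> Inl ` {i. a i \<noteq> \<zero>\<^bsub>M\<^esub>} \<union> Inr ` {i. b i \<noteq> \<zero>\<^bsub>M\<^esub>}"
  proof
    fix x assume "x \<in> {x. case_sum a b x \<noteq> \<zero>\<^bsub>M\<^esub>}"
    then show "x \<in> Inl ` {i. a i \<noteq> \<zero>\<^bsub>M\<^esub>} \<union> Inr ` {i. b i \<noteq> \<zero>\<^bsub>M\<^esub>}" by (cases x) auto
  qed
  moreover have "finite (Inl ` {i. a i \<noteq> \<zero>\<^bsub>M\<^esub>} \<union> Inr ` {i. b i \<noteq> \<zero>\<^bsub>M\<^esub>})" using assms by (simp add: fs_carrier)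
  ultimately have "finite {x. case_sum a b x \<noteq> \<zero>\<^bsub>M\<^esub>}" by (rule finite_subset)
  then show ?thesis using assms by (auto simp: fs_carrier split: sum.splits)
qed

lemma fs_component_eqI:
  "(\<And>i. z (Inl i) = w (Inl i)) \<Longrightarrow> (\<And>i. z (Inr i) = w (Inr i)) \<Longrightarrow> z = w"
  by (rule ext, case_tac x) auto

section \<open>Exactness of the cone\<close>

context
  fixes R :: "('a, 'm) ring_scheme" and I :: "nat \<Rightarrow> 'i set" and A :: "nat \<Rightarrow> 'i \<Rightarrow> 'i \<Rightarrow> 'a"
  assumes R: "cring R" and res: "free_resolution R I A"
begin

interpretation R: cring R by (fact R)
interpretation U: UP_cring R "UP R" by (rule UP_cring.intro[OF R])

abbreviation (input) "FR k \<equiv> fs (regular_module R) (I k)"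
abbreviation (input) "FX k \<equiv> fs (regular_module (UP R)) (cone_index I k)"
abbreviation (input) "D k \<equiv> mx (regular_module R) (I k) (A k)"
abbreviation (input) "D' k \<equiv> mx (regular_module (UP R)) (cone_index I k) (cone_matrix R A k)"

lemma poly_value: "p \<in> carrier (UP R) \<Longrightarrow> p c \<in> carrier R"
  using UP_carrier_iff[OF R] by blast

lemma matrix_value: "j \<in> I (Suc k) \<Longrightarrow> A k j i \<in> carrier R"
  using fs_value[OF free_resolutionD(1)[OF res]] by simp

lemma modsR: "module R (regular_module R)" "module (UP R) (regular_module (UP R))"
  by (rule modules_regular[OF R])+

lemma minus_regular: "x \<in> carrier R \<Longrightarrow> \<ominus>\<^bsub>regular_module R\<^esub> x = \<ominus>\<^bsub>R\<^esub> x"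
  using abelian_group.r_neg[OF module.axioms(2)[OF modsR(1)], of x]
    abelian_group.a_inv_closed[OF module.axioms(2)[OF modsR(1)], of x]
  by simp (metis R.minus_equality R.a_comm)

lemma D_hom: "D k \<in> mod_hom R (FR (Suc k)) (FR k)"
  by (rule free_resolution_hom[OF modsR(1) res])

lemma const_closed:
  assumes "w \<in> carrier (fs (regular_module R) J)" shows "(\<lambda>i. monom (UP R) (w i) 0) \<in> carrier (fs (regular_module (UP R)) J)"
proof -
  have w: "w i \<in> carrier R" for i using fs_value[OF assms] by simp
  have "{i. monom (UP R) (w i) 0 \<noteq> \<zero>\<^bsub>UP R\<^esub>} \<subseteq> {i. w i \<noteq> \<zero>\<^bsub>R\<^esub>}" by auto
  moreover have "finite {i. w i \<noteq> \<zero>\<^bsub>R\<^esub>}" using assms by (simp add: fs_carrier)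
  ultimately have "finite {i. monom (UP R) (w i) 0 \<noteq> \<zero>\<^bsub>UP R\<^esub>}" by (rule finite_subset)
  then show ?thesis using assms w by (auto simp: fs_carrier)
qed

lemma cone_matrix_closed:
  assumes v: "v \<in> cone_index I (Suc k)"
  shows "cone_matrix R A k v \<in> carrier (FX k)"
proof -
  have zero: "(\<lambda>_. \<zero>\<^bsub>UP R\<^esub>) \<in> carrier (fs (regular_module (UP R)) J)" for J :: "'i set" by (simp add: fs_carrier)
  show ?thesis
  proof (cases v)
    case (Inl j)
    then have j: "j \<in> I (Suc k)" using v by (auto simp: cone_index_def)
    have "cone_matrix R A k v = case_sum (\<lambda>i. monom (UP R) (A k j i) 0) (\<lambda>_. \<zero>\<^bsub>UP R\<^esub>)"
      by (auto simp: cone_matrix_def Inl fun_eq_iff split: sum.split)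
    then show ?thesis unfolding cone_index_def
      using fs_case_sum[OF const_closed[OF free_resolutionD(1)[OF res j]] zero] by simp
  next
    case (Inr j)
    then have j: "j \<in> I k" using v by (auto simp: cone_index_def prev_def)
    define b where "b = (\<lambda>i. case k of 0 \<Rightarrow> \<zero>\<^bsub>UP R\<^esub> | Suc k \<Rightarrow> monom (UP R) (\<ominus>\<^bsub>R\<^esub> A k j i) 0)"
    have eq: "cone_matrix R A k v = case_sum (single (regular_module (UP R)) j (monom (UP R) \<one>\<^bsub>R\<^esub> 1)) b"
      by (auto simp: cone_matrix_def Inr b_def single_def fun_eq_iff split: sum.split)
    have a: "single (regular_module (UP R)) j (monom (UP R) \<one>\<^bsub>R\<^esub> 1) \<in> carrier (fs (regular_module (UP R)) (I k))"
      by (rule single_closed[OF modsR(2) j]) simp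
    have b: "b \<in> carrier (fs (regular_module (UP R)) (prev I k))"
    proof (cases k)
      case 0
      then show ?thesis using zero by (simp add: b_def)
    next
      case (Suc k')
      have Aj: "A k' j \<in> carrier (FR k')" using free_resolutionD(1)[OF res] j Suc by simp
      have "(\<lambda>i. \<ominus>\<^bsub>regular_module R\<^esub> A k' j i) \<in> carrier (FR k')"
        using abelian_group.a_inv_closed[OF module.axioms(2)[OF module_fs[OF modsR(1)]] Aj] fs_minus[OF modsR(1) Aj] by simp
      moreover have "\<ominus>\<^bsub>regular_module R\<^esub> A k' j i = \<ominus>\<^bsub>R\<^esub> A k' j i" for i
        using fs_value[OF Aj, of i] by (simp add: minus_regular)
      ultimately have "(\<lambda>i. \<ominus>\<^bsub>R\<^esub> A k' j i) \<in> carrier (FR k')" by simp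
      from const_closed[OF this] show ?thesis by (simp add: Suc b_def prev_def)
    qed
    show ?thesis unfolding eq cone_index_def by (rule fs_case_sum[OF a b])
  qed
qed

lemma D'_hom: "D' k \<in> mod_hom (UP R) (FX (Suc k)) (FX k)"
  by (rule mx_hom[OF modsR(2) cone_matrix_closed])

lemma coeff_closed:
  assumes "z \<in> carrier (fs (regular_module (UP R)) J)" shows "(\<lambda>i. z i c) \<in> carrier (fs (regular_module R) J)"
proof -
  have z: "\<And>i. z i \<in> carrier (UP R)" "\<And>i. i \<notin> J \<Longrightarrow> z i = (\<lambda>_. \<zero>\<^bsub>R\<^esub>)" "finite {i. z i \<noteq> (\<lambda>_. \<zero>\<^bsub>R\<^esub>)}"
    using assms by (auto simp: fs_carrier UP_ops(1)[OF R])
  have "{i. z i c \<noteq> \<zero>\<^bsub>R\<^esub>} \<subseteq> {i. z i \<noteq> (\<lambda>_. \<zero>\<^bsub>R\<^esub>)}" by auto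
  then have "finite {i. z i c \<noteq> \<zero>\<^bsub>R\<^esub>}" by (rule finite_subset) (rule z(3))
  then show ?thesis using z(1,2) poly_value by (simp add: fs_carrier)
qed

lemma coeff_hom: "(\<lambda>z i. z i c) \<in> mod_hom R (restrict_scalars R (fs (regular_module (UP R)) J)) (fs (regular_module R) J)"
proof (rule mod_homI)
  show "(\<lambda>i. (x \<oplus>\<^bsub>restrict_scalars R (fs (regular_module (UP R)) J)\<^esub> y) i c) = (\<lambda>i. x i c) \<oplus>\<^bsub>fs (regular_module R) J\<^esub> (\<lambda>i. y i c)"
    if "x \<in> carrier (restrict_scalars R (fs (regular_module (UP R)) J))" "y \<in> carrier (restrict_scalars R (fs (regular_module (UP R)) J))" for x y
    using that fs_value[of x "regular_module (UP R)" J] fs_value[of y "regular_module (UP R)" J] by (simp add: UP_ops(2)[OF R])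
  show "(\<lambda>i. (r \<odot>\<^bsub>restrict_scalars R (fs (regular_module (UP R)) J)\<^esub> x) i c) = r \<odot>\<^bsub>fs (regular_module R) J\<^esub> (\<lambda>i. x i c)"
    if "r \<in> carrier R" "x \<in> carrier (restrict_scalars R (fs (regular_module (UP R)) J))" for r x
    using that fs_value[of x "regular_module (UP R)" J] by (simp add: UP_ops(4)[OF R])
qed (simp add: coeff_closed)

lemma inl_hom: "(\<lambda>z i. z (Inl i)) \<in> mod_hom Q (fs M (J <+> K)) (fs M J)"
  and inr_hom: "(\<lambda>z i. z (Inr i)) \<in> mod_hom Q (fs M (J <+> K)) (fs M K)"
  by (rule mod_homI; simp add: fs_component)+

lemma inl_coeff_hom: "(\<lambda>z i. z (Inl i) c) \<in> mod_hom R (restrict_scalars R (FX k)) (FR k)"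
  unfolding cone_index_def
  by (rule mod_hom_comp[OF mod_hom_restrict_scalars[OF R inl_hom] coeff_hom])

lemma inr_coeff_hom: "(\<lambda>z i. z (Inr i) c) \<in> mod_hom R (restrict_scalars R (FX k)) (fs (regular_module R) (prev I k))"
  unfolding cone_index_def
  by (rule mod_hom_comp[OF mod_hom_restrict_scalars[OF R inr_hom] coeff_hom])

lemma inr_coeff_hom': "(\<lambda>z i. z (Inr i) c) \<in> mod_hom R (restrict_scalars R (FX (Suc k))) (FR k)"
  using inr_coeff_hom[of c "Suc k"] by (simp add: prev_def)

lemma zero_RM_hom: "(\<lambda>z. (\<lambda>_. \<zero>\<^bsub>R\<^esub>)) \<in> mod_hom R N (fs (regular_module R) J)"
  by (rule mod_hom_zero[OF module_fs[OF modsR(1)], simplified])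

lemma const_mult:
  assumes "r \<in> carrier R" "p \<in> carrier (UP R)"
  shows "(monom (UP R) r 0 \<otimes>\<^bsub>UP R\<^esub> p) c = r \<otimes>\<^bsub>R\<^esub> p c"
  using UP_ops(4)[OF R assms] by simp

lemma X_mult:
  assumes "p \<in> carrier (UP R)"
  shows "(monom (UP R) \<one>\<^bsub>R\<^esub> 1 \<otimes>\<^bsub>UP R\<^esub> p) c = (case c of 0 \<Rightarrow> \<zero>\<^bsub>R\<^esub> | Suc c \<Rightarrow> p c)"
proof -
  have "monom (UP R) \<one>\<^bsub>R\<^esub> 1 \<otimes>\<^bsub>UP R\<^esub> p = p \<otimes>\<^bsub>UP R\<^esub> monom (UP R) \<one>\<^bsub>R\<^esub> 1"
    by (rule U.UP_m_comm) (use assms in simp_all)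
  then show ?thesis using UP_ops(5)[OF R assms] by simp
qed

text \<open>The upper block row, one coefficient at a time: \<open>D\<close> acts on each
  coefficient separately and \<open>x\<close> raises the index. In this form the cone is governed by
  the complex over \<open>R\<close>.\<close>

lemma cone_inl:
  assumes z: "z \<in> carrier (FX (Suc k))"
  shows "(\<lambda>i. D' k z (Inl i) c) =
    (\<lambda>i. D k (\<lambda>i. z (Inl i) c) i \<oplus>\<^bsub>R\<^esub> (case c of 0 \<Rightarrow> \<zero>\<^bsub>R\<^esub> | Suc c \<Rightarrow> z (Inr i) c))"
proof -
  have mods: "module R (FR k)" by (rule module_fs[OF modsR(1)])
  have h1: "(\<lambda>z i. D' k z (Inl i) c) \<in> mod_hom R (restrict_scalars R (FX (Suc k))) (FR k)"
    by (rule mod_hom_comp[OF mod_hom_restrict_scalars[OF R D'_hom] inl_coeff_hom])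
  have h2: "(\<lambda>z. D k (\<lambda>i. z (Inl i) c)) \<in> mod_hom R (restrict_scalars R (FX (Suc k))) (FR k)"
    by (rule mod_hom_comp[OF inl_coeff_hom D_hom])
  have h3: "(\<lambda>z i. case c of 0 \<Rightarrow> \<zero>\<^bsub>R\<^esub> | Suc c \<Rightarrow> z (Inr i) c) \<in> mod_hom R (restrict_scalars R (FX (Suc k))) (FR k)"
    by (cases c) (simp_all add: inr_coeff_hom' zero_RM_hom)
  have h4: "(\<lambda>z i. D k (\<lambda>i. z (Inl i) c) i \<oplus>\<^bsub>R\<^esub> (case c of 0 \<Rightarrow> \<zero>\<^bsub>R\<^esub> | Suc c \<Rightarrow> z (Inr i) c))
      \<in> mod_hom R (restrict_scalars R (FX (Suc k))) (FR k)"
    using mod_hom_add[OF mods h2 h3] by simp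
  show ?thesis
  proof (rule fs_hom_eq_restrict_scalars[OF R modsR(2) mods h1 h4 _ z])
    fix v p assume v: "v \<in> cone_index I (Suc k)" and p': "p \<in> carrier (regular_module (UP R))"
    have p: "p \<in> carrier (UP R)" using p' by simp
    have D': "D' k (single (regular_module (UP R)) v p) u = cone_matrix R A k v u \<otimes>\<^bsub>UP R\<^esub> p" for u
      using mx_single[where A = "cone_matrix R A k", OF modsR(2) cone_matrix_closed v p'] by (simp add: act_def)
    have D0: "D k (\<lambda>_. \<zero>\<^bsub>R\<^esub>) = (\<lambda>_. \<zero>\<^bsub>R\<^esub>)"
      using mod_hom_zero_minus(1)[OF module_fs[OF modsR(1)] mods D_hom] by simp
    show "(\<lambda>i. D' k (single (regular_module (UP R)) v p) (Inl i) c) = (\<lambda>i. D k (\<lambda>i. single (regular_module (UP R)) v p (Inl i) c) i \<oplus>\<^bsub>R\<^esub>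
        (case c of 0 \<Rightarrow> \<zero>\<^bsub>R\<^esub> | Suc c \<Rightarrow> single (regular_module (UP R)) v p (Inr i) c))"
    proof (cases v)
      case (Inl j)
      then have j: "j \<in> I (Suc k)" using v by (auto simp: cone_index_def)
      have "(\<lambda>i. single (regular_module (UP R)) v p (Inl i) c) = single (regular_module R) j (p c)"
        by (auto simp: Inl single_def UP_ops(1)[OF R])
      then have "D k (\<lambda>i. single (regular_module (UP R)) v p (Inl i) c) = act (regular_module R) (A k j) (p c)"
        using mx_single[where A = "A k", OF modsR(1) free_resolutionD(1)[OF res] j, of "p c"] poly_value[OF p] by simp
      moreover have "single (regular_module (UP R)) v p (Inr i) = (\<lambda>_. \<zero>\<^bsub>R\<^esub>)" for i by (simp add: Inl single_def UP_ops(1)[OF R])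
      ultimately show ?thesis
        unfolding D' using matrix_value[OF j] poly_value[OF p]
        by (cases c) (simp_all add: cone_matrix_def Inl const_mult[OF _ p] act_def)
    next
      case (Inr j)
      have "single (regular_module (UP R)) v p (Inl i) = (\<lambda>_. \<zero>\<^bsub>R\<^esub>)" for i by (simp add: Inr single_def UP_ops(1)[OF R])
      moreover have "single (regular_module (UP R)) v p (Inr i) c = (if i = j then p c else \<zero>\<^bsub>R\<^esub>)" for i c
        by (simp add: Inr single_def UP_ops(1)[OF R])
      moreover have "(\<zero>\<^bsub>UP R\<^esub> \<otimes>\<^bsub>UP R\<^esub> p) c = \<zero>\<^bsub>R\<^esub>"
        using cring.cring_simprules(26)[OF cring_UP[OF R] p] by (simp add: UP_ops(1)[OF R])
      ultimately show ?thesis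
        unfolding D' using poly_value[OF p] X_mult[OF p]
        by (cases c) (auto simp: cone_matrix_def Inr D0)
    qed
  qed
qed

lemma cone_inr:
  assumes z: "z \<in> carrier (FX (Suc (Suc k)))"
  shows "(\<lambda>i. D' (Suc k) z (Inr i) c) = (\<lambda>i. \<ominus>\<^bsub>R\<^esub> D k (\<lambda>i. z (Inr i) c) i)"
proof -
  let ?N = "restrict_scalars R (FX (Suc (Suc k)))"
  have mods: "module R (FR k)" by (rule module_fs[OF modsR(1)])
  have mods': "module R ?N" by (rule module_restrict_scalars[OF R module_fs[OF modsR(2)]])
  have h1: "(\<lambda>z i. D' (Suc k) z (Inr i) c) \<in> mod_hom R ?N (FR k)"
    by (rule mod_hom_comp[OF mod_hom_restrict_scalars[OF R D'_hom] inr_coeff_hom'])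
  have h2: "(\<lambda>z. D k (\<lambda>i. z (Inr i) c)) \<in> mod_hom R ?N (FR k)"
    by (rule mod_hom_comp[OF inr_coeff_hom' D_hom])
  have Dc: "D k (\<lambda>i. y (Inr i) c) i \<in> carrier R" if "y \<in> carrier ?N" for y i
    using fs_value[OF mod_homD(1)[OF h2 that]] by simp
  have h3: "(\<lambda>z i. \<ominus>\<^bsub>R\<^esub> D k (\<lambda>i. z (Inr i) c) i) \<in> mod_hom R ?N (FR k)"
  proof -
    have "(\<lambda>z. (\<ominus>\<^bsub>R\<^esub> \<one>\<^bsub>R\<^esub>) \<odot>\<^bsub>FR k\<^esub> D k (\<lambda>i. z (Inr i) c)) \<in> mod_hom R ?N (FR k)"
      by (rule mod_hom_smult[OF mods h2]) simp
    moreover have "(\<ominus>\<^bsub>R\<^esub> \<one>\<^bsub>R\<^esub>) \<odot>\<^bsub>FR k\<^esub> D k (\<lambda>i. z (Inr i) c) = (\<lambda>i. \<ominus>\<^bsub>R\<^esub> D k (\<lambda>i. z (Inr i) c) i)"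
      if "z \<in> carrier ?N" for z using Dc[OF that] by (simp add: R.l_minus)
    ultimately show ?thesis by (rule mod_hom_cong[OF _ mods']) assumption
  qed
  show ?thesis
  proof (rule fs_hom_eq_restrict_scalars[OF R modsR(2) mods h1 h3 _ z])
    fix v p assume v: "v \<in> cone_index I (Suc (Suc k))" and p': "p \<in> carrier (regular_module (UP R))"
    have p: "p \<in> carrier (UP R)" using p' by simp
    have D': "D' (Suc k) (single (regular_module (UP R)) v p) u = cone_matrix R A (Suc k) v u \<otimes>\<^bsub>UP R\<^esub> p" for u
      using mx_single[where A = "cone_matrix R A (Suc k)", OF modsR(2) cone_matrix_closed v p'] by (simp add: act_def)
    have D0: "D k (\<lambda>_. \<zero>\<^bsub>R\<^esub>) = (\<lambda>_. \<zero>\<^bsub>R\<^esub>)"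
      using mod_hom_zero_minus(1)[OF module_fs[OF modsR(1)] mods D_hom] by simp
    show "(\<lambda>i. D' (Suc k) (single (regular_module (UP R)) v p) (Inr i) c) =
        (\<lambda>i. \<ominus>\<^bsub>R\<^esub> D k (\<lambda>i. single (regular_module (UP R)) v p (Inr i) c) i)"
    proof (cases v)
      case (Inl j)
      have "single (regular_module (UP R)) v p (Inr i) = (\<lambda>_. \<zero>\<^bsub>R\<^esub>)" for i by (simp add: Inl single_def UP_ops(1)[OF R])
      moreover have "(\<zero>\<^bsub>UP R\<^esub> \<otimes>\<^bsub>UP R\<^esub> p) c = \<zero>\<^bsub>R\<^esub>"
        using cring.cring_simprules(26)[OF cring_UP[OF R] p] by (simp add: UP_ops(1)[OF R])
      ultimately show ?thesis unfolding D' by (simp add: cone_matrix_def Inl D0)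
    next
      case (Inr j)
      then have j: "j \<in> I (Suc k)" using v by (auto simp: cone_index_def prev_def)
      have "(\<lambda>i. single (regular_module (UP R)) v p (Inr i) c) = single (regular_module R) j (p c)"
        by (auto simp: Inr single_def UP_ops(1)[OF R])
      then have "D k (\<lambda>i. single (regular_module (UP R)) v p (Inr i) c) = act (regular_module R) (A k j) (p c)"
        using mx_single[where A = "A k", OF modsR(1) free_resolutionD(1)[OF res] j, of "p c"] poly_value[OF p] by simp
      then show ?thesis
        unfolding D' using matrix_value[OF j] poly_value[OF p]
        by (simp add: cone_matrix_def Inr const_mult[OF _ p] act_def R.l_minus del: U.monom_a_inv)
    qed
  qed
qed

text \<open>The upper row is \<open>D (D a + x b) - x D b\<close>, the lower one
  \<open>D D b\<close>; both vanish because \<open>D\<close> squares to zero and commutes with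
  \<open>x\<close>.\<close>

lemma cone_square:
  assumes z: "z \<in> carrier (FX (Suc (Suc k)))"
  shows "D' k (D' (Suc k) z) = (\<lambda>_. \<zero>\<^bsub>UP R\<^esub>)"
proof -
  note modF = module_fs[OF modsR(1)]
  have z1: "D' (Suc k) z \<in> carrier (FX (Suc k))" by (rule mod_homD(1)[OF D'_hom z])
  have z0: "D' k (D' (Suc k) z) \<in> carrier (FX k)" by (rule mod_homD(1)[OF D'_hom z1])
  have a: "(\<lambda>i. z (Inl i) c) \<in> carrier (FR (Suc (Suc k)))"
    and b: "(\<lambda>i. z (Inr i) c) \<in> carrier (FR (Suc k))" for c
    using mod_homD(1)[OF inl_coeff_hom] mod_homD(1)[OF inr_coeff_hom'] z by simp_all
  have Db: "D k (\<lambda>i. z (Inr i) c) \<in> carrier (FR k)" for c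
    by (rule mod_homD(1)[OF D_hom b])
  have Da: "D (Suc k) (\<lambda>i. z (Inl i) c) \<in> carrier (FR (Suc k))" for c
    by (rule mod_homD(1)[OF D_hom a])
  have DDa: "D k (D (Suc k) (\<lambda>i. z (Inl i) c)) = (\<lambda>_. \<zero>\<^bsub>R\<^esub>)" for c
    using free_resolution_square[OF modsR(1) res a] by simp
  have inl: "D' k (D' (Suc k) z) (Inl i) c = \<zero>\<^bsub>R\<^esub>" for i c
  proof -
    have bc: "(\<lambda>i. case c of 0 \<Rightarrow> \<zero>\<^bsub>R\<^esub> | Suc c \<Rightarrow> z (Inr i) c) \<in> carrier (FR (Suc k))"
      using b by (cases c) (simp_all add: fs_carrier)
    have "(\<lambda>i. D' k (D' (Suc k) z) (Inl i) c) = (\<lambda>i. D k (\<lambda>i. D' (Suc k) z (Inl i) c) i \<oplus>\<^bsub>R\<^esub>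
        (case c of 0 \<Rightarrow> \<zero>\<^bsub>R\<^esub> | Suc c \<Rightarrow> D' (Suc k) z (Inr i) c))"
      by (rule cone_inl[OF z1])
    also have "(\<lambda>i. D' (Suc k) z (Inl i) c) = D (Suc k) (\<lambda>i. z (Inl i) c) \<oplus>\<^bsub>FR (Suc k)\<^esub>
        (\<lambda>i. case c of 0 \<Rightarrow> \<zero>\<^bsub>R\<^esub> | Suc c \<Rightarrow> z (Inr i) c)"
      unfolding cone_inl[OF z] by simp
    also have "D k \<dots> = D k (\<lambda>i. case c of 0 \<Rightarrow> \<zero>\<^bsub>R\<^esub> | Suc c \<Rightarrow> z (Inr i) c)"
      unfolding mod_homD(2)[OF D_hom Da bc] DDa using fs_value[OF mod_homD(1)[OF D_hom bc]] by simp
    finally have eq: "D' k (D' (Suc k) z) (Inl i) c = D k (\<lambda>i. case c of 0 \<Rightarrow> \<zero>\<^bsub>R\<^esub> | Suc c \<Rightarrow> z (Inr i) c) i \<oplus>\<^bsub>R\<^esub>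
        (case c of 0 \<Rightarrow> \<zero>\<^bsub>R\<^esub> | Suc c \<Rightarrow> D' (Suc k) z (Inr i) c)"
      by (rule fun_cong)
    show ?thesis
    proof (cases c)
      case 0
      then show ?thesis using eq mod_hom_zero_minus(1)[OF modF modF D_hom, of k] by simp
    next
      case (Suc c')
      have "D' (Suc k) z (Inr i) c' = \<ominus>\<^bsub>R\<^esub> D k (\<lambda>i. z (Inr i) c') i"
        using fun_cong[OF cone_inr[OF z, of c'], of i] .
      then show ?thesis using eq Suc fs_value[OF Db, of c' i] by (simp add: R.r_neg)
    qed
  qed
  have inr: "D' k (D' (Suc k) z) (Inr i) c = \<zero>\<^bsub>R\<^esub>" for i c
  proof (cases k)
    case 0
    have "Inr i \<notin> cone_index I k" by (auto simp: cone_index_def prev_def 0)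
    then have "D' k (D' (Suc k) z) (Inr i) = \<zero>\<^bsub>UP R\<^esub>" using z0 by (simp add: fs_carrier)
    then show ?thesis by (simp add: UP_ops(1)[OF R])
  next
    case (Suc k')
    have "(\<lambda>i. D' (Suc k') (D' (Suc (Suc k')) z) (Inr i) c) = (\<lambda>i. \<ominus>\<^bsub>R\<^esub> D k' (\<lambda>i. D' (Suc (Suc k')) z (Inr i) c) i)"
      by (rule cone_inr) (use z1 Suc in simp)
    also have "(\<lambda>i. D' (Suc (Suc k')) z (Inr i) c) = \<ominus>\<^bsub>FR (Suc k')\<^esub> D (Suc k') (\<lambda>i. z (Inr i) c)"
    proof -
      have D: "D (Suc k') (\<lambda>i. z (Inr i) c) \<in> carrier (FR (Suc k'))" using Db Suc by simp
      show ?thesis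
        unfolding fs_minus[OF modsR(1) D] using cone_inr[of z "Suc k'" c] z Suc fs_value[OF D] by (simp add: minus_regular)
    qed
    also have "D k' \<dots> = \<ominus>\<^bsub>FR k'\<^esub> D k' (D (Suc k') (\<lambda>i. z (Inr i) c))"
      by (rule mod_hom_zero_minus(2)[OF modF modF D_hom]) (use Db Suc in simp)
    also have "D k' (D (Suc k') (\<lambda>i. z (Inr i) c)) = \<zero>\<^bsub>FR k'\<^esub>"
      by (rule free_resolution_square[OF modsR(1) res]) (use b Suc in simp)
    also have "\<ominus>\<^bsub>FR k'\<^esub> \<zero>\<^bsub>FR k'\<^esub> = \<zero>\<^bsub>FR k'\<^esub>"
      by (rule module_minus_zero[OF modF])
    finally show ?thesis using fun_cong[of _ _ i] Suc by (simp add: fun_eq_iff)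
  qed
  show ?thesis by (rule fs_component_eqI) (auto simp: inl inr UP_ops(1)[OF R])
qed

text \<open>If \<open>D a + x b = 0\<close>, the constant coefficient of \<open>a\<close> is a cycle
  over \<open>R\<close>, hence of the form \<open>D w0\<close>. Writing
  \<open>a = D w0 + x a'\<close>, comparison of the other coefficients gives
  \<open>b = - D a'\<close>, so \<open>(a, b)\<close> is the image of
  \<open>(w0, a')\<close>.\<close>

lemma cone_exact:
  assumes z: "z \<in> carrier (FX (Suc (Suc k)))"
    and zero: "D' (Suc k) z = (\<lambda>_. \<zero>\<^bsub>UP R\<^esub>)"
  shows "\<exists>w\<in>carrier (FX (Suc (Suc (Suc k)))). D' (Suc (Suc k)) w = z"
proof -
  note modF = module_fs[OF modsR(1)]
  have a: "(\<lambda>i. z (Inl i) c) \<in> carrier (FR (Suc (Suc k)))"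
    and b: "(\<lambda>i. z (Inr i) c) \<in> carrier (FR (Suc k))" for c
    using mod_homD(1)[OF inl_coeff_hom] mod_homD(1)[OF inr_coeff_hom'] z by simp_all
  have Da: "D (Suc k) (\<lambda>i. z (Inl i) c) i \<in> carrier R" for c i
    using fs_value[OF mod_homD(1)[OF D_hom a]] by simp
  have sum: "D (Suc k) (\<lambda>i. z (Inl i) c) i \<oplus>\<^bsub>R\<^esub> (case c of 0 \<Rightarrow> \<zero>\<^bsub>R\<^esub> | Suc c \<Rightarrow> z (Inr i) c) = \<zero>\<^bsub>R\<^esub>" for c i
    using fun_cong[OF cone_inl[OF z, of c], of i] by (simp add: zero UP_ops(1)[OF R])
  have "D (Suc k) (\<lambda>i. z (Inl i) 0) = (\<lambda>_. \<zero>\<^bsub>R\<^esub>)"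
    using sum[of 0] Da[of 0] by (simp add: fun_eq_iff)
  from free_resolutionD(3)[OF res a this] obtain w0 where
    w0: "w0 \<in> carrier (FR (Suc (Suc (Suc k))))" "D (Suc (Suc k)) w0 = (\<lambda>i. z (Inl i) 0)" by blast
  have zb: "z (Inr i) c = \<ominus>\<^bsub>R\<^esub> D (Suc k) (\<lambda>i. z (Inl i) (Suc c)) i" for i c
    using sum[of "Suc c" i] Da[of "Suc c" i] fs_value[OF b, of i c] by (simp add: R.minus_equality R.a_comm)
  define w where "w = case_sum (\<lambda>i. monom (UP R) (w0 i) 0) (\<lambda>i c. z (Inl i) (Suc c))"
  have zl: "(\<lambda>i. z (Inl i)) \<in> carrier (fs (regular_module (UP R)) (I (Suc (Suc k))))"
    by (rule fs_component(1)) (use z in \<open>simp add: cone_index_def\<close>)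
  have "(\<lambda>i c. z (Inl i) (Suc c)) \<in> carrier (fs (regular_module (UP R)) (I (Suc (Suc k))))"
  proof -
    have zi: "\<And>i. z (Inl i) \<in> carrier (UP R)" "\<And>i. i \<notin> I (Suc (Suc k)) \<Longrightarrow> z (Inl i) = (\<lambda>_. \<zero>\<^bsub>R\<^esub>)"
      "finite {i. z (Inl i) \<noteq> (\<lambda>_. \<zero>\<^bsub>R\<^esub>)}"
      using zl by (auto simp: fs_carrier UP_ops(1)[OF R])
    have "{i. (\<lambda>c. z (Inl i) (Suc c)) \<noteq> (\<lambda>_. \<zero>\<^bsub>R\<^esub>)} \<subseteq> {i. z (Inl i) \<noteq> (\<lambda>_. \<zero>\<^bsub>R\<^esub>)}" by auto
    then have "finite {i. (\<lambda>c. z (Inl i) (Suc c)) \<noteq> (\<lambda>_. \<zero>\<^bsub>R\<^esub>)}" by (rule finite_subset) (rule zi(3))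
    moreover have "(\<lambda>c. z (Inl i) (Suc c)) \<in> carrier (UP R)" for i
    proof -
      have "finite {c. z (Inl i) c \<noteq> \<zero>\<^bsub>R\<^esub>}" using zi(1) UP_carrier_iff[OF R] by blast
      from finite_vimageI[OF this inj_Suc] have "finite {c. z (Inl i) (Suc c) \<noteq> \<zero>\<^bsub>R\<^esub>}" by (simp add: vimage_def)
      then show ?thesis using poly_value[OF zi(1)] by (simp add: UP_carrier_iff[OF R])
    qed
    ultimately show ?thesis using zi(2) by (simp add: fs_carrier UP_ops(1)[OF R])
  qed
  then have w: "w \<in> carrier (FX (Suc (Suc (Suc k))))"
    unfolding w_def cone_index_def using fs_case_sum[OF const_closed[OF w0(1)]] by (simp add: prev_def)
  have D0: "D (Suc (Suc k)) (\<lambda>_. \<zero>\<^bsub>R\<^esub>) = (\<lambda>_. \<zero>\<^bsub>R\<^esub>)"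
    using mod_hom_zero_minus(1)[OF modF modF D_hom] by simp
  have wc: "w0 i \<in> carrier R" for i using fs_value[OF w0(1)] by simp
  have inl: "D' (Suc (Suc k)) w (Inl i) c = z (Inl i) c" for i c
  proof (cases c)
    case 0
    have "(\<lambda>i. w (Inl i) 0) = w0" using wc by (simp add: w_def UP_ops(3)[OF R])
    then show ?thesis
      using fun_cong[OF cone_inl[OF w, of 0], of i] w0(2) fs_value[OF a, of i 0] by (simp add: 0)
  next
    case (Suc c')
    have "(\<lambda>i. w (Inl i) (Suc c')) = (\<lambda>_. \<zero>\<^bsub>R\<^esub>)" using wc by (simp add: w_def UP_ops(3)[OF R])
    moreover have "w (Inr i) c' = z (Inl i) (Suc c')" by (simp add: w_def)
    ultimately show ?thesis
      using fun_cong[OF cone_inl[OF w, of "Suc c'"], of i] D0 fs_value[OF a, of i "Suc c'"] by (simp add: Suc)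
  qed
  have inr: "D' (Suc (Suc k)) w (Inr i) c = z (Inr i) c" for i c
    using fun_cong[OF cone_inr[OF w, of c], of i] by (simp add: zb) (simp add: w_def)
  show ?thesis by (rule bexI[OF _ w], rule fs_component_eqI; rule ext) (simp_all add: inl inr)
qed

lemma free_resolution_cone: "free_resolution (UP R) (cone_index I) (cone_matrix R A)"
  unfolding free_resolution_def
proof (intro conjI allI ballI impI)
  fix k v assume v: "v \<in> cone_index I (Suc (Suc k))"
  have s: "single (regular_module (UP R)) v \<one>\<^bsub>UP R\<^esub> \<in> carrier (FX (Suc (Suc k)))"
    by (rule single_closed[OF modsR(2) v]) simp
  have "cone_matrix R A (Suc k) v u \<in> carrier (UP R)" for u
    using fs_value[OF cone_matrix_closed[OF v]] by simp
  then have "D' (Suc k) (single (regular_module (UP R)) v \<one>\<^bsub>UP R\<^esub>) = cone_matrix R A (Suc k) v"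
    using mx_single[where A = "cone_matrix R A (Suc k)", OF modsR(2) cone_matrix_closed v, of "\<one>\<^bsub>UP R\<^esub>"]
    by (simp add: act_def)
  then show "D' k (cone_matrix R A (Suc k) v) = \<zero>\<^bsub>FX k\<^esub>"
    using cone_square[OF s] by simp
next
  fix k z assume "z \<in> carrier (FX (Suc (Suc k)))"
    "D' (Suc k) z = \<zero>\<^bsub>FX (Suc k)\<^esub>"
  then show "\<exists>w\<in>carrier (FX (Suc (Suc (Suc k)))). D' (Suc (Suc k)) w = z"
    using cone_exact[of z k] by simp
qed (rule cone_matrix_closed)

end

section \<open>The cone with coefficients on which \<open>x\<close> acts as zero\<close>

lemma fs_zero_extension: "carrier (fs (zero_extension N) K) = carrier (fs N K)"
  by (auto simp: fs_carrier)

lemma inl_zero_extension_hom: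
  assumes "module R N"
  shows "(\<lambda>z i. z (Inl i)) \<in> mod_hom R (restrict_scalars R (fs (zero_extension N) (I <+> J))) (fs N I)"
    and "(\<lambda>z i. z (Inr i)) \<in> mod_hom R (restrict_scalars R (fs (zero_extension N) (I <+> J))) (fs N J)"
proof -
  interpret N: module R N by fact
  show "(\<lambda>z i. z (Inl i)) \<in> mod_hom R (restrict_scalars R (fs (zero_extension N) (I <+> J))) (fs N I)"
    by (rule mod_homI) (simp_all add: fs_zero_extension fs_component UP_ops(3)[OF N.is_cring])
  show "(\<lambda>z i. z (Inr i)) \<in> mod_hom R (restrict_scalars R (fs (zero_extension N) (I <+> J))) (fs N J)"
    by (rule mod_homI) (simp_all add: fs_zero_extension fs_component UP_ops(3)[OF N.is_cring])
qed

text \<open>The block \<open>x\<close> acts as zero, so the cone tensored with \<open>N\<close> is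
  the direct sum of \<open>Q \<otimes> N\<close> and its shift by one degree.\<close>

lemma cone_zero_extension:
  assumes N: "module R N" and res: "free_resolution R I A"
  shows "z \<in> carrier (fs (zero_extension N) (cone_index I (Suc k))) \<Longrightarrow>
      (\<lambda>i. mx (zero_extension N) (cone_index I k) (cone_matrix R A k) z (Inl i)) = mx N (I k) (A k) (\<lambda>i. z (Inl i))"
    and "z \<in> carrier (fs (zero_extension N) (cone_index I (Suc (Suc k)))) \<Longrightarrow>
      (\<lambda>i. mx (zero_extension N) (cone_index I (Suc k)) (cone_matrix R A (Suc k)) z (Inr i)) =
      \<ominus>\<^bsub>fs N (I k)\<^esub> mx N (I k) (A k) (\<lambda>i. z (Inr i))"
proof -
  interpret N: module R N by fact
  note R = N.is_cring
  interpret U: UP_cring R "UP R" by (rule UP_cring.intro[OF R])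
  let ?M = "zero_extension N"
  note M = module_zero_extension[OF N]
  note modF = module_fs[OF N]
  interpret F: module R "fs N (I k)" for k by (rule modF)
  let ?D' = "\<lambda>k. mx ?M (cone_index I k) (cone_matrix R A k)"
  have D: "mx N (I k) (A k) \<in> mod_hom R (fs N (I (Suc k))) (fs N (I k))" for k
    by (rule free_resolution_hom[OF N res])
  have D': "?D' k \<in> mod_hom R (restrict_scalars R (fs ?M (cone_index I (Suc k)))) (restrict_scalars R (fs ?M (cone_index I k)))" for k
    by (rule mod_hom_restrict_scalars[OF R mx_hom[OF M cone_matrix_closed[OF R res]]])
  have inl: "(\<lambda>z i. z (Inl i)) \<in> mod_hom R (restrict_scalars R (fs ?M (cone_index I k))) (fs N (I k))" for k
    unfolding cone_index_def by (rule inl_zero_extension_hom(1)[OF N])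
  have inr: "(\<lambda>z i. z (Inr i)) \<in> mod_hom R (restrict_scalars R (fs ?M (cone_index I (Suc k)))) (fs N (I k))" for k
    using inl_zero_extension_hom(2)[OF N, of "I (Suc k)" "prev I (Suc k)"] by (simp add: cone_index_def prev_def)
  have D'_single: "?D' k (single ?M v m) u = cone_matrix R A k v u 0 \<odot>\<^bsub>N\<^esub> m"
    if "v \<in> cone_index I (Suc k)" "m \<in> carrier N" for k v m u
    using mx_single[where A = "cone_matrix R A k", OF M cone_matrix_closed[OF R res] that(1), of m] that(2)
    by (simp add: act_def)
  have D0: "mx N (I k) (A k) (\<lambda>_. \<zero>\<^bsub>N\<^esub>) = (\<lambda>_. \<zero>\<^bsub>N\<^esub>)" for k
    using mod_hom_zero_minus(1)[OF modF modF D] by simp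
  have D_single: "mx N (I k) (A k) (single N j m) = (\<lambda>i. A k j i \<odot>\<^bsub>N\<^esub> m)" if "j \<in> I (Suc k)" "m \<in> carrier N" for k j m
    using mx_single[where A = "A k", OF N free_resolutionD(1)[OF res] that] by (simp add: act_def)
  note Aji = matrix_value[OF R res]
  note vals = UP_ops(1,3)[OF R]
  show "(\<lambda>i. ?D' k z (Inl i)) = mx N (I k) (A k) (\<lambda>i. z (Inl i))" if z: "z \<in> carrier (fs ?M (cone_index I (Suc k)))"
  proof (rule fs_hom_eq_restrict_scalars[OF R M modF mod_hom_comp[OF D' inl] mod_hom_comp[OF inl D] _ z])
    fix v m assume v: "v \<in> cone_index I (Suc k)" and m': "m \<in> carrier ?M"
    have m: "m \<in> carrier N" using m' by simp
    show "(\<lambda>i. ?D' k (single ?M v m) (Inl i)) = mx N (I k) (A k) (\<lambda>i. single ?M v m (Inl i))"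
    proof (cases v)
      case (Inl j)
      then have j: "j \<in> I (Suc k)" using v by (auto simp: cone_index_def)
      have "(\<lambda>i. single ?M v m (Inl i)) = single N j m" by (auto simp: Inl single_def)
      then show ?thesis unfolding D'_single[OF v m]
        using D_single[OF j m] Aji[OF j] by (simp add: cone_matrix_def Inl vals)
    next
      case (Inr j)
      have "(\<lambda>i. single ?M v m (Inl i)) = (\<lambda>_. \<zero>\<^bsub>N\<^esub>)" by (auto simp: Inr single_def)
      then show ?thesis unfolding D'_single[OF v m] using m by (auto simp: cone_matrix_def Inr vals D0)
    qed
  qed
  show "(\<lambda>i. ?D' (Suc k) z (Inr i)) = \<ominus>\<^bsub>fs N (I k)\<^esub> mx N (I k) (A k) (\<lambda>i. z (Inr i))"
    if z: "z \<in> carrier (fs ?M (cone_index I (Suc (Suc k))))"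
  proof (rule fs_hom_eq_restrict_scalars[OF R M modF mod_hom_comp[OF D' inr] _ _ z])
    show "(\<lambda>z. \<ominus>\<^bsub>fs N (I k)\<^esub> mx N (I k) (A k) (\<lambda>i. z (Inr i)))
        \<in> mod_hom R (restrict_scalars R (fs ?M (cone_index I (Suc (Suc k))))) (fs N (I k))"
      using mod_homD[OF mod_hom_comp[OF inr D]]
      by (intro mod_homI) (simp_all add: F.M.minus_add F.M.a_comm F.smult_r_minus del: fs_simps restrict_scalars_simps)
    fix v m assume v: "v \<in> cone_index I (Suc (Suc k))" and m': "m \<in> carrier ?M"
    have m: "m \<in> carrier N" using m' by simp
    show "(\<lambda>i. ?D' (Suc k) (single ?M v m) (Inr i)) = \<ominus>\<^bsub>fs N (I k)\<^esub> mx N (I k) (A k) (\<lambda>i. single ?M v m (Inr i))"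
    proof (cases v)
      case (Inl j)
      have eq: "(\<lambda>i. single ?M v m (Inr i)) = (\<lambda>_. \<zero>\<^bsub>N\<^esub>)" by (auto simp: Inl single_def)
      have "(\<lambda>_. \<zero>\<^bsub>N\<^esub>) \<in> carrier (fs N (I k))" using F.M.zero_closed by simp
      then show ?thesis unfolding D'_single[OF v m] eq D0 using m
        by (simp add: cone_matrix_def Inl vals fs_minus[OF N] module_minus_zero[OF N])
    next
      case (Inr j)
      then have j: "j \<in> I (Suc k)" using v by (auto simp: cone_index_def prev_def)
      have eq: "(\<lambda>i. single ?M v m (Inr i)) = single N j m" by (auto simp: Inr single_def)
      have "(\<lambda>i. A k j i \<odot>\<^bsub>N\<^esub> m) \<in> carrier (fs N (I k))"
        unfolding D_single[OF j m, symmetric] by (rule mod_homD(1)[OF D single_closed[OF N j m]])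
      then show ?thesis unfolding D'_single[OF v m] eq D_single[OF j m]
        using m Aji[OF j] by (simp add: cone_matrix_def Inr vals fs_minus[OF N] N.smult_l_minus del: U.monom_a_inv)
    qed
  qed
qed

lemma tor_killed_of_zero_extension:
  assumes N: "module R N" and S: "submonoid S R"
    and tor: "tor_killed TYPE('i + 'i) (UP R) (const_polys R S) (zero_extension N) (Suc n)"
  shows "tor_killed TYPE('i) R S N n"
  unfolding tor_killed_def
proof (intro allI impI)
  fix I :: "nat \<Rightarrow> 'i set" and A
  assume res: "free_resolution R I A"
  interpret N: module R N by fact
  interpret S: submonoid S R by fact
  note R = N.is_cring
  let ?M = "zero_extension N"
  let ?D' = "\<lambda>k. mx ?M (cone_index I k) (cone_matrix R A k)"
  note modF = module_fs[OF N]
  interpret F: module R "fs N (I k)" for k by (rule modF)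
  note cone = cone_zero_extension[OF N res]
  have "homology_killed (const_polys R S) (\<lambda>k. fs ?M (cone_index I k)) ?D' (Suc n)"
    using tor free_resolution_cone[OF R res] unfolding tor_killed_def by blast
  then obtain q where q: "q \<in> const_polys R S" and killed: "\<forall>z\<in>carrier (fs ?M (cone_index I (Suc (Suc n)))).
      ?D' (Suc n) z = \<zero>\<^bsub>fs ?M (cone_index I (Suc n))\<^esub> \<longrightarrow>
      (\<exists>w\<in>carrier (fs ?M (cone_index I (Suc (Suc (Suc n))))). ?D' (Suc (Suc n)) w = q \<odot>\<^bsub>fs ?M (cone_index I (Suc (Suc n)))\<^esub> z)"
    unfolding homology_killed_def by (rule bexE)
  obtain s where s: "s \<in> S" "q = monom (UP R) s 0" using q by (auto simp: const_polys_def)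
  have sR: "s \<in> carrier R" using s(1) S.subset by blast
  show "homology_killed S (\<lambda>k. fs N (I k)) (\<lambda>k. mx N (I k) (A k)) n"
    unfolding homology_killed_def
  proof (intro bexI[OF _ s(1)] ballI impI)
    fix z assume z: "z \<in> carrier (fs N (I (Suc n)))" "mx N (I n) (A n) z = \<zero>\<^bsub>fs N (I n)\<^esub>"
    \<comment> \<open>The cycle is placed in the shifted summand, one degree higher, where the
      differential is that of \<open>Q \<otimes> N\<close> up to sign.\<close>
    define z' where "z' = case_sum (\<lambda>_ :: 'i. \<zero>\<^bsub>N\<^esub>) z"
    have zl: "(\<lambda>i. z' (Inl i)) = (\<lambda>_. \<zero>\<^bsub>N\<^esub>)" and zr: "(\<lambda>i. z' (Inr i)) = z" by (simp_all add: z'_def)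
    have "(\<lambda>_. \<zero>\<^bsub>N\<^esub>) \<in> carrier (fs N (I (Suc (Suc n))))" using F.M.zero_closed by simp
    from fs_case_sum[OF this z(1)] have z': "z' \<in> carrier (fs ?M (cone_index I (Suc (Suc n))))"
      unfolding fs_zero_extension by (simp add: z'_def cone_index_def prev_def)
    have "?D' (Suc n) z' = \<zero>\<^bsub>fs ?M (cone_index I (Suc n))\<^esub>"
    proof (rule fs_component_eqI)
      have "mx N (I (Suc n)) (A (Suc n)) (\<lambda>_. \<zero>\<^bsub>N\<^esub>) = (\<lambda>_. \<zero>\<^bsub>N\<^esub>)"
        using mod_hom_zero_minus(1)[OF modF modF free_resolution_hom[OF N res]] by simp
      then show "?D' (Suc n) z' (Inl i) = \<zero>\<^bsub>fs ?M (cone_index I (Suc n))\<^esub> (Inl i)" for i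
        using fun_cong[OF cone(1)[OF z'], of i] by (simp add: zl)
      show "?D' (Suc n) z' (Inr i) = \<zero>\<^bsub>fs ?M (cone_index I (Suc n))\<^esub> (Inr i)" for i
        using fun_cong[OF cone(2)[OF z'], of i] z(2) fs_minus[OF N F.M.zero_closed[of n]] by (simp add: zr module_minus_zero[OF N])
    qed
    then obtain w where w: "w \<in> carrier (fs ?M (cone_index I (Suc (Suc (Suc n)))))"
      "?D' (Suc (Suc n)) w = q \<odot>\<^bsub>fs ?M (cone_index I (Suc (Suc n)))\<^esub> z'"
      using killed z' by blast
    let ?w = "\<lambda>i. w (Inr i)"
    have wr: "?w \<in> carrier (fs N (I (Suc (Suc n))))"
      using fs_component(2)[of w N "I (Suc (Suc (Suc n)))" "I (Suc (Suc n))"] w(1) unfolding fs_zero_extension by (simp add: cone_index_def prev_def)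
    have "\<ominus>\<^bsub>fs N (I (Suc n))\<^esub> mx N (I (Suc n)) (A (Suc n)) ?w = s \<odot>\<^bsub>fs N (I (Suc n))\<^esub> z"
      unfolding cone(2)[OF w(1), symmetric] w(2) using sR by (simp add: s(2) UP_ops(3)[OF R] fun_cong[OF zr])
    \<comment> \<open>The sign is absorbed into the bounding chain.\<close>
    then have "mx N (I (Suc n)) (A (Suc n)) (\<ominus>\<^bsub>fs N (I (Suc (Suc n)))\<^esub> ?w) = s \<odot>\<^bsub>fs N (I (Suc n))\<^esub> z"
      using mod_hom_zero_minus(2)[OF modF modF free_resolution_hom[OF N res] wr] by simp
    then show "\<exists>w\<in>carrier (fs N (I (Suc (Suc n)))). mx N (I (Suc n)) (A (Suc n)) w = s \<odot>\<^bsub>fs N (I (Suc n))\<^esub> z"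
      using F.M.a_inv_closed[OF wr] by blast
  qed
qed

section \<open>The dimension formula\<close>

text \<open>A finite upper bound on the supremum is a condition on each module separately, so the
  two rings can be compared bound by bound.\<close>

lemma S_w_gl_dim_le_iff:
  assumes "submonoid S R" "infinite (UNIV :: 'u set)" "carrier R \<lesssim> (UNIV :: 'u set)"
  shows "S_w_gl_dim TYPE('u) R S \<le> enat n \<longleftrightarrow>
    (\<forall>M :: ('a, 'u) module. module (R :: ('a, 'm) ring_scheme) M \<longrightarrow> tor_killed TYPE('u) R S M (Suc n))"
proof -
  have "S_fd R S M \<le> enat n \<longleftrightarrow> tor_killed TYPE('u) R S M (Suc n)" if M: "module R M" for M :: "('a, 'u) module"
  proof -
    note iff = S_fd_le_iff_tor_killed[OF assms M]
    show ?thesis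
    proof
      assume "S_fd R S M \<le> enat n"
      then have ex: "\<exists>k. S_fd_le R S M k" and le: "(LEAST k. S_fd_le R S M k) \<le> n"
        by (auto simp: S_fd_def split: if_splits)
      have "tor_killed TYPE('u) R S M (Suc (LEAST k. S_fd_le R S M k))"
        using LeastI_ex[OF ex] iff by blast
      then show "tor_killed TYPE('u) R S M (Suc n)" using tor_killed_mono le by blast
    next
      assume "tor_killed TYPE('u) R S M (Suc n)"
      then have "S_fd_le R S M n" using iff by blast
      then show "S_fd R S M \<le> enat n" by (auto simp: S_fd_def intro: Least_le)
    qed
  qed
  then show ?thesis unfolding S_w_gl_dim_def by (auto simp: Sup_le_iff)
qed

text \<open>The complex with \<open>R\<close> in degree 1 and zero elsewhere counts as a resolution,
  exactness being required from degree 2 on. With coefficients in \<open>M\<close>, its homology in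
  degree 1 is \<open>M\<close> itself.\<close>

lemma torsion_of_tor_killed:
  assumes M: "module R M" and tor: "tor_killed TYPE('i) R S M 0" and S: "S \<subseteq> carrier R"
  shows "\<exists>s\<in>S. \<forall>m\<in>carrier M. s \<odot>\<^bsub>M\<^esub> m = \<zero>\<^bsub>M\<^esub>"
proof -
  interpret M: module R M by fact
  note modR = module_regular_module[OF M.is_cring]
  let ?i = "undefined :: 'i"
  define I :: "nat \<Rightarrow> 'i set" where "I k = (if k = 1 then {?i} else {})" for k
  define A :: "nat \<Rightarrow> 'i \<Rightarrow> 'i \<Rightarrow> 'a" where "A k j i = \<zero>\<^bsub>R\<^esub>" for k j i
  have empty: "I 0 = {}" "I (Suc (Suc k)) = {}" for k by (simp_all add: I_def)
  have res: "free_resolution R I A" unfolding free_resolution_def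
  proof (intro conjI allI ballI impI)
    show "A k j \<in> carrier (fs (regular_module R) (I k))" for k j by (simp add: A_def fs_carrier)
    fix k z assume "z \<in> carrier (fs (regular_module R) (I (Suc (Suc k))))"
    then have z: "z = (\<lambda>_. \<zero>\<^bsub>R\<^esub>)" unfolding empty by (simp add: fs_empty[OF modR])
    show "\<exists>w\<in>carrier (fs (regular_module R) (I (Suc (Suc (Suc k))))).
        mx (regular_module R) (I (Suc (Suc k))) (A (Suc (Suc k))) w = z"
      using mx_zero[OF modR, of "I (Suc (Suc k))" "A (Suc (Suc k))"] by (intro bexI[of _ "\<lambda>_. \<zero>\<^bsub>R\<^esub>"]) (simp_all add: z fs_carrier)
  qed (simp add: empty)
  have "homology_killed S (\<lambda>k. fs M (I k)) (\<lambda>k. mx M (I k) (A k)) 0"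
    using tor res unfolding tor_killed_def by blast
  then obtain s where s: "s \<in> S" and killed: "\<forall>z\<in>carrier (fs M (I (Suc 0))). mx M (I 0) (A 0) z = \<zero>\<^bsub>fs M (I 0)\<^esub> \<longrightarrow>
      (\<exists>w\<in>carrier (fs M (I (Suc (Suc 0)))). mx M (I (Suc 0)) (A (Suc 0)) w = s \<odot>\<^bsub>fs M (I (Suc 0))\<^esub> z)"
    unfolding homology_killed_def by (rule bexE)
  have "s \<odot>\<^bsub>M\<^esub> m = \<zero>\<^bsub>M\<^esub>" if m: "m \<in> carrier M" for m
  proof -
    have z: "single M ?i m \<in> carrier (fs M (I (Suc 0)))" by (rule single_closed[OF M _ m]) (simp add: I_def)
    have "mx M (I 0) (A 0) (single M ?i m) \<in> carrier (fs M {})"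
      using mod_homD(1)[OF free_resolution_hom[OF M res] z] by (simp add: empty)
    then have "mx M (I 0) (A 0) (single M ?i m) = \<zero>\<^bsub>fs M (I 0)\<^esub>" by (simp add: fs_empty[OF M])
    then obtain w where "w \<in> carrier (fs M {})" "mx M (I (Suc 0)) (A (Suc 0)) w = s \<odot>\<^bsub>fs M (I (Suc 0))\<^esub> single M ?i m"
      using killed z unfolding empty by blast
    then have "s \<odot>\<^bsub>fs M (I (Suc 0))\<^esub> single M ?i m = (\<lambda>_. \<zero>\<^bsub>M\<^esub>)" by (simp add: fs_empty[OF M] mx_zero[OF M])
    from fun_cong[OF this, of ?i] show ?thesis by (simp add: single_def)
  qed
  with s show ?thesis by blast
qed

theorem theorem4p7:
  fixes R :: "('a, 'm) ring_scheme" and S :: "'a set"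
  assumes "cring R"
    and "submonoid S R"
    and "\<zero>\<^bsub>R\<^esub> \<notin> S"
    and "infinite (UNIV :: 'u set)"
    and "carrier R \<lesssim> (UNIV :: 'u set)"
  shows "S_w_gl_dim TYPE('u) (UP R) (const_polys R S) = S_w_gl_dim TYPE('u) R S + 1"
proof -
  interpret R: cring R by fact
  interpret U: UP_cring R "UP R" by (rule UP_cring.intro) fact
  interpret S: submonoid S R by fact
  let ?T = "const_polys R S"
  have T: "submonoid ?T (UP R)"
  proof
    show "?T \<subseteq> carrier (UP R)" using S.subset by (auto simp: const_polys_def)
    show "x \<otimes>\<^bsub>UP R\<^esub> y \<in> ?T" if "x \<in> ?T" "y \<in> ?T" for x y
    proof -
      obtain a b where ab: "a \<in> S" "b \<in> S" "x = monom (UP R) a 0" "y = monom (UP R) b 0"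
        using \<open>x \<in> ?T\<close> \<open>y \<in> ?T\<close> unfolding const_polys_def by blast
      then have "x \<otimes>\<^bsub>UP R\<^esub> y = monom (UP R) (a \<otimes>\<^bsub>R\<^esub> b) 0"
        using U.monom_mult[of a b 0 0] S.subset by auto
      then show ?thesis using ab by (simp add: const_polys_def)
    qed
    show "\<one>\<^bsub>UP R\<^esub> \<in> ?T" unfolding const_polys_def U.monom_one[symmetric] by (rule imageI) simp
  qed
  \<comment> \<open>The criterion over \<open>R[x]\<close> requires that the polynomials, too, fit
    into \<open>'u\<close>.\<close>
  have "carrier (UP R) = carrier (fs (regular_module R) (UNIV :: nat set))"
    by (auto simp: UP_carrier_iff[OF assms(1)] fs_carrier)
  moreover have "(UNIV :: nat set) \<lesssim> (UNIV :: 'u set)" using assms(4) by (simp add: infinite_le_lepoll)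
  ultimately have UP_card: "carrier (UP R) \<lesssim> (UNIV :: 'u set)"
    using fs_lepoll[OF assms(4)] assms(5) by (metis regular_module_simps(1))
  have UU: "(UNIV :: 'u set) \<times> (UNIV :: 'u set) \<lesssim> (UNIV :: 'u set)"
    using card_of_Times_same_infinite[OF assms(4)] by (metis card_of_ordIso eqpoll_def eqpoll_imp_lepoll)
  have prod: "(UNIV :: ('u \<times> nat) set) \<lesssim> (UNIV :: 'u set)"
    using lepoll_trans[OF times_lepoll_mono[OF lepoll_refl \<open>(UNIV :: nat set) \<lesssim> (UNIV :: 'u set)\<close>] UU]
    by (simp only: UNIV_Times_UNIV)
  have sum: "(UNIV :: ('u + 'u) set) \<lesssim> (UNIV :: 'u set)"
  proof -
    have "inj (\<lambda>x :: 'u + 'u. case x of Inl u \<Rightarrow> (u, 0 :: nat) | Inr u \<Rightarrow> (u, 1))"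
      by (auto intro!: injI split: sum.splits)
    then have "(UNIV :: ('u + 'u) set) \<lesssim> (UNIV :: ('u \<times> nat) set)" by (auto simp: lepoll_def)
    then show ?thesis using prod by (rule lepoll_trans)
  qed
  note dim = S_w_gl_dim_le_iff[OF assms(2,4,5)] and dim_UP = S_w_gl_dim_le_iff[OF T assms(4) UP_card]
  \<comment> \<open>This includes \<open>n = 0\<close>, the case that excludes dimension 0 over
    \<open>R[x]\<close> below.\<close>
  have lower: "tor_killed TYPE('u) R S N n"
    if "\<forall>M :: (nat \<Rightarrow> 'a, 'u) module. module (UP R) M \<longrightarrow> tor_killed TYPE('u) (UP R) ?T M (Suc n)"
      and N: "module R N" for n and N :: "('a, 'u) module"
  proof (rule tor_killed_of_zero_extension[OF N assms(2)])
    note M = module_zero_extension[OF N]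
    show "tor_killed TYPE('u + 'u) (UP R) ?T (zero_extension N) (Suc n)"
      using that(1) M by (intro tor_killed_reindex[OF M _ sum submonoid.subset[OF T]]) blast
  qed
  have upper: "tor_killed TYPE('u) (UP R) ?T M (Suc n)"
    if "\<forall>N :: ('a, 'u) module. module R N \<longrightarrow> tor_killed TYPE('u) R S N n"
      and M: "module (UP R) M" for n and M :: "(nat \<Rightarrow> 'a, 'u) module"
  proof (rule tor_killed_polynomial_ring[OF assms(1,2) M])
    note N = module_restrict_scalars[OF assms(1) M]
    show "tor_killed TYPE('u \<times> nat) R S (restrict_scalars R M) n"
      using that(1) N by (intro tor_killed_reindex[OF N _ prod S.subset]) blast
  qed
  \<comment> \<open>All finite upper bounds are shifted by one. This leaves open whether the
    dimension over \<open>R[x]\<close> is 0.\<close>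
  have step: "S_w_gl_dim TYPE('u) (UP R) ?T \<le> enat (Suc n) \<longleftrightarrow> S_w_gl_dim TYPE('u) R S \<le> enat n" for n
    unfolding dim dim_UP using lower upper by blast
  \<comment> \<open>Dimension 0 over \<open>R[x]\<close> would make each \<open>R\<close>-module
    killed by one element of \<open>S\<close>. For \<open>R\<close> itself that element is zero,
    which does not lie in \<open>S\<close>.\<close>
  have nonzero: "\<not> S_w_gl_dim TYPE('u) (UP R) ?T \<le> enat 0"
  proof
    assume "S_w_gl_dim TYPE('u) (UP R) ?T \<le> enat 0"
    then have tor0: "tor_killed TYPE('u) R S N 0" if "module R N" for N :: "('a, 'u) module"
      unfolding dim_UP using lower that by blast
    have card: "carrier (regular_module R) \<lesssim> (UNIV :: 'u set)" using assms(5) by simp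
    from transport[OF module_regular_module[OF assms(1)] card] obtain N :: "('a, 'u) module" and f g
      where N: "module R N" "f \<in> mod_hom R (regular_module R) N" "g \<in> mod_hom R N (regular_module R)"
        "\<And>x. x \<in> carrier (regular_module R) \<Longrightarrow> g (f x) = x" by metis
    obtain s where s: "s \<in> S" "\<And>m. m \<in> carrier N \<Longrightarrow> s \<odot>\<^bsub>N\<^esub> m = \<zero>\<^bsub>N\<^esub>"
      using torsion_of_tor_killed[OF N(1) tor0[OF N(1)] S.subset] by blast
    have sR: "s \<in> carrier R" using s(1) S.subset by blast
    have f1: "f \<one>\<^bsub>R\<^esub> \<in> carrier N" using mod_homD(1)[OF N(2)] by simp
    \<comment> \<open>The copy \<open>N\<close> of \<open>R\<close> is killed by \<open>s\<close>;
      the chain of equations is \<open>s = s 1 = 0\<close>, carried back to \<open>R\<close> by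
      \<open>g\<close>.\<close>
    have "s = g (f \<one>\<^bsub>R\<^esub>) \<otimes>\<^bsub>R\<^esub> s" using N(4) sR by simp
    also have "\<dots> = g (s \<odot>\<^bsub>N\<^esub> f \<one>\<^bsub>R\<^esub>)"
      using mod_homD(3)[OF N(3) sR f1] mod_homD(1)[OF N(3) f1] sR by (simp add: R.m_comm)
    also have "\<dots> = \<zero>\<^bsub>R\<^esub>"
      using s(2)[OF f1] mod_hom_zero_minus(1)[OF N(1) module_regular_module[OF assms(1)] N(3)] by simp
    finally show False using s(1) assms(3) by simp
  qed
  show ?thesis
  proof (cases "S_w_gl_dim TYPE('u) R S")
    case (enat n)
    then have "S_w_gl_dim TYPE('u) (UP R) ?T \<le> enat (Suc n)" using step by simp
    \<comment> \<open>For \<open>n = 0\<close> this is \<open>nonzero\<close>, and otherwise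
      \<open>step\<close> at \<open>n - 1\<close>.\<close>
    moreover have "\<not> S_w_gl_dim TYPE('u) (UP R) ?T \<le> enat n"
      using nonzero step enat by (cases n) auto
    ultimately show ?thesis unfolding enat
      by (cases "S_w_gl_dim TYPE('u) (UP R) ?T") (auto simp: one_enat_def)
  next
    case infinity
    then have "\<not> S_w_gl_dim TYPE('u) (UP R) ?T \<le> enat n" for n
      using nonzero step by (cases n) auto
    then have "S_w_gl_dim TYPE('u) (UP R) ?T = \<infinity>"
      by (cases "S_w_gl_dim TYPE('u) (UP R) ?T") auto
    then show ?thesis using infinity by simp
  qed
qed

end
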